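(* Let $q: W \to T^2$ be a $\Sigma_{g,1}$ bundle over $T^2$ whose monodromy $\rho$ fixes the boundary $\partial \Sigma_{g,1}$ pointwise, so that $\partial W = T^3$. Let $\pi: T^3 = \partial W \to S^1$ be a fiber bundle with $T$ a fiber of $\pi$. If $T$ contains $\lambda = \partial \Sigma_{g,1} \times \{\mathrm{pt}\}$, then $\pi$ extends over $W$; that is, there is a fiber bundle $\hat\pi: W\to S^1$ with $\hat\pi|_{\partial W}=\pi$.
   Context: All manifolds, maps and bundles are smooth. $\Sigma_{g,1}$ is the compact, oriented surface of genus $g$ with one boundary component. A $\Sigma_{g,1}$ bundle over $T^2$ is a compact $4$-manifold with a smooth fiber bundle map onto $T^2$ with fiber $\Sigma_{g,1}$; its monodromy fixes the boundary pointwise means the structure group is the group of diffeomorphisms of $\Sigma_{g,1}$ that restrict to the identity on $\partial\Sigma_{g,1}$, so that $\partial W$ is identified with $\partial\Sigma_{g,1}\times T^2 \cong T^3$. In $\partial\Sigma_{g,1}\times\{\mathrm{pt}\}$ the point lies in $T^2$, so $\lambda$ is the boundary of a fiber of $q$. *)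

theory Defs
  imports "HOL-Analysis.Analysis"
begin

section \<open>Smooth functions between Euclidean spaces\<close>

text \<open>\<open>Ck_on k f S\<close> is meant for open \<open>S\<close>: all partial derivatives of \<open>f\<close> up to order \<open>k\<close> exist
  and are continuous on \<open>S\<close>.\<close>

primrec Ck_on :: "nat \<Rightarrow> ('a::euclidean_space \<Rightarrow> 'b::euclidean_space) \<Rightarrow> 'a set \<Rightarrow> bool" where
  "Ck_on 0 f S \<longleftrightarrow> continuous_on S f"
| "Ck_on (Suc k) f S \<longleftrightarrow>
     (\<forall>x\<in>S. f differentiable (at x)) \<and> (\<forall>v. Ck_on k (\<lambda>x. frechet_derivative f (at x) v) S)"

text \<open>On an arbitrary set (in particular on relatively open subsets of half-spaces), smooth means
  locally the restriction of a smooth function defined on an open set.\<close>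

definition smooth_on :: "'a::euclidean_space set \<Rightarrow> ('a \<Rightarrow> 'b::euclidean_space) \<Rightarrow> bool" where
  "smooth_on S f \<longleftrightarrow>
     (\<forall>x\<in>S. \<exists>N g. open N \<and> x \<in> N \<and> (\<forall>k. Ck_on k g N) \<and> (\<forall>y\<in>S \<inter> N. g y = f y))"

section \<open>Smooth manifolds with boundary\<close>

text \<open>A manifold modelled on \<open>'e\<close> (hence of dimension \<open>DIM('e)\<close>) with points in \<open>'a\<close>. An atlas
  consists of pairs of a chart domain and a coordinate map; it need not be maximal.\<close>

record ('a, 'e) mfd =
  mtop :: "'a topology"
  atlas :: "('a set \<times> ('a \<Rightarrow> 'e)) set"

abbreviation points :: "('a, 'e) mfd \<Rightarrow> 'a set" where
  "points M \<equiv> topspace (mtop M)"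

text \<open>Charts take values in a closed half-space \<open>{x. 0 \<le> x \<bullet> u}\<close>; \<open>u = 0\<close> gives the whole
  space. Allowing every \<open>u\<close> avoids singling out a coordinate of \<open>'e\<close>.\<close>

definition topological_chart ::
  "'a topology \<Rightarrow> 'a set \<times> ('a \<Rightarrow> 'e::euclidean_space) \<Rightarrow> bool" where
  "topological_chart X = (\<lambda>(U, \<phi>).
     openin X U \<and>
     (\<exists>u. openin (top_of_set {x. 0 \<le> x \<bullet> u}) (\<phi> ` U)) \<and>
     homeomorphic_map (subtopology X U) (top_of_set (\<phi> ` U)) \<phi>)"

definition smooth_transition ::
  "'a set \<times> ('a \<Rightarrow> 'e::euclidean_space) \<Rightarrow> 'a set \<times> ('a \<Rightarrow> 'e) \<Rightarrow> bool" where
  "smooth_transition = (\<lambda>(U, \<phi>) (V, \<psi>). smooth_on (\<phi> ` (U \<inter> V)) (\<psi> \<circ> inv_into U \<phi>))"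

text \<open>The members of the maximal atlas.\<close>

definition smooth_chart ::
  "('a, 'e::euclidean_space) mfd \<Rightarrow> 'a set \<times> ('a \<Rightarrow> 'e) \<Rightarrow> bool" where
  "smooth_chart M c \<longleftrightarrow> topological_chart (mtop M) c \<and>
     (\<forall>d\<in>atlas M. smooth_transition c d \<and> smooth_transition d c)"

definition smooth_manifold :: "('a, 'e::euclidean_space) mfd \<Rightarrow> bool" where
  "smooth_manifold M \<longleftrightarrow>
     Hausdorff_space (mtop M) \<and> second_countable (mtop M) \<and>
     (\<forall>c\<in>atlas M. smooth_chart M c) \<and> \<Union>(fst ` atlas M) = points M"

text \<open>For a relatively open subset of a half-space, the points on the bounding hyperplane are
  exactly those outside its interior in \<open>'e\<close>.\<close>

definition bdry :: "('a, 'e::euclidean_space) mfd \<Rightarrow> 'a set" where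
  "bdry M = {p. \<exists>(U, \<phi>)\<in>atlas M. p \<in> U \<and> \<phi> p \<notin> interior (\<phi> ` U)}"

definition smooth_map ::
  "('a, 'e::euclidean_space) mfd \<Rightarrow> ('b, 'f::euclidean_space) mfd \<Rightarrow> ('a \<Rightarrow> 'b) \<Rightarrow> bool" where
  "smooth_map M N f \<longleftrightarrow>
     continuous_map (mtop M) (mtop N) f \<and>
     (\<forall>(U, \<phi>)\<in>atlas M. \<forall>(V, \<psi>)\<in>atlas N.
        smooth_on (\<phi> ` (U \<inter> f -` V)) (\<psi> \<circ> f \<circ> inv_into U \<phi>))"

definition diffeomorphism ::
  "('a, 'e::euclidean_space) mfd \<Rightarrow> ('b, 'f::euclidean_space) mfd \<Rightarrow> ('a \<Rightarrow> 'b) \<Rightarrow> bool" where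
  "diffeomorphism M N f \<longleftrightarrow>
     smooth_map M N f \<and>
     (\<exists>g. smooth_map N M g \<and> (\<forall>x\<in>points M. g (f x) = x) \<and> (\<forall>y\<in>points N. f (g y) = y))"

definition open_submfd :: "('a, 'e) mfd \<Rightarrow> 'a set \<Rightarrow> ('a, 'e) mfd" where
  "open_submfd M A =
     \<lparr>mtop = subtopology (mtop M) A, atlas = (\<lambda>(U, \<phi>). (U \<inter> A, \<phi>)) ` atlas M\<rparr>"

text \<open>Used only when at most one factor has nonempty boundary, so that no corners arise.\<close>

definition prod_mfd :: "('a, 'e) mfd \<Rightarrow> ('b, 'f) mfd \<Rightarrow> ('a \<times> 'b, 'e \<times> 'f) mfd" where
  "prod_mfd M N =
     \<lparr>mtop = prod_topology (mtop M) (mtop N),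
      atlas = {(U \<times> V, map_prod \<phi> \<psi>) | U \<phi> V \<psi>. (U, \<phi>) \<in> atlas M \<and> (V, \<psi>) \<in> atlas N}\<rparr>"

text \<open>The boundary as a manifold modelled on \<open>'f\<close>, where \<open>DIM('f) + 1 = DIM('e)\<close>: boundary charts
  of \<open>M\<close> are followed by linear identifications of the bounding hyperplane with \<open>'f\<close>.\<close>

definition bdry_mfd ::
  "('a, 'e::euclidean_space) mfd \<Rightarrow> ('a, 'f::euclidean_space) mfd" where
  "bdry_mfd M =
     \<lparr>mtop = subtopology (mtop M) (bdry M),
      atlas = {(U \<inter> bdry M, L \<circ> \<phi>) | U \<phi> u L.
        (U, \<phi>) \<in> atlas M \<and> u \<noteq> 0 \<and> openin (top_of_set {x. 0 \<le> x \<bullet> u}) (\<phi> ` U) \<and>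
        linear L \<and> bij_betw L {x. x \<bullet> u = 0} UNIV}\<rparr>"

definition oriented_atlas ::
  "('a, real ^ 'n) mfd \<Rightarrow> ('a set \<times> ('a \<Rightarrow> real ^ 'n)) set \<Rightarrow> bool" where
  "oriented_atlas M Or \<longleftrightarrow>
     (\<forall>c\<in>Or. smooth_chart M c) \<and> \<Union>(fst ` Or) = points M \<and>
     (\<forall>(U, \<phi>)\<in>Or. \<forall>(V, \<psi>)\<in>Or. \<forall>p\<in>U \<inter> V. \<exists>D.
        ((\<psi> \<circ> inv_into U \<phi>) has_derivative D) (at (\<phi> p) within \<phi> ` (U \<inter> V)) \<and>
        det (matrix D) > 0)"

section \<open>The circle and the torus\<close>

text \<open>Charts are the branches of the angle on the complement of one point.\<close>

definition circle :: "(complex, real) mfd" where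
  "circle =
     \<lparr>mtop = top_of_set (sphere 0 1),
      atlas = {(cis ` {t<..<t + 2 * pi}, inv_into {t<..<t + 2 * pi} cis) | t. True}\<rparr>"

definition torus :: "(complex \<times> complex, real \<times> real) mfd" where
  "torus = prod_mfd circle circle"

section \<open>The surface of genus \<open>g\<close> with one boundary component\<close>

text \<open>The genus is the maximal number of disjoint simple closed curves in the interior whose union
  does not separate the surface. (A boundary-parallel curve pushed onto the boundary would never
  separate, hence the restriction to the interior.)\<close>

definition nonseparating_curves :: "('a, 'e::euclidean_space) mfd \<Rightarrow> 'a set set \<Rightarrow> bool" where
  "nonseparating_curves M \<C> \<longleftrightarrow>
     finite \<C> \<and> disjoint \<C> \<and>
     (\<forall>C\<in>\<C>. C \<subseteq> points M - bdry M \<and>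
        subtopology (mtop M) C homeomorphic_space top_of_set (sphere (0::complex) 1)) \<and>
     connectedin (mtop M) (points M - \<Union>\<C>)"

definition has_genus :: "('a, 'e::euclidean_space) mfd \<Rightarrow> nat \<Rightarrow> bool" where
  "has_genus M g \<longleftrightarrow>
     (\<exists>\<C>. nonseparating_curves M \<C> \<and> card \<C> = g) \<and>
     (\<forall>\<C>. nonseparating_curves M \<C> \<longrightarrow> card \<C> \<le> g)"

definition surface_one_bdry :: "nat \<Rightarrow> ('a, real ^ 2) mfd \<Rightarrow> bool" where
  "surface_one_bdry g S \<longleftrightarrow>
     smooth_manifold S \<and> compact_space (mtop S) \<and> connected_space (mtop S) \<and>
     (\<exists>Or. oriented_atlas S Or) \<and> has_genus S g \<and>
     bdry S \<noteq> {} \<and> connectedin (mtop S) (bdry S)"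

section \<open>Smooth fiber bundles\<close>

definition local_trivialization ::
  "('f, 'd::euclidean_space) mfd \<Rightarrow> ('a, 'e::euclidean_space) mfd \<Rightarrow>
   ('b, 'c::euclidean_space) mfd \<Rightarrow> ('a \<Rightarrow> 'b) \<Rightarrow> 'b set \<times> ('a \<Rightarrow> 'f \<times> 'b) \<Rightarrow> bool" where
  "local_trivialization F E B p = (\<lambda>(U, h).
     openin (mtop B) U \<and>
     diffeomorphism (open_submfd E {x \<in> points E. p x \<in> U}) (prod_mfd F (open_submfd B U)) h \<and>
     (\<forall>x\<in>points E. p x \<in> U \<longrightarrow> snd (h x) = p x))"

definition fiber_bundle ::
  "('f, 'd::euclidean_space) mfd \<Rightarrow> ('a, 'e::euclidean_space) mfd \<Rightarrow>
   ('b, 'c::euclidean_space) mfd \<Rightarrow> ('a \<Rightarrow> 'b) \<Rightarrow> bool" where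
  "fiber_bundle F E B p \<longleftrightarrow>
     smooth_manifold F \<and> smooth_map E B p \<and> p ` points E = points B \<and>
     (\<forall>b\<in>points B. \<exists>U h. b \<in> U \<and> local_trivialization F E B p (U, h))"

text \<open>A bundle atlas whose structure group is the group of diffeomorphisms of the fiber that are
  the identity on the boundary of the fiber: whenever \<open>h x\<close> has first component in the boundary,
  the transition function \<open>k \<circ> h\<^sup>-\<^sup>1\<close> fixes \<open>h x\<close>.\<close>

definition bdry_fixing_bundle_atlas ::
  "('f, 'd::euclidean_space) mfd \<Rightarrow> ('a, 'e::euclidean_space) mfd \<Rightarrow>
   ('b, 'c::euclidean_space) mfd \<Rightarrow> ('a \<Rightarrow> 'b) \<Rightarrow> ('b set \<times> ('a \<Rightarrow> 'f \<times> 'b)) set \<Rightarrow> bool" where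
  "bdry_fixing_bundle_atlas F E B p \<Theta> \<longleftrightarrow>
     (\<forall>t\<in>\<Theta>. local_trivialization F E B p t) \<and> \<Union>(fst ` \<Theta>) = points B \<and>
     (\<forall>(U, h)\<in>\<Theta>. \<forall>(V, k)\<in>\<Theta>. \<forall>x\<in>points E.
        p x \<in> U \<inter> V \<and> fst (h x) \<in> bdry F \<longrightarrow> k x = h x)"

text \<open>For such an atlas, the identification of the product of \<open>bdry F\<close> and the base with the
  boundary of \<open>E\<close>; on \<open>bdry F\<close> it does not depend on the trivialization used.\<close>

definition bdry_identification ::
  "('a, 'e) mfd \<Rightarrow> ('a \<Rightarrow> 'b) \<Rightarrow> ('b set \<times> ('a \<Rightarrow> 'f \<times> 'b)) set \<Rightarrow> 'f \<times> 'b \<Rightarrow> 'a" where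
  "bdry_identification E p \<Theta> y =
     (THE x. x \<in> points E \<and> (\<exists>(U, h)\<in>\<Theta>. p x \<in> U \<and> h x = y))"

end

theory Submission
  imports Defs
begin

text \<open>Let \<open>(y, z)\<close> be the coordinates of \<open>q\<close>. Since \<open>\<pi>\<close> is constant on \<open>\<lambda>\<close>, its class in
  \<open>H\<^sup>1(T\<^sup>3)\<close> comes from the base, that is, \<open>\<pi> = y\<^sup>m z\<^sup>n cis f\<close> on the boundary for a
  real-valued function \<open>f\<close>; here \<open>(m, n) \<noteq> (0, 0)\<close>, because otherwise \<open>\<pi>\<close> would have a
  critical point where \<open>f\<close> is maximal. Extend \<open>f\<close> to a smooth function on \<open>W\<close>, let \<open>r\<close> be a
  boundary defining function, and let \<open>\<theta>\<close> be a cut-off function of \<open>r\<close> which equals 1 for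
  \<open>r = 0\<close> and decreases to 0 at \<open>r = \<epsilon>\<close>. For large \<open>N\<close> the map
  \<open>y\<^sup>m z\<^sup>n cis ((f + 2\<pi>N) \<theta>)\<close> is a submersion, on \<open>W\<close> and on its boundary: outside the collar
  it is \<open>y\<^sup>m z\<^sup>n\<close>, on the boundary it is \<open>\<pi>\<close>, and inside the collar its derivative across the
  collar is dominated by \<open>(f + 2\<pi>N) d\<theta>\<close>.

  Submersions of a compact manifold with boundary to the circle are bundles. Instead of
  integrating a vector field, a retraction of a neighbourhood of a fiber onto the fiber is
  composed from finitely many local pushes along charts in which the submersion is a
  coordinate.\<close>

section \<open>Calculus of smooth functions on open sets\<close>

text \<open>The lift f is built along the two base circles, with the boundary of the surface as a
  compact connected parameter space; constancy on \<lambda> is its initial condition. Adding 2 pi N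
  leaves \<open>cis f\<close> alone but makes f + 2 pi N large, and this fixes the sign of the
  inward derivative of the phase: the derivative of f is only bounded, while the cut-off and its
  derivative both die at the inner end of the collar. The test vector there is tangent to the fibers
  of q, so it does not see y^m z^n; beyond the collar the vector (m, n) of the base is used instead.
  A trivialization has to carry boundary to boundary, so at the boundary it is not enough that the
  phase has a nonzero derivative: it needs one in a direction tangent to the boundary. There the
  bundle \<pi> itself supplies the vector, as the velocity of a local section. Charts are therefore
  required to have the angle as one coordinate and the half-space condition in the others, and every
  push towards a fiber has to preserve the boundary in both directions.\<close>

lemma Ck_on_cong:
  assumes "Ck_on k f S" "open S" "\<And>x. x \<in> S \<Longrightarrow> f x = g x"
  shows "Ck_on k g S"
  using assms(1,3)
proof (induction k arbitrary: f g)
  case 0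
  then show ?case by (simp cong: continuous_on_cong)
next
  case (Suc k)
  have *: "(g has_derivative frechet_derivative f (at x)) (at x)" if x: "x \<in> S" for x
  proof -
    have "(f has_derivative frechet_derivative f (at x)) (at x)"
      using Suc.prems(1) x frechet_derivative_works by auto
    then show ?thesis
      by (rule has_derivative_transform_within_open[OF _ \<open>open S\<close> x]) (simp add: Suc.prems)
  qed
  then have "\<forall>x\<in>S. g differentiable (at x)"
    using differentiable_def by blast
  moreover have "Ck_on k (\<lambda>x. frechet_derivative g (at x) v) S" for v
    by (rule Suc.IH[of "\<lambda>x. frechet_derivative f (at x) v"])
       (use Suc.prems(1) frechet_derivative_at[OF *] in simp_all)
  ultimately show ?case by simp
qed

text \<open>Derivatives at points of an open set are unique, so any explicit family of derivatives
  may replace \<open>frechet_derivative\<close> in the recursion.\<close>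

lemma Ck_on_SucI:
  assumes "\<And>x. x \<in> S \<Longrightarrow> (f has_derivative f' x) (at x)"
    and "\<And>v. Ck_on k (\<lambda>x. f' x v) S" and "open S"
  shows "Ck_on (Suc k) f S"
proof -
  have eq: "f' x = frechet_derivative f (at x)" if "x \<in> S" for x
    using assms(1)[OF that] by (rule frechet_derivative_at)
  have "Ck_on k (\<lambda>x. frechet_derivative f (at x) v) S" for v
    by (rule Ck_on_cong[OF assms(2)[of v] assms(3)]) (simp add: eq)
  moreover have "\<forall>x\<in>S. f differentiable (at x)"
    using assms(1) differentiable_def by blast
  ultimately show ?thesis by simp
qed

lemma Ck_on_SucE:
  assumes "Ck_on (Suc k) f S"
  obtains f' where "\<And>x. x \<in> S \<Longrightarrow> (f has_derivative f' x) (at x)" "\<And>v. Ck_on k (\<lambda>x. f' x v) S"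
proof (rule that)
  show "(f has_derivative frechet_derivative f (at x)) (at x)" if "x \<in> S" for x
    using assms that by (simp add: frechet_derivative_works)
  show "Ck_on k (\<lambda>x. frechet_derivative f (at x) v) S" for v
    using assms by simp
qed

lemma Ck_on_Suc_imp: "Ck_on (Suc k) f S \<Longrightarrow> Ck_on k f S"
proof (induction k arbitrary: f)
  case 0
  then show ?case
    by (auto intro!: continuous_at_imp_continuous_on differentiable_imp_continuous_within)
qed auto

lemma Ck_on_subset: "Ck_on k f S \<Longrightarrow> T \<subseteq> S \<Longrightarrow> Ck_on k f T"
  by (induction k arbitrary: f) (auto intro: continuous_on_subset)

lemma Ck_on_const [simp]: "Ck_on k (\<lambda>x. c) S"
proof (induction k arbitrary: c)
  case (Suc k)
  then show ?case by (simp add: frechet_derivative_const)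
qed auto

lemma Ck_on_bounded_linear:
  assumes "bounded_linear f" "open S" shows "Ck_on k f S"
proof (cases k)
  case 0
  then show ?thesis using assms by (simp add: linear_continuous_on)
next
  case (Suc j)
  show ?thesis unfolding Suc
    by (rule Ck_on_SucI[where f' = "\<lambda>_. f"]) (use assms bounded_linear_imp_has_derivative in auto)
qed

lemma Ck_on_bounded_linear_compose:
  assumes "bounded_linear l" "Ck_on k f S" "open S" shows "Ck_on k (\<lambda>x. l (f x)) S"
  using assms(2)
proof (induction k arbitrary: f)
  case 0
  then show ?case using assms(1) by (simp add: linear_continuous_on_compose bounded_linear.linear)
next
  case (Suc k)
  from Suc.prems obtain f' where f': "\<And>x. x \<in> S \<Longrightarrow> (f has_derivative f' x) (at x)"
    "\<And>v. Ck_on k (\<lambda>x. f' x v) S" by (rule Ck_on_SucE) blast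
  show ?case
    by (rule Ck_on_SucI[where f' = "\<lambda>x v. l (f' x v)"])
       (use f' Suc.IH assms in \<open>auto intro: bounded_linear.has_derivative\<close>)
qed

lemma Ck_on_add:
  assumes "Ck_on k f S" "Ck_on k g S" "open S" shows "Ck_on k (\<lambda>x. f x + g x) S"
  using assms(1,2)
proof (induction k arbitrary: f g)
  case 0
  then show ?case by (simp add: continuous_on_add)
next
  case (Suc k)
  from Suc.prems(1) obtain f' where f': "\<And>x. x \<in> S \<Longrightarrow> (f has_derivative f' x) (at x)"
    "\<And>v. Ck_on k (\<lambda>x. f' x v) S" by (rule Ck_on_SucE) blast
  from Suc.prems(2) obtain g' where g': "\<And>x. x \<in> S \<Longrightarrow> (g has_derivative g' x) (at x)"
    "\<And>v. Ck_on k (\<lambda>x. g' x v) S" by (rule Ck_on_SucE) blast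
  show ?case
    by (rule Ck_on_SucI[where f' = "\<lambda>x v. f' x v + g' x v"])
       (use f' g' Suc.IH assms has_derivative_add in auto)
qed

lemma Ck_on_sum:
  assumes "\<And>i. i \<in> I \<Longrightarrow> Ck_on k (f i) S" "open S" shows "Ck_on k (\<lambda>x. \<Sum>i\<in>I. f i x) S"
  using assms by (induction I rule: infinite_finite_induct) (auto intro: Ck_on_add)

lemma Ck_on_bilinear:
  assumes "bounded_bilinear B" "Ck_on k f S" "Ck_on k g S" "open S"
  shows "Ck_on k (\<lambda>x. B (f x) (g x)) S"
  using assms(2,3)
proof (induction k arbitrary: f g)
  case 0
  then show ?case using assms(1) by (simp add: bounded_bilinear.continuous_on)
next
  case (Suc k)
  from Suc.prems(1) obtain f' where f': "\<And>x. x \<in> S \<Longrightarrow> (f has_derivative f' x) (at x)"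
    "\<And>v. Ck_on k (\<lambda>x. f' x v) S" by (rule Ck_on_SucE) blast
  from Suc.prems(2) obtain g' where g': "\<And>x. x \<in> S \<Longrightarrow> (g has_derivative g' x) (at x)"
    "\<And>v. Ck_on k (\<lambda>x. g' x v) S" by (rule Ck_on_SucE) blast
  show ?case
  proof (rule Ck_on_SucI[where f' = "\<lambda>x v. B (f x) (g' x v) + B (f' x v) (g x)"])
    show "((\<lambda>x. B (f x) (g x)) has_derivative (\<lambda>v. B (f x) (g' x v) + B (f' x v) (g x))) (at x)"
      if "x \<in> S" for x by (rule bounded_bilinear.FDERIV[OF assms(1) f'(1)[OF that] g'(1)[OF that]])
    show "Ck_on k (\<lambda>x. B (f x) (g' x v) + B (f' x v) (g x)) S" for v
      using Ck_on_add[OF Suc.IH[OF Ck_on_Suc_imp[OF Suc.prems(1)] g'(2)]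
          Suc.IH[OF f'(2) Ck_on_Suc_imp[OF Suc.prems(2)]] assms(4)] .
  qed (rule assms)
qed

lemma linear_euclidean_expand:
  fixes l :: "'a::euclidean_space \<Rightarrow> 'b::real_vector"
  assumes "linear l" shows "l w = (\<Sum>b\<in>Basis. (w \<bullet> b) *\<^sub>R l b)"
  by (metis (mono_tags, lifting) assms euclidean_representation linear_scale linear_sum sum.cong)

text \<open>Smoothness of an operator family is only ever tested on fixed vectors. Expanding the
  argument in the basis turns the application to a moving vector into a finite sum of
  products.\<close>

lemma Ck_on_linear_family:
  fixes L :: "'a::euclidean_space \<Rightarrow> 'b::euclidean_space \<Rightarrow> 'c::euclidean_space"
  assumes "\<And>x. x \<in> S \<Longrightarrow> linear (L x)" "\<And>b. Ck_on k (\<lambda>x. L x b) S" "Ck_on k w S" "open S"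
  shows "Ck_on k (\<lambda>x. L x (w x)) S"
proof -
  have "Ck_on k (\<lambda>x. \<Sum>b\<in>Basis. (w x \<bullet> b) *\<^sub>R L x b) S"
    by (intro Ck_on_sum Ck_on_bilinear[OF bounded_bilinear_scaleR] assms
        Ck_on_bounded_linear_compose[OF bounded_linear_inner_left])
  then show ?thesis
    by (rule Ck_on_cong) (use assms linear_euclidean_expand in metis)+
qed

text \<open>By the chain rule the derivative of the composite is the family \<open>g' (f x)\<close>
  applied to the moving vector \<open>f' x v\<close>. The induction hypothesis covers the family on
  fixed vectors, and \<open>Ck_on_linear_family\<close> covers the application.\<close>

lemma Ck_on_compose:
  fixes f :: "'a::euclidean_space \<Rightarrow> 'b::euclidean_space" and g :: "'b \<Rightarrow> 'c::euclidean_space"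
  assumes "Ck_on k f S" "Ck_on k g T" "f ` S \<subseteq> T" "open S" "open T"
  shows "Ck_on k (\<lambda>x. g (f x)) S"
  using assms(1-3)
proof (induction k arbitrary: g f)
  case 0
  then show ?case using continuous_on_compose2[of T g S f] by simp
next
  case (Suc k)
  from Suc.prems(1) obtain f' where f': "\<And>x. x \<in> S \<Longrightarrow> (f has_derivative f' x) (at x)"
    "\<And>v. Ck_on k (\<lambda>x. f' x v) S" by (rule Ck_on_SucE) blast
  from Suc.prems(2) obtain g' where g': "\<And>x. x \<in> T \<Longrightarrow> (g has_derivative g' x) (at x)"
    "\<And>v. Ck_on k (\<lambda>x. g' x v) T" by (rule Ck_on_SucE) blast
  have fT: "f x \<in> T" if "x \<in> S" for x using that Suc.prems(3) by auto
  show ?case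
  proof (rule Ck_on_SucI[where f' = "\<lambda>x v. g' (f x) (f' x v)"])
    show "((\<lambda>x. g (f x)) has_derivative (\<lambda>v. g' (f x) (f' x v))) (at x)" if "x \<in> S" for x
      by (rule has_derivative_compose[OF f'(1)[OF that] g'(1)[OF fT[OF that]]])
    show "Ck_on k (\<lambda>x. g' (f x) (f' x v)) S" for v
    proof (rule Ck_on_linear_family[where L = "\<lambda>x. g' (f x)"])
      show "linear (g' (f x))" if "x \<in> S" for x
        using g'(1)[OF fT[OF that]] has_derivative_linear by blast
      show "Ck_on k (\<lambda>x. g' (f x) b) S" for b
        using Suc.IH[OF Ck_on_Suc_imp[OF Suc.prems(1)] g'(2) Suc.prems(3)] .
    qed (use f' assms in auto)
  qed (rule assms)
qed

text \<open>Where the scalar factor vanishes, mere continuity of the other factor is enough: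
  \<open>s\<close> is of first order in \<open>x - x0\<close>, and it multiplies a difference
  \<open>a x - a x0\<close> that tends to zero. This is how an operator inverse gets differentiated
  when only its continuity is known.\<close>

lemma has_derivative_scaleR_vanishing:
  fixes s :: "'a::real_normed_vector \<Rightarrow> real" and a :: "'a \<Rightarrow> 'b::real_normed_vector"
  assumes s: "(s has_derivative s') (at x0)" and "s x0 = 0" and a: "isCont a x0"
  shows "((\<lambda>x. s x *\<^sub>R a x) has_derivative (\<lambda>h. s' h *\<^sub>R a x0)) (at x0)"
proof -
  have 1: "((\<lambda>x. s x *\<^sub>R a x0) has_derivative (\<lambda>h. s' h *\<^sub>R a x0)) (at x0)"
    by (rule has_derivative_scaleR_left[OF s])
  have 2: "((\<lambda>x. s x *\<^sub>R (a x - a x0)) has_derivative (\<lambda>h. 0)) (at x0)"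
    unfolding has_derivative_at_within
  proof (intro conjI)
    obtain C d where "C > 0" "d > 0" and C: "\<And>x. norm (x - x0) < d \<Longrightarrow> \<bar>s x\<bar> \<le> C * norm (x - x0)"
    proof -
      obtain K where K: "\<And>h. norm (s' h) \<le> norm h * K" "K > 0"
        using bounded_linear.pos_bounded[OF has_derivative_bounded_linear[OF s]] by blast
      obtain d where d: "d > 0"
        "\<And>x. norm (x - x0) < d \<Longrightarrow> norm (s x - s x0 - s' (x - x0)) \<le> 1 * norm (x - x0)"
        using s unfolding has_derivative_at_alt by (meson zero_less_one)
      have "\<bar>s x\<bar> \<le> (K + 1) * norm (x - x0)" if "norm (x - x0) < d" for x
        using d(2)[OF that] K(1)[of "x - x0"] \<open>s x0 = 0\<close> by (simp add: algebra_simps)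
      then show ?thesis using that[of "K + 1" d] K d by auto
    qed
    have lim: "((\<lambda>x. C * norm (a x - a x0)) \<longlongrightarrow> 0) (at x0)"
      using a unfolding isCont_def by (intro tendsto_mult_right_zero tendsto_norm_zero LIM_zero)
    show "((\<lambda>x. (s x *\<^sub>R (a x - a x0) - s x0 *\<^sub>R (a x0 - a x0) - 0) /\<^sub>R norm (x - x0)) \<longlongrightarrow> 0) (at x0)"
    proof (rule Lim_null_comparison[OF _ lim])
      show "\<forall>\<^sub>F x in at x0. norm ((s x *\<^sub>R (a x - a x0) - s x0 *\<^sub>R (a x0 - a x0) - 0) /\<^sub>R norm (x - x0))
         \<le> C * norm (a x - a x0)"
        unfolding eventually_at
      proof (intro exI conjI ballI impI)
        fix x assume x: "x \<noteq> x0 \<and> dist x x0 < d"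
        then have "\<bar>s x\<bar> / norm (x - x0) \<le> C"
          using C[of x] by (simp add: dist_norm divide_le_eq)
        then show "norm ((s x *\<^sub>R (a x - a x0) - s x0 *\<^sub>R (a x0 - a x0) - 0) /\<^sub>R norm (x - x0))
         \<le> C * norm (a x - a x0)"
          using mult_right_mono[of "\<bar>s x\<bar> / norm (x - x0)" C "norm (a x - a x0)"]
          by (simp add: divide_inverse mult_ac abs_mult)
      qed (use \<open>d > 0\<close> in auto)
    qed
  qed auto
  show ?thesis
    using has_derivative_add[OF 1 2] by (simp add: algebra_simps)
qed

section \<open>Inverses\<close>

text \<open>A lower bound \<open>c\<close> for \<open>M x0\<close> survives as \<open>c / 2\<close>
  for nearby \<open>M x\<close>, so the inverses are uniformly bounded there. The difference of the
  inverses is then controlled by \<open>M x0 z - M x z\<close> at the single vector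
  \<open>z\<close>.\<close>

lemma continuous_inv_linear_family:
  fixes M :: "'a::euclidean_space \<Rightarrow> 'b::euclidean_space \<Rightarrow> 'b"
  assumes S: "open S" "x0 \<in> S"
    and lin: "\<And>x. x \<in> S \<Longrightarrow> linear (M x)" and bij: "\<And>x. x \<in> S \<Longrightarrow> bij (M x)"
    and cont: "\<And>b. continuous_on S (\<lambda>x. M x b)"
  shows "isCont (\<lambda>x. inv (M x) w) x0"
proof -
  obtain c where c: "c > 0" "\<And>v. c * norm v \<le> norm (M x0 v)"
    using linear_inj_bounded_below_pos[OF lin] bij bij_is_inj S by metis
  \<comment> \<open>The errors on the basis vectors, summed up, dominate the operator norm of
    \<open>M x - M x0\<close>.\<close>
  define e where "e x = (\<Sum>b\<in>Basis. norm (M x b - M x0 b))" for x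
  have "isCont (\<lambda>x. M x b) x0" for b
    using cont S continuous_on_eq_continuous_at by blast
  then have econt: "isCont e x0" unfolding e_def by (intro continuous_intros) auto
  have evS: "\<forall>\<^sub>F x in at x0. x \<in> S"
    using S by (rule eventually_at_in_open')
  have "e x0 = 0" by (simp add: e_def)
  have "\<forall>\<^sub>F x in at x0. e x < c / 2"
    by (rule order_tendstoD[where y = 0]) (use econt \<open>e x0 = 0\<close> c in \<open>auto simp: isCont_def\<close>)
  with evS have ev: "\<forall>\<^sub>F x in at x0. x \<in> S \<and> e x < c / 2" by (rule eventually_conj)
  have low: "c / 2 * norm v \<le> norm (M x v)" if "x \<in> S" "e x < c / 2" for x v
  proof -
    have lin': "linear (\<lambda>v. M x v - M x0 v)"
      using lin that S by (intro linear_compose_sub) auto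
    have "norm (M x v - M x0 v) = norm (\<Sum>b\<in>Basis. (v \<bullet> b) *\<^sub>R (M x b - M x0 b))"
      using linear_euclidean_expand[OF lin', of v] by simp
    also have "\<dots> \<le> (\<Sum>b\<in>Basis. norm v * norm (M x b - M x0 b))"
      by (intro sum_norm_le) (simp add: Basis_le_norm mult_right_mono)
    also have "\<dots> = norm v * e x" by (simp add: e_def sum_distrib_left)
    also have "\<dots> \<le> norm v * (c / 2)" using that by (intro mult_left_mono) auto
    finally show ?thesis
      using c(2)[of v] norm_triangle_ineq2[of "M x0 v" "M x v"] by (simp add: norm_minus_commute algebra_simps)
  qed
  define z where "z = inv (M x0) w"
  have z: "M x0 z = w" using bij S by (simp add: z_def bij_is_surj surj_f_inv_f)
  have bound: "norm (inv (M x) w - inv (M x0) w) \<le> 2 / c * norm (M x0 z - M x z)"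
    if "x \<in> S" "e x < c / 2" for x
  proof -
    have "M x (inv (M x) w - z) = w - M x z"
      using bij lin that by (simp add: linear_diff bij_is_surj surj_f_inv_f)
    then have "c / 2 * norm (inv (M x) w - z) \<le> norm (w - M x z)"
      using low[OF that, of "inv (M x) w - z"] by simp
    then show ?thesis using c(1) by (simp add: z flip: z_def) (simp add: field_simps)
  qed
  have "isCont (\<lambda>x. M x z) x0"
    using cont S continuous_on_eq_continuous_at by blast
  then have "((\<lambda>x. M x0 z - M x z) \<longlongrightarrow> M x0 z - M x0 z) (at x0)"
    unfolding isCont_def by (intro tendsto_diff tendsto_const)
  then have "((\<lambda>x. 2 / c * norm (M x0 z - M x z)) \<longlongrightarrow> 0) (at x0)"
    by (intro tendsto_mult_right_zero tendsto_norm_zero) simp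
  then have "((\<lambda>x. inv (M x) w - inv (M x0) w) \<longlongrightarrow> 0) (at x0)"
    by (rule Lim_null_comparison[rotated]) (use ev bound in \<open>auto elim!: eventually_mono\<close>)
  then show ?thesis unfolding isCont_def by (rule LIM_zero_cancel)
qed

text \<open>Uses \<open>M(x)\<^sup>-\<^sup>1 w = z + M(x)\<^sup>-\<^sup>1 (M(x\<^sub>0) z - M(x) z)\<close> with \<open>z = M(x\<^sub>0)\<^sup>-\<^sup>1 w\<close>.\<close>

lemma has_derivative_inv_linear_family:
  fixes M :: "'a::euclidean_space \<Rightarrow> 'b::euclidean_space \<Rightarrow> 'b"
  assumes S: "open S" "x0 \<in> S"
    and lin: "\<And>x. x \<in> S \<Longrightarrow> linear (M x)" and bij: "\<And>x. x \<in> S \<Longrightarrow> bij (M x)"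
    and der: "\<And>x b. x \<in> S \<Longrightarrow> ((\<lambda>x. M x b) has_derivative M' b x) (at x)"
  shows "((\<lambda>x. inv (M x) w) has_derivative (\<lambda>h. inv (M x0) (- M' (inv (M x0) w) x0 h))) (at x0)"
proof -
  define z where "z = inv (M x0) w"
  have cont: "continuous_on S (\<lambda>x. M x b)" for b
    using der has_derivative_continuous by (intro continuous_at_imp_continuous_on) blast
  have z: "M x0 z = w" using bij S by (simp add: z_def bij_is_surj surj_f_inv_f)
  have lininv: "linear (inv (M x))" if "x \<in> S" for x
    using lin bij that by (simp add: bij_is_inj inj_linear_imp_inv_linear)
  have "((\<lambda>x. \<Sum>b\<in>Basis. ((w - M x z) \<bullet> b) *\<^sub>R inv (M x) b) has_derivative
        (\<lambda>h. \<Sum>b\<in>Basis. ((- M' z x0 h) \<bullet> b) *\<^sub>R inv (M x0) b)) (at x0)"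
  proof (intro has_derivative_sum has_derivative_scaleR_vanishing)
    show "((\<lambda>x. (w - M x z) \<bullet> b) has_derivative (\<lambda>h. (- M' z x0 h) \<bullet> b)) (at x0)" for b
      using der[OF S(2)] by (auto intro!: derivative_eq_intros)
    show "isCont (\<lambda>x. inv (M x) b) x0" for b
      by (rule continuous_inv_linear_family[OF S lin bij cont])
  qed (simp add: z)
  from has_derivative_add[OF has_derivative_const[of z] this]
  have "((\<lambda>x. z + (\<Sum>b\<in>Basis. ((w - M x z) \<bullet> b) *\<^sub>R inv (M x) b)) has_derivative
        (\<lambda>h. inv (M x0) (- M' z x0 h))) (at x0)"
    by (simp only: linear_euclidean_expand[OF lininv[OF S(2)], symmetric] add_0)
  then have "((\<lambda>x. inv (M x) w) has_derivative (\<lambda>h. inv (M x0) (- M' z x0 h))) (at x0)"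
  proof (rule has_derivative_transform_within_open[OF _ S])
    fix x assume x: "x \<in> S"
    have "inv (M x) (M x z) = z" using bij x by (simp add: bij_is_inj)
    then show "z + (\<Sum>b\<in>Basis. ((w - M x z) \<bullet> b) *\<^sub>R inv (M x) b) = inv (M x) w"
      using linear_euclidean_expand[OF lininv[OF x], of "w - M x z"] linear_diff[OF lininv[OF x], of w]
      by (metis add.commute diff_add_cancel)
  qed
  then show ?thesis by (simp add: z_def)
qed

text \<open>The derivative of the inverse is made of the inverse itself and of \<open>M'\<close>, so
  each order of regularity of the inverse yields the next one.\<close>

lemma Ck_on_inv_linear_family:
  fixes M :: "'a::euclidean_space \<Rightarrow> 'b::euclidean_space \<Rightarrow> 'b"
  assumes S: "open S"
    and lin: "\<And>x. x \<in> S \<Longrightarrow> linear (M x)" and bij: "\<And>x. x \<in> S \<Longrightarrow> bij (M x)"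
    and Ck: "\<And>b. Ck_on k (\<lambda>x. M x b) S"
  shows "Ck_on k (\<lambda>x. inv (M x) w) S"
  using Ck
proof (induction k arbitrary: w)
  case 0
  then show ?case
    using continuous_inv_linear_family[OF S _ lin bij] by (auto intro: continuous_at_imp_continuous_on)
next
  case (Suc k)
  have "\<exists>M'. (\<forall>x\<in>S. ((\<lambda>x. M x b) has_derivative M' x) (at x)) \<and> (\<forall>v. Ck_on k (\<lambda>x. M' x v) S)" for b
    using Ck_on_SucE[OF Suc.prems[of b]] by metis
  then obtain M' where M': "\<And>b x. x \<in> S \<Longrightarrow> ((\<lambda>x. M x b) has_derivative M' b x) (at x)"
    "\<And>b v. Ck_on k (\<lambda>x. M' b x v) S" by metis
  have IH: "Ck_on k (\<lambda>x. inv (M x) w) S" for w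
    using Suc.IH Suc.prems Ck_on_Suc_imp by blast
  \<comment> \<open>Linearity in the argument passes to the derivative in \<open>x\<close>; this
    allows \<open>M'\<close> to be applied to the moving vector \<open>inv (M x) w\<close> as a
    linear family.\<close>
  have linM': "linear (\<lambda>z. M' z x v)" if "x \<in> S" for x v
  proof
    fix b c :: 'b and r :: real
    have "((\<lambda>x. M x (b + c)) has_derivative (\<lambda>v. M' b x v + M' c x v)) (at x)"
      using has_derivative_add[OF M'(1) M'(1), OF that that]
      by (rule has_derivative_transform_within_open[OF _ S that]) (simp add: lin linear_add)
    then show "M' (b + c) x v = M' b x v + M' c x v"
      using M'(1)[OF that] has_derivative_unique by metis
    have "((\<lambda>x. M x (r *\<^sub>R b)) has_derivative (\<lambda>v. r *\<^sub>R M' b x v)) (at x)"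
      using has_derivative_scaleR_right[OF M'(1), OF that]
      by (rule has_derivative_transform_within_open[OF _ S that]) (simp add: lin linear_scale)
    then show "M' (r *\<^sub>R b) x v = r *\<^sub>R M' b x v"
      using M'(1)[OF that] has_derivative_unique by metis
  qed
  show ?case
  proof (rule Ck_on_SucI[where f' = "\<lambda>x h. inv (M x) (- M' (inv (M x) w) x h)"])
    show "((\<lambda>x. inv (M x) w) has_derivative (\<lambda>h. inv (M x) (- M' (inv (M x) w) x h))) (at x)"
      if "x \<in> S" for x by (rule has_derivative_inv_linear_family[OF S that lin bij M'(1)])
    show "Ck_on k (\<lambda>x. inv (M x) (- M' (inv (M x) w) x v)) S" for v
      proof (rule Ck_on_linear_family[where L = "\<lambda>x. inv (M x)", OF _ IH _ S])
      show "linear (inv (M x))" if "x \<in> S" for x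
        using lin bij that by (simp add: bij_is_inj inj_linear_imp_inv_linear)
      have "Ck_on k (\<lambda>x. M' (inv (M x) w) x v) S"
        by (rule Ck_on_linear_family[where L = "\<lambda>x z. M' z x v", OF linM' M'(2) IH S])
      then show "Ck_on k (\<lambda>x. - M' (inv (M x) w) x v) S"
        by (rule Ck_on_bounded_linear_compose[OF bounded_linear_minus[OF bounded_linear_ident] _ S])
    qed
  qed (rule S)
qed

section \<open>Functions with all derivatives, and the inverse function theorem\<close>

definition Cinf_on :: "('a::euclidean_space \<Rightarrow> 'b::euclidean_space) \<Rightarrow> 'a set \<Rightarrow> bool" where
  "Cinf_on f S \<longleftrightarrow> open S \<and> (\<forall>k. Ck_on k f S)"

lemma Cinf_on_open: "Cinf_on f S \<Longrightarrow> open S"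
  by (simp add: Cinf_on_def)

lemma Cinf_on_subset: "Cinf_on f S \<Longrightarrow> T \<subseteq> S \<Longrightarrow> open T \<Longrightarrow> Cinf_on f T"
  by (auto simp: Cinf_on_def intro: Ck_on_subset)

lemma Cinf_on_cong: "Cinf_on f S \<Longrightarrow> (\<And>x. x \<in> S \<Longrightarrow> f x = g x) \<Longrightarrow> Cinf_on g S"
  by (auto simp: Cinf_on_def intro: Ck_on_cong)

lemma Cinf_on_has_derivative:
  assumes "Cinf_on f S" "x \<in> S"
  shows "(f has_derivative frechet_derivative f (at x)) (at x)"
  using assms Ck_on.simps(2)[of 0 f S] by (auto simp: Cinf_on_def frechet_derivative_works)

lemma Cinf_on_derivative:
  assumes "Cinf_on f S" shows "Cinf_on (\<lambda>x. frechet_derivative f (at x) v) S"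
  using assms Ck_on.simps(2)[of _ f S] by (auto simp: Cinf_on_def)

lemma Cinf_on_continuous: "Cinf_on f S \<Longrightarrow> continuous_on S f"
  using Ck_on.simps(1)[of f S] unfolding Cinf_on_def by blast

lemma Cinf_on_compose:
  assumes "Cinf_on f S" "Cinf_on g T" "f ` S \<subseteq> T" shows "Cinf_on (\<lambda>x. g (f x)) S"
  using assms Ck_on_compose unfolding Cinf_on_def by blast

lemma Cinf_on_bounded_linear: "bounded_linear f \<Longrightarrow> open S \<Longrightarrow> Cinf_on f S"
  by (simp add: Cinf_on_def Ck_on_bounded_linear)

lemma Cinf_on_const [simp]: "open S \<Longrightarrow> Cinf_on (\<lambda>x. c) S"
  by (simp add: Cinf_on_def)

lemma Cinf_on_ident [simp]: "open S \<Longrightarrow> Cinf_on (\<lambda>x. x) S"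
  by (intro Cinf_on_bounded_linear bounded_linear_ident)

lemma Cinf_on_bounded_linear_compose:
  "bounded_linear l \<Longrightarrow> Cinf_on f S \<Longrightarrow> Cinf_on (\<lambda>x. l (f x)) S"
  by (simp add: Cinf_on_def Ck_on_bounded_linear_compose)

lemma Cinf_on_bilinear:
  "bounded_bilinear B \<Longrightarrow> Cinf_on f S \<Longrightarrow> Cinf_on g S \<Longrightarrow> Cinf_on (\<lambda>x. B (f x) (g x)) S"
  by (simp add: Cinf_on_def Ck_on_bilinear)

lemma Cinf_on_add: "Cinf_on f S \<Longrightarrow> Cinf_on g S \<Longrightarrow> Cinf_on (\<lambda>x. f x + g x) S"
  by (simp add: Cinf_on_def Ck_on_add)

lemma Cinf_on_minus: "Cinf_on f S \<Longrightarrow> Cinf_on (\<lambda>x. - f x) S"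
  by (rule Cinf_on_bounded_linear_compose[OF bounded_linear_minus[OF bounded_linear_ident]])

lemma Cinf_on_diff: "Cinf_on f S \<Longrightarrow> Cinf_on g S \<Longrightarrow> Cinf_on (\<lambda>x. f x - g x) S"
  using Cinf_on_add[OF _ Cinf_on_minus] by force

lemma Cinf_on_Pair:
  assumes "Cinf_on f S" "Cinf_on g S" shows "Cinf_on (\<lambda>x. (f x, g x)) S"
proof -
  have "Cinf_on (\<lambda>x. (f x, 0) + (0, g x)) S"
    using assms by (intro Cinf_on_add Cinf_on_bounded_linear_compose[where l = "\<lambda>y. (y, 0)"]
        Cinf_on_bounded_linear_compose[where l = "\<lambda>y. (0, y)"] bounded_linear_Pair
        bounded_linear_ident bounded_linear_zero)
  then show ?thesis by simp
qed

lemma linear_inj_imp_bij: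
  fixes f :: "'a::euclidean_space \<Rightarrow> 'a" assumes "linear f" "inj f" shows "bij f"
  using assms linear_injective_imp_surjective by (auto simp: bij_def)

text \<open>The inverse function theorem for continuously differentiable maps gives a local inverse
  \<open>g\<close> with derivative \<open>inv (D (g y))\<close>. Since inversion of operator
  families keeps the order of regularity, \<open>g\<close> gains one order at each step of an
  induction.\<close>

lemma Cinf_inverse_function_same:
  fixes G :: "'a::euclidean_space \<Rightarrow> 'a"
  assumes G: "Cinf_on G N" "x0 \<in> N" and inj: "inj (frechet_derivative G (at x0))"
  obtains N' g where "open N'" "x0 \<in> N'" "N' \<subseteq> N" "open (G ` N')" "\<And>x. x \<in> N' \<Longrightarrow> g (G x) = x"
    "Cinf_on g (G ` N')"
proof -
  define D where "D x = frechet_derivative G (at x)" for x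
  have N: "open N" using G by (simp add: Cinf_on_def)
  have der: "(G has_derivative D x) (at x)" if "x \<in> N" for x
    unfolding D_def using G that by (intro Cinf_on_has_derivative)
  have bl: "bounded_linear (D x)" if "x \<in> N" for x
    using der[OF that] by (rule has_derivative_bounded_linear)
  define f' where "f' x = Blinfun (D x)" for x
  have f': "blinfun_apply (f' x) = D x" if "x \<in> N" for x
    using bl[OF that] by (simp add: f'_def bounded_linear_Blinfun_apply)
  have contf: "continuous_on N f'"
  proof (rule continuous_on_blinfun_componentwise)
    fix i :: 'a
    have "continuous_on N (\<lambda>x. D x i)"
      unfolding D_def using G Cinf_on_derivative Cinf_on_continuous by blast
    then show "continuous_on N (\<lambda>x. blinfun_apply (f' x) i)"
      by (simp add: f' cong: continuous_on_cong)
  qed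
  have bij: "bij (D x0)"
    using inj bl[OF G(2)] by (auto simp: D_def intro!: linear_inj_imp_bij bounded_linear.linear)
  obtain L where L: "linear L" "L \<circ> D x0 = id"
    using linear_injective_left_inverse[OF bounded_linear.linear[OF bl[OF G(2)]]] bij bij_is_inj by blast
  have inv: "Blinfun L o\<^sub>L f' x0 = id_blinfun"
    by (rule blinfun_eqI)
      (use L f'[OF G(2)] in \<open>simp add: bounded_linear_Blinfun_apply linear_conv_bounded_linear pointfree_idE\<close>)
  obtain U' V g g' where ift: "open U'" "U' \<subseteq> N" "x0 \<in> U'" "open V" "G x0 \<in> V" "homeomorphism U' V G g"
    "\<And>y. y \<in> V \<Longrightarrow> (g has_derivative (g' y)) (at y)"
    "\<And>y. y \<in> V \<Longrightarrow> g' y = inv (blinfun_apply (f'(g y)))"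
    "\<And>y. y \<in> V \<Longrightarrow> bij (blinfun_apply (f'(g y)))"
    using inverse_function_theorem[OF N _ contf G(2) inv, of G] der f' by metis
  have gV: "g y \<in> U'" if "y \<in> V" for y using ift(6) that by (auto simp: homeomorphism_def)
  have gN: "g ` V \<subseteq> N" using gV ift(2) by auto
  have bij': "bij (D x)" if "x \<in> U'" for x
    using ift(9)[of "G x"] ift(6) that f' ift(2) by (auto simp: homeomorphism_def)
  have Ckinv: "Ck_on k (\<lambda>x. inv (D x) w) U'" for k w
  proof (rule Ck_on_inv_linear_family[OF ift(1)])
    show "Ck_on k (\<lambda>x. D x b) U'" for b
      unfolding D_def using Cinf_on_derivative[OF G(1)] ift(2) by (auto simp: Cinf_on_def intro: Ck_on_subset)
  qed (use bij' bl ift(2) bounded_linear.linear in blast)+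
  have "Ck_on k g V" for k
  proof (induction k)
    case 0
    then show ?case using ift(6) by (simp add: homeomorphism_def)
  next
    case (Suc k)
    show ?case
    proof (rule Ck_on_SucI[OF _ _ ift(4)])
      show "(g has_derivative (\<lambda>w. inv (D (g y)) w)) (at y)" if "y \<in> V" for y
        using ift(7,8)[OF that] f'[of "g y"] gN that by auto
      show "Ck_on k (\<lambda>x. inv (D (g x)) w) V" for w
        by (rule Ck_on_compose[OF Suc Ckinv]) (use gV ift in auto)
    qed
  qed
  moreover have "G ` U' = V" using ift(6) by (simp add: homeomorphism_def)
  ultimately have *: "open (G ` U')" "Cinf_on g (G ` U')" using ift(4) by (auto simp: Cinf_on_def)
  have **: "g (G x) = x" if "x \<in> U'" for x using ift(6) that by (simp add: homeomorphism_def)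
  show thesis by (rule that[OF ift(1,3,2) *(1) ** *(2)])
qed

text \<open>Product models and \<open>real ^ n\<close> are different types of equal dimension;
  composing with a linear isomorphism reduces this case to that of one type.\<close>

theorem Cinf_inverse_function:
  fixes G :: "'a::euclidean_space \<Rightarrow> 'b::euclidean_space"
  assumes G: "Cinf_on G N" "x0 \<in> N" and inj: "inj (frechet_derivative G (at x0))"
    and dim: "DIM('a) = DIM('b)"
  obtains N' g where "open N'" "x0 \<in> N'" "N' \<subseteq> N" "open (G ` N')" "\<And>x. x \<in> N' \<Longrightarrow> g (G x) = x"
    "Cinf_on g (G ` N')"
proof -
  obtain S :: "'b \<Rightarrow> 'a" and T where ST: "linear S" "linear T" "\<And>x. T (S x) = x" "\<And>y. S (T y) = y"
    using isomorphisms_UNIV_UNIV[of thesis] dim by metis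
  have blS: "bounded_linear S"
    using ST by (simp_all add: linear_conv_bounded_linear)
  have SG: "Cinf_on (\<lambda>x. S (G x)) N"
    by (rule Cinf_on_bounded_linear_compose[OF blS G(1)])
  have "frechet_derivative (\<lambda>x. S (G x)) (at x0) = (\<lambda>v. S (frechet_derivative G (at x0) v))"
    by (rule frechet_derivative_at[symmetric])
      (rule bounded_linear.has_derivative[OF blS Cinf_on_has_derivative[OF G]])
  moreover have "inj S" using ST(3) by (metis injI)
  ultimately have "inj (frechet_derivative (\<lambda>x. S (G x)) (at x0))"
    using inj by (auto simp: inj_def)
  then obtain N' g where g: "open N'" "x0 \<in> N'" "N' \<subseteq> N" "open ((\<lambda>x. S (G x)) ` N')"
    "\<And>x. x \<in> N' \<Longrightarrow> g (S (G x)) = x" "Cinf_on g ((\<lambda>x. S (G x)) ` N')"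
    using Cinf_inverse_function_same[OF SG G(2)] by metis
  have im: "G ` N' = S -` ((\<lambda>x. S (G x)) ` N')"
    using \<open>inj S\<close> by (auto simp: inj_def)
  have "open (G ` N')" unfolding im
    using g(4) blS by (intro continuous_open_vimage) (auto intro: bounded_linear.continuous)
  moreover have "Cinf_on (\<lambda>y. g (S y)) (G ` N')"
    by (rule Cinf_on_compose[OF Cinf_on_bounded_linear[OF blS] g(6)]) (use calculation in auto)
  ultimately show thesis using that[OF g(1-3), of "\<lambda>y. g (S y)"] g(5) by auto
qed

section \<open>Some smooth functions\<close>

text \<open>Meant for functions such as \<open>inverse\<close> and \<open>cis\<close>, whose
  derivative is expressed by the function itself, so that each order of regularity yields the
  next.\<close>

lemma Cinf_onI:
  assumes "open S" "continuous_on S f"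
    and "\<And>k. Ck_on k f S \<Longrightarrow> Ck_on (Suc k) f S"
  shows "Cinf_on f S"
proof -
  have "Ck_on k f S" for k
    using assms by (induction k) (simp_all only: Ck_on.simps(1))
  then show ?thesis using assms by (simp add: Cinf_on_def)
qed

lemma Cinf_on_inverse: "Cinf_on (inverse :: 'a::{real_normed_div_algebra, euclidean_space} \<Rightarrow> 'a) (- {0})"
proof (rule Cinf_onI)
  show "continuous_on (- {0}) (inverse :: 'a \<Rightarrow> 'a)"
    by (intro continuous_on_inverse continuous_on_id) auto
  fix k assume k: "Ck_on k (inverse :: 'a \<Rightarrow> 'a) (- {0})"
  show "Ck_on (Suc k) (inverse :: 'a \<Rightarrow> 'a) (- {0})"
  proof (rule Ck_on_SucI[where f' = "\<lambda>x h. - (inverse x * h * inverse x)"])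
    show "(inverse has_derivative (\<lambda>h. - (inverse x * h * inverse x))) (at x)" if "x \<in> - {0}" for x :: 'a
      using has_derivative_inverse'[of x UNIV] that by simp
    show "Ck_on k (\<lambda>x::'a. - (inverse x * v * inverse x)) (- {0})" for v
      by (rule Ck_on_bounded_linear_compose[OF bounded_linear_minus[OF bounded_linear_ident]])
        (auto intro!: Ck_on_bilinear[OF bounded_bilinear_mult] k)
  qed auto
qed auto

lemma Cinf_on_Ln: "Cinf_on Ln (- \<real>\<^sub>\<le>\<^sub>0)"
proof (rule Cinf_onI)
  show op: "open (- \<real>\<^sub>\<le>\<^sub>0 :: complex set)" by (simp add: open_Compl)
  show "continuous_on (- \<real>\<^sub>\<le>\<^sub>0) Ln" by (intro continuous_intros) auto
  have "Cinf_on inverse (- \<real>\<^sub>\<le>\<^sub>0 :: complex set)"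
    using op by (rule Cinf_on_subset[OF Cinf_on_inverse, rotated]) (auto simp: complex_nonpos_Reals_iff)
  then show "Ck_on (Suc k) Ln (- \<real>\<^sub>\<le>\<^sub>0)" for k
  proof (intro Ck_on_SucI[where f' = "\<lambda>z h. inverse z * h"])
    show "(Ln has_derivative (*) (inverse z)) (at z)" if "z \<in> - \<real>\<^sub>\<le>\<^sub>0" for z
      using has_field_derivative_Ln that by (simp add: has_field_derivative_def)
  qed (auto simp: Cinf_on_def intro!: Ck_on_bilinear[OF bounded_bilinear_mult])
qed

lemma Cinf_on_cis: "Cinf_on cis UNIV"
proof (rule Cinf_onI)
  show "continuous_on UNIV cis" by (intro continuous_intros)
  show "Ck_on (Suc k) cis UNIV" if "Ck_on k cis UNIV" for k
  proof (rule Ck_on_SucI[where f' = "\<lambda>t h. h *\<^sub>R (\<i> * cis t)"])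
    show "(cis has_derivative (\<lambda>h. h *\<^sub>R (\<i> * cis t))) (at t)" for t
    proof -
      have "((\<lambda>t. cos t *\<^sub>R 1 + sin t *\<^sub>R \<i>) has_derivative (\<lambda>h. h *\<^sub>R (\<i> * cis t))) (at t)"
        by (rule derivative_eq_intros refl)+ (auto simp: complex_eq_iff fun_eq_iff)
      moreover have "(\<lambda>t. cos t *\<^sub>R 1 + sin t *\<^sub>R \<i>) = cis" by (auto simp: complex_eq_iff)
      ultimately show ?thesis by simp
    qed
    show "Ck_on k (\<lambda>t. v *\<^sub>R (\<i> * cis t)) UNIV" for v
      by (rule Ck_on_bounded_linear_compose[OF bounded_linear_compose[OF
            bounded_linear_scaleR_right bounded_linear_mult_right] that]) simp
  qed auto
qed auto

lemma Cinf_on_mult: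
  fixes f g :: "'a::euclidean_space \<Rightarrow> 'b::{real_normed_algebra, euclidean_space}"
  shows "Cinf_on f S \<Longrightarrow> Cinf_on g S \<Longrightarrow> Cinf_on (\<lambda>x. f x * g x) S"
  by (rule Cinf_on_bilinear[OF bounded_bilinear_mult])

lemma Cinf_on_power:
  fixes f :: "'a::euclidean_space \<Rightarrow> 'b::{real_normed_algebra_1, euclidean_space}"
  assumes "Cinf_on f S" shows "Cinf_on (\<lambda>x. f x ^ n) S"
  by (induction n) (use assms Cinf_on_open[OF assms] in \<open>auto intro: Cinf_on_mult\<close>)

lemma Cinf_on_power_int: "Cinf_on (\<lambda>z::complex. z powi m) (- {0})"
  unfolding power_int_def by (cases "m \<ge> 0") (auto intro!: Cinf_on_power Cinf_on_inverse Cinf_on_ident)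

section \<open>Flat functions, steps and bumps\<close>

text \<open>The extra powers of \<open>inverse s\<close> make the family closed under
  differentiation up to linear combinations, so one induction over the order of regularity serves
  all members at once.\<close>

definition flat :: "nat \<Rightarrow> real \<Rightarrow> real" where
  "flat n s = (if s > 0 then exp (- inverse s) * inverse s ^ n else 0)"

lemma flat_0_pos [simp]: "flat 0 s > 0 \<longleftrightarrow> s > 0" and flat_nonneg [simp]: "flat n s \<ge> 0"
  and flat_eq_0 [simp]: "s \<le> 0 \<Longrightarrow> flat n s = 0"
  by (auto simp: flat_def)

lemma flat_tendsto_0: "(flat n \<longlongrightarrow> 0) (at 0)"
proof -
  have "((\<lambda>t::real. t ^ n / exp t) \<longlongrightarrow> 0) at_top" by (rule tendsto_power_div_exp_0)
  then have "((\<lambda>s::real. inverse s ^ n / exp (inverse s)) \<longlongrightarrow> 0) (at_right 0)"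
    by (rule filterlim_compose[OF _ filterlim_inverse_at_top_right])
  then have "(flat n \<longlongrightarrow> 0) (at_right 0)"
    by (rule Lim_transform_eventually)
      (auto simp: flat_def exp_minus field_simps eventually_at_right_less eventually_at_filter)
  moreover have "(flat n \<longlongrightarrow> 0) (at_left 0)"
    by (rule tendsto_eventually) (auto simp: eventually_at_filter)
  ultimately show ?thesis by (simp add: filterlim_split_at)
qed

text \<open>At the origin the difference quotient of \<open>flat n\<close> is the function
  \<open>flat (Suc n)\<close> itself, so the limit already computed gives the derivative
  there.\<close>

lemma flat_has_derivative:
  "(flat n has_real_derivative flat (n + 2) s - n * flat (Suc n) s) (at s)"
proof (cases "s = 0")
  case True
  have "(\<lambda>h. (flat n (0 + h) - flat n 0) / h) = flat (Suc n)"
    by (auto simp: flat_def fun_eq_iff field_simps)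
  then have "(flat n has_real_derivative 0) (at 0)"
    unfolding DERIV_def using flat_tendsto_0 by simp
  then show ?thesis using True by simp
next
  case False
  then consider "s > 0" | "s < 0" by linarith
  then show ?thesis
  proof cases
    case 1
    have pw: "inverse s ^ m = inverse s * inverse s ^ (m - Suc 0)" if "m \<noteq> 0" for m
      using that by (cases m) auto
    have "((\<lambda>s. exp (- inverse s) * inverse s ^ n) has_real_derivative
        exp (- inverse s) * inverse s ^ (n + 2) - n * (exp (- inverse s) * inverse s ^ Suc n)) (at s)"
      using 1 by (cases n; cases "n - 1") (auto intro!: derivative_eq_intros simp: algebra_simps power2_eq_square, metis pw)
    then have "(flat n has_real_derivative
        exp (- inverse s) * inverse s ^ (n + 2) - n * (exp (- inverse s) * inverse s ^ Suc n)) (at s)"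
      by (rule has_field_derivative_transform_within_open[where S = "{0<..}"]) (use 1 in \<open>auto simp: flat_def\<close>)
    then show ?thesis using 1 by (simp add: flat_def)
  next
    case 2
    have "(flat n has_real_derivative 0) (at s)"
      by (rule has_field_derivative_transform_within_open[where S = "{..<0}" and f = "\<lambda>_. 0"])
        (use 2 in auto)
    then show ?thesis using 2 by simp
  qed
qed

lemma Cinf_on_flat: "Cinf_on (flat n) UNIV"
proof -
  have "Ck_on k (flat n) UNIV" for k
  proof (induction k arbitrary: n)
    case 0
    then show ?case
      by (auto intro!: continuous_at_imp_continuous_on DERIV_isCont[OF flat_has_derivative])
  next
    case (Suc k)
    show ?case
    proof (rule Ck_on_SucI[where f' = "\<lambda>s h. (flat (n + 2) s - n * flat (Suc n) s) * h"])
      show "(flat n has_derivative (\<lambda>h. (flat (n + 2) s - n * flat (Suc n) s) * h)) (at s)" for s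
        using flat_has_derivative[of n s] by (simp add: has_field_derivative_def)
      have "Ck_on k (\<lambda>s. flat (n + 2) s + (- real n) * flat (Suc n) s) UNIV"
        by (intro Ck_on_add Suc Ck_on_bounded_linear_compose[OF bounded_linear_mult_right]) auto
      then show "Ck_on k (\<lambda>s. (flat (n + 2) s - n * flat (Suc n) s) * v) UNIV" for v
        by (intro Ck_on_bounded_linear_compose[OF bounded_linear_mult_left]) auto
    qed auto
  qed
  then show ?thesis by (simp add: Cinf_on_def)
qed

text \<open>The arguments \<open>2 - s\<close> and \<open>s - 1\<close> add up to 1, so at least one
  of the two flat terms is positive and the quotient is smooth on the whole line.\<close>

definition step :: "real \<Rightarrow> real" where
  "step s = flat 0 (2 - s) * inverse (flat 0 (2 - s) + flat 0 (s - 1))"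

lemma step_denominator: "flat 0 (2 - s) + flat 0 (s - 1) > 0"
proof (cases "s < 2")
  case True
  then have "flat 0 (2 - s) > 0" by simp
  then show ?thesis using flat_nonneg[of 0 "s - 1"] by linarith
next
  case False
  then have "flat 0 (s - 1) > 0" by simp
  then show ?thesis using flat_nonneg[of 0 "2 - s"] by linarith
qed

lemma step_props: "s \<le> 1 \<Longrightarrow> step s = 1" "s \<ge> 2 \<Longrightarrow> step s = 0" "0 \<le> step s" "step s \<le> 1"
proof -
  have p: "flat 0 (2 - s) + flat 0 (s - 1) > 0" by (rule step_denominator)
  show "step s = 1" if "s \<le> 1"
  proof -
    have "flat 0 (2 - s) > 0" using that by simp
    then show ?thesis using that by (simp add: step_def del: flat_0_pos)
  qed
  show "s \<ge> 2 \<Longrightarrow> step s = 0" by (simp add: step_def)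
  show "0 \<le> step s" using p by (simp add: step_def)
  show "step s \<le> 1" using p flat_nonneg[of 0 "s - 1"] by (simp add: step_def field_simps)
qed

lemma Cinf_on_step: "Cinf_on step UNIV"
proof -
  have a: "Cinf_on (\<lambda>s::real. 2 - s) UNIV" "Cinf_on (\<lambda>s::real. s - 1) UNIV"
    by (auto intro!: Cinf_on_diff)
  have b: "Cinf_on (\<lambda>s. flat 0 (2 - s)) UNIV" "Cinf_on (\<lambda>s. flat 0 (s - 1)) UNIV"
    using a by (auto intro!: Cinf_on_compose[OF _ Cinf_on_flat])
  show ?thesis unfolding step_def
    by (intro Cinf_on_mult Cinf_on_compose[OF Cinf_on_add[OF b] Cinf_on_inverse] b)
      (use step_denominator in \<open>force simp: less_le\<close>)
qed

text \<open>The squared distance enters the profile because it is smooth at the center as well. In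
  units of the squared radius the distance \<open>2 * \<delta>\<close> corresponds to the value 4,
  which is beyond the point 2 where \<open>step\<close> has reached zero.\<close>

lemma Cinf_bump:
  fixes y0 :: "'a::euclidean_space"
  assumes "\<delta> > 0"
  obtains B :: "'a \<Rightarrow> real" where "Cinf_on B UNIV" "\<And>y. 0 \<le> B y" "\<And>y. B y \<le> 1"
    "\<And>y. dist y0 y < \<delta> \<Longrightarrow> B y = 1" "\<And>y. dist y0 y \<ge> 2 * \<delta> \<Longrightarrow> B y = 0"
proof
  let ?B = "\<lambda>y. step (inverse (\<delta>\<^sup>2) * ((y - y0) \<bullet> (y - y0)))"
  have "Cinf_on (\<lambda>y. y - y0) UNIV"
    by (auto intro!: Cinf_on_diff)
  then show "Cinf_on ?B UNIV"
    by (intro Cinf_on_compose[OF _ Cinf_on_step] Cinf_on_bounded_linear_compose[OF bounded_linear_mult_right]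
        Cinf_on_bilinear[OF bounded_bilinear_inner]) auto
  show "0 \<le> ?B y" "?B y \<le> 1" for y by (simp_all add: step_props)
  have eq: "(y - y0) \<bullet> (y - y0) = (dist y0 y)\<^sup>2" for y
    by (simp add: dist_norm power2_norm_eq_inner norm_minus_commute[of y0])
  show "?B y = 1" if "dist y0 y < \<delta>" for y
  proof (rule step_props)
    have "(dist y0 y)\<^sup>2 \<le> \<delta>\<^sup>2" using that by (intro power_mono) auto
    then show "inverse (\<delta>\<^sup>2) * ((y - y0) \<bullet> (y - y0)) \<le> 1"
      using assms by (simp add: eq field_simps)
  qed
  show "?B y = 0" if "dist y0 y \<ge> 2 * \<delta>" for y
  proof (rule step_props)
    have "(2 * \<delta>)\<^sup>2 \<le> (dist y0 y)\<^sup>2" using that assms by (intro power_mono) auto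
    moreover have "2 * \<delta>\<^sup>2 \<le> 2\<^sup>2 * \<delta>\<^sup>2" by (intro mult_right_mono) auto
    ultimately have "2 * \<delta>\<^sup>2 \<le> (dist y0 y)\<^sup>2"
      unfolding power_mult_distrib by (rule order_trans[rotated])
    then show "2 \<le> inverse (\<delta>\<^sup>2) * ((y - y0) \<bullet> (y - y0))"
      using assms by (simp add: eq field_simps)
  qed
qed

section \<open>Germs of smooth functions on manifolds\<close>

text \<open>The representative lives on an open subset of the model space, so at a boundary point it
  is an extension across the bounding hyperplane. One chart suffices, because transitions between
  compatible charts also extend; and smoothness at a point spreads to a neighbourhood.\<close>

definition smooth_at :: "('a, 'e::euclidean_space) mfd \<Rightarrow> ('a \<Rightarrow> 'b::euclidean_space) \<Rightarrow> 'a \<Rightarrow> bool" where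
  "smooth_at M f p \<longleftrightarrow> (\<exists>(U, \<phi>)\<in>atlas M. p \<in> U \<and>
     (\<exists>N g. \<phi> p \<in> N \<and> Cinf_on g N \<and> (\<forall>y\<in>U. \<phi> y \<in> N \<longrightarrow> f y = g (\<phi> y))))"

text \<open>A chart compatible with the atlas, whose model space may be of another type.\<close>

definition gchart :: "('a, 'e::euclidean_space) mfd \<Rightarrow> 'a set \<Rightarrow> ('a \<Rightarrow> 'c::euclidean_space) \<Rightarrow> bool" where
  "gchart M U \<kappa> \<longleftrightarrow> openin (mtop M) U \<and> inj_on \<kappa> U \<and> (\<forall>x\<in>U. smooth_at M \<kappa> x) \<and>
     (\<forall>x\<in>U. \<forall>(V, \<phi>)\<in>atlas M. x \<in> V \<longrightarrow>
        (\<exists>N g. \<kappa> x \<in> N \<and> Cinf_on g N \<and> (\<forall>y\<in>U. \<kappa> y \<in> N \<longrightarrow> y \<in> V \<and> \<phi> y = g (\<kappa> y))))"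

text \<open>A smooth manifold without any condition on the images of the charts.\<close>

definition premfd :: "('a, 'e::euclidean_space) mfd \<Rightarrow> bool" where
  "premfd M \<longleftrightarrow> \<Union>(fst ` atlas M) = points M \<and>
     (\<forall>(U, \<phi>)\<in>atlas M. gchart M U \<phi> \<and>
        (\<forall>N. open N \<longrightarrow> openin (mtop M) {y\<in>U. \<phi> y \<in> N}) \<and>
        (\<forall>A x. openin (mtop M) A \<longrightarrow> x \<in> A \<inter> U \<longrightarrow>
           (\<exists>N. open N \<and> \<phi> x \<in> N \<and> (\<forall>y\<in>U. \<phi> y \<in> N \<longrightarrow> y \<in> A))))"

lemma gchart_transition:
  assumes "gchart M U \<kappa>" "x \<in> U" "(V, \<phi>) \<in> atlas M" "x \<in> V"
  obtains N g where "\<kappa> x \<in> N" "Cinf_on g N" "\<And>y. y \<in> U \<Longrightarrow> \<kappa> y \<in> N \<Longrightarrow> y \<in> V \<and> \<phi> y = g (\<kappa> y)"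
proof -
  have "\<forall>x\<in>U. \<forall>c\<in>atlas M. x \<in> fst c \<longrightarrow>
        (\<exists>N g. \<kappa> x \<in> N \<and> Cinf_on g N \<and> (\<forall>y\<in>U. \<kappa> y \<in> N \<longrightarrow> y \<in> fst c \<and> snd c y = g (\<kappa> y)))"
    using assms(1) by (simp add: gchart_def split_beta)
  from this[rule_format, OF assms(2,3)] show thesis using assms(4) that by auto
qed

lemma gchartI:
  assumes "openin (mtop M) U" "inj_on \<kappa> U" "\<And>x. x \<in> U \<Longrightarrow> smooth_at M \<kappa> x"
    and "\<And>x V \<phi>. x \<in> U \<Longrightarrow> (V, \<phi>) \<in> atlas M \<Longrightarrow> x \<in> V \<Longrightarrow>
        \<exists>N g. \<kappa> x \<in> N \<and> Cinf_on g N \<and> (\<forall>y\<in>U. \<kappa> y \<in> N \<longrightarrow> y \<in> V \<and> \<phi> y = g (\<kappa> y))"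
  shows "gchart M U \<kappa>"
  unfolding gchart_def split_beta using assms by (simp add: split_paired_all)

lemma premfd_preimage:
  assumes "premfd M" "(U, \<phi>) \<in> atlas M" "open N" shows "openin (mtop M) {y\<in>U. \<phi> y \<in> N}"
  using assms unfolding premfd_def by blast

lemma premfd_nhd:
  assumes "premfd M" "(U, \<phi>) \<in> atlas M" "openin (mtop M) A" "x \<in> A" "x \<in> U"
  obtains N where "open N" "\<phi> x \<in> N" "\<And>y. y \<in> U \<Longrightarrow> \<phi> y \<in> N \<Longrightarrow> y \<in> A"
proof -
  have "\<forall>c\<in>atlas M. \<forall>A x. openin (mtop M) A \<longrightarrow> x \<in> A \<inter> fst c \<longrightarrow>
           (\<exists>N. open N \<and> snd c x \<in> N \<and> (\<forall>y\<in>fst c. snd c y \<in> N \<longrightarrow> y \<in> A))"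
    using assms(1) by (simp add: premfd_def split_beta)
  from this[rule_format, OF assms(2,3), of x] show thesis using assms(4,5) that by auto
qed

lemma smooth_at_atlas: "(U, \<phi>) \<in> atlas M \<Longrightarrow> x \<in> U \<Longrightarrow> smooth_at M \<phi> x"
  unfolding smooth_at_def by (rule bexI[of _ "(U, \<phi>)"]) (auto intro!: exI[of _ UNIV] exI[of _ "\<lambda>y. y"] Cinf_on_ident)

lemma smooth_atI:
  assumes "(U, \<phi>) \<in> atlas M" "p \<in> U" "\<phi> p \<in> N" "Cinf_on g N" "\<And>y. y \<in> U \<Longrightarrow> \<phi> y \<in> N \<Longrightarrow> f y = g (\<phi> y)"
  shows "smooth_at M f p"
  unfolding smooth_at_def using assms by blast

lemma smooth_atE:
  assumes "smooth_at M f p"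
  obtains U \<phi> N g where "(U, \<phi>) \<in> atlas M" "p \<in> U" "\<phi> p \<in> N" "Cinf_on g N"
    "\<And>y. y \<in> U \<Longrightarrow> \<phi> y \<in> N \<Longrightarrow> f y = g (\<phi> y)"
  using assms unfolding smooth_at_def by blast

lemma gchart_atlas: "premfd M \<Longrightarrow> (U, \<phi>) \<in> atlas M \<Longrightarrow> gchart M U \<phi>"
  unfolding premfd_def by auto

lemma premfd_chart:
  assumes "premfd M" "p \<in> points M"
  obtains U \<phi> where "(U, \<phi>) \<in> atlas M" "p \<in> U"
proof -
  have "p \<in> \<Union>(fst ` atlas M)" using assms by (simp add: premfd_def)
  then show thesis using that by force
qed

lemma gchart_points: "gchart M U \<kappa> \<Longrightarrow> U \<subseteq> points M"
  by (auto simp: gchart_def dest: openin_subset)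

lemma gchart_openin: "gchart M U \<kappa> \<Longrightarrow> openin (mtop M) U"
  by (auto simp: gchart_def)

lemma gchart_inj: "gchart M U \<kappa> \<Longrightarrow> inj_on \<kappa> U"
  by (auto simp: gchart_def)

lemma gchart_smooth_at: "gchart M U \<kappa> \<Longrightarrow> x \<in> U \<Longrightarrow> smooth_at M \<kappa> x"
  by (auto simp: gchart_def)

lemma gchart_subset:
  assumes "gchart M U \<kappa>" "openin (mtop M) V" "V \<subseteq> U" shows "gchart M V \<kappa>"
proof (rule gchartI)
  fix x W \<phi> assume x: "x \<in> V" and W: "(W, \<phi>) \<in> atlas M" "x \<in> W"
  obtain N g where "\<kappa> x \<in> N" "Cinf_on g N" "\<And>y. y \<in> U \<Longrightarrow> \<kappa> y \<in> N \<Longrightarrow> y \<in> W \<and> \<phi> y = g (\<kappa> y)"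
    using gchart_transition[OF assms(1) _ W] x assms(3) by blast
  then show "\<exists>N g. \<kappa> x \<in> N \<and> Cinf_on g N \<and> (\<forall>y\<in>V. \<kappa> y \<in> N \<longrightarrow> y \<in> W \<and> \<phi> y = g (\<kappa> y))"
    using assms(3) by (intro exI[of _ N] exI[of _ g]) auto
qed (use assms in \<open>auto simp: gchart_def inj_on_subset\<close>)

lemma Cinf_on_vimage:
  assumes "Cinf_on f S" "open T" shows "open (S \<inter> f -` T)"
  using continuous_open_preimage[OF Cinf_on_continuous[OF assms(1)] Cinf_on_open[OF assms(1)] assms(2)] .

lemma smooth_at_gchart:
  assumes "smooth_at M f p" "gchart M U \<kappa>" "p \<in> U"
  obtains N g where "\<kappa> p \<in> N" "Cinf_on g N" "\<And>y. y \<in> U \<Longrightarrow> \<kappa> y \<in> N \<Longrightarrow> f y = g (\<kappa> y)"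
proof -
  obtain V \<phi> N0 g0 where 0: "(V, \<phi>) \<in> atlas M" "p \<in> V" "\<phi> p \<in> N0" "Cinf_on g0 N0"
    "\<And>y. y \<in> V \<Longrightarrow> \<phi> y \<in> N0 \<Longrightarrow> f y = g0 (\<phi> y)"
    by (rule smooth_atE[OF assms(1)]) blast
  then obtain N1 g1 where 1: "\<kappa> p \<in> N1" "Cinf_on g1 N1"
    "\<And>y. y \<in> U \<Longrightarrow> \<kappa> y \<in> N1 \<Longrightarrow> y \<in> V \<and> \<phi> y = g1 (\<kappa> y)"
    using gchart_transition[OF assms(2,3) 0(1,2)] by blast
  show thesis
  proof (rule that[of "N1 \<inter> g1 -` N0" "\<lambda>y. g0 (g1 y)"])
    have "open (N1 \<inter> g1 -` N0)" by (rule Cinf_on_vimage[OF 1(2) Cinf_on_open[OF 0(4)]])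
    then show "Cinf_on (\<lambda>y. g0 (g1 y)) (N1 \<inter> g1 -` N0)"
      by (intro Cinf_on_compose[OF Cinf_on_subset[OF 1(2)] 0(4)]) auto
  qed (use 0 1 assms(3) in auto)
qed

lemma gchart_nhd:
  assumes M: "premfd M" and "gchart M U \<kappa>" "openin (mtop M) A" "x \<in> A \<inter> U"
  obtains N where "open N" "\<kappa> x \<in> N" "\<And>y. y \<in> U \<Longrightarrow> \<kappa> y \<in> N \<Longrightarrow> y \<in> A"
proof -
  have "x \<in> points M" using assms openin_subset by blast
  then obtain V \<phi> where V: "(V, \<phi>) \<in> atlas M" "x \<in> V" using premfd_chart[OF M] by blast
  then obtain N0 where 0: "open N0" "\<phi> x \<in> N0" "\<And>y. y \<in> V \<Longrightarrow> \<phi> y \<in> N0 \<Longrightarrow> y \<in> A"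
    using premfd_nhd[OF M V(1) assms(3)] assms(4) by blast
  obtain N1 g1 where 1: "\<kappa> x \<in> N1" "Cinf_on g1 N1"
    "\<And>y. y \<in> U \<Longrightarrow> \<kappa> y \<in> N1 \<Longrightarrow> y \<in> V \<and> \<phi> y = g1 (\<kappa> y)"
    using gchart_transition[OF assms(2) _ V] assms(4) by blast
  show thesis
    by (rule that[of "N1 \<inter> g1 -` N0"]) (use 0 1 assms(4) Cinf_on_vimage[OF 1(2) 0(1)] in auto)
qed

lemma smooth_at_points: "premfd M \<Longrightarrow> smooth_at M f p \<Longrightarrow> p \<in> points M"
  unfolding smooth_at_def using gchart_points[OF gchart_atlas] by blast

lemma smooth_at_continuous:
  assumes M: "premfd M" and "smooth_at M f p" "open B" "f p \<in> B"
  obtains A where "openin (mtop M) A" "p \<in> A" "\<And>y. y \<in> A \<Longrightarrow> f y \<in> B"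
proof -
  obtain V \<phi> N g where 0: "(V, \<phi>) \<in> atlas M" "p \<in> V" "\<phi> p \<in> N" "Cinf_on g N"
    "\<And>y. y \<in> V \<Longrightarrow> \<phi> y \<in> N \<Longrightarrow> f y = g (\<phi> y)"
    by (rule smooth_atE[OF assms(2)]) blast
  show thesis
  proof (rule that[of "{y\<in>V. \<phi> y \<in> N \<inter> g -` B}"])
    show "openin (mtop M) {y\<in>V. \<phi> y \<in> N \<inter> g -` B}"
      by (rule premfd_preimage[OF M 0(1) Cinf_on_vimage[OF 0(4) assms(3)]])
  qed (use 0 assms in auto)
qed

lemma smooth_at_openin_vimage:
  assumes M: "premfd M" and "openin (mtop M) A" "\<And>p. p \<in> A \<Longrightarrow> smooth_at M f p" "open B"
  shows "openin (mtop M) {p\<in>A. f p \<in> B}"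
proof (subst openin_subopen, intro ballI)
  fix p assume p: "p \<in> {p\<in>A. f p \<in> B}"
  then obtain C where "openin (mtop M) C" "p \<in> C" "\<And>y. y \<in> C \<Longrightarrow> f y \<in> B"
    using smooth_at_continuous[OF M assms(3) assms(4)] by blast
  then show "\<exists>T. openin (mtop M) T \<and> p \<in> T \<and> T \<subseteq> {p\<in>A. f p \<in> B}"
    using p assms(2) by (intro exI[of _ "A \<inter> C"]) auto
qed

lemma smooth_at_continuous_map:
  assumes M: "premfd M" and "\<And>p. p \<in> points M \<Longrightarrow> smooth_at M f p"
  shows "continuous_map (mtop M) euclidean f"
  using smooth_at_openin_vimage[OF M openin_topspace assms(2)] by (simp add: continuous_map_def)

lemma smooth_at_cong:
  assumes M: "premfd M" and "smooth_at M f p" "openin (mtop M) A" "p \<in> A" "\<And>y. y \<in> A \<Longrightarrow> f y = h y"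
  shows "smooth_at M h p"
proof -
  obtain V \<phi> N g where 0: "(V, \<phi>) \<in> atlas M" "p \<in> V" "\<phi> p \<in> N" "Cinf_on g N"
    "\<And>y. y \<in> V \<Longrightarrow> \<phi> y \<in> N \<Longrightarrow> f y = g (\<phi> y)"
    by (rule smooth_atE[OF assms(2)]) blast
  obtain N' where N': "open N'" "\<phi> p \<in> N'" "\<And>y. y \<in> V \<Longrightarrow> \<phi> y \<in> N' \<Longrightarrow> y \<in> A"
    using gchart_nhd[OF M gchart_atlas[OF M 0(1)] assms(3)] 0 assms by blast
  have "Cinf_on g (N \<inter> N')"
    using 0(4) N'(1) Cinf_on_open by (blast intro: Cinf_on_subset)
  then show ?thesis
    by (rule smooth_atI[OF 0(1,2), rotated]) (use 0 N' assms(5) in \<open>auto, metis\<close>)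
qed

lemma smooth_at_compose:
  assumes "smooth_at M f p" "Cinf_on g B" "f p \<in> B" shows "smooth_at M (\<lambda>x. g (f x)) p"
proof -
  obtain V \<phi> N f' where 0: "(V, \<phi>) \<in> atlas M" "p \<in> V" "\<phi> p \<in> N" "Cinf_on f' N"
    "\<And>y. y \<in> V \<Longrightarrow> \<phi> y \<in> N \<Longrightarrow> f y = f' (\<phi> y)"
    by (rule smooth_atE[OF assms(1)]) blast
  have "Cinf_on (\<lambda>y. g (f' y)) (N \<inter> f' -` B)"
    using Cinf_on_vimage[OF 0(4) Cinf_on_open[OF assms(2)]]
    by (intro Cinf_on_compose[OF Cinf_on_subset[OF 0(4)] assms(2)]) auto
  then show ?thesis
    by (rule smooth_atI[OF 0(1,2), rotated]) (use 0 assms(3) in auto)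
qed

lemma smooth_at_const: "premfd M \<Longrightarrow> p \<in> points M \<Longrightarrow> smooth_at M (\<lambda>x. c) p"
  using smooth_at_compose[OF smooth_at_atlas Cinf_on_const[of UNIV c]] by (metis premfd_chart UNIV_I open_UNIV)

lemma smooth_at_Pair:
  assumes M: "premfd M" and "smooth_at M f p" "smooth_at M h p"
  shows "smooth_at M (\<lambda>x. (f x, h x)) p"
proof -
  obtain V \<phi> N g where 0: "(V, \<phi>) \<in> atlas M" "p \<in> V" "\<phi> p \<in> N" "Cinf_on g N"
    "\<And>y. y \<in> V \<Longrightarrow> \<phi> y \<in> N \<Longrightarrow> f y = g (\<phi> y)"
    by (rule smooth_atE[OF assms(2)]) blast
  obtain N1 g1 where 1: "\<phi> p \<in> N1" "Cinf_on g1 N1" "\<And>y. y \<in> V \<Longrightarrow> \<phi> y \<in> N1 \<Longrightarrow> h y = g1 (\<phi> y)"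
    using smooth_at_gchart[OF assms(3) gchart_atlas[OF M 0(1)] 0(2)] by blast
  have "open (N \<inter> N1)" using 0(4) 1(2) by (simp add: Cinf_on_open open_Int)
  then have "Cinf_on (\<lambda>y. (g y, g1 y)) (N \<inter> N1)"
    by (intro Cinf_on_Pair Cinf_on_subset[OF 0(4)] Cinf_on_subset[OF 1(2)]) auto
  then show ?thesis
    by (rule smooth_atI[OF 0(1,2), rotated]) (use 0 1 in auto)
qed

lemma smooth_at_bounded_linear: "bounded_linear l \<Longrightarrow> smooth_at M f p \<Longrightarrow> smooth_at M (\<lambda>x. l (f x)) p"
  by (rule smooth_at_compose[OF _ Cinf_on_bounded_linear[of _ UNIV]]) auto

lemma smooth_at_fst: "smooth_at M f p \<Longrightarrow> smooth_at M (\<lambda>x. fst (f x)) p"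
  and smooth_at_snd: "smooth_at M f p \<Longrightarrow> smooth_at M (\<lambda>x. snd (f x)) p"
  by (auto intro: smooth_at_bounded_linear bounded_linear_fst bounded_linear_snd)

lemma smooth_at_bilinear:
  assumes "premfd M" "bounded_bilinear B" "smooth_at M f p" "smooth_at M h p"
  shows "smooth_at M (\<lambda>x. B (f x) (h x)) p"
proof -
  have "Cinf_on (\<lambda>z. B (fst z) (snd z)) UNIV"
    by (intro Cinf_on_bilinear[OF assms(2)] Cinf_on_bounded_linear bounded_linear_fst bounded_linear_snd) auto
  from smooth_at_compose[OF smooth_at_Pair[OF assms(1,3,4)] this] show ?thesis by simp
qed

lemma smooth_at_mult:
  fixes f h :: "'a \<Rightarrow> 'b::{real_normed_algebra, euclidean_space}"
  shows "premfd M \<Longrightarrow> smooth_at M f p \<Longrightarrow> smooth_at M h p \<Longrightarrow> smooth_at M (\<lambda>x. f x * h x) p"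
  by (rule smooth_at_bilinear[OF _ bounded_bilinear_mult])

lemma smooth_at_scaleR:
  "premfd M \<Longrightarrow> smooth_at M f p \<Longrightarrow> smooth_at M h p \<Longrightarrow> smooth_at M (\<lambda>x. f x *\<^sub>R h x) p"
  by (rule smooth_at_bilinear[OF _ bounded_bilinear_scaleR])

lemma smooth_at_add:
  assumes "premfd M" "smooth_at M f p" "smooth_at M h p"
  shows "smooth_at M (\<lambda>x. f x + h x) p"
proof -
  have "bounded_linear (\<lambda>z::'c \<times> 'c. fst z + snd z)"
    by (intro bounded_linear_add bounded_linear_fst bounded_linear_snd)
  from smooth_at_bounded_linear[OF this smooth_at_Pair[OF assms]] show ?thesis by simp
qed

lemma smooth_at_minus: "smooth_at M f p \<Longrightarrow> smooth_at M (\<lambda>x. - f x) p"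
  by (rule smooth_at_bounded_linear[OF bounded_linear_minus[OF bounded_linear_ident]])

lemma smooth_at_sum:
  assumes "premfd M" "p \<in> points M" "\<And>i. i \<in> I \<Longrightarrow> smooth_at M (f i) p"
  shows "smooth_at M (\<lambda>x. \<Sum>i\<in>I. f i x) p"
  using assms(3) by (induction I rule: infinite_finite_induct)
    (auto intro: smooth_at_add[OF assms(1)] smooth_at_const[OF assms(1,2)])

lemma gchart_compose:
  assumes M: "premfd M" and \<kappa>: "gchart M U \<kappa>" and N: "\<kappa> ` U \<subseteq> N" and G: "Cinf_on G N"
    and g: "Cinf_on g (G ` N)" "\<And>y. y \<in> N \<Longrightarrow> g (G y) = y"
  shows "gchart M U (\<lambda>x. G (\<kappa> x))"
proof (rule gchartI)
  show "openin (mtop M) U" by (rule gchart_openin[OF \<kappa>])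
  show "inj_on (\<lambda>x. G (\<kappa> x)) U"
    using gchart_inj[OF \<kappa>] g(2) N unfolding inj_on_def by (metis image_subset_iff)
  show "smooth_at M (\<lambda>x. G (\<kappa> x)) x" if "x \<in> U" for x
    using that N by (intro smooth_at_compose[OF gchart_smooth_at[OF \<kappa>] G]) auto
  fix x V \<phi> assume x: "x \<in> U" and V: "(V, \<phi>) \<in> atlas M" "x \<in> V"
  obtain N1 g1 where 1: "\<kappa> x \<in> N1" "Cinf_on g1 N1"
    "\<And>y. y \<in> U \<Longrightarrow> \<kappa> y \<in> N1 \<Longrightarrow> y \<in> V \<and> \<phi> y = g1 (\<kappa> y)"
    using gchart_transition[OF \<kappa> x V] by blast
  have "open (G ` N \<inter> g -` N1)" by (rule Cinf_on_vimage[OF g(1) Cinf_on_open[OF 1(2)]])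
  then have "Cinf_on (\<lambda>z. g1 (g z)) (G ` N \<inter> g -` N1)"
    by (intro Cinf_on_compose[OF Cinf_on_subset[OF g(1)] 1(2)]) auto
  then show "\<exists>N g. G (\<kappa> x) \<in> N \<and> Cinf_on g N \<and> (\<forall>y\<in>U. G (\<kappa> y) \<in> N \<longrightarrow> y \<in> V \<and> \<phi> y = g (G (\<kappa> y)))"
    using 1(1,3) g(2) N x by (intro exI[of _ "G ` N \<inter> g -` N1"] exI[of _ "\<lambda>z. g1 (g z)"]) (auto simp: image_subset_iff)
qed

text \<open>The conclusion is stated for all smaller open sets \<open>N''\<close> because the domain
  is cut down afterwards, to fit the image of a half-space chart or a range of angles.\<close>

lemma gchart_inverse_function:
  fixes \<kappa> :: "'a \<Rightarrow> 'c::euclidean_space" and G :: "'c \<Rightarrow> 'd::euclidean_space"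
  assumes M: "premfd M" and \<kappa>: "gchart M U \<kappa>" and x: "x \<in> U" "\<kappa> x \<in> N" and G: "Cinf_on G N"
    and inj: "inj (frechet_derivative G (at (\<kappa> x)))" and dim: "DIM('c) = DIM('d)"
  obtains N' where "open N'" "\<kappa> x \<in> N'" "N' \<subseteq> N" "inj_on G N'" "open (G ` N')"
    "\<And>N'' . open N'' \<Longrightarrow> N'' \<subseteq> N' \<Longrightarrow> open (G ` N'') \<and> gchart M {y\<in>U. \<kappa> y \<in> N''} (\<lambda>y. G (\<kappa> y))"
proof -
  obtain N' g where g: "open N'" "\<kappa> x \<in> N'" "N' \<subseteq> N" "open (G ` N')" "\<And>y. y \<in> N' \<Longrightarrow> g (G y) = y"
    "Cinf_on g (G ` N')"
    using Cinf_inverse_function[OF G x(2) inj dim] by blast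
  show thesis
  proof (rule that[OF g(1-3)])
    show "inj_on G N'" using g(5) by (metis inj_onI)
    fix N'' assume N'': "open N''" "N'' \<subseteq> N'"
    have "G ` N'' = G ` N' \<inter> g -` N''" using N'' g(5) by (auto simp: image_iff subset_iff)
    then have op: "open (G ` N'')" using Cinf_on_vimage[OF g(6) N''(1)] by simp
    have "openin (mtop M) {y\<in>U. \<kappa> y \<in> N''}"
      by (rule smooth_at_openin_vimage[OF M gchart_openin[OF \<kappa>] gchart_smooth_at[OF \<kappa>] N''(1)])
    then have "gchart M {y\<in>U. \<kappa> y \<in> N''} \<kappa>" by (rule gchart_subset[OF \<kappa>]) auto
    then have "gchart M {y\<in>U. \<kappa> y \<in> N''} (\<lambda>y. G (\<kappa> y))"
    proof (rule gchart_compose[OF M])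
      show "Cinf_on G N''" using N'' g(3) by (intro Cinf_on_subset[OF G]) auto
      show "Cinf_on g (G ` N'')" using N'' op by (intro Cinf_on_subset[OF g(6)]) auto
    qed (use g(5) N'' in auto)
    with op show "open (G ` N'') \<and> gchart M {y\<in>U. \<kappa> y \<in> N''} (\<lambda>y. G (\<kappa> y))" by simp
  qed (rule g(4))
qed

lemma smooth_onE:
  assumes "smooth_on S f" "x \<in> S"
  obtains N g where "x \<in> N" "Cinf_on g N" "\<And>y. y \<in> S \<Longrightarrow> y \<in> N \<Longrightarrow> g y = f y"
proof -
  obtain N g where "open N \<and> x \<in> N \<and> (\<forall>k. Ck_on k g N) \<and> (\<forall>y\<in>S \<inter> N. g y = f y)"
    using assms unfolding smooth_on_def by meson
  then show thesis using that by (auto simp: Cinf_on_def)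
qed

section \<open>Comparison with smooth manifolds and smooth maps\<close>

lemma smooth_manifold_imp_premfd:
  assumes "smooth_manifold M" shows "premfd M"
proof -
  have ch: "smooth_chart M c" if "c \<in> atlas M" for c using assms that by (simp add: smooth_manifold_def)
  have op: "openin (mtop M) U" and inj: "inj_on \<phi> U"
    and cont: "\<And>N. open N \<Longrightarrow> openin (mtop M) {y\<in>U. \<phi> y \<in> N}"
    and nhd: "\<And>A x. openin (mtop M) A \<Longrightarrow> x \<in> A \<inter> U \<Longrightarrow> \<exists>N. open N \<and> \<phi> x \<in> N \<and> (\<forall>y\<in>U. \<phi> y \<in> N \<longrightarrow> y \<in> A)"
    if c: "(U, \<phi>) \<in> atlas M" for U \<phi>
  proof -
    have t: "openin (mtop M) U" "homeomorphic_map (subtopology (mtop M) U) (top_of_set (\<phi> ` U)) \<phi>"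
      using ch[OF c] by (auto simp: smooth_chart_def topological_chart_def)
    then have sub: "topspace (subtopology (mtop M) U) = U" using openin_subset by fastforce
    show "openin (mtop M) U" by fact
    show "inj_on \<phi> U" using t(2) sub by (auto simp: homeomorphic_eq_everything_map)
    have cm: "continuous_map (subtopology (mtop M) U) (top_of_set (\<phi> ` U)) \<phi>"
      and om: "open_map (subtopology (mtop M) U) (top_of_set (\<phi> ` U)) \<phi>"
      using t(2) by (auto simp: homeomorphic_eq_everything_map)
    show "openin (mtop M) {y\<in>U. \<phi> y \<in> N}" if "open N" for N
    proof -
      have "openin (top_of_set (\<phi> ` U)) (\<phi> ` U \<inter> N)" using that by (simp add: openin_open_Int)
      then have "openin (subtopology (mtop M) U) {y\<in>U. \<phi> y \<in> \<phi> ` U \<inter> N}"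
        using openin_continuous_map_preimage[OF cm, unfolded sub] by blast
      moreover have "{y\<in>U. \<phi> y \<in> \<phi> ` U \<inter> N} = {y\<in>U. \<phi> y \<in> N}" by auto
      ultimately show ?thesis using t(1) openin_trans_full by metis
    qed
    show "\<exists>N. open N \<and> \<phi> x \<in> N \<and> (\<forall>y\<in>U. \<phi> y \<in> N \<longrightarrow> y \<in> A)"
      if "openin (mtop M) A" "x \<in> A \<inter> U" for A x
    proof -
      have "openin (subtopology (mtop M) U) (A \<inter> U)"
        using that(1) openin_subtopology by blast
      then have "openin (top_of_set (\<phi> ` U)) (\<phi> ` (A \<inter> U))" using om by (simp add: open_map_def)
      then obtain N where N: "open N" "\<phi> ` (A \<inter> U) = \<phi> ` U \<inter> N" by (auto simp: openin_open)
      have "y \<in> A" if "y \<in> U" "\<phi> y \<in> N" for y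
      proof -
        have "\<phi> y \<in> \<phi> ` (A \<inter> U)" using N that by auto
        then show ?thesis using \<open>inj_on \<phi> U\<close> that(1) by (metis IntD1 IntD2 imageE inj_onD)
      qed
      moreover have "\<phi> x \<in> N" using N that(2) by blast
      ultimately show ?thesis using N by blast
    qed
  qed
  have gc: "gchart M U \<phi>" if c: "(U, \<phi>) \<in> atlas M" for U \<phi>
  proof (rule gchartI)
    fix x V \<psi> assume x: "x \<in> U" and V: "(V, \<psi>) \<in> atlas M" "x \<in> V"
    have "smooth_on (\<phi> ` (U \<inter> V)) (\<psi> \<circ> inv_into U \<phi>)"
      using ch[OF c] V by (auto simp: smooth_chart_def smooth_transition_def)
    then obtain N g where N: "\<phi> x \<in> N" "Cinf_on g N"
      "\<And>z. z \<in> \<phi> ` (U \<inter> V) \<Longrightarrow> z \<in> N \<Longrightarrow> g z = (\<psi> \<circ> inv_into U \<phi>) z"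
      by (rule smooth_onE[of _ _ "\<phi> x"]) (use x V in auto)
    obtain N' where N': "open N'" "\<phi> x \<in> N'" "\<And>y. y \<in> U \<Longrightarrow> \<phi> y \<in> N' \<Longrightarrow> y \<in> V"
      using nhd[OF c op[OF V(1)], of x] x V by blast
    have "Cinf_on g (N \<inter> N')" using N(2) N'(1) by (auto simp: Cinf_on_def intro: Ck_on_subset)
    moreover have "\<psi> y = g (\<phi> y)" if "y \<in> U" "\<phi> y \<in> N \<inter> N'" for y
      using N(3)[of "\<phi> y"] N'(3) that inv_into_f_f[OF inj[OF c] that(1)] by auto
    ultimately show "\<exists>N g. \<phi> x \<in> N \<and> Cinf_on g N \<and> (\<forall>y\<in>U. \<phi> y \<in> N \<longrightarrow> y \<in> V \<and> \<psi> y = g (\<phi> y))"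
      using N N' by (intro exI[of _ "N \<inter> N'"] exI[of _ g]) auto
  qed (use op inj c smooth_at_atlas in auto)
  show ?thesis unfolding premfd_def
  proof (intro conjI ballI)
    show "\<Union> (fst ` atlas M) = points M" using assms by (simp add: smooth_manifold_def)
    fix c assume "c \<in> atlas M"
    then show "case c of (U, \<phi>) \<Rightarrow> gchart M U \<phi> \<and>
        (\<forall>N. open N \<longrightarrow> openin (mtop M) {y\<in>U. \<phi> y \<in> N}) \<and>
        (\<forall>A x. openin (mtop M) A \<longrightarrow> x \<in> A \<inter> U \<longrightarrow>
           (\<exists>N. open N \<and> \<phi> x \<in> N \<and> (\<forall>y\<in>U. \<phi> y \<in> N \<longrightarrow> y \<in> A)))"
      using gc cont nhd by (cases c) simp
  qed
qed

text \<open>A partial converse, meant for the fibers of a submersion: beyond \<open>premfd\<close>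
  only the half-space condition on the images has to be supplied.\<close>

lemma premfd_imp_smooth_charts:
  fixes M :: "('a, 'b::euclidean_space) mfd"
  assumes M: "premfd M" and half: "\<And>U \<phi>. (U, \<phi>) \<in> atlas M \<Longrightarrow> \<exists>u. openin (top_of_set {x. 0 \<le> x \<bullet> u}) (\<phi> ` U)"
    and c: "c \<in> atlas M"
  shows "smooth_chart M c"
proof -
  obtain U \<phi> where c_eq: "c = (U, \<phi>)" by force
  have \<phi>: "gchart M U \<phi>" using M c by (auto simp: c_eq gchart_atlas)
  have sub: "topspace (subtopology (mtop M) U) = U" using gchart_points[OF \<phi>] by auto
  have trans: "smooth_transition (U, \<phi>) (V, \<psi>)" if U: "(U, \<phi>) \<in> atlas M" and V: "(V, \<psi>) \<in> atlas M" for U V \<phi> \<psi>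
    unfolding smooth_transition_def smooth_on_def
  proof (clarsimp)
    fix x assume x: "x \<in> U" "x \<in> V"
    have \<phi>: "gchart M U \<phi>" using M U by (rule gchart_atlas)
    then obtain N g where N: "\<phi> x \<in> N" "Cinf_on g N" "\<And>y. y \<in> U \<Longrightarrow> \<phi> y \<in> N \<Longrightarrow> y \<in> V \<and> \<psi> y = g (\<phi> y)"
      using gchart_transition[OF _ x(1) V x(2)] by blast
    then show "\<exists>N. open N \<and> \<phi> x \<in> N \<and> (\<exists>g. (\<forall>k. Ck_on k g N) \<and>
        (\<forall>y\<in>\<phi> ` (U \<inter> V) \<inter> N. g y = \<psi> (inv_into U \<phi> y)))"
      using inv_into_f_f[OF gchart_inj[OF \<phi>]]
      by (intro exI[of _ N] conjI exI[of _ g]) (auto simp: Cinf_on_def)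
  qed
  have "continuous_map (subtopology (mtop M) U) (top_of_set (\<phi> ` U)) \<phi>"
  proof -
    have "continuous_map (subtopology (mtop M) U) euclidean \<phi>"
      unfolding continuous_map_def sub
    proof (intro conjI allI impI)
      fix N :: "'b set" assume "openin euclidean N"
      then have "openin (mtop M) {y\<in>U. \<phi> y \<in> N}"
        using premfd_preimage[OF M] c c_eq by simp
      then show "openin (subtopology (mtop M) U) {y\<in>U. \<phi> y \<in> N}"
        by (simp add: openin_open_subtopology gchart_openin[OF \<phi>])
    qed simp
    then show ?thesis by (simp add: continuous_map_in_subtopology)
  qed
  moreover have "open_map (subtopology (mtop M) U) (top_of_set (\<phi> ` U)) \<phi>"
    unfolding open_map_def
  proof (intro allI impI)
    fix A assume "openin (subtopology (mtop M) U) A"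
    then have A: "openin (mtop M) A" "A \<subseteq> U"
      using gchart_openin[OF \<phi>] openin_open_subtopology by blast+
    show "openin (top_of_set (\<phi> ` U)) (\<phi> ` A)"
    proof (subst openin_subopen, safe)
      fix x assume x: "x \<in> A"
      then obtain N where N: "open N" "\<phi> x \<in> N" "\<And>y. y \<in> U \<Longrightarrow> \<phi> y \<in> N \<Longrightarrow> y \<in> A"
        using gchart_nhd[OF M \<phi> A(1)] A(2) by blast
      then show "\<exists>T. openin (top_of_set (\<phi> ` U)) T \<and> \<phi> x \<in> T \<and> T \<subseteq> \<phi> ` A"
        using x A by (intro exI[of _ "\<phi> ` U \<inter> N"]) (auto intro: openin_open_Int)
    qed
  qed
  ultimately have "homeomorphic_map (subtopology (mtop M) U) (top_of_set (\<phi> ` U)) \<phi>"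
    using gchart_inj[OF \<phi>] by (intro bijective_open_imp_homeomorphic_map) (simp_all only: sub topspace_euclidean_subtopology)
  then have "topological_chart (mtop M) c"
    using half[of U \<phi>] c gchart_openin[OF \<phi>] by (simp add: c_eq topological_chart_def)
  moreover have "smooth_transition c d \<and> smooth_transition d c" if "d \<in> atlas M" for d
    using that trans c by (cases d) (simp add: c_eq)
  ultimately show ?thesis by (simp add: smooth_chart_def)
qed

lemma smooth_map_smooth_at:
  assumes M: "premfd M" and N: "premfd N" and f: "smooth_map M N f" and x: "x \<in> points M"
    and h: "smooth_at N h (f x)"
  shows "smooth_at M (\<lambda>x. h (f x)) x"
proof -
  obtain V \<psi> N1 h' where V: "(V, \<psi>) \<in> atlas N" "f x \<in> V" "\<psi> (f x) \<in> N1" "Cinf_on h' N1"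
    "\<And>y. y \<in> V \<Longrightarrow> \<psi> y \<in> N1 \<Longrightarrow> h y = h' (\<psi> y)"
    by (rule smooth_atE[OF h]) blast
  obtain U \<phi> where U: "(U, \<phi>) \<in> atlas M" "x \<in> U" using premfd_chart[OF M x] by blast
  have \<phi>: "gchart M U \<phi>" using M U by (simp add: gchart_atlas)
  have "smooth_on (\<phi> ` (U \<inter> f -` V)) (\<psi> \<circ> f \<circ> inv_into U \<phi>)"
    using f U V by (auto simp: smooth_map_def)
  then obtain N0 g where g: "\<phi> x \<in> N0" "Cinf_on g N0"
      "\<And>z. z \<in> \<phi> ` (U \<inter> f -` V) \<Longrightarrow> z \<in> N0 \<Longrightarrow> g z = (\<psi> \<circ> f \<circ> inv_into U \<phi>) z"
    by (rule smooth_onE[of _ _ "\<phi> x"]) (use U V in auto)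
  have "openin (mtop N) V" using gchart_openin[OF gchart_atlas[OF N V(1)]] .
  then have opV: "openin (mtop M) {y\<in>points M. f y \<in> V}"
    using f by (auto simp: smooth_map_def continuous_map_def)
  have "smooth_at M (\<lambda>y. h' (g (\<phi> y))) x"
  proof (rule smooth_at_compose[OF smooth_at_compose[OF smooth_at_atlas[OF U]] V(4)])
    show "Cinf_on g N0" by (rule g)
    have "g (\<phi> x) = \<psi> (f x)" using g(3)[of "\<phi> x"] g(1) U V inv_into_f_f[OF gchart_inj[OF \<phi>]] by auto
    then show "g (\<phi> x) \<in> N1" using V by simp
  qed (use g in auto)
  moreover have eq: "g (\<phi> y) = \<psi> (f y)" if "y \<in> U" "\<phi> y \<in> N0" "f y \<in> V" for y
    using g(3)[of "\<phi> y"] that inv_into_f_f[OF gchart_inj[OF \<phi>]] by auto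
  have "openin (mtop M) ({y\<in>points M. f y \<in> V} \<inter> {y\<in>U. \<phi> y \<in> N0 \<inter> g -` N1})"
  proof -
    have "open (N0 \<inter> g -` N1)"
      by (rule Cinf_on_vimage[OF g(2) Cinf_on_open[OF V(4)]])
    then show ?thesis
      using premfd_preimage[OF M U(1)] opV by blast
  qed
  ultimately show ?thesis
  proof (rule smooth_at_cong[OF M])
    have "g (\<phi> x) = \<psi> (f x)" using eq U g V by auto
    then show "x \<in> {y\<in>points M. f y \<in> V} \<inter> {y\<in>U. \<phi> y \<in> N0 \<inter> g -` N1}"
      using x U V g by auto
    fix y assume y: "y \<in> {y\<in>points M. f y \<in> V} \<inter> {y\<in>U. \<phi> y \<in> N0 \<inter> g -` N1}"
    then have "g (\<phi> y) = \<psi> (f y)" using eq by auto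
    then show "h' (g (\<phi> y)) = h (f y)" using V(5)[of "f y"] y by auto
  qed
qed

lemma smooth_mapI:
  assumes M: "premfd M" and "continuous_map (mtop M) (mtop N) f"
    and f: "\<And>x V \<psi>. x \<in> points M \<Longrightarrow> (V, \<psi>) \<in> atlas N \<Longrightarrow> f x \<in> V \<Longrightarrow> smooth_at M (\<lambda>x. \<psi> (f x)) x"
  shows "smooth_map M N f"
  unfolding smooth_map_def
proof (intro conjI ballI assms(2), safe)
  fix U \<phi> V \<psi> assume U: "(U, \<phi>) \<in> atlas M" and V: "(V, \<psi>) \<in> atlas N"
  have \<phi>: "gchart M U \<phi>" using M U by (simp add: gchart_atlas)
  show "smooth_on (\<phi> ` (U \<inter> f -` V)) (\<psi> \<circ> f \<circ> inv_into U \<phi>)"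
    unfolding smooth_on_def
  proof clarsimp
    fix x assume x: "x \<in> U" "f x \<in> V"
    then have "smooth_at M (\<lambda>x. \<psi> (f x)) x" using f V gchart_points[OF \<phi>] by blast
    then obtain N g where "\<phi> x \<in> N" "Cinf_on g N" "\<And>y. y \<in> U \<Longrightarrow> \<phi> y \<in> N \<Longrightarrow> \<psi> (f y) = g (\<phi> y)"
      using smooth_at_gchart[OF _ \<phi> x(1)] by blast
    then show "\<exists>N. open N \<and> \<phi> x \<in> N \<and> (\<exists>g. (\<forall>k. Ck_on k g N) \<and>
        (\<forall>y\<in>\<phi> ` (U \<inter> f -` V) \<inter> N. g y = \<psi> (f (inv_into U \<phi> y))))"
      using inv_into_f_f[OF gchart_inj[OF \<phi>]]
      by (intro exI[of _ N] conjI exI[of _ g]) (auto simp: Cinf_on_def)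
  qed
qed

lemma smooth_map_points: "smooth_map M N f \<Longrightarrow> x \<in> points M \<Longrightarrow> f x \<in> points N"
  by (auto simp: smooth_map_def continuous_map_def)

lemma smooth_map_compose:
  assumes "premfd M" "premfd N" "premfd K" "smooth_map M N f" "smooth_map N K h"
  shows "smooth_map M K (\<lambda>x. h (f x))"
proof (rule smooth_mapI[OF assms(1)])
  show "continuous_map (mtop M) (mtop K) (\<lambda>x. h (f x))"
    using continuous_map_compose[of "mtop M" "mtop N" f "mtop K" h] assms by (auto simp: smooth_map_def comp_def)
  fix x V \<psi> assume x: "x \<in> points M" "(V, \<psi>) \<in> atlas K" "h (f x) \<in> V"
  have "smooth_at N (\<lambda>y. \<psi> (h y)) (f x)"
    by (rule smooth_map_smooth_at[OF assms(2,3,5) smooth_map_points[OF assms(4) x(1)] smooth_at_atlas[OF x(2,3)]])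
  then show "smooth_at M (\<lambda>x. \<psi> (h (f x))) x"
    by (rule smooth_map_smooth_at[OF assms(1,2,4) x(1)])
qed

section \<open>Open submanifolds, products, the circle\<close>

lemma mtop_open_submfd [simp]: "mtop (open_submfd M A) = subtopology (mtop M) A"
  by (simp add: open_submfd_def)

lemma atlas_open_submfd: "(V, \<phi>) \<in> atlas (open_submfd M A) \<longleftrightarrow> (\<exists>U. (U, \<phi>) \<in> atlas M \<and> V = U \<inter> A)"
  by (force simp: open_submfd_def)

lemma smooth_at_open_submfd:
  assumes M: "premfd M" and A: "openin (mtop M) A" "p \<in> A"
  shows "smooth_at (open_submfd M A) f p \<longleftrightarrow> smooth_at M f p"
proof
  assume "smooth_at M f p"
  then show "smooth_at (open_submfd M A) f p"
  proof (rule smooth_atE)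
    fix U \<phi> N g assume *: "(U, \<phi>) \<in> atlas M" "p \<in> U" "\<phi> p \<in> N" "Cinf_on g N"
      "\<And>y. y \<in> U \<Longrightarrow> \<phi> y \<in> N \<Longrightarrow> f y = g (\<phi> y)"
    show ?thesis
      by (rule smooth_atI[of "U \<inter> A" \<phi>]) (use * A in \<open>auto simp: atlas_open_submfd\<close>)
  qed
next
  assume "smooth_at (open_submfd M A) f p"
  then show "smooth_at M f p"
  proof (rule smooth_atE)
    fix V \<phi> N g assume *: "(V, \<phi>) \<in> atlas (open_submfd M A)" "p \<in> V" "\<phi> p \<in> N" "Cinf_on g N"
      "\<And>y. y \<in> V \<Longrightarrow> \<phi> y \<in> N \<Longrightarrow> f y = g (\<phi> y)"
    then obtain U where U: "(U, \<phi>) \<in> atlas M" "V = U \<inter> A" by (auto simp: atlas_open_submfd)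
    obtain N' where N': "open N'" "\<phi> p \<in> N'" "\<And>y. y \<in> U \<Longrightarrow> \<phi> y \<in> N' \<Longrightarrow> y \<in> A"
      using premfd_nhd[OF M U(1) A(1)] A * U by blast
    show ?thesis
    proof (rule smooth_atI[OF U(1)])
      show "Cinf_on g (N \<inter> N')" using *(4) N'(1) by (intro Cinf_on_subset[OF *(4)]) (auto simp: Cinf_on_open)
    qed (use * N' U in auto)
  qed
qed

lemma gchart_open_submfd:
  assumes M: "premfd M" and A: "openin (mtop M) A"
  shows "gchart (open_submfd M A) U \<kappa> \<longleftrightarrow> gchart M U \<kappa> \<and> U \<subseteq> A"
proof safe
  assume *: "gchart (open_submfd M A) U \<kappa>"
  have U: "openin (mtop M) U" "U \<subseteq> A"
    using gchart_openin[OF *] A by (auto simp: openin_open_subtopology)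
  then show "x \<in> U \<Longrightarrow> x \<in> A" for x by auto
  show "gchart M U \<kappa>"
  proof (rule gchartI)
    show "inj_on \<kappa> U" by (rule gchart_inj[OF *])
    show "smooth_at M \<kappa> x" if "x \<in> U" for x
      using gchart_smooth_at[OF * that] smooth_at_open_submfd[OF M A] that U by blast
    fix x V \<phi> assume x: "x \<in> U" "(V, \<phi>) \<in> atlas M" "x \<in> V"
    then have "(V \<inter> A, \<phi>) \<in> atlas (open_submfd M A)" by (auto simp: atlas_open_submfd)
    then obtain N g where "\<kappa> x \<in> N" "Cinf_on g N" "\<And>y. y \<in> U \<Longrightarrow> \<kappa> y \<in> N \<Longrightarrow> y \<in> V \<inter> A \<and> \<phi> y = g (\<kappa> y)"
      using gchart_transition[OF * x(1), of "V \<inter> A" \<phi>] x U by blast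
    then show "\<exists>N g. \<kappa> x \<in> N \<and> Cinf_on g N \<and> (\<forall>y\<in>U. \<kappa> y \<in> N \<longrightarrow> y \<in> V \<and> \<phi> y = g (\<kappa> y))"
      by blast
  qed (rule U)
next
  assume *: "gchart M U \<kappa>" "U \<subseteq> A"
  show "gchart (open_submfd M A) U \<kappa>"
  proof (rule gchartI)
    show "inj_on \<kappa> U" by (rule gchart_inj[OF *(1)])
    show "openin (mtop (open_submfd M A)) U"
      using gchart_openin[OF *(1)] *(2) by (simp add: openin_open_subtopology[OF A])
    show "smooth_at (open_submfd M A) \<kappa> x" if "x \<in> U" for x
      using gchart_smooth_at[OF *(1) that] smooth_at_open_submfd[OF M A] that * by blast
    fix x V \<phi> assume x: "x \<in> U" "(V, \<phi>) \<in> atlas (open_submfd M A)" "x \<in> V"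
    then obtain W where W: "(W, \<phi>) \<in> atlas M" "V = W \<inter> A" by (auto simp: atlas_open_submfd)
    obtain N g where "\<kappa> x \<in> N" "Cinf_on g N" "\<And>y. y \<in> U \<Longrightarrow> \<kappa> y \<in> N \<Longrightarrow> y \<in> W \<and> \<phi> y = g (\<kappa> y)"
      using gchart_transition[OF *(1) x(1) W(1)] x W by blast
    then show "\<exists>N g. \<kappa> x \<in> N \<and> Cinf_on g N \<and> (\<forall>y\<in>U. \<kappa> y \<in> N \<longrightarrow> y \<in> V \<and> \<phi> y = g (\<kappa> y))"
      using W * by (intro exI[of _ N] exI[of _ g]) auto
  qed
qed

lemma premfdI:
  assumes "\<Union>(fst ` atlas M) = points M"
    and "\<And>U \<phi>. (U, \<phi>) \<in> atlas M \<Longrightarrow> gchart M U \<phi>"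
    and "\<And>U \<phi> N. (U, \<phi>) \<in> atlas M \<Longrightarrow> open N \<Longrightarrow> openin (mtop M) {y\<in>U. \<phi> y \<in> N}"
    and "\<And>U \<phi> A x. (U, \<phi>) \<in> atlas M \<Longrightarrow> openin (mtop M) A \<Longrightarrow> x \<in> A \<Longrightarrow> x \<in> U \<Longrightarrow>
       \<exists>N. open N \<and> \<phi> x \<in> N \<and> (\<forall>y\<in>U. \<phi> y \<in> N \<longrightarrow> y \<in> A)"
  shows "premfd M"
  unfolding premfd_def
proof (intro conjI ballI)
  fix c assume "c \<in> atlas M"
  then show "case c of (U, \<phi>) \<Rightarrow> gchart M U \<phi> \<and>
      (\<forall>N. open N \<longrightarrow> openin (mtop M) {y\<in>U. \<phi> y \<in> N}) \<and>
      (\<forall>A x. openin (mtop M) A \<longrightarrow> x \<in> A \<inter> U \<longrightarrow>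
         (\<exists>N. open N \<and> \<phi> x \<in> N \<and> (\<forall>y\<in>U. \<phi> y \<in> N \<longrightarrow> y \<in> A)))"
    using assms(2-4) by (cases c) simp
qed (rule assms(1))

lemma premfd_cover: "premfd M \<Longrightarrow> \<Union>(fst ` atlas M) = points M"
  by (simp add: premfd_def)

lemma premfd_open_submfd:
  assumes M: "premfd M" and A: "openin (mtop M) A" shows "premfd (open_submfd M A)"
proof (rule premfdI)
  have "fst ` atlas (open_submfd M A) = (\<lambda>U. U \<inter> A) ` fst ` atlas M"
    by (force simp: open_submfd_def image_iff)
  then show "\<Union>(fst ` atlas (open_submfd M A)) = points (open_submfd M A)"
    using premfd_cover[OF M] by auto
  fix U \<phi> assume "(U, \<phi>) \<in> atlas (open_submfd M A)"
  then obtain W where W: "(W, \<phi>) \<in> atlas M" "U = W \<inter> A" by (auto simp: atlas_open_submfd)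
  have op: "openin (mtop M) U" using gchart_openin[OF gchart_atlas[OF M W(1)]] A W by blast
  show "gchart (open_submfd M A) U \<phi>"
    using gchart_subset[OF gchart_atlas[OF M W(1)] op] W by (simp add: gchart_open_submfd[OF M A])
  show "openin (mtop (open_submfd M A)) {y\<in>U. \<phi> y \<in> N}" if "open N" for N
  proof -
    have "openin (mtop M) ({y\<in>W. \<phi> y \<in> N} \<inter> A)" using premfd_preimage[OF M W(1) that] A by blast
    moreover have "{y\<in>W. \<phi> y \<in> N} \<inter> A = {y\<in>U. \<phi> y \<in> N}" using W by auto
    ultimately show ?thesis by (auto simp: openin_open_subtopology[OF A])
  qed
  fix B x assume B: "openin (mtop (open_submfd M A)) B" "x \<in> B" "x \<in> U"
  then have "openin (mtop M) B" by (simp add: openin_open_subtopology[OF A])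
  then obtain N where "open N" "\<phi> x \<in> N" "\<And>y. y \<in> W \<Longrightarrow> \<phi> y \<in> N \<Longrightarrow> y \<in> B"
    using premfd_nhd[OF M W(1)] B W by blast
  then show "\<exists>N. open N \<and> \<phi> x \<in> N \<and> (\<forall>y\<in>U. \<phi> y \<in> N \<longrightarrow> y \<in> B)" using W by blast
qed

lemma smooth_map_into_open_submfd:
  assumes M: "premfd M" and f: "smooth_map M N f" and N: "premfd N" and "f ` points M \<subseteq> A"
  shows "smooth_map M (open_submfd N A) f"
proof (rule smooth_mapI[OF M])
  show "continuous_map (mtop M) (mtop (open_submfd N A)) f"
    using f assms(4) by (auto simp: smooth_map_def continuous_map_in_subtopology)
  fix x V \<psi> assume x: "x \<in> points M" "(V, \<psi>) \<in> atlas (open_submfd N A)" "f x \<in> V"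
  then obtain W where W: "(W, \<psi>) \<in> atlas N" "V = W \<inter> A" by (auto simp: atlas_open_submfd)
  show "smooth_at M (\<lambda>x. \<psi> (f x)) x"
    by (rule smooth_map_smooth_at[OF M N f x(1)], rule smooth_at_atlas[OF W(1)]) (use x W in auto)
qed

lemma mtop_prod_mfd [simp]: "mtop (prod_mfd M N) = prod_topology (mtop M) (mtop N)"
  by (simp add: prod_mfd_def)

lemma atlas_prod_mfd: "(W, \<xi>) \<in> atlas (prod_mfd M N) \<longleftrightarrow>
   (\<exists>U \<phi> V \<psi>. (U, \<phi>) \<in> atlas M \<and> (V, \<psi>) \<in> atlas N \<and> W = U \<times> V \<and> \<xi> = map_prod \<phi> \<psi>)"
  by (auto simp: prod_mfd_def)

lemma Cinf_on_map_prod: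
  assumes "Cinf_on f A" "Cinf_on g B" shows "Cinf_on (map_prod f g) (A \<times> B)"
proof -
  have op: "open (A \<times> B)" by (rule open_Times[OF Cinf_on_open[OF assms(1)] Cinf_on_open[OF assms(2)]])
  have "Cinf_on (\<lambda>z. (f (fst z), g (snd z))) (A \<times> B)"
    by (intro Cinf_on_Pair Cinf_on_compose[OF Cinf_on_bounded_linear[OF bounded_linear_fst op] assms(1)]
        Cinf_on_compose[OF Cinf_on_bounded_linear[OF bounded_linear_snd op] assms(2)]) auto
  then show ?thesis by (rule Cinf_on_cong) (simp add: map_prod_def split_beta)
qed

lemma smooth_at_map_prod:
  assumes "smooth_at M f x" "smooth_at N h y"
  shows "smooth_at (prod_mfd M N) (map_prod f h) (x, y)"
proof -
  obtain U \<phi> A g where f: "(U, \<phi>) \<in> atlas M" "x \<in> U" "\<phi> x \<in> A" "Cinf_on g A"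
    "\<And>y. y \<in> U \<Longrightarrow> \<phi> y \<in> A \<Longrightarrow> f y = g (\<phi> y)"
    by (rule smooth_atE[OF assms(1)]) blast
  obtain V \<psi> B k where h: "(V, \<psi>) \<in> atlas N" "y \<in> V" "\<psi> y \<in> B" "Cinf_on k B"
    "\<And>y. y \<in> V \<Longrightarrow> \<psi> y \<in> B \<Longrightarrow> h y = k (\<psi> y)"
    by (rule smooth_atE[OF assms(2)]) blast
  show ?thesis
    by (rule smooth_atI[of "U \<times> V" "map_prod \<phi> \<psi>" _ _ "A \<times> B" "map_prod g k"])
      (use f h Cinf_on_map_prod in \<open>auto simp: atlas_prod_mfd\<close>)
qed

lemma gchart_prod:
  assumes "gchart M U \<kappa>" "gchart N V \<mu>"
  shows "gchart (prod_mfd M N) (U \<times> V) (map_prod \<kappa> \<mu>)"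
proof (rule gchartI)
  show "openin (mtop (prod_mfd M N)) (U \<times> V)"
    using gchart_openin[OF assms(1)] gchart_openin[OF assms(2)] by (simp add: openin_prod_Times_iff)
  show "inj_on (map_prod \<kappa> \<mu>) (U \<times> V)"
    by (rule map_prod_inj_on[OF gchart_inj[OF assms(1)] gchart_inj[OF assms(2)]])
  show "smooth_at (prod_mfd M N) (map_prod \<kappa> \<mu>) z" if "z \<in> U \<times> V" for z
    using smooth_at_map_prod[OF gchart_smooth_at[OF assms(1)] gchart_smooth_at[OF assms(2)]] that
    by (cases z) auto
  fix z W \<xi> assume z: "z \<in> U \<times> V" and W: "(W, \<xi>) \<in> atlas (prod_mfd M N)" "z \<in> W"
  then obtain A \<phi> B \<psi> where c: "(A, \<phi>) \<in> atlas M" "(B, \<psi>) \<in> atlas N" "W = A \<times> B" "\<xi> = map_prod \<phi> \<psi>"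
    unfolding atlas_prod_mfd by blast
  have zz: "fst z \<in> U" "fst z \<in> A" "snd z \<in> V" "snd z \<in> B" using z W c by auto
  obtain N1 g1 where 1: "\<kappa> (fst z) \<in> N1" "Cinf_on g1 N1"
    "\<And>y. y \<in> U \<Longrightarrow> \<kappa> y \<in> N1 \<Longrightarrow> y \<in> A \<and> \<phi> y = g1 (\<kappa> y)"
    using gchart_transition[OF assms(1) zz(1) c(1) zz(2)] by blast
  obtain N2 g2 where 2: "\<mu> (snd z) \<in> N2" "Cinf_on g2 N2"
    "\<And>y. y \<in> V \<Longrightarrow> \<mu> y \<in> N2 \<Longrightarrow> y \<in> B \<and> \<psi> y = g2 (\<mu> y)"
    using gchart_transition[OF assms(2) zz(3) c(2) zz(4)] by blast
  show "\<exists>N g. map_prod \<kappa> \<mu> z \<in> N \<and> Cinf_on g N \<and>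
      (\<forall>y\<in>U \<times> V. map_prod \<kappa> \<mu> y \<in> N \<longrightarrow> y \<in> W \<and> \<xi> y = g (map_prod \<kappa> \<mu> y))"
    by (rule exI[of _ "N1 \<times> N2"], rule exI[of _ "map_prod g1 g2"])
      (use 1 2 c Cinf_on_map_prod[OF 1(2) 2(2)] in \<open>cases z; auto\<close>)
qed

lemma premfd_prod:
  assumes M: "premfd M" and N: "premfd N" shows "premfd (prod_mfd M N)"
proof (rule premfdI)
  show "\<Union>(fst ` atlas (prod_mfd M N)) = points (prod_mfd M N)"
  proof safe
    fix z W \<xi> assume "(W, \<xi>) \<in> atlas (prod_mfd M N)" "z \<in> fst (W, \<xi>)"
    then show "z \<in> points (prod_mfd M N)"
      using gchart_points[OF gchart_atlas[OF M]] gchart_points[OF gchart_atlas[OF N]]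
      unfolding atlas_prod_mfd by fastforce
  next
    fix x y assume "(x, y) \<in> points (prod_mfd M N)"
    then have xy: "x \<in> points M" "y \<in> points N" by auto
    obtain U \<phi> where U: "(U, \<phi>) \<in> atlas M" "x \<in> U" using premfd_chart[OF M xy(1)] .
    obtain V \<psi> where V: "(V, \<psi>) \<in> atlas N" "y \<in> V" using premfd_chart[OF N xy(2)] .
    have "(U \<times> V, map_prod \<phi> \<psi>) \<in> atlas (prod_mfd M N)" using U V by (auto simp: atlas_prod_mfd)
    then show "(x, y) \<in> \<Union>(fst ` atlas (prod_mfd M N))" using U V by (intro UN_I) auto
  qed
  fix W \<xi> assume "(W, \<xi>) \<in> atlas (prod_mfd M N)"
  then obtain U \<phi> V \<psi> where c: "(U, \<phi>) \<in> atlas M" "(V, \<psi>) \<in> atlas N" "W = U \<times> V" "\<xi> = map_prod \<phi> \<psi>"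
    unfolding atlas_prod_mfd by blast
  show "gchart (prod_mfd M N) W \<xi>"
    unfolding c by (intro gchart_prod gchart_atlas[OF M c(1)] gchart_atlas[OF N c(2)])
  show "openin (mtop (prod_mfd M N)) {z\<in>W. \<xi> z \<in> O'}" if O': "open O'" for O'
  proof (subst openin_subopen, safe)
    fix x y assume xy: "(x, y) \<in> W" "\<xi> (x, y) \<in> O'"
    then obtain A B where AB: "open A" "open B" "\<phi> x \<in> A" "\<psi> y \<in> B" "A \<times> B \<subseteq> O'"
      using O' c by (auto elim: open_prod_elim)
    have "openin (mtop (prod_mfd M N)) ({x\<in>U. \<phi> x \<in> A} \<times> {y\<in>V. \<psi> y \<in> B})"
      using premfd_preimage[OF M c(1) AB(1)] premfd_preimage[OF N c(2) AB(2)] by (simp add: openin_prod_Times_iff)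
    then show "\<exists>T. openin (mtop (prod_mfd M N)) T \<and> (x, y) \<in> T \<and> T \<subseteq> {z\<in>W. \<xi> z \<in> O'}"
      using AB xy c by (intro exI conjI) auto
  qed
  fix T z assume T: "openin (mtop (prod_mfd M N)) T" "z \<in> T" "z \<in> W"
  obtain x y where z: "z = (x, y)" by force
  obtain A B where AB: "openin (mtop M) A" "openin (mtop N) B" "x \<in> A" "y \<in> B" "A \<times> B \<subseteq> T"
    using T(1,2) unfolding z mtop_prod_mfd openin_prod_topology_alt by meson
  obtain N1 where 1: "open N1" "\<phi> x \<in> N1" "\<And>y. y \<in> U \<Longrightarrow> \<phi> y \<in> N1 \<Longrightarrow> y \<in> A"
    using premfd_nhd[OF M c(1) AB(1,3)] T z c by blast
  obtain N2 where 2: "open N2" "\<psi> y \<in> N2" "\<And>y. y \<in> V \<Longrightarrow> \<psi> y \<in> N2 \<Longrightarrow> y \<in> B"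
    using premfd_nhd[OF N c(2) AB(2,4)] T z c by blast
  show "\<exists>N. open N \<and> \<xi> z \<in> N \<and> (\<forall>y\<in>W. \<xi> y \<in> N \<longrightarrow> y \<in> T)"
    by (rule exI[of _ "N1 \<times> N2"]) (use 1 2 c AB z in \<open>auto intro: open_Times\<close>)
qed

lemma smooth_at_prod_fst:
  assumes "premfd N" "smooth_at M f x" "y \<in> points N"
  shows "smooth_at (prod_mfd M N) (\<lambda>z. f (fst z)) (x, y)"
  using smooth_at_fst[OF smooth_at_map_prod[OF assms(2) smooth_at_const[OF assms(1,3), of "0::real"]]]
  by (simp add: fst_map_prod)

lemma smooth_at_prod_snd:
  assumes "premfd M" "smooth_at N f y" "x \<in> points M"
  shows "smooth_at (prod_mfd M N) (\<lambda>z. f (snd z)) (x, y)"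
  using smooth_at_snd[OF smooth_at_map_prod[OF smooth_at_const[OF assms(1,3), of "0::real"] assms(2)]]
  by (simp add: snd_map_prod)

lemma smooth_at_slice_snd:
  assumes "smooth_at (prod_mfd M N) f (x, y)" shows "smooth_at N (\<lambda>y. f (x, y)) y"
proof -
  obtain W \<xi> A g where f: "(W, \<xi>) \<in> atlas (prod_mfd M N)" "(x, y) \<in> W" "\<xi> (x, y) \<in> A" "Cinf_on g A"
    "\<And>z. z \<in> W \<Longrightarrow> \<xi> z \<in> A \<Longrightarrow> f z = g (\<xi> z)"
    by (rule smooth_atE[OF assms(1)]) blast
  obtain U \<phi> V \<psi> where c: "(U, \<phi>) \<in> atlas M" "(V, \<psi>) \<in> atlas N" "W = U \<times> V" "\<xi> = map_prod \<phi> \<psi>"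
    using f(1) unfolding atlas_prod_mfd by blast
  have l: "Cinf_on (\<lambda>a. (\<phi> x, a)) UNIV" by (intro Cinf_on_Pair) auto
  have "open (UNIV \<inter> (\<lambda>a. (\<phi> x, a)) -` A)" by (rule Cinf_on_vimage[OF l Cinf_on_open[OF f(4)]])
  then have "Cinf_on (\<lambda>a. g (\<phi> x, a)) ((\<lambda>a. (\<phi> x, a)) -` A)"
    by (intro Cinf_on_compose[OF Cinf_on_subset[OF l] f(4)]) auto
  then show ?thesis
    by (rule smooth_atI[OF c(2), rotated 2]) (use f c in auto)
qed

lemma smooth_map_Pair:
  assumes M: "premfd M" and N: "premfd N" and K: "premfd K" and f: "smooth_map M N f" and h: "smooth_map M K h"
  shows "smooth_map M (prod_mfd N K) (\<lambda>x. (f x, h x))"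
proof (rule smooth_mapI[OF M])
  show "continuous_map (mtop M) (mtop (prod_mfd N K)) (\<lambda>x. (f x, h x))"
    using f h by (simp add: smooth_map_def continuous_map_paired)
  fix x V \<psi> assume x: "x \<in> points M" "(V, \<psi>) \<in> atlas (prod_mfd N K)" "(f x, h x) \<in> V"
  then obtain A \<phi> B \<xi> where c: "(A, \<phi>) \<in> atlas N" "(B, \<xi>) \<in> atlas K" "V = A \<times> B" "\<psi> = map_prod \<phi> \<xi>"
    unfolding atlas_prod_mfd by blast
  have "smooth_at M (\<lambda>x. \<phi> (f x)) x" "smooth_at M (\<lambda>x. \<xi> (h x)) x"
    using x c smooth_map_smooth_at[OF M N f x(1) smooth_at_atlas[OF c(1)]]
      smooth_map_smooth_at[OF M K h x(1) smooth_at_atlas[OF c(2)]] by auto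
  from smooth_at_Pair[OF M this] show "smooth_at M (\<lambda>x. \<psi> (f x, h x)) x" by (simp add: c)
qed

lemma smooth_map_fst:
  assumes "premfd M" "premfd N" shows "smooth_map (prod_mfd M N) M fst"
  by (rule smooth_mapI[OF premfd_prod[OF assms]])
    (auto simp: continuous_map_fst intro!: smooth_at_prod_fst assms smooth_at_atlas)

lemma smooth_map_snd:
  assumes "premfd M" "premfd N" shows "smooth_map (prod_mfd M N) N snd"
  by (rule smooth_mapI[OF premfd_prod[OF assms]])
    (auto simp: continuous_map_snd intro!: smooth_at_prod_snd assms smooth_at_atlas)

subsection \<open>The circle\<close>

abbreviation carc :: "real \<Rightarrow> complex set" where "carc t \<equiv> cis ` {t<..<t + 2 * pi}"

abbreviation cangle :: "real \<Rightarrow> complex \<Rightarrow> real" where "cangle t \<equiv> inv_into {t<..<t + 2 * pi} cis"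

lemma atlas_circle: "(U, \<phi>) \<in> atlas circle \<longleftrightarrow> (\<exists>t. U = carc t \<and> \<phi> = cangle t)"
  and mtop_circle [simp]: "mtop circle = top_of_set (sphere 0 1)"
  by (auto simp: circle_def)

lemma Ln_cis: "\<bar>t\<bar> < pi \<Longrightarrow> Ln (cis t) = \<i> * t"
  unfolding cis_conv_exp by (rule Ln_exp) auto

lemma cis_inj_arc: "inj_on cis {t<..<t + 2 * pi}"
proof (rule inj_onI)
  fix a b assume ab: "a \<in> {t<..<t + 2 * pi}" "b \<in> {t<..<t + 2 * pi}" "cis a = cis b"
  then have "cos a = cos b" "sin a = sin b" by (metis cis.sel)+
  then obtain n :: int where n: "a = b + 2 * pi * n" using sin_cos_eq_iff by metis
  then have "\<bar>2 * pi * n\<bar> < 2 * pi" using ab by auto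
  then have "\<bar>real_of_int n\<bar> < 1" by (simp add: abs_mult)
  then show "a = b" using n by auto
qed

lemma angle_cis: "s \<in> {t<..<t + 2 * pi} \<Longrightarrow> cangle t (cis s) = s"
  by (rule inv_into_f_f[OF cis_inj_arc])

lemma cis_angle: "z \<in> carc t \<Longrightarrow> cis (cangle t z) = z" "z \<in> carc t \<Longrightarrow> cangle t z \<in> {t<..<t + 2 * pi}"
  by (auto simp: f_inv_into_f inv_into_into angle_cis)

lemma norm_eq_1_imp_cis: "norm z = 1 \<Longrightarrow> z = cis (Arg z)"
  using cis_Arg[of z] by (cases "z = 0") (auto simp: sgn_div_norm)

lemma cis_Im_Ln: "norm z = 1 \<Longrightarrow> cis (Im (Ln z)) = z"
  using norm_eq_1_imp_cis Arg_eq_Im_Ln by (metis norm_zero zero_neq_one)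

text \<open>Near \<open>cis a\<close> every branch of the angle is \<open>a\<close> plus the
  principal argument of the quotient by \<open>cis a\<close>. All statements about branches thus
  reduce to \<open>Ln\<close> near 1.\<close>

lemma arc_nhd:
  assumes "a \<in> {t<..<t + 2 * pi}" "norm z = 1" "\<bar>Im (Ln (z / cis a))\<bar> < \<delta>" "ball a \<delta> \<subseteq> {t<..<t + 2 * pi}"
  shows "z \<in> carc t" "cangle t z = a + Im (Ln (z / cis a))"
proof -
  let ?s = "a + Im (Ln (z / cis a))"
  have s: "?s \<in> {t<..<t + 2 * pi}" using assms(3,4) by (auto simp: dist_real_def subset_iff)
  have z: "cis ?s = z" using assms(2) by (simp add: cis_mult[symmetric] cis_Im_Ln norm_divide)
  show "z \<in> carc t" using s z by (metis imageI)
  show "cangle t z = ?s" using angle_cis[OF s] z by simp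
qed

lemma Im_Ln_nhd:
  assumes "\<delta> > 0" "norm w = 1"
  shows "open {z. z / w \<in> - \<real>\<^sub>\<le>\<^sub>0 \<and> \<bar>Im (Ln (z / w))\<bar> < \<delta>}"
proof -
  have "open ((- \<real>\<^sub>\<le>\<^sub>0) \<inter> (\<lambda>z. \<bar>Im (Ln z)\<bar>) -` {..<\<delta>})"
    by (intro continuous_open_preimage continuous_intros) (auto simp: open_Compl)
  then have "open ((\<lambda>z. z / w) -` ((- \<real>\<^sub>\<le>\<^sub>0) \<inter> (\<lambda>z. \<bar>Im (Ln z)\<bar>) -` {..<\<delta>}))"
    using assms by (intro open_vimage) (auto intro!: continuous_intros)
  then show ?thesis by (simp add: vimage_def)
qed

lemma arc_subset_sphere: "carc t \<subseteq> sphere 0 1" by auto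

lemma premfd_circle: "premfd circle"
proof (rule premfdI)
  have "z \<in> \<Union>(fst ` atlas circle)" if "norm z = 1" for z
  proof -
    \<comment> \<open>This arc has \<open>z\<close> as its midpoint.\<close>
    have "z \<in> carc (Arg z - pi)" using norm_eq_1_imp_cis[OF that] by (rule image_eqI) auto
    moreover have "(carc (Arg z - pi), cangle (Arg z - pi)) \<in> atlas circle"
      unfolding atlas_circle by blast
    ultimately show ?thesis by (intro UN_I[of "(carc (Arg z - pi), cangle (Arg z - pi))"]) simp_all
  qed
  moreover have "U \<subseteq> sphere 0 1" if "(U, \<phi>) \<in> atlas circle" for U \<phi>
    using that by (auto simp: atlas_circle)
  ultimately show "\<Union>(fst ` atlas circle) = points circle" by fastforce
  have pre: "openin (mtop circle) {y\<in>carc t. cangle t y \<in> N}" if N: "open N" for t N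
  proof (subst openin_subopen, safe)
    fix z s assume s: "s \<in> {t<..<t + 2 * pi}" "cangle t (cis s) \<in> N"
    then have "s \<in> N \<inter> {t<..<t + 2 * pi}" by (simp add: angle_cis)
    moreover have "open (N \<inter> {t<..<t + 2 * pi})" using N by auto
    ultimately obtain \<delta> where \<delta>: "\<delta> > 0" "ball s \<delta> \<subseteq> N \<inter> {t<..<t + 2 * pi}"
      using open_contains_ball by metis
    let ?T = "{z. z / cis s \<in> - \<real>\<^sub>\<le>\<^sub>0 \<and> \<bar>Im (Ln (z / cis s))\<bar> < \<delta>}"
    have "y \<in> carc t \<and> cangle t y \<in> N" if "y \<in> sphere 0 1 \<inter> ?T" for y
    proof -
      have y: "y \<in> carc t" "cangle t y = s + Im (Ln (y / cis s))"
        using arc_nhd[OF s(1), of y \<delta>] that \<delta> by auto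
      have "s + Im (Ln (y / cis s)) \<in> ball s \<delta>" using that by (auto simp: dist_real_def)
      then show ?thesis using y \<delta>(2) by auto
    qed
    moreover have "openin (mtop circle) (sphere 0 1 \<inter> ?T)"
      using Im_Ln_nhd[OF \<delta>(1), of "cis s"] by (auto intro: openin_open_Int)
    moreover have "cis s \<in> sphere 0 1 \<inter> ?T" using \<delta> by (auto simp: complex_nonpos_Reals_iff)
    ultimately show "\<exists>T. openin (mtop circle) T \<and> cis s \<in> T \<and> T \<subseteq> {y\<in>carc t. cangle t y \<in> N}"
      by blast
  qed
  show "gchart circle U \<phi>" if U: "(U, \<phi>) \<in> atlas circle" for U \<phi>
  proof -
    obtain t where t: "U = carc t" "\<phi> = cangle t" using U by (auto simp: atlas_circle)
    show ?thesis
    proof (rule gchartI)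
      show "openin (mtop circle) U" using pre[of UNIV t] by (simp add: t)
      show "inj_on \<phi> U" unfolding t by (rule inj_on_inv_into) simp
      show "smooth_at circle \<phi> x" if "x \<in> U" for x using smooth_at_atlas[OF U that] .
      fix z V \<psi> assume z: "z \<in> U" "(V, \<psi>) \<in> atlas circle" "z \<in> V"
      obtain t' where t': "V = carc t'" "\<psi> = cangle t'" using z by (auto simp: atlas_circle)
      define a a' where "a = cangle t z" and "a' = cangle t' z"
      have a: "cis a = z" "a \<in> {t<..<t + 2 * pi}" "cis a' = z" "a' \<in> {t'<..<t' + 2 * pi}"
        using cis_angle z t t' by (auto simp: a_def a'_def)
      obtain \<delta> where \<delta>: "\<delta> > 0" "ball a' \<delta> \<subseteq> {t'<..<t' + 2 * pi}"
        using a(4) open_contains_ball open_greaterThanLessThan by metis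
      have "z \<noteq> 0" using a(1) cis_neq_zero by metis
      \<comment> \<open>Near \<open>z\<close> two branches of the angle differ by the constant
        \<open>a' - a\<close>, so the transition function is a translation.\<close>
      then have "cis s = cis (a' + (s - a))" for s
        using a by (simp add: cis_mult[symmetric] cis_divide[symmetric] del: cis_mult cis_divide)
      then have "y \<in> V \<and> \<psi> y = a' + (\<phi> y - a)" if "y \<in> U" "\<phi> y \<in> ball a \<delta>" for y
      proof -
        have "a' + (\<phi> y - a) \<in> ball a' \<delta>" using that(2) by (auto simp: dist_real_def)
        then have "a' + (\<phi> y - a) \<in> {t'<..<t' + 2 * pi}" using \<delta> by blast
        moreover have "y = cis (a' + (\<phi> y - a))"
          using cis_angle(1)[of y t] that(1) t \<open>\<And>s. cis s = cis (a' + (s - a))\<close>[of "\<phi> y"] by simp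
        ultimately show ?thesis using angle_cis t' by (metis imageI)
      qed
      moreover have "Cinf_on (\<lambda>s. a' + (s - a)) (ball a \<delta>)"
        by (intro Cinf_on_add Cinf_on_diff) auto
      ultimately show "\<exists>N g. \<phi> z \<in> N \<and> Cinf_on g N \<and> (\<forall>y\<in>U. \<phi> y \<in> N \<longrightarrow> y \<in> V \<and> \<psi> y = g (\<phi> y))"
        using \<delta> by (intro exI[of _ "ball a \<delta>"] exI[of _ "\<lambda>s. a' + (s - a)"]) (auto simp: a_def t)
    qed
  qed
  show "openin (mtop circle) {y\<in>U. \<phi> y \<in> N}" if "(U, \<phi>) \<in> atlas circle" "open N" for U \<phi> N
    using that pre by (auto simp: atlas_circle)
  fix U \<phi> A z assume U: "(U, \<phi>) \<in> atlas circle" and A: "openin (mtop circle) A" "z \<in> A" "z \<in> U"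
  obtain t where t: "U = carc t" "\<phi> = cangle t" using U by (auto simp: atlas_circle)
  obtain A' where A': "open A'" "A = sphere 0 1 \<inter> A'" using A by (auto simp: openin_open)
  have "open (cis -` A')" by (intro open_vimage A' continuous_intros)
  moreover have "y \<in> A" if "y \<in> U" "\<phi> y \<in> cis -` A'" for y
    using that cis_angle[of y t] arc_subset_sphere[of t] by (auto simp: t A')
  moreover have "\<phi> z \<in> cis -` A'" using A cis_angle[of z t] by (simp add: t A')
  ultimately show "\<exists>N. open N \<and> \<phi> z \<in> N \<and> (\<forall>y\<in>U. \<phi> y \<in> N \<longrightarrow> y \<in> A)" by blast
qed

lemma smooth_at_circle_ident: "z \<in> sphere 0 1 \<Longrightarrow> smooth_at circle (\<lambda>z. z) z"
proof -
  assume "z \<in> sphere 0 1"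
  then obtain U \<phi> where U: "(U, \<phi>) \<in> atlas circle" "z \<in> U"
    using premfd_chart[OF premfd_circle, of z] by auto
  then obtain t where t: "U = carc t" "\<phi> = cangle t" by (auto simp: atlas_circle)
  show ?thesis
    by (rule smooth_atI[OF U _ Cinf_on_cis]) (auto simp: t cis_angle)
qed

lemma smooth_at_Im_Ln:
  fixes f :: "'a \<Rightarrow> complex"
  assumes "smooth_at M f p" "norm w = 1" "f p / w \<notin> \<real>\<^sub>\<le>\<^sub>0"
  shows "smooth_at M (\<lambda>x. Im (Ln (f x / w))) p"
proof -
  have "smooth_at M (\<lambda>x. Ln (inverse w * f x)) p"
    by (rule smooth_at_compose[OF smooth_at_bounded_linear[OF bounded_linear_mult_right assms(1)] Cinf_on_Ln])
      (use assms(3) in \<open>auto simp: field_simps\<close>)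
  from smooth_at_bounded_linear[OF bounded_linear_Im this] show ?thesis by (simp add: divide_inverse mult.commute)
qed

lemma smooth_at_angle:
  assumes M: "premfd M" and f: "smooth_at M f p" and A: "openin (mtop M) A" "p \<in> A"
    "\<And>x. x \<in> A \<Longrightarrow> norm (f x) = 1" and t: "f p \<in> carc t"
  shows "smooth_at M (\<lambda>x. cangle t (f x)) p"
proof -
  define a where "a = cangle t (f p)"
  have a: "cis a = f p" "a \<in> {t<..<t + 2 * pi}" using cis_angle t by (auto simp: a_def)
  obtain \<delta> where \<delta>: "\<delta> > 0" "ball a \<delta> \<subseteq> {t<..<t + 2 * pi}"
    using a(2) open_contains_ball open_greaterThanLessThan by metis
  let ?T = "{z. z / cis a \<in> - \<real>\<^sub>\<le>\<^sub>0 \<and> \<bar>Im (Ln (z / cis a))\<bar> < \<delta>}"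
  have fp: "f p \<in> ?T" using \<delta> a by (auto simp: complex_nonpos_Reals_iff)
  obtain B where B: "openin (mtop M) B" "p \<in> B" "\<And>y. y \<in> B \<Longrightarrow> f y \<in> ?T"
    using smooth_at_continuous[OF M f Im_Ln_nhd[OF \<delta>(1)] fp] by auto
  have "smooth_at M (\<lambda>x. a + Im (Ln (f x / cis a))) p"
    using smooth_at_points[OF M f] f a A(3)[OF A(2)]
    by (intro smooth_at_add[OF M] smooth_at_const[OF M] smooth_at_Im_Ln) (auto simp: complex_nonpos_Reals_iff)
  then show ?thesis
  proof (rule smooth_at_cong[OF M])
    show "openin (mtop M) (A \<inter> B)" using A B by blast
    show "a + Im (Ln (f y / cis a)) = cangle t (f y)" if "y \<in> A \<inter> B" for y
      using arc_nhd(2)[OF a(2), of "f y" \<delta>] A(3) B(3) \<delta>(2) that by auto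
  qed (use A B in auto)
qed

lemma smooth_map_circleI:
  assumes M: "premfd M" and f: "\<And>x. x \<in> points M \<Longrightarrow> smooth_at M f x" "\<And>x. x \<in> points M \<Longrightarrow> norm (f x) = 1"
  shows "smooth_map M circle f"
proof (rule smooth_mapI[OF M])
  show "continuous_map (mtop M) (mtop circle) f"
    using smooth_at_continuous_map[OF M f(1)] f(2) by (auto simp: continuous_map_in_subtopology)
  fix x V \<psi> assume x: "x \<in> points M" "(V, \<psi>) \<in> atlas circle" "f x \<in> V"
  then show "smooth_at M (\<lambda>x. \<psi> (f x)) x"
    using smooth_at_angle[OF M f(1) openin_topspace] f(2) by (auto simp: atlas_circle)
qed

lemma smooth_at_circle_map:
  assumes M: "premfd M" and f: "smooth_map M circle f" "x \<in> points M"
  shows "smooth_at M f x" "norm (f x) = 1"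
proof -
  have "f x \<in> points circle" by (rule smooth_map_points[OF f])
  then show "norm (f x) = 1" by simp
  then show "smooth_at M f x"
    using smooth_map_smooth_at[OF M premfd_circle f(1,2) smooth_at_circle_ident] by simp
qed

section \<open>Half-space charts and the boundary\<close>

definition hchart :: "('a, 'e::euclidean_space) mfd \<Rightarrow> 'a set \<Rightarrow> ('a \<Rightarrow> 'c::euclidean_space) \<Rightarrow> 'c \<Rightarrow> bool" where
  "hchart M U \<kappa> u \<longleftrightarrow> gchart M U \<kappa> \<and> openin (top_of_set {x. 0 \<le> x \<bullet> u}) (\<kappa> ` U)"

lemma hchart_gchart: "hchart M U \<kappa> u \<Longrightarrow> gchart M U \<kappa>"
  by (simp add: hchart_def)

lemma hchart_ge_0: "hchart M U \<kappa> u \<Longrightarrow> x \<in> U \<Longrightarrow> 0 \<le> \<kappa> x \<bullet> u"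
  unfolding hchart_def using openin_imp_subset by fastforce

lemma hchart_image_nhd:
  assumes "hchart M U \<kappa> u" "x \<in> U"
  obtains N where "open N" "\<kappa> x \<in> N" "\<And>z. z \<in> N \<Longrightarrow> 0 \<le> z \<bullet> u \<Longrightarrow> z \<in> \<kappa> ` U"
proof -
  obtain N where "open N" "\<kappa> ` U = {x. 0 \<le> x \<bullet> u} \<inter> N"
    using assms(1) by (auto simp: hchart_def openin_open)
  then show thesis using that[of N] assms(2) by blast
qed

lemma hchart_subset:
  assumes M: "premfd M" and \<kappa>: "hchart M U \<kappa> u" and V: "openin (mtop M) V" "V \<subseteq> U"
  shows "hchart M V \<kappa> u"
  unfolding hchart_def
proof
  show "gchart M V \<kappa>" by (rule gchart_subset[OF hchart_gchart[OF \<kappa>] V])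
  show "openin (top_of_set {x. 0 \<le> x \<bullet> u}) (\<kappa> ` V)"
  proof (subst openin_subopen, safe)
    fix x assume x: "x \<in> V"
    obtain N where N: "open N" "\<kappa> x \<in> N" "\<And>y. y \<in> U \<Longrightarrow> \<kappa> y \<in> N \<Longrightarrow> y \<in> V"
      using gchart_nhd[OF M hchart_gchart[OF \<kappa>] V(1), of x] V(2) x by blast
    have "openin (top_of_set {x. 0 \<le> x \<bullet> u}) (\<kappa> ` U \<inter> N)"
      using \<kappa> N(1) unfolding hchart_def by (meson openin_Int_open)
    then show "\<exists>T. openin (top_of_set {x. 0 \<le> x \<bullet> u}) T \<and> \<kappa> x \<in> T \<and> T \<subseteq> \<kappa> ` V"
      using N x V(2) by (intro exI[of _ "\<kappa> ` U \<inter> N"]) auto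
  qed
qed

lemma smooth_manifold_hchart:
  assumes "smooth_manifold M" "(U, \<phi>) \<in> atlas M" obtains u where "hchart M U \<phi> u"
proof -
  have "topological_chart (mtop M) (U, \<phi>)"
    using assms by (auto simp: smooth_manifold_def smooth_chart_def)
  then show thesis
    using that gchart_atlas[OF smooth_manifold_imp_premfd[OF assms(1)] assms(2)]
    by (auto simp: topological_chart_def hchart_def)
qed

text \<open>Invariance of domain: on a small open set inside the image of \<open>\<kappa>\<close>
  the coordinate change is continuous and injective, hence open. The boundary can therefore be
  detected in any compatible chart whose model space has the right dimension.\<close>

lemma gchart_interior_transfer:
  fixes \<kappa> :: "'a \<Rightarrow> 'c::euclidean_space" and \<phi> :: "'a \<Rightarrow> 'd::euclidean_space"
  assumes M: "premfd M" and \<kappa>: "gchart M U \<kappa>" and \<phi>: "gchart M V \<phi>" and x: "x \<in> U" "x \<in> V"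
    and dim: "DIM('c) = DIM('d)" and int: "\<kappa> x \<in> interior (\<kappa> ` U)"
  shows "\<phi> x \<in> interior (\<phi> ` V)"
proof -
  obtain N g where g: "\<kappa> x \<in> N" "Cinf_on g N" "\<And>y. y \<in> U \<Longrightarrow> \<kappa> y \<in> N \<Longrightarrow> \<phi> y = g (\<kappa> y)"
    by (rule smooth_at_gchart[OF gchart_smooth_at[OF \<phi> x(2)] \<kappa> x(1)]) blast
  obtain N' where N': "open N'" "\<kappa> x \<in> N'" "\<And>y. y \<in> U \<Longrightarrow> \<kappa> y \<in> N' \<Longrightarrow> y \<in> V"
    using gchart_nhd[OF M \<kappa> gchart_openin[OF \<phi>], of x] x by blast
  define B where "B = N \<inter> N' \<inter> interior (\<kappa> ` U)"
  have B: "open B" using g(2) N'(1) by (auto simp: B_def dest: Cinf_on_open)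
  have sub: "z \<in> \<kappa> ` U" if "z \<in> B" for z using that interior_subset by (auto simp: B_def)
  have "inj_on g B"
  proof (rule inj_onI)
    fix a b assume ab: "a \<in> B" "b \<in> B" "g a = g b"
    obtain y z where yz: "y \<in> U" "a = \<kappa> y" "z \<in> U" "b = \<kappa> z" using sub ab by blast
    then have "\<phi> y = \<phi> z" "y \<in> V" "z \<in> V" using g(3) N'(3) ab by (auto simp: B_def)
    then show "a = b" using gchart_inj[OF \<phi>] yz by (auto dest: inj_onD)
  qed
  then have "open (g ` B)"
    using invariance_of_domain_gen[OF B continuous_on_subset[OF Cinf_on_continuous[OF g(2)]]] dim
    by (auto simp: B_def)
  moreover have "g ` B \<subseteq> \<phi> ` V"
  proof safe
    fix a assume a: "a \<in> B"
    obtain y where "y \<in> U" "a = \<kappa> y" using sub a by blast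
    then show "g a \<in> \<phi> ` V" using g(3)[of y] N'(3)[of y] a by (metis B_def IntD1 IntD2 imageI)
  qed
  moreover have "\<phi> x \<in> g ` B" using g(1,3) N'(2) x int by (auto simp: B_def)
  ultimately show ?thesis by (meson interiorI)
qed

lemma bdry_iff:
  fixes M :: "('a, 'e::euclidean_space) mfd" and \<kappa> :: "'a \<Rightarrow> 'c::euclidean_space"
  assumes M: "premfd M" and \<kappa>: "gchart M U \<kappa>" and x: "x \<in> U" and dim: "DIM('c) = DIM('e)"
  shows "x \<in> bdry M \<longleftrightarrow> \<kappa> x \<notin> interior (\<kappa> ` U)"
proof
  assume "x \<in> bdry M"
  then obtain V \<phi> where V: "(V, \<phi>) \<in> atlas M" "x \<in> V" "\<phi> x \<notin> interior (\<phi> ` V)"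
    by (auto simp: bdry_def)
  then show "\<kappa> x \<notin> interior (\<kappa> ` U)"
    using gchart_interior_transfer[OF M \<kappa> gchart_atlas[OF M V(1)] x V(2) dim] by blast
next
  assume *: "\<kappa> x \<notin> interior (\<kappa> ` U)"
  have "x \<in> points M" using gchart_points[OF \<kappa>] x by blast
  then obtain V \<phi> where V: "(V, \<phi>) \<in> atlas M" "x \<in> V" by (rule premfd_chart[OF M])
  then have "\<phi> x \<notin> interior (\<phi> ` V)"
    using gchart_interior_transfer[OF M gchart_atlas[OF M V(1)] \<kappa> V(2) x dim[symmetric]] * by blast
  then show "x \<in> bdry M" using V by (auto simp: bdry_def)
qed

lemma interior_halfspace_iff:
  fixes z u :: "'c::euclidean_space"
  assumes "openin (top_of_set {x. 0 \<le> x \<bullet> u}) S" "z \<in> S"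
  shows "z \<in> interior S \<longleftrightarrow> u = 0 \<or> z \<bullet> u > 0"
proof
  obtain N where N: "open N" "S = {x. 0 \<le> x \<bullet> u} \<inter> N" using assms by (auto simp: openin_open)
  assume "u = 0 \<or> z \<bullet> u > 0"
  then show "z \<in> interior S"
  proof
    assume "u = 0"
    then show ?thesis using N assms(2) by (simp add: interior_open)
  next
    assume u: "z \<bullet> u > 0"
    have "open ({x. 0 < x \<bullet> u} \<inter> N)"
      using N by (intro open_Int open_Collect_less continuous_intros) auto
    then show ?thesis using N assms(2) u by (intro interiorI[of "{x. 0 < x \<bullet> u} \<inter> N"]) auto
  qed
next
  assume z: "z \<in> interior S"
  have sub: "S \<subseteq> {x. 0 \<le> x \<bullet> u}" using assms(1) by (rule openin_imp_subset)
  show "u = 0 \<or> z \<bullet> u > 0"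
  proof (rule ccontr)
    assume "\<not> (u = 0 \<or> z \<bullet> u > 0)"
    then have u: "u \<noteq> 0" "z \<bullet> u \<le> 0" by auto
    obtain e where e: "e > 0" "ball z e \<subseteq> S" using z by (auto simp: mem_interior)
    let ?w = "z - (e / 2 / norm u) *\<^sub>R u"
    have "?w \<in> ball z e" using e u by (simp add: dist_norm)
    then have "0 \<le> ?w \<bullet> u" using e sub by blast
    moreover have "(e / 2 / norm u) * (u \<bullet> u) > 0" using e u by simp
    ultimately show False using u by (simp add: inner_diff_left)
  qed
qed

lemma hchart_bdry_iff:
  fixes M :: "('a, 'e::euclidean_space) mfd" and \<kappa> :: "'a \<Rightarrow> 'c::euclidean_space"
  assumes M: "premfd M" and \<kappa>: "hchart M U \<kappa> u" and x: "x \<in> U" and dim: "DIM('c) = DIM('e)"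
  shows "x \<in> bdry M \<longleftrightarrow> u \<noteq> 0 \<and> \<kappa> x \<bullet> u = 0"
proof -
  have "openin (top_of_set {x. 0 \<le> x \<bullet> u}) (\<kappa> ` U)" using \<kappa> by (simp add: hchart_def)
  from interior_halfspace_iff[OF this imageI[OF x]] show ?thesis
    using bdry_iff[OF M hchart_gchart[OF \<kappa>] x dim] hchart_ge_0[OF \<kappa> x] by (auto simp: less_le)
qed

lemma hchart_interior_point:
  fixes M :: "('a, 'e::euclidean_space) mfd" and \<kappa> :: "'a \<Rightarrow> 'c::euclidean_space"
  assumes M: "premfd M" and \<kappa>: "gchart M U \<kappa>" and x: "x \<in> U" "x \<notin> bdry M" and dim: "DIM('c) = DIM('e)"
  obtains U' where "x \<in> U'" "U' \<subseteq> U" "hchart M U' \<kappa> 0"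
proof (rule that[of "{y\<in>U. \<kappa> y \<in> interior (\<kappa> ` U)}"])
  let ?V = "{y\<in>U. \<kappa> y \<in> interior (\<kappa> ` U)}"
  show "x \<in> ?V" using bdry_iff[OF M \<kappa> x(1) dim] x by auto
  have "openin (mtop M) ?V"
    by (rule smooth_at_openin_vimage[OF M gchart_openin[OF \<kappa>] gchart_smooth_at[OF \<kappa>]]) auto
  then have "gchart M ?V \<kappa>" by (rule gchart_subset[OF \<kappa>]) auto
  moreover have "\<kappa> ` ?V = interior (\<kappa> ` U)" using interior_subset by fastforce
  ultimately show "hchart M ?V \<kappa> 0" by (simp add: hchart_def)
qed auto

lemma bdry_points: "premfd M \<Longrightarrow> bdry M \<subseteq> points M"
  using gchart_points[OF gchart_atlas] by (fastforce simp: bdry_def)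

lemma closedin_bdry:
  fixes M :: "('a, 'e::euclidean_space) mfd"
  assumes M: "premfd M" shows "closedin (mtop M) (bdry M)"
  unfolding closedin_def
proof
  show "bdry M \<subseteq> points M" by (rule bdry_points[OF M])
  show "openin (mtop M) (points M - bdry M)"
  proof (subst openin_subopen, safe)
    fix x assume x: "x \<in> points M" "x \<notin> bdry M"
    obtain U \<phi> where U: "(U, \<phi>) \<in> atlas M" "x \<in> U" using premfd_chart[OF M x(1)] .
    obtain U' where U': "x \<in> U'" "U' \<subseteq> U" "hchart M U' \<phi> 0"
      using hchart_interior_point[OF M gchart_atlas[OF M U(1)] U(2) x(2)] by blast
    have "U' \<inter> bdry M = {}" using hchart_bdry_iff[OF M U'(3)] by auto
    then show "\<exists>T. openin (mtop M) T \<and> x \<in> T \<and> T \<subseteq> points M - bdry M"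
      using U' gchart_openin[OF hchart_gchart[OF U'(3)]] gchart_points[OF hchart_gchart[OF U'(3)]] by blast
  qed
qed

lemma bdry_open_submfd:
  fixes M :: "('a, 'e::euclidean_space) mfd"
  assumes M: "premfd M" and A: "openin (mtop M) A" and x: "x \<in> A"
  shows "x \<in> bdry (open_submfd M A) \<longleftrightarrow> x \<in> bdry M"
proof -
  have "x \<in> points (open_submfd M A)" using x A openin_subset by fastforce
  then obtain U \<phi> where U: "(U, \<phi>) \<in> atlas (open_submfd M A)" "x \<in> U"
    using premfd_chart[OF premfd_open_submfd[OF M A]] by blast
  then have *: "gchart (open_submfd M A) U \<phi>" by (intro gchart_atlas premfd_open_submfd M A)
  then have "gchart M U \<phi>" by (simp add: gchart_open_submfd[OF M A])
  from bdry_iff[OF M this U(2)] bdry_iff[OF premfd_open_submfd[OF M A] * U(2)]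
  show ?thesis by simp
qed

lemma bdry_prod:
  fixes M :: "('a, 'e::euclidean_space) mfd" and N :: "('b, 'f::euclidean_space) mfd"
  assumes M: "premfd M" and N: "premfd N" and xy: "x \<in> points M" "y \<in> points N" "y \<notin> bdry N"
  shows "(x, y) \<in> bdry (prod_mfd M N) \<longleftrightarrow> x \<in> bdry M"
proof -
  obtain U \<phi> where U: "(U, \<phi>) \<in> atlas M" "x \<in> U" using premfd_chart[OF M xy(1)] .
  obtain V \<psi> where V: "(V, \<psi>) \<in> atlas N" "y \<in> V" using premfd_chart[OF N xy(2)] .
  have "\<psi> y \<in> interior (\<psi> ` V)" using bdry_iff[OF N gchart_atlas[OF N V(1)] V(2)] xy by simp
  moreover have "map_prod \<phi> \<psi> ` (U \<times> V) = \<phi> ` U \<times> \<psi> ` V" by auto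
  ultimately show ?thesis
    using bdry_iff[OF premfd_prod[OF M N] gchart_prod[OF gchart_atlas[OF M U(1)] gchart_atlas[OF N V(1)]], of "(x, y)"]
      bdry_iff[OF M gchart_atlas[OF M U(1)] U(2)] U V by (simp add: interior_Times)
qed

text \<open>The pulled back chart has literally the same image, so half-space conditions and
  interior points carry over without further computation.\<close>

lemma gchart_diffeo:
  assumes M: "premfd M" and N: "premfd N" and h: "smooth_map M N h" and k: "smooth_map N M k"
    and kh: "\<And>x. x \<in> points M \<Longrightarrow> k (h x) = x" and hk: "\<And>y. y \<in> points N \<Longrightarrow> h (k y) = y"
    and \<psi>: "gchart N V \<psi>"
  shows "gchart M {x\<in>points M. h x \<in> V} (\<lambda>x. \<psi> (h x))"
    and "(\<lambda>x. \<psi> (h x)) ` {x\<in>points M. h x \<in> V} = \<psi> ` V"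
proof -
  show "gchart M {x\<in>points M. h x \<in> V} (\<lambda>x. \<psi> (h x))"
  proof (rule gchartI)
    show "openin (mtop M) {x\<in>points M. h x \<in> V}"
      using h gchart_openin[OF \<psi>] by (auto simp: smooth_map_def continuous_map_def)
    show "inj_on (\<lambda>x. \<psi> (h x)) {x\<in>points M. h x \<in> V}"
      using gchart_inj[OF \<psi>] kh by (auto simp: inj_on_def) metis
    show "smooth_at M (\<lambda>x. \<psi> (h x)) x" if "x \<in> {x\<in>points M. h x \<in> V}" for x
      using smooth_map_smooth_at[OF M N h _ gchart_smooth_at[OF \<psi>]] that by auto
    fix x W \<phi> assume x: "x \<in> {x\<in>points M. h x \<in> V}" and W: "(W, \<phi>) \<in> atlas M" "x \<in> W"
    have hx: "h x \<in> points N" "h x \<in> V" "x \<in> points M" using smooth_map_points[OF h] x by auto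
    have "smooth_at N (\<lambda>y. \<phi> (k y)) (h x)"
      by (rule smooth_map_smooth_at[OF N M k hx(1)]) (use kh hx W smooth_at_atlas in auto)
    then obtain A g where g: "\<psi> (h x) \<in> A" "Cinf_on g A"
      "\<And>y. y \<in> V \<Longrightarrow> \<psi> y \<in> A \<Longrightarrow> \<phi> (k y) = g (\<psi> y)"
      using smooth_at_gchart[OF _ \<psi> hx(2)] by blast
    have "openin (mtop N) {y\<in>points N. k y \<in> W}"
      using k gchart_openin[OF gchart_atlas[OF M W(1)]] by (auto simp: smooth_map_def continuous_map_def)
    then obtain B where B: "open B" "\<psi> (h x) \<in> B" "\<And>y. y \<in> V \<Longrightarrow> \<psi> y \<in> B \<Longrightarrow> y \<in> {y\<in>points N. k y \<in> W}"
      using gchart_nhd[OF N \<psi>, of "{y\<in>points N. k y \<in> W}" "h x"] hx W kh by auto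
    show "\<exists>A g. \<psi> (h x) \<in> A \<and> Cinf_on g A \<and>
        (\<forall>y\<in>{x\<in>points M. h x \<in> V}. \<psi> (h y) \<in> A \<longrightarrow> y \<in> W \<and> \<phi> y = g (\<psi> (h y)))"
    proof (intro exI conjI ballI impI)
      show "\<psi> (h x) \<in> A \<inter> B" using g B by simp
      show "Cinf_on g (A \<inter> B)" using g(2) B(1) by (intro Cinf_on_subset[OF g(2)]) (auto simp: Cinf_on_open)
      fix y assume y: "y \<in> {x\<in>points M. h x \<in> V}" "\<psi> (h y) \<in> A \<inter> B"
      show "y \<in> W" using B(3)[of "h y"] y kh[of y] by auto
      show "\<phi> y = g (\<psi> (h y))" using g(3)[of "h y"] y kh[of y] by auto
    qed
  qed
  have "\<psi> y \<in> (\<lambda>x. \<psi> (h x)) ` {x\<in>points M. h x \<in> V}" if "y \<in> V" for y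
  proof -
    have "y \<in> points N" using gchart_points[OF \<psi>] that by blast
    then show ?thesis using hk[of y] smooth_map_points[OF k, of y] that
      by (intro image_eqI[of _ _ "k y"]) auto
  qed
  then show "(\<lambda>x. \<psi> (h x)) ` {x\<in>points M. h x \<in> V} = \<psi> ` V" by auto
qed

lemma bdry_diffeo:
  fixes M :: "('a, 'e::euclidean_space) mfd" and N :: "('b, 'f::euclidean_space) mfd"
  assumes M: "premfd M" and N: "premfd N" and h: "smooth_map M N h" and k: "smooth_map N M k"
    and kh: "\<And>x. x \<in> points M \<Longrightarrow> k (h x) = x" and hk: "\<And>y. y \<in> points N \<Longrightarrow> h (k y) = y"
    and dim: "DIM('e) = DIM('f)" and x: "x \<in> points M"
  shows "x \<in> bdry M \<longleftrightarrow> h x \<in> bdry N"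
proof -
  obtain V \<psi> where V: "(V, \<psi>) \<in> atlas N" "h x \<in> V"
    using premfd_chart[OF N smooth_map_points[OF h x]] .
  note gc = gchart_atlas[OF N V(1)]
  show ?thesis
    using bdry_iff[OF M gchart_diffeo(1)[OF M N h k kh hk gc], of x] bdry_iff[OF N gc V(2)]
      gchart_diffeo(2)[OF M N h k kh hk gc] dim x V by simp
qed

section \<open>The boundary as a manifold\<close>

locale bdry_manifold =
  fixes M :: "('a, 'e::euclidean_space) mfd" and B :: "('a, 'f::euclidean_space) mfd"
  assumes M_manifold: "smooth_manifold M" and B_eq: "B = bdry_mfd M" and dim: "DIM('f) + 1 = DIM('e)"
begin

lemma M: "premfd M" by (rule smooth_manifold_imp_premfd[OF M_manifold])

lemma mtop_B [simp]: "mtop B = subtopology (mtop M) (bdry M)"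
  by (simp add: B_eq bdry_mfd_def)

lemma points_B [simp]: "points B = bdry M"
  using bdry_points[OF M] by auto

lemma atlas_B: "(V, \<psi>) \<in> atlas B \<longleftrightarrow> (\<exists>U \<phi> u L. V = U \<inter> bdry M \<and> \<psi> = L \<circ> \<phi> \<and> (U, \<phi>) \<in> atlas M \<and>
    u \<noteq> 0 \<and> openin (top_of_set {x. 0 \<le> x \<bullet> u}) (\<phi> ` U) \<and> linear L \<and> bij_betw L {x. x \<bullet> u = 0} UNIV)"
  by (auto simp: B_eq bdry_mfd_def)

text \<open>\<open>L\<close> is invertible on the bounding hyperplane only. Its inverse
  \<open>R\<close> has values in that hyperplane and so recovers the coordinates of \<open>M\<close>
  from those of the boundary at boundary points; smoothness on the boundary is computed through this
  pair.\<close>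

lemma chart_B:
  assumes "(V, \<psi>) \<in> atlas B"
  obtains U \<phi> u L R where "V = U \<inter> bdry M" "\<psi> = L \<circ> \<phi>" "(U, \<phi>) \<in> atlas M" "hchart M U \<phi> u" "u \<noteq> 0"
    "bounded_linear L" "bounded_linear R" "\<And>x. x \<in> V \<Longrightarrow> R (\<psi> x) = \<phi> x" "\<And>y. R y \<bullet> u = 0" "\<And>y. L (R y) = y"
proof -
  obtain U \<phi> u L where *: "V = U \<inter> bdry M" "\<psi> = L \<circ> \<phi>" "(U, \<phi>) \<in> atlas M"
    "u \<noteq> 0" "openin (top_of_set {x. 0 \<le> x \<bullet> u}) (\<phi> ` U)" "linear L" "bij_betw L {x. x \<bullet> u = 0} UNIV"
    using iffD1[OF atlas_B assms] by (elim exE conjE) (rule that; assumption)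
  define H where "H = {x. x \<bullet> u = 0}"
  have subH: "subspace H" by (auto simp: H_def subspace_def inner_add_left)
  have hc: "hchart M U \<phi> u" using * gchart_atlas[OF M] by (simp add: hchart_def)
  define R where "R = inv_into H L"
  have inj: "inj_on L H" and im: "L ` H = UNIV" using *(7) by (auto simp: bij_betw_def H_def)
  have RH: "R y \<in> H" and LR: "L (R y) = y" for y
    using im by (auto simp: R_def inv_into_into f_inv_into_f)
  have RL: "R (L x) = x" if "x \<in> H" for x using inj that by (simp add: R_def)
  have "linear R"
  proof
    fix a b :: 'f and r :: real
    have "R a + R b \<in> H" "r *\<^sub>R R a \<in> H" using RH subH by (auto simp: subspace_def)
    moreover have "L (R a + R b) = a + b" "L (r *\<^sub>R R a) = r *\<^sub>R a"
      using *(6) LR by (simp_all add: linear_add linear_scale)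
    ultimately show "R (a + b) = R a + R b" "R (r *\<^sub>R a) = r *\<^sub>R R a" using RL by metis+
  qed
  moreover have "R (\<psi> x) = \<phi> x" if "x \<in> V" for x
  proof -
    have "\<phi> x \<in> H" using that hchart_bdry_iff[OF M hc, of x] *(1) by (auto simp: H_def)
    then show ?thesis using RL *(2) by simp
  qed
  ultimately show thesis
    using that[OF *(1-3) hc *(4), of R] *(6) RH LR by (auto simp: H_def linear_conv_bounded_linear)
qed

lemma chart_B_exists:
  assumes "p \<in> bdry M"
  obtains V \<psi> where "(V, \<psi>) \<in> atlas B" "p \<in> V"
proof -
  obtain U \<phi> where U: "(U, \<phi>) \<in> atlas M" "p \<in> U" using assms by (auto simp: bdry_def)
  obtain u where u: "hchart M U \<phi> u" by (rule smooth_manifold_hchart[OF M_manifold U(1)])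
  have "u \<noteq> 0" using hchart_bdry_iff[OF M u U(2)] assms by simp
  define H where "H = {x. x \<bullet> u = 0}"
  have subH: "subspace H" by (auto simp: H_def subspace_def inner_add_left)
  have "dim H = dim (UNIV :: 'f set)"
    using dim_hyperplane[OF \<open>u \<noteq> 0\<close>] dim by (simp add: H_def inner_commute)
  then obtain f :: "'e \<Rightarrow> 'f" and g where f: "linear f" "f ` H = UNIV" "\<And>x. x \<in> H \<Longrightarrow> g (f x) = x"
    using isometries_subspaces[OF subH subspace_UNIV, of thesis] by metis
  have "bij_betw f H UNIV" using f by (auto simp: bij_betw_def intro: inj_on_inverseI)
  then have "(U \<inter> bdry M, f \<circ> \<phi>) \<in> atlas B"
    unfolding atlas_B using U u \<open>u \<noteq> 0\<close> f by (auto simp: hchart_def H_def)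
  then show thesis using that U(2) assms by blast
qed

lemma smooth_at_restrict:
  assumes "smooth_at M f p" "p \<in> bdry M" shows "smooth_at B f p"
proof -
  obtain V \<psi> where V: "(V, \<psi>) \<in> atlas B" "p \<in> V" using chart_B_exists[OF assms(2)] .
  obtain U \<phi> u L R where c: "V = U \<inter> bdry M" "\<psi> = L \<circ> \<phi>" "(U, \<phi>) \<in> atlas M" "hchart M U \<phi> u" "u \<noteq> 0"
    "bounded_linear L" "bounded_linear R" "\<And>x. x \<in> V \<Longrightarrow> R (\<psi> x) = \<phi> x" "\<And>y. R y \<bullet> u = 0" "\<And>y. L (R y) = y"
    by (rule chart_B[OF V(1)]) blast
  have pU: "p \<in> U" using V c by auto
  obtain N g where g: "\<phi> p \<in> N" "Cinf_on g N" "\<And>y. y \<in> U \<Longrightarrow> \<phi> y \<in> N \<Longrightarrow> f y = g (\<phi> y)"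
    using smooth_at_gchart[OF assms(1) gchart_atlas[OF M c(3)] pU] by blast
  have R: "Cinf_on R UNIV" by (rule Cinf_on_bounded_linear[OF c(7)]) simp
  have "open (UNIV \<inter> R -` N)" by (rule Cinf_on_vimage[OF R Cinf_on_open[OF g(2)]])
  then have "Cinf_on (\<lambda>y. g (R y)) (R -` N)"
    by (intro Cinf_on_compose[OF Cinf_on_subset[OF R] g(2)]) auto
  then show ?thesis
  proof (rule smooth_atI[OF V, rotated])
    show "\<psi> p \<in> R -` N" using c(8)[OF V(2)] g(1) by simp
    show "f y = g (R (\<psi> y))" if "y \<in> V" "\<psi> y \<in> R -` N" for y
      using c(8)[OF that(1)] that g(3)[of y] c(1) by auto
  qed
qed

lemma openin_B: "openin (mtop B) S \<longleftrightarrow> (\<exists>T. openin (mtop M) T \<and> S = T \<inter> bdry M)"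
  by (simp add: openin_subtopology)

text \<open>Since \<open>L\<close> is defined on the whole model space, composition with it extends
  a germ from the boundary. The extension is constant along the kernel of \<open>L\<close>, a line
  transverse to the bounding hyperplane.\<close>

lemma smooth_at_extend:
  assumes "smooth_at B f p"
  obtains F A where "smooth_at M F p" "openin (mtop M) A" "p \<in> A" "\<And>y. y \<in> A \<Longrightarrow> smooth_at M F y"
    "\<And>y. y \<in> A \<inter> bdry M \<Longrightarrow> F y = f y"
proof -
  obtain V \<psi> N g where f: "(V, \<psi>) \<in> atlas B" "p \<in> V" "\<psi> p \<in> N" "Cinf_on g N"
    "\<And>y. y \<in> V \<Longrightarrow> \<psi> y \<in> N \<Longrightarrow> f y = g (\<psi> y)" by (rule smooth_atE[OF assms]) blast
  obtain U \<phi> u L R where c: "V = U \<inter> bdry M" "\<psi> = L \<circ> \<phi>" "(U, \<phi>) \<in> atlas M" "hchart M U \<phi> u" "u \<noteq> 0"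
    "bounded_linear L" "bounded_linear R" "\<And>x. x \<in> V \<Longrightarrow> R (\<psi> x) = \<phi> x" "\<And>y. R y \<bullet> u = 0" "\<And>y. L (R y) = y"
    by (rule chart_B[OF f(1)]) blast
  have pU: "p \<in> U" using f c by auto
  have L: "Cinf_on L UNIV" by (rule Cinf_on_bounded_linear[OF c(6)]) simp
  have op: "open (L -` N)" using Cinf_on_vimage[OF L Cinf_on_open[OF f(4)]] by simp
  have sm: "smooth_at M (\<lambda>y. g (L (\<phi> y))) y" if "y \<in> U" "\<phi> y \<in> L -` N" for y
    by (rule smooth_at_compose[OF smooth_at_bounded_linear[OF c(6) smooth_at_atlas[OF c(3) that(1)]] f(4)])
      (use that in auto)
  show thesis
  proof (rule that[of "\<lambda>y. g (L (\<phi> y))" "{y\<in>U. \<phi> y \<in> L -` N}"])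
    show "openin (mtop M) {y\<in>U. \<phi> y \<in> L -` N}" by (rule premfd_preimage[OF M c(3) op])
  qed (use f c pU sm in auto)
qed

lemma premfd_B: "premfd B"
proof (rule premfdI)
  show "\<Union>(fst ` atlas B) = points B"
  proof safe
    fix p V \<psi> assume "(V, \<psi>) \<in> atlas B" "p \<in> fst (V, \<psi>)"
    then show "p \<in> points B" unfolding points_B by (auto simp: atlas_B)
  next
    fix p assume "p \<in> points B"
    then obtain V \<psi> where "(V, \<psi>) \<in> atlas B" "p \<in> V" using chart_B_exists by auto
    then show "p \<in> \<Union>(fst ` atlas B)" by (intro UN_I[of "(V, \<psi>)"]) auto
  qed
  fix V \<psi> assume V: "(V, \<psi>) \<in> atlas B"
  obtain U \<phi> u L R where c: "V = U \<inter> bdry M" "\<psi> = L \<circ> \<phi>" "(U, \<phi>) \<in> atlas M" "hchart M U \<phi> u" "u \<noteq> 0"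
    "bounded_linear L" "bounded_linear R" "\<And>x. x \<in> V \<Longrightarrow> R (\<psi> x) = \<phi> x" "\<And>y. R y \<bullet> u = 0" "\<And>y. L (R y) = y"
    by (rule chart_B[OF V]) blast
  have L: "Cinf_on L UNIV" and R: "Cinf_on R UNIV" using Cinf_on_bounded_linear c by auto
  note gc = gchart_atlas[OF M c(3)]
  show pre: "openin (mtop B) {y\<in>V. \<psi> y \<in> N}" if "open N" for N
  proof -
    have "open (L -` N)" using Cinf_on_vimage[OF L that] by simp
    then have "openin (mtop M) {y\<in>U. \<phi> y \<in> L -` N}" by (rule premfd_preimage[OF M c(3)])
    moreover have "{y\<in>V. \<psi> y \<in> N} = {y\<in>U. \<phi> y \<in> L -` N} \<inter> bdry M" using c by auto
    ultimately show ?thesis unfolding openin_B by blast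
  qed
  have openR: "open (R -` N)" if "open N" for N using Cinf_on_vimage[OF R that] by simp
  show "\<exists>N. open N \<and> \<psi> x \<in> N \<and> (\<forall>y\<in>V. \<psi> y \<in> N \<longrightarrow> y \<in> A)"
    if A: "openin (mtop B) A" and x: "x \<in> A" "x \<in> V" for A x
  proof -
    obtain T where T: "openin (mtop M) T" "A = T \<inter> bdry M" using iffD1[OF openin_B A] by blast
    obtain N where N: "open N" "\<phi> x \<in> N" "\<And>y. y \<in> U \<Longrightarrow> \<phi> y \<in> N \<Longrightarrow> y \<in> T"
      using premfd_nhd[OF M c(3) T(1)] x T c by blast
    show ?thesis
      by (rule exI[of _ "R -` N"]) (use N c T x openR in auto)
  qed
  show "gchart B V \<psi>"
  proof (rule gchartI)
    show "openin (mtop B) V" using pre[of UNIV] by simp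
    show "inj_on \<psi> V"
    proof (rule inj_onI)
      fix x y assume "x \<in> V" "y \<in> V" "\<psi> x = \<psi> y"
      then have "\<phi> x = \<phi> y" "x \<in> U" "y \<in> U" using c(1,8) by (metis, auto)
      then show "x = y" using gchart_inj[OF gc] by (auto dest: inj_onD)
    qed
    show "smooth_at B \<psi> x" if "x \<in> V" for x by (rule smooth_at_atlas[OF V that])
    fix x V' \<psi>' assume x: "x \<in> V" and V': "(V', \<psi>') \<in> atlas B" "x \<in> V'"
    obtain U' \<phi>' u' L' R' where c': "V' = U' \<inter> bdry M" "\<psi>' = L' \<circ> \<phi>'" "(U', \<phi>') \<in> atlas M"
      "hchart M U' \<phi>' u'" "u' \<noteq> 0" "bounded_linear L'" "bounded_linear R'"
      "\<And>x. x \<in> V' \<Longrightarrow> R' (\<psi>' x) = \<phi>' x" "\<And>y. R' y \<bullet> u' = 0" "\<And>y. L' (R' y) = y"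
      by (rule chart_B[OF V'(1)]) blast
    obtain N g where g: "\<phi> x \<in> N" "Cinf_on g N" "\<And>y. y \<in> U \<Longrightarrow> \<phi> y \<in> N \<Longrightarrow> y \<in> U' \<and> \<phi>' y = g (\<phi> y)"
      using gchart_transition[OF gc _ c'(3), of x] x V' c c' by blast
    have "Cinf_on (\<lambda>y. L' (g (R y))) (R -` N)"
      by (intro Cinf_on_bounded_linear_compose[OF c'(6)] Cinf_on_compose[OF Cinf_on_subset[OF R] g(2)]
          openR Cinf_on_open[OF g(2)]) auto
    moreover have "R (\<psi> x) \<in> N" using c(8)[OF x] g(1) by simp
    moreover have "y \<in> V' \<and> \<psi>' y = L' (g (R (\<psi> y)))" if "y \<in> V" "\<psi> y \<in> R -` N" for y
    proof -
      have "R (\<psi> y) = \<phi> y" using c(8) that by blast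
      then have "y \<in> U' \<and> \<phi>' y = g (\<phi> y)" using g(3)[of y] that c(1) by auto
      then show ?thesis using that c c' \<open>R (\<psi> y) = \<phi> y\<close> by auto
    qed
    ultimately show "\<exists>N g. \<psi> x \<in> N \<and> Cinf_on g N \<and> (\<forall>y\<in>V. \<psi> y \<in> N \<longrightarrow> y \<in> V' \<and> \<psi>' y = g (\<psi> y))"
      by (intro exI[of _ "R -` N"] exI[of _ "\<lambda>y. L' (g (R y))"]) auto
  qed
qed

end

section \<open>Bump functions and partitions of unity\<close>

text \<open>The closed set \<open>K\<close> inside \<open>A\<close> encloses the support. Together
  \<open>A\<close> and the complement of \<open>K\<close> cover \<open>M\<close>, which is what
  makes extension by zero smooth; regularity of the compact Hausdorff space provides
  \<open>K\<close> within a chart.\<close>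

lemma smooth_bump:
  assumes M: "premfd M" and "compact_space (mtop M)" "Hausdorff_space (mtop M)"
    and A: "openin (mtop M) A" "p \<in> A"
  obtains b :: "'a \<Rightarrow> real" and C K where "\<And>x. x \<in> points M \<Longrightarrow> smooth_at M b x"
    "\<And>x. 0 \<le> b x" "\<And>x. b x \<le> 1" "openin (mtop M) C" "p \<in> C" "\<And>x. x \<in> C \<Longrightarrow> b x = 1"
    "closedin (mtop M) K" "K \<subseteq> A" "\<And>x. x \<notin> K \<Longrightarrow> b x = 0"
proof -
  have p: "p \<in> points M" using A openin_subset by blast
  obtain U \<phi> where U: "(U, \<phi>) \<in> atlas M" "p \<in> U" using premfd_chart[OF M p] .
  note gc = gchart_atlas[OF M U(1)]
  have AU: "openin (mtop M) (A \<inter> U)" using A gchart_openin[OF gc] by blast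
  have "regular_space (mtop M)" using assms by (simp add: compact_Hausdorff_imp_regular_space)
  then have "neighbourhood_base_of (closedin (mtop M)) (mtop M)" by (simp add: neighbourhood_base_of_closedin)
  then obtain V K where V: "openin (mtop M) V" "closedin (mtop M) K" "p \<in> V" "V \<subseteq> K" "K \<subseteq> A \<inter> U"
    using iffD1[OF neighbourhood_base_of, rule_format, of _ _ "A \<inter> U" p] AU A(2) U(2) by (metis IntI)
  obtain N where N: "open N" "\<phi> p \<in> N" "\<And>y. y \<in> U \<Longrightarrow> \<phi> y \<in> N \<Longrightarrow> y \<in> V"
    using premfd_nhd[OF M U(1) V(1) V(3) U(2)] by blast
  obtain e where e: "e > 0" "ball (\<phi> p) e \<subseteq> N" using N open_contains_ball by blast
  obtain B :: "_ \<Rightarrow> real" where B: "Cinf_on B UNIV" "\<And>y. 0 \<le> B y" "\<And>y. B y \<le> 1"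
    "\<And>y. dist (\<phi> p) y < e / 2 \<Longrightarrow> B y = 1" "\<And>y. dist (\<phi> p) y \<ge> 2 * (e / 2) \<Longrightarrow> B y = 0"
    using Cinf_bump[of "e / 2" "\<phi> p"] e by auto
  define b where "b x = (if x \<in> U then B (\<phi> x) else 0)" for x
  have b0: "b x = 0" if "x \<notin> K" for x
  proof (cases "x \<in> U")
    case True
    then have "\<phi> x \<notin> N" using N(3) V that by blast
    then have "dist (\<phi> p) (\<phi> x) \<ge> 2 * (e / 2)" using e by (auto simp: subset_iff not_less[symmetric])
    then show ?thesis using B(5) by (simp add: b_def)
  qed (simp add: b_def)
  show thesis
  proof (rule that[of b "{y\<in>U. \<phi> y \<in> ball (\<phi> p) (e / 2)}" K])
    show "smooth_at M b x" if x: "x \<in> points M" for x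
    proof (cases "x \<in> U")
      case True
      have "smooth_at M (\<lambda>y. B (\<phi> y)) x"
        by (rule smooth_at_compose[OF smooth_at_atlas[OF U(1) True] B(1)]) simp
      then show ?thesis
        by (rule smooth_at_cong[OF M _ gchart_openin[OF gc] True]) (simp add: b_def)
    next
      case False
      then have "x \<in> points M - K" using V x by blast
      then show ?thesis
        using V(2) by (intro smooth_at_cong[OF M smooth_at_const[OF M x], of "points M - K" 0]) (auto simp: b0)
    qed
    show "openin (mtop M) {y\<in>U. \<phi> y \<in> ball (\<phi> p) (e / 2)}" by (rule premfd_preimage[OF M U(1)]) simp
    show "b x = 0" if "x \<notin> K" for x using b0 that .
  qed (use B V U e in \<open>auto simp: b_def\<close>)
qed

text \<open>A point outside \<open>A\<close> has the complement of \<open>K\<close> as a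
  neighbourhood, and there the function is identically zero.\<close>

lemma smooth_at_cutoff:
  fixes f :: "'a \<Rightarrow> 'b::euclidean_space"
  assumes M: "premfd M" and A: "openin (mtop M) A" "\<And>x. x \<in> A \<Longrightarrow> smooth_at M f x"
    and b: "\<And>x. x \<in> points M \<Longrightarrow> smooth_at M b x"
    and K: "closedin (mtop M) K" "K \<subseteq> A" "\<And>x. x \<notin> K \<Longrightarrow> b x = (0::real)"
    and x: "x \<in> points M"
  shows "smooth_at M (\<lambda>x. if x \<in> A then b x *\<^sub>R f x else 0) x"
proof (cases "x \<in> A")
  case True
  show ?thesis
    by (rule smooth_at_cong[OF M smooth_at_scaleR[OF M b[OF x] A(2)[OF True]] A(1) True]) simp
next
  case False
  then have "x \<in> points M - K" using K x by blast
  then show ?thesis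
    using K(1,3) by (intro smooth_at_cong[OF M smooth_at_const[OF M x], of "points M - K" 0]) auto
qed

lemma compact_space_finite_cover:
  assumes "compact_space X" "\<And>x. x \<in> topspace X \<Longrightarrow> openin X (C x) \<and> x \<in> C x"
  obtains S where "finite S" "S \<subseteq> topspace X" "topspace X \<subseteq> (\<Union>x\<in>S. C x)"
proof -
  have "topspace X \<subseteq> \<Union>(C ` topspace X)" using assms(2) by blast
  then obtain F where "finite F" "F \<subseteq> C ` topspace X" "topspace X \<subseteq> \<Union>F"
    using assms unfolding compact_space_alt by (metis (no_types, lifting) imageE)
  then show thesis using that by (metis finite_subset_image)
qed

lemma smooth_partition_of_unity:
  assumes M: "premfd M" and "compact_space (mtop M)" "Hausdorff_space (mtop M)"
    and A: "\<And>x. x \<in> points M \<Longrightarrow> openin (mtop M) (A x) \<and> x \<in> A x"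
  obtains S and b :: "'a \<Rightarrow> 'a \<Rightarrow> real" and K where "finite S" "S \<subseteq> points M"
    "\<And>p x. p \<in> S \<Longrightarrow> x \<in> points M \<Longrightarrow> smooth_at M (b p) x"
    "\<And>p x. p \<in> S \<Longrightarrow> x \<in> points M \<Longrightarrow> 0 \<le> b p x"
    "\<And>p. p \<in> S \<Longrightarrow> closedin (mtop M) (K p)" "\<And>p. p \<in> S \<Longrightarrow> K p \<subseteq> A p"
    "\<And>p x. p \<in> S \<Longrightarrow> x \<notin> K p \<Longrightarrow> b p x = 0"
    "\<And>x. x \<in> points M \<Longrightarrow> (\<Sum>p\<in>S. b p x) = 1"
proof -
  \<comment> \<open>The bump function, the set where it equals 1 and its closed support form one
    triple, so that a single use of choice selects all three.\<close>
  define Q :: "'a \<Rightarrow> ('a \<Rightarrow> real) \<times> 'a set \<times> 'a set \<Rightarrow> bool" where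
    "Q p t \<longleftrightarrow> (\<forall>x\<in>points M. smooth_at M (fst t) x) \<and> (\<forall>x. 0 \<le> fst t x) \<and>
      openin (mtop M) (fst (snd t)) \<and> p \<in> fst (snd t) \<and> (\<forall>x\<in>fst (snd t). fst t x = 1) \<and>
      closedin (mtop M) (snd (snd t)) \<and> snd (snd t) \<subseteq> A p \<and> (\<forall>x. x \<notin> snd (snd t) \<longrightarrow> fst t x = 0)" for p t
  have "\<exists>t. Q p t" if p: "p \<in> points M" for p
  proof -
    obtain b :: "'a \<Rightarrow> real" and C K where "\<And>x. x \<in> points M \<Longrightarrow> smooth_at M b x"
    "\<And>x. 0 \<le> b x" "\<And>x. b x \<le> 1" "openin (mtop M) C" "p \<in> C" "\<And>x. x \<in> C \<Longrightarrow> b x = 1"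
    "closedin (mtop M) K" "K \<subseteq> A p" "\<And>x. x \<notin> K \<Longrightarrow> b x = 0"
      using smooth_bump[OF assms(1-3), of "A p" p] A[OF p] by metis
    then show ?thesis by (intro exI[of _ "(b, C, K)"]) (simp add: Q_def)
  qed
  then obtain t where t: "\<And>p. p \<in> points M \<Longrightarrow> Q p (t p)" using bchoice[of "points M" Q] by blast
  define b C K where "b p = fst (t p)" and "C p = fst (snd (t p))" and "K p = snd (snd (t p))" for p
  have b: "\<And>p x. p \<in> points M \<Longrightarrow> x \<in> points M \<Longrightarrow> smooth_at M (b p) x"
    "\<And>p x. p \<in> points M \<Longrightarrow> 0 \<le> b p x"
    "\<And>p. p \<in> points M \<Longrightarrow> openin (mtop M) (C p) \<and> p \<in> C p"
    "\<And>p x. p \<in> points M \<Longrightarrow> x \<in> C p \<Longrightarrow> b p x = 1"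
    "\<And>p. p \<in> points M \<Longrightarrow> closedin (mtop M) (K p)" "\<And>p. p \<in> points M \<Longrightarrow> K p \<subseteq> A p"
    "\<And>p x. p \<in> points M \<Longrightarrow> x \<notin> K p \<Longrightarrow> b p x = 0"
    using t by (simp_all add: Q_def b_def C_def K_def)
  obtain S where S: "finite S" "S \<subseteq> points M" "points M \<subseteq> (\<Union>x\<in>S. C x)"
    using compact_space_finite_cover[OF assms(2) b(3)] by blast
  define s where "s x = (\<Sum>p\<in>S. b p x)" for x
  have s_pos: "s x > 0" if x: "x \<in> points M" for x
  proof -
    obtain p where "p \<in> S" "x \<in> C p" using S(3) x by blast
    then have "b p x = 1" using b(4) S by blast
    moreover have "b p x \<le> s x"
      unfolding s_def using S b(2) \<open>p \<in> S\<close> by (intro member_le_sum) auto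
    ultimately show ?thesis by simp
  qed
  have s_smooth: "smooth_at M s x" if "x \<in> points M" for x
    unfolding s_def using S b(1) that by (intro smooth_at_sum[OF M]) auto
  show thesis
  proof (rule that[of S "\<lambda>p x. inverse (s x) * b p x" K])
    show "smooth_at M (\<lambda>x. inverse (s x) * b p x) x" if "p \<in> S" "x \<in> points M" for p x
      using that S b(1) s_pos[OF that(2)]
      by (intro smooth_at_mult[OF M] smooth_at_compose[OF s_smooth Cinf_on_inverse]) auto
    show "0 \<le> inverse (s x) * b p x" if "p \<in> S" "x \<in> points M" for p x
    proof -
      have "0 \<le> b p x" using b(2) S that by blast
      then show ?thesis using s_pos[OF that(2)] by simp
    qed
    show "(\<Sum>p\<in>S. inverse (s x) * b p x) = 1" if "x \<in> points M" for x
      using s_pos[OF that] by (simp add: sum_distrib_left[symmetric] s_def)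
    show "K p \<subseteq> A p" if "p \<in> S" for p using b(6) S(2) that by blast
    show "inverse (s x) * b p x = 0" if "p \<in> S" "x \<notin> K p" for p x using b(7)[of p x] S(2) that by auto
    show "closedin (mtop M) (K p)" if "p \<in> S" for p using b(5) S(2) that by blast
  qed (rule S)+
qed

section \<open>Charts adapted to a circle-valued function\<close>

text \<open>Orthogonal projection along \<open>v\<close>, followed by an isometry of the complement
  of \<open>v\<close> with the smaller space. As \<open>u\<close> is orthogonal to \<open>v\<close>,
  inner products with \<open>u\<close> are preserved and the half-space of \<open>u\<close> goes to
  that of \<open>P u\<close>.\<close>

lemma isometric_projection:
  fixes v u :: "'c::euclidean_space"
  assumes v: "v \<noteq> 0" "u \<bullet> v = 0" and dim: "DIM('f::euclidean_space) + 1 = DIM('c)"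
  obtains P :: "'c \<Rightarrow> 'f::euclidean_space" where "linear P" "\<And>z. P z \<bullet> P u = z \<bullet> u" "\<And>z. P z = 0 \<Longrightarrow> \<exists>s. z = s *\<^sub>R v"
proof -
  define S where "S = {x. x \<bullet> v = 0}"
  have subS: "subspace S" by (auto simp: S_def subspace_def inner_add_left)
  have "dim S = dim (UNIV :: 'f set)"
    using dim_hyperplane[OF v(1)] dim by (simp add: S_def inner_commute)
  then obtain f :: "'c \<Rightarrow> 'f" and g where f: "linear f" "\<And>x. x \<in> S \<Longrightarrow> norm (f x) = norm x" "\<And>x. x \<in> S \<Longrightarrow> g (f x) = x"
    using isometries_subspaces[OF subS subspace_UNIV, of thesis] by metis
  have inner: "f x \<bullet> f y = x \<bullet> y" if "x \<in> S" "y \<in> S" for x y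
  proof -
    have "x + y \<in> S" using that subS by (simp add: subspace_add)
    then have "norm (f x + f y) = norm (x + y)" using f by (metis linear_add)
    then show ?thesis using f(2) that by (simp add: dot_norm)
  qed
  define l where "l z = z - ((z \<bullet> v) / (v \<bullet> v)) *\<^sub>R v" for z
  have lS: "l z \<in> S" for z using v by (simp add: S_def l_def inner_diff_left)
  have "linear l" unfolding l_def
    by (intro linearI) (auto simp: inner_add_left add_divide_distrib scaleR_add_left algebra_simps)
  then have lin: "linear (\<lambda>z. f (l z))" using f(1) linear_compose[of l f] by (simp add: comp_def)
  have lu: "l u = u" using v by (simp add: l_def)
  show thesis
  proof (rule that[OF lin])
    show "f (l z) \<bullet> f (l u) = z \<bullet> u" for z
    proof -
      have "v \<bullet> u = 0" using v(2) by (simp add: inner_commute)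
      then have "l z \<bullet> u = z \<bullet> u" by (simp add: l_def inner_diff_left)
      then show ?thesis using inner[OF lS lS, of z u] by (simp add: lu)
    qed
    show "\<exists>s. z = s *\<^sub>R v" if "f (l z) = 0" for z
    proof -
      have "l z = 0" using f(2)[OF lS, of z] that by simp
      then show ?thesis unfolding l_def by (metis eq_iff_diff_eq_0)
    qed
  qed
qed

lemma cis_close:
  assumes "\<bar>t\<bar> < pi" shows "cis t \<notin> \<real>\<^sub>\<le>\<^sub>0" "Im (Ln (cis t)) = t"
proof -
  show "Im (Ln (cis t)) = t" using Ln_cis[OF assms] by simp
  show "cis t \<notin> \<real>\<^sub>\<le>\<^sub>0"
  proof
    assume "cis t \<in> \<real>\<^sub>\<le>\<^sub>0"
    then have "cis t = -1" by (auto simp: complex_nonpos_Reals_iff complex_eq_iff dest: sin_zero_abs_cos_one)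
    then have "Ln (cis t) = \<i> * pi" by simp
    then show False using Ln_cis[OF assms] assms by (auto simp: complex_eq_iff)
  qed
qed

text \<open>The half-space vector has no component in the angle direction. Hence where the chart
  meets the boundary, the angle is a coordinate of the boundary too, so the restriction of
  \<open>p\<close> to the boundary is a submersion as well.\<close>

definition adapted_chart ::
  "('a, 'e::euclidean_space) mfd \<Rightarrow> ('a \<Rightarrow> complex) \<Rightarrow> complex \<Rightarrow> 'a set \<Rightarrow> ('a \<Rightarrow> 'f::euclidean_space \<times> real) \<Rightarrow> 'f \<Rightarrow> bool" where
  "adapted_chart M p c U \<kappa> u \<longleftrightarrow> hchart M U \<kappa> (u, 0) \<and>
     (\<forall>y\<in>U. p y / c \<notin> \<real>\<^sub>\<le>\<^sub>0 \<and> snd (\<kappa> y) = Im (Ln (p y / c)))"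

text \<open>The vector \<open>v\<close> is parallel to the bounding hyperplane, and the phase
  \<open>g\<close> has nonzero derivative along it. Collapsing \<open>v\<close> and recording the
  phase in its place gives an injective derivative, hence new coordinates that keep the
  half-space.\<close>

lemma adapted_chartI:
  fixes M :: "('a, 'e::euclidean_space) mfd" and \<kappa> :: "'a \<Rightarrow> 'c::euclidean_space"
  assumes M: "premfd M" and \<kappa>: "hchart M U \<kappa> u" and x: "x \<in> U"
    and dim: "DIM('f::euclidean_space) + 1 = DIM('c)"
    and uv: "u \<bullet> v = 0" and p: "norm (p x) = 1"
    and g: "Cinf_on g N" "\<kappa> x \<in> N" "\<And>y. y \<in> U \<Longrightarrow> \<kappa> y \<in> N \<Longrightarrow> p y = p x * cis (g (\<kappa> y) - g (\<kappa> x))"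
    and der: "frechet_derivative g (at (\<kappa> x)) v \<noteq> 0"
  obtains V and \<mu> :: "'a \<Rightarrow> 'f::euclidean_space \<times> real" and w where "x \<in> V" "adapted_chart M p (p x) V \<mu> w"
proof -
  have gder: "(g has_derivative frechet_derivative g (at (\<kappa> x))) (at (\<kappa> x))"
    by (rule Cinf_on_has_derivative[OF g(1,2)])
  have lin_g: "linear (frechet_derivative g (at (\<kappa> x)))" by (rule has_derivative_linear[OF gder])
  have "v \<noteq> 0" using der linear_0[OF lin_g] by auto
  then obtain P :: "'c \<Rightarrow> 'f" where P: "linear P" "\<And>z. P z \<bullet> P u = z \<bullet> u" "\<And>z. P z = 0 \<Longrightarrow> \<exists>s. z = s *\<^sub>R v"
    using isometric_projection[OF _ uv dim] by blast
  have blP: "bounded_linear P" using P(1) by (simp add: linear_conv_bounded_linear)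
  define G where "G z = (P z, g z - g (\<kappa> x))" for z
  have G: "Cinf_on G N" unfolding G_def
    using Cinf_on_open[OF g(1)] by (intro Cinf_on_Pair Cinf_on_diff g(1) Cinf_on_bounded_linear[OF blP]) auto
  have "(G has_derivative (\<lambda>h. (P h, frechet_derivative g (at (\<kappa> x)) h))) (at (\<kappa> x))"
    unfolding G_def by (intro has_derivative_Pair bounded_linear_imp_has_derivative[OF blP])
      (use has_derivative_diff[OF gder has_derivative_const] in simp)
  then have Gd: "frechet_derivative G (at (\<kappa> x)) = (\<lambda>h. (P h, frechet_derivative g (at (\<kappa> x)) h))"
    by (rule frechet_derivative_at[symmetric])
  have inj: "inj (frechet_derivative G (at (\<kappa> x)))"
  proof -
    have "linear (\<lambda>h. (P h, frechet_derivative g (at (\<kappa> x)) h))"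
      using P(1) lin_g by (intro linearI) (auto simp: linear_add linear_scale)
    moreover have "h = 0" if "(P h, frechet_derivative g (at (\<kappa> x)) h) = 0" for h
    proof -
      have "P h = 0" using that by (simp add: zero_prod_def)
      then obtain s where s: "h = s *\<^sub>R v" using P(3) by blast
      then have "s * frechet_derivative g (at (\<kappa> x)) v = 0"
        using that linear_scale[OF lin_g, of s v] by (auto simp: zero_prod_def)
      then show ?thesis using der s by simp
    qed
    ultimately show ?thesis unfolding Gd by (metis (no_types, lifting) linear_injective_0)
  qed
  have dim': "DIM('c) = DIM('f \<times> real)" using dim by simp
  obtain N' where N': "open N'" "\<kappa> x \<in> N'" "N' \<subseteq> N" "inj_on G N'" "open (G ` N')"
    "\<And>N'' . open N'' \<Longrightarrow> N'' \<subseteq> N' \<Longrightarrow> open (G ` N'') \<and> gchart M {y\<in>U. \<kappa> y \<in> N''} (\<lambda>y. G (\<kappa> y))"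
    using gchart_inverse_function[OF M hchart_gchart[OF \<kappa>] x g(2) G inj dim'] by blast
  obtain N1 where N1: "open N1" "\<kappa> x \<in> N1" "\<And>z. z \<in> N1 \<Longrightarrow> 0 \<le> z \<bullet> u \<Longrightarrow> z \<in> \<kappa> ` U"
    using hchart_image_nhd[OF \<kappa> x] by blast
  \<comment> \<open>Three restrictions: the phase stays within pi of its value at \<open>x\<close>,
    so it is a principal argument; \<open>G\<close> is invertible; and every point of the half-space
    in \<open>N1\<close> is a value of the chart.\<close>
  define N'' where "N'' = (N \<inter> (\<lambda>z. g z - g (\<kappa> x)) -` {-pi<..<pi}) \<inter> N' \<inter> N1"
  have "open (N \<inter> (\<lambda>z. g z - g (\<kappa> x)) -` {-pi<..<pi})"
    using Cinf_on_open[OF g(1)] by (intro Cinf_on_vimage Cinf_on_diff g(1)) auto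
  then have N'': "open N''" "N'' \<subseteq> N'" using N' N1 by (auto simp: N''_def)
  let ?V = "{y\<in>U. \<kappa> y \<in> N''}"
  have im: "(\<lambda>y. G (\<kappa> y)) ` ?V = {z. 0 \<le> z \<bullet> (P u, 0)} \<inter> G ` N''"
  proof (intro subset_antisym subsetI)
    fix w assume "w \<in> {z. 0 \<le> z \<bullet> (P u, 0)} \<inter> G ` N''"
    then obtain z where z: "w = G z" "z \<in> N''" "0 \<le> G z \<bullet> (P u, 0)" by blast
    then have "0 \<le> z \<bullet> u" using P(2) by (simp add: G_def)
    then obtain y where "y \<in> U" "z = \<kappa> y" using N1(3)[of z] z by (auto simp: N''_def)
    then show "w \<in> (\<lambda>y. G (\<kappa> y)) ` ?V" using z by auto
  next
    fix w assume "w \<in> (\<lambda>y. G (\<kappa> y)) ` ?V"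
    then obtain y where "y \<in> U" "\<kappa> y \<in> N''" "w = G (\<kappa> y)" by blast
    then show "w \<in> {z. 0 \<le> z \<bullet> (P u, 0)} \<inter> G ` N''"
      using hchart_ge_0[OF \<kappa>] P(2) by (auto simp: G_def)
  qed
  have gc: "gchart M ?V (\<lambda>y. G (\<kappa> y))" using N'(6)[OF N''] by simp
  have "openin (top_of_set {z. 0 \<le> z \<bullet> (P u, 0)}) ((\<lambda>y. G (\<kappa> y)) ` ?V)"
    unfolding im using N'(6)[OF N''] by (intro openin_open_Int) simp
  then have hc: "hchart M ?V (\<lambda>y. G (\<kappa> y)) (P u, 0)" using gc by (simp add: hchart_def)
  have ang: "p y / p x \<notin> \<real>\<^sub>\<le>\<^sub>0 \<and> snd (G (\<kappa> y)) = Im (Ln (p y / p x))" if y: "y \<in> ?V" for y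
  proof -
    have "p y = p x * cis (g (\<kappa> y) - g (\<kappa> x))" using g(3) y by (auto simp: N''_def)
    moreover have "p x \<noteq> 0" using p by auto
    ultimately have py: "p y / p x = cis (g (\<kappa> y) - g (\<kappa> x))" by simp
    have "\<bar>g (\<kappa> y) - g (\<kappa> x)\<bar> < pi" using y by (auto simp: N''_def)
    then show ?thesis unfolding py using cis_close by (simp add: G_def)
  qed
  have "adapted_chart M p (p x) ?V (\<lambda>y. G (\<kappa> y)) (P u)"
    unfolding adapted_chart_def using hc ang by blast
  then show thesis using that[of ?V] x N'(2) N1(2) g(2) by (auto simp: N''_def)
qed

section \<open>Local triviality of submersions to the circle\<close>

text \<open>Continuity comes out of the argument: \<open>f\<close> sends a neighbourhood into one
  chart domain, and there its coordinate expression is continuous. The charts of the target may have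
  a model space of another type.\<close>

lemma smooth_mapI_gchart:
  assumes M: "premfd M" and N: "premfd N" and f: "\<And>x. x \<in> points M \<Longrightarrow>
      \<exists>V \<psi> A. gchart N V (\<psi> :: 'b \<Rightarrow> 'd::euclidean_space) \<and> openin (mtop M) A \<and> x \<in> A \<and> f ` A \<subseteq> V \<and> smooth_at M (\<lambda>y. \<psi> (f y)) x"
  shows "smooth_map M N f"
proof (rule smooth_mapI[OF M])
  have fN: "f x \<in> points N" if "x \<in> points M" for x
    using f[OF that] gchart_points by blast
  have nhd: "\<exists>A. openin (mtop M) A \<and> x \<in> A \<and> f ` A \<subseteq> T"
    if x: "x \<in> points M" and T: "openin (mtop N) T" "f x \<in> T" for x T
  proof -
    obtain V and \<psi> :: "'b \<Rightarrow> 'd" and A where A: "gchart N V \<psi>" "openin (mtop M) A" "x \<in> A" "f ` A \<subseteq> V"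
      "smooth_at M (\<lambda>y. \<psi> (f y)) x" using f[OF x] by blast
    obtain B where B: "open B" "\<psi> (f x) \<in> B" "\<And>y. y \<in> V \<Longrightarrow> \<psi> y \<in> B \<Longrightarrow> y \<in> T"
      using gchart_nhd[OF N A(1) T(1), of "f x"] A T by blast
    obtain C where C: "openin (mtop M) C" "x \<in> C" "\<And>y. y \<in> C \<Longrightarrow> \<psi> (f y) \<in> B"
      using smooth_at_continuous[OF M A(5) B(1,2)] by blast
    show ?thesis by (rule exI[of _ "A \<inter> C"]) (use A B C in auto)
  qed
  show "continuous_map (mtop M) (mtop N) f"
    unfolding continuous_map_def
  proof (intro conjI allI impI)
    show "f \<in> points M \<rightarrow> points N" using fN by blast
    fix T assume T: "openin (mtop N) T"
    show "openin (mtop M) {x \<in> points M. f x \<in> T}"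
    proof (subst openin_subopen, safe)
      fix x assume "x \<in> points M" "f x \<in> T"
      then obtain A where "openin (mtop M) A" "x \<in> A" "f ` A \<subseteq> T" using nhd T by blast
      then show "\<exists>A. openin (mtop M) A \<and> x \<in> A \<and> A \<subseteq> {x \<in> points M. f x \<in> T}"
        using openin_subset by blast
    qed
  qed
  fix x W \<phi> assume x: "x \<in> points M" and W: "(W, \<phi>) \<in> atlas N" "f x \<in> W"
  obtain V and \<psi> :: "'b \<Rightarrow> 'd" and A where A: "gchart N V \<psi>" "openin (mtop M) A" "x \<in> A" "f ` A \<subseteq> V"
    "smooth_at M (\<lambda>y. \<psi> (f y)) x" using f[OF x] by blast
  obtain B g where g: "\<psi> (f x) \<in> B" "Cinf_on g B" "\<And>y. y \<in> V \<Longrightarrow> \<psi> y \<in> B \<Longrightarrow> y \<in> W \<and> \<phi> y = g (\<psi> y)"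
    using gchart_transition[OF A(1) _ W] A by blast
  obtain C where C: "openin (mtop M) C" "x \<in> C" "\<And>y. y \<in> C \<Longrightarrow> \<psi> (f y) \<in> B"
    using smooth_at_continuous[OF M A(5) Cinf_on_open[OF g(2)] g(1)] by blast
  show "smooth_at M (\<lambda>y. \<phi> (f y)) x"
  proof (rule smooth_at_cong[OF M smooth_at_compose[OF A(5) g(2,1)]])
    show "openin (mtop M) (A \<inter> C)" using A C by blast
    show "g (\<psi> (f y)) = \<phi> (f y)" if "y \<in> A \<inter> C" for y
      using g(3)[of "f y"] A C that by auto
  qed (use A C in auto)
qed

lemma smooth_map_ident: "premfd M \<Longrightarrow> smooth_map M M (\<lambda>x. x)"
  by (rule smooth_mapI) (simp_all, rule smooth_at_atlas)

lemma smooth_map_const: "premfd M \<Longrightarrow> y \<in> points N \<Longrightarrow> smooth_map M N (\<lambda>x. y)"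
  by (rule smooth_mapI) (auto simp: smooth_at_const)

lemma smooth_map_from_open_submfd:
  assumes M: "premfd M" and A: "openin (mtop M) A" and f: "smooth_map M N f" and N: "premfd N"
  shows "smooth_map (open_submfd M A) N f"
proof (rule smooth_mapI[OF premfd_open_submfd[OF M A]])
  show "continuous_map (mtop (open_submfd M A)) (mtop N) f"
    using f by (simp add: smooth_map_def continuous_map_from_subtopology)
  fix x V \<psi> assume x: "x \<in> points (open_submfd M A)" "(V, \<psi>) \<in> atlas N" "f x \<in> V"
  then have "smooth_at M (\<lambda>x. \<psi> (f x)) x"
    by (intro smooth_map_smooth_at[OF M N f] smooth_at_atlas) simp_all
  then show "smooth_at (open_submfd M A) (\<lambda>x. \<psi> (f x)) x"
    using smooth_at_open_submfd[OF M A] x by auto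
qed

text \<open>The complement of \<open>W\<close> is compact, so its image is closed, and it misses
  \<open>c\<close>.\<close>

lemma compact_fiber_nhd:
  fixes f :: "'a \<Rightarrow> 'b::metric_space"
  assumes "compact_space X" "continuous_map X euclidean f" "openin X W" "\<And>x. x \<in> topspace X \<Longrightarrow> f x = c \<Longrightarrow> x \<in> W"
  obtains \<delta> where "\<delta> > 0" "\<And>x. x \<in> topspace X \<Longrightarrow> dist (f x) c < \<delta> \<Longrightarrow> x \<in> W"
proof -
  have "compactin X (topspace X - W)"
    using assms(1,3) by (intro closedin_compact_space) (auto simp: closedin_def)
  then have "compactin euclidean (f ` (topspace X - W))" by (rule image_compactin[OF _ assms(2)])
  then have "closed (f ` (topspace X - W))" by (simp add: compact_imp_closed)
  moreover have "c \<notin> f ` (topspace X - W)" using assms(4) by blast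
  ultimately obtain \<delta> where \<delta>: "\<delta> > 0" "ball c \<delta> \<subseteq> - f ` (topspace X - W)"
    using openE[of "- f ` (topspace X - W)" c] by (auto simp: open_Compl)
  have "x \<in> W" if "x \<in> topspace X" "dist (f x) c < \<delta>" for x
  proof (rule ccontr)
    assume "x \<notin> W"
    then have "f x \<in> f ` (topspace X - W)" using that by blast
    moreover have "f x \<in> ball c \<delta>" using that by (simp add: dist_commute)
    ultimately show False using \<delta> by blast
  qed
  then show thesis using that \<delta>(1) by blast
qed

text \<open>The hypotheses speak of the closed half-space only, but a chart needs to know that
  nothing from the other side is folded into it. Injectivity excludes this: a segment joining two
  image points in the open half-space, pulled back, would have to cross the hyperplane.\<close>

lemma halfspace_image:
  fixes G :: "'c::euclidean_space \<Rightarrow> 'c"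
  assumes N: "open N" "y0 \<in> N" and G: "continuous_on N G" "inj_on G N" and y0: "0 \<le> y0 \<bullet> w"
    and pos: "\<And>z. z \<in> N \<Longrightarrow> 0 < z \<bullet> w \<Longrightarrow> 0 < G z \<bullet> w"
    and zero: "\<And>z. z \<in> N \<Longrightarrow> z \<bullet> w = 0 \<Longrightarrow> G z \<bullet> w = 0"
  obtains N' where "open N'" "y0 \<in> N'" "N' \<subseteq> N" "\<And>z. z \<in> N' \<Longrightarrow> 0 \<le> G z \<bullet> w \<Longrightarrow> 0 \<le> z \<bullet> w"
proof -
  obtain g where hom: "homeomorphism N (G ` N) G g"
    using invariance_of_domain_homeomorphism[OF N(1) G(1) _ G(2)] by auto
  have opG: "open (G ` S)" if "open S" "S \<subseteq> N" for S
    using that invariance_of_domain[of S G] G by (meson continuous_on_subset inj_on_subset)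
  have "G y0 \<in> G ` N" using N by blast
  then obtain e where e: "e > 0" "ball (G y0) e \<subseteq> G ` N" using opG[OF N(1) order_refl] open_contains_ball by blast
  define N' where "N' = N \<inter> G -` ball (G y0) e"
  have N': "open N'" unfolding N'_def using G N by (intro continuous_open_preimage) auto
  have gG: "g (G z) = z" if "z \<in> N" for z using hom that by (simp add: homeomorphism_def)
  \<comment> \<open>First the case of a strictly positive image: the preimage of the segment from
    \<open>G z\<close> to \<open>G y1\<close> is connected and joins the two sides, so it meets the
    hyperplane, whose points have images on the hyperplane.\<close>
  have key: False if z: "z \<in> N'" "z \<bullet> w < 0" "0 < G z \<bullet> w" for z
  proof -
    have "w \<noteq> 0" using z by auto
    obtain y1 where y1: "y1 \<in> N'" "0 < y1 \<bullet> w"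
    proof -
      have "y0 \<in> N'" using N e by (simp add: N'_def)
      then obtain d where d: "d > 0" "ball y0 d \<subseteq> N'" using openE[OF N'] by blast
      let ?y = "y0 + (d / 2 / norm w) *\<^sub>R w"
      have "?y \<in> N'" using d \<open>w \<noteq> 0\<close> by (intro subsetD[OF d(2)]) (simp add: dist_norm)
      moreover have "0 < (d / 2 / norm w) * (w \<bullet> w)" using d \<open>w \<noteq> 0\<close> by simp
      ultimately show thesis using that[of ?y] y0 by (simp add: inner_add_left)
    qed
    let ?I = "closed_segment (G z) (G y1)"
    have "G y1 \<bullet> w > 0" using pos y1 by (auto simp: N'_def)
    then have I1: "?I \<subseteq> {x. 0 < x \<bullet> w}"
      using z convex_halfspace_gt[of 0 w] by (intro closed_segment_subset) (auto simp: inner_commute)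
    have I2: "?I \<subseteq> G ` N"
      using z y1 by (intro order_trans[OF closed_segment_subset e(2)]) (auto simp: N'_def)
    have "connected (g ` ?I)"
      using hom I2 by (intro connected_continuous_image) (auto simp: homeomorphism_def intro: continuous_on_subset)
    moreover have "z \<in> g ` ?I" "y1 \<in> g ` ?I"
      using gG[of z] gG[of y1] z y1 by (auto simp: N'_def image_iff intro: bexI[of _ "G z"] bexI[of _ "G y1"])
    moreover have "w \<bullet> z \<le> 0" "0 \<le> w \<bullet> y1" using z y1 by (simp_all add: inner_commute)
    ultimately have "\<exists>x\<in>g ` ?I. w \<bullet> x = 0" by (intro connected_ivt_hyperplane)
    then obtain x where x: "x \<in> g ` ?I" "x \<bullet> w = 0" unfolding inner_commute[of w] by blast
    then obtain v where v: "v \<in> ?I" "x = g v" by blast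
    then have "v \<in> G ` N" using I2 by blast
    then have "x \<in> N" "G x = v" using v hom by (auto simp: homeomorphism_def)
    then have "v \<bullet> w = 0" using zero x by auto
    then show False using I1 v by auto
  qed
  show thesis
  proof (rule that[OF N'])
    fix z assume z: "z \<in> N'" "0 \<le> G z \<bullet> w"
    show "0 \<le> z \<bullet> w"
    proof (rule ccontr)
      assume "\<not> 0 \<le> z \<bullet> w"
      then have neg: "z \<bullet> w < 0" by simp
      then have "w \<noteq> 0" by auto
      \<comment> \<open>An image on the hyperplane itself is reduced to the strict case:
        \<open>G\<close> is open, so moving \<open>G z\<close> a little in the direction
        \<open>w\<close> gives the image of another point of the negative side.\<close>
      have "open (N' \<inter> {x. x \<bullet> w < 0})" using N' by (intro open_Int open_Collect_less continuous_intros)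
      then have "open (G ` (N' \<inter> {x. x \<bullet> w < 0}))" by (rule opG) (auto simp: N'_def)
      moreover have "G z \<in> G ` (N' \<inter> {x. x \<bullet> w < 0})" using z neg by auto
      ultimately obtain d where d: "d > 0" "ball (G z) d \<subseteq> G ` (N' \<inter> {x. x \<bullet> w < 0})"
        using open_contains_ball by blast
      let ?v = "G z + (d / 2 / norm w) *\<^sub>R w"
      have "?v \<in> ball (G z) d" using d \<open>w \<noteq> 0\<close> by (simp add: dist_norm)
      then obtain z' where z': "z' \<in> N'" "z' \<bullet> w < 0" "?v = G z'" using d by blast
      have "0 < (d / 2 / norm w) * (w \<bullet> w)" using d \<open>w \<noteq> 0\<close> by simp
      then have "0 < G z' \<bullet> w" using z(2) z'(3)[symmetric] by (simp add: inner_add_left)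
      then show False using key z' by blast
    qed
  qed (use N e in \<open>auto simp: N'_def\<close>)
qed

text \<open>One-sided difference quotients determine the derivative on vectors pointing into the
  half-space. The negatives of these vectors follow by linearity, and together they are all
  vectors.\<close>

lemma derivative_eq_ident_halfspace:
  fixes G :: "'f::euclidean_space \<times> real \<Rightarrow> 'f"
  assumes G: "(G has_derivative D) (at (a, 0))" and a: "0 \<le> a \<bullet> u" and N: "open N" "(a, 0::real) \<in> N"
    and eq: "\<And>b. 0 \<le> b \<bullet> u \<Longrightarrow> (b, 0) \<in> N \<Longrightarrow> G (b, 0) = b"
  shows "D (h, 0) = h"
proof -
  have lin: "linear D" using G by (rule has_derivative_linear)
  have pos: "D (h, 0) = h" if h: "0 \<le> h \<bullet> u" for h
  proof -
    obtain e where e: "e > 0" "ball (a, 0) e \<subseteq> N" using N open_contains_ball by blast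
    \<comment> \<open>The summand 1 covers the case \<open>h = 0\<close>.\<close>
    define d where "d = e / (norm h + 1)"
    have d: "d > 0" using e by (simp add: d_def add_nonneg_pos)
    have inN: "(a + s *\<^sub>R h, 0) \<in> N" if "s \<in> {0..<d}" for s
    proof -
      have "s * norm h \<le> s * (norm h + 1)" using that by (intro mult_left_mono) auto
      also have "\<dots> < d * (norm h + 1)" using that by (intro mult_strict_right_mono) (auto simp: add_nonneg_pos)
      also have "\<dots> = e" by (simp add: d_def add_nonneg_pos less_imp_neq[symmetric])
      finally have "s * norm h < e" .
      then have "(a + s *\<^sub>R h, 0) \<in> ball (a, 0) e" using that by (simp add: dist_Pair_Pair dist_norm)
      then show ?thesis using e by blast
    qed
    have "((\<lambda>s. (a + s *\<^sub>R h, 0)) has_derivative (\<lambda>s. (s *\<^sub>R h, 0))) (at 0 within {0..d/2})"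
      by (auto intro!: derivative_eq_intros)
    then have "((\<lambda>s. G (a + s *\<^sub>R h, 0)) has_derivative (\<lambda>s. D (s *\<^sub>R h, 0))) (at 0 within {0..d/2})"
      by (rule has_derivative_compose) (use G in simp)
    moreover have "(\<lambda>s. D (s *\<^sub>R h, 0)) = (\<lambda>s. s *\<^sub>R D (h, 0))"
    proof
      fix s :: real
      have "(s *\<^sub>R h, 0) = s *\<^sub>R (h, 0 :: real)" by simp
      then show "D (s *\<^sub>R h, 0) = s *\<^sub>R D (h, 0)" using linear_scale[OF lin] by metis
    qed
    ultimately have "((\<lambda>s. G (a + s *\<^sub>R h, 0)) has_vector_derivative D (h, 0)) (at 0 within {0..d/2})"
      by (simp add: has_vector_derivative_def)
    then have 1: "((\<lambda>s. a + s *\<^sub>R h) has_vector_derivative D (h, 0)) (at 0 within {0..d/2})"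
    proof (rule has_vector_derivative_transform[rotated 2])
      show "a + s *\<^sub>R h = G (a + s *\<^sub>R h, 0)" if "s \<in> {0..d/2}" for s
        using eq[of "a + s *\<^sub>R h"] inN[of s] that d a h by (auto simp: inner_add_left)
    qed (use d in auto)
    have 2: "((\<lambda>s. a + s *\<^sub>R h) has_vector_derivative h) (at 0 within {0..d/2})"
      by (auto intro!: derivative_eq_intros)
    show ?thesis
      using vector_derivative_unique_within_closed_interval[of 0 "d/2" 0 "\<lambda>s. a + s *\<^sub>R h" "D (h, 0)" h] 1 2 d
      by (simp add: cbox_interval)
  qed
  show ?thesis
  proof (cases "0 \<le> h \<bullet> u")
    case False
    then have "D (- h, 0) = - h" by (intro pos) auto
    moreover have "(- h, 0) = - (h, 0 :: real)" by simp
    ultimately show ?thesis using linear_neg[OF lin] by (metis minus_equation_iff)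
  qed (rule pos)
qed

section \<open>Submersions to the circle and their level sets\<close>

text \<open>Being a submersion is encoded by the existence of adapted charts, so no tangent maps
  occur. \<open>Fib\<close> is a parameter with a defining equation because its type is what records
  the model space of the fibers.\<close>

locale circle_submersion =
  fixes M :: "('a, 'e::euclidean_space) mfd" and p :: "'a \<Rightarrow> complex" and Fib :: "complex \<Rightarrow> ('a, 'f::euclidean_space) mfd"
  assumes M_manifold: "smooth_manifold M" and compact: "compact_space (mtop M)"
    and p_smooth: "\<And>x. x \<in> points M \<Longrightarrow> smooth_at M p x" and p_norm: "\<And>x. x \<in> points M \<Longrightarrow> norm (p x) = 1"
    and dim: "DIM('f) + 1 = DIM('e)"
    and adapted: "\<And>x. x \<in> points M \<Longrightarrow> \<exists>U (\<kappa> :: 'a \<Rightarrow> 'f \<times> real) u. x \<in> U \<and> adapted_chart M p (p x) U \<kappa> u"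
    and Fib: "Fib = (\<lambda>c. \<lparr>mtop = subtopology (mtop M) {x\<in>points M. p x = c},
        atlas = {(U \<inter> {x\<in>points M. p x = c}, \<lambda>x. fst (\<kappa> x)) | U \<kappa> u. adapted_chart M p c U \<kappa> u}\<rparr>)"
begin

lemma M: "premfd M" by (rule smooth_manifold_imp_premfd[OF M_manifold])

abbreviation level :: "complex \<Rightarrow> 'a set" where "level c \<equiv> {x\<in>points M. p x = c}"

lemma mtop_Fib [simp]: "mtop (Fib c) = subtopology (mtop M) (level c)"
  by (simp add: Fib)

lemma points_Fib [simp]: "points (Fib c) = level c"
  by auto

lemma atlas_Fib: "(V, \<psi>) \<in> atlas (Fib c) \<longleftrightarrow>
    (\<exists>U \<kappa> u. V = U \<inter> level c \<and> \<psi> = (\<lambda>x. fst (\<kappa> x)) \<and> adapted_chart M p c U \<kappa> u)"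
  by (simp add: Fib)

lemma dim': "DIM('f \<times> real) = DIM('e)" using dim by simp

lemma adapted_gchart: "adapted_chart M p c U \<kappa> u \<Longrightarrow> gchart M U \<kappa>"
  and adapted_hchart: "adapted_chart M p c U \<kappa> u \<Longrightarrow> hchart M U \<kappa> (u, 0)"
  and adapted_snd: "adapted_chart M p c U \<kappa> u \<Longrightarrow> y \<in> U \<Longrightarrow> snd (\<kappa> y) = Im (Ln (p y / c))"
  and adapted_nonpos: "adapted_chart M p c U \<kappa> u \<Longrightarrow> y \<in> U \<Longrightarrow> p y / c \<notin> \<real>\<^sub>\<le>\<^sub>0"
  by (simp_all add: adapted_chart_def hchart_def)

lemma adapted_points: "adapted_chart M p c U \<kappa> u \<Longrightarrow> U \<subseteq> points M"
  using gchart_points[OF adapted_gchart] .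

lemma adapted_snd_0:
  assumes "norm c = 1" "adapted_chart M p c U \<kappa> u" "y \<in> U"
  shows "snd (\<kappa> y) = 0 \<longleftrightarrow> p y = c"
proof
  assume "p y = c"
  then show "snd (\<kappa> y) = 0" using adapted_snd[OF assms(2,3)] assms(1) by auto
next
  assume "snd (\<kappa> y) = 0"
  then have "cis (Im (Ln (p y / c))) = 1" using adapted_snd[OF assms(2,3)] by simp
  moreover have "norm (p y / c) = 1"
    using p_norm adapted_points[OF assms(2)] assms by (auto simp: norm_divide)
  ultimately have "p y / c = 1" using cis_Im_Ln by metis
  then show "p y = c" using assms(1) by auto
qed

lemma adapted_level: "norm c = 1 \<Longrightarrow> adapted_chart M p c U \<kappa> u \<Longrightarrow> y \<in> U \<inter> level c \<Longrightarrow> \<kappa> y = (fst (\<kappa> y), 0)"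
  using adapted_snd_0[of c U \<kappa> u y] by (cases "\<kappa> y") auto

lemma Cinf_slice: "Cinf_on (\<lambda>a::'f. (a, 0::real)) UNIV"
  by (rule Cinf_on_Pair) simp_all

lemma open_slice: "open N \<Longrightarrow> open ((\<lambda>a::'f. (a, 0::real)) -` N)"
  using Cinf_on_vimage[OF Cinf_slice] by simp

lemma smooth_at_Fib_restrict:
  assumes c: "norm c = 1" and f: "smooth_at M f x" and x: "p x = c"
  shows "smooth_at (Fib c) f x"
proof -
  have xM: "x \<in> points M" by (rule smooth_at_points[OF M f])
  obtain U \<kappa> u where U: "x \<in> U" "adapted_chart M p c U (\<kappa> :: 'a \<Rightarrow> 'f \<times> real) u" using adapted[OF xM] x by blast
  obtain N g where g: "\<kappa> x \<in> N" "Cinf_on g N" "\<And>y. y \<in> U \<Longrightarrow> \<kappa> y \<in> N \<Longrightarrow> f y = g (\<kappa> y)"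
    using smooth_at_gchart[OF f adapted_gchart[OF U(2)] U(1)] by blast
  have "Cinf_on (\<lambda>a. g (a, 0)) ((\<lambda>a::'f. (a, 0::real)) -` N)"
    by (intro Cinf_on_compose[OF Cinf_on_subset[OF Cinf_slice] g(2)] open_slice Cinf_on_open[OF g(2)]) auto
  then show ?thesis
  proof (rule smooth_atI[of "U \<inter> level c" "\<lambda>x. fst (\<kappa> x)", rotated 3])
    show "(U \<inter> level c, \<lambda>x. fst (\<kappa> x)) \<in> atlas (Fib c)" unfolding atlas_Fib using U by blast
    show "fst (\<kappa> x) \<in> (\<lambda>a. (a, 0)) -` N" using adapted_level[OF c U(2), of x] g(1) U xM x by simp
    show "f y = g (fst (\<kappa> y), 0)" if "y \<in> U \<inter> level c" "fst (\<kappa> y) \<in> (\<lambda>a. (a, 0)) -` N" for y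
      using adapted_level[OF c U(2) that(1)] that g(3)[of y] by auto
  qed (use U xM x in auto)
qed

lemma premfd_Fib:
  assumes c: "norm c = 1" shows "premfd (Fib c)"
proof (rule premfdI)
  show "\<Union>(fst ` atlas (Fib c)) = points (Fib c)"
  proof (intro subset_antisym subsetI)
    fix x assume "x \<in> \<Union>(fst ` atlas (Fib c))"
    then obtain V \<psi> where "(V, \<psi>) \<in> atlas (Fib c)" "x \<in> V" by force
    then show "x \<in> points (Fib c)" unfolding atlas_Fib points_Fib by blast
  next
    fix x assume "x \<in> points (Fib c)"
    then have x: "x \<in> level c" by simp
    then obtain U \<kappa> u where U: "x \<in> U" "adapted_chart M p c U (\<kappa> :: 'a \<Rightarrow> 'f \<times> real) u" using adapted[of x] by blast
    have "(U \<inter> level c, \<lambda>x. fst (\<kappa> x)) \<in> atlas (Fib c)" unfolding atlas_Fib using U by blast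
    then show "x \<in> \<Union>(fst ` atlas (Fib c))"
      using x U by (intro UN_I[of "(U \<inter> level c, \<lambda>x. fst (\<kappa> x))"]) auto
  qed
  fix V \<psi> assume V: "(V, \<psi>) \<in> atlas (Fib c)"
  then obtain U \<kappa> u where U: "V = U \<inter> level c" "\<psi> = (\<lambda>x. fst (\<kappa> x))" "adapted_chart M p c U \<kappa> u"
    unfolding atlas_Fib by blast
  note gc = adapted_gchart[OF U(3)]
  show pre: "openin (mtop (Fib c)) {y\<in>V. \<psi> y \<in> N}" if N: "open N" for N
  proof -
    have "openin (mtop M) {y\<in>U. fst (\<kappa> y) \<in> N}"
      by (rule smooth_at_openin_vimage[OF M gchart_openin[OF gc] smooth_at_fst[OF gchart_smooth_at[OF gc]] N])
    moreover have "{y\<in>V. \<psi> y \<in> N} = {y\<in>U. fst (\<kappa> y) \<in> N} \<inter> level c" using U by auto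
    ultimately show ?thesis by (auto simp: openin_subtopology)
  qed
  show "\<exists>N. open N \<and> \<psi> x \<in> N \<and> (\<forall>y\<in>V. \<psi> y \<in> N \<longrightarrow> y \<in> A)"
    if A: "openin (mtop (Fib c)) A" and x: "x \<in> A" "x \<in> V" for A x
  proof -
    obtain T where T: "openin (mtop M) T" "A = T \<inter> level c" using A by (auto simp: openin_subtopology)
    obtain N where N: "open N" "\<kappa> x \<in> N" "\<And>y. y \<in> U \<Longrightarrow> \<kappa> y \<in> N \<Longrightarrow> y \<in> T"
      using gchart_nhd[OF M gc T(1), of x] T x U by blast
    show ?thesis
    proof (rule exI[of _ "(\<lambda>a. (a, 0)) -` N"], intro conjI ballI impI)
      show "\<psi> x \<in> (\<lambda>a. (a, 0)) -` N" using adapted_level[OF c U(3), of x] x U N by simp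
      show "y \<in> A" if "y \<in> V" "\<psi> y \<in> (\<lambda>a. (a, 0)) -` N" for y
        using adapted_level[OF c U(3), of y] that U N T by auto
    qed (use open_slice N in auto)
  qed
  show "gchart (Fib c) V \<psi>"
  proof (rule gchartI)
    show "openin (mtop (Fib c)) V" using pre[of UNIV] by simp
    show "inj_on \<psi> V"
    proof (rule inj_onI)
      fix x y assume xy: "x \<in> V" "y \<in> V" "\<psi> x = \<psi> y"
      then have "\<kappa> x = \<kappa> y" using adapted_level[OF c U(3)] U(1,2) by metis
      then show "x = y" using gchart_inj[OF gc] xy U(1) by (auto dest: inj_onD)
    qed
    show "smooth_at (Fib c) \<psi> x" if "x \<in> V" for x by (rule smooth_at_atlas[OF V that])
    fix x V' \<psi>' assume x: "x \<in> V" and V': "(V', \<psi>') \<in> atlas (Fib c)" "x \<in> V'"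
    then obtain U' \<kappa>' u' where U': "V' = U' \<inter> level c" "\<psi>' = (\<lambda>x. fst (\<kappa>' x))" "adapted_chart M p c U' \<kappa>' u'"
      unfolding atlas_Fib by blast
    note gc' = adapted_gchart[OF U'(3)]
    obtain N g where g: "\<kappa> x \<in> N" "Cinf_on g N" "\<And>y. y \<in> U \<Longrightarrow> \<kappa> y \<in> N \<Longrightarrow> \<kappa>' y = g (\<kappa> y)"
      using smooth_at_gchart[OF gchart_smooth_at[OF gc'] gc, of x] x V' U U' by blast
    obtain N' where N': "open N'" "\<kappa> x \<in> N'" "\<And>y. y \<in> U \<Longrightarrow> \<kappa> y \<in> N' \<Longrightarrow> y \<in> U'"
      using gchart_nhd[OF M gc gchart_openin[OF gc'], of x] x V' U U' by blast
    let ?A = "(\<lambda>a. (a, 0)) -` (N \<inter> N')"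
    have "open (N \<inter> N')" using N' Cinf_on_open[OF g(2)] by blast
    then have "Cinf_on (\<lambda>a. fst (g (a, 0))) ?A"
      by (intro Cinf_on_bounded_linear_compose[OF bounded_linear_fst]
          Cinf_on_compose[OF Cinf_on_subset[OF Cinf_slice] g(2)] open_slice) auto
    moreover have "\<psi> x \<in> ?A" using adapted_level[OF c U(3), of x] x U N' g by simp
    moreover have "y \<in> V' \<and> \<psi>' y = fst (g (\<psi> y, 0))" if "y \<in> V" "\<psi> y \<in> ?A" for y
      using adapted_level[OF c U(3), of y] that U U' g(3)[of y] N'(3)[of y] by auto
    ultimately show "\<exists>N g. \<psi> x \<in> N \<and> Cinf_on g N \<and> (\<forall>y\<in>V. \<psi> y \<in> N \<longrightarrow> y \<in> V' \<and> \<psi>' y = g (\<psi> y))"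
      by (intro exI[of _ ?A] exI[of _ "\<lambda>a. fst (g (a, 0))"]) simp
  qed
qed

text \<open>The slice at angle zero of the half-space with vector \<open>(u, 0)\<close> is the
  half-space with vector \<open>u\<close>. Adapted charts thus restrict to half-space charts of the
  level set.\<close>

lemma smooth_manifold_Fib:
  assumes c: "norm c = 1" shows "smooth_manifold (Fib c)"
  unfolding smooth_manifold_def
proof (intro conjI ballI)
  show "Hausdorff_space (mtop (Fib c))" "second_countable (mtop (Fib c))"
    using M_manifold by (simp_all add: smooth_manifold_def Hausdorff_space_subtopology second_countable_subtopology)
  show "\<Union>(fst ` atlas (Fib c)) = points (Fib c)" by (rule premfd_cover[OF premfd_Fib[OF c]])
  fix ch assume ch: "ch \<in> atlas (Fib c)"
  show "smooth_chart (Fib c) ch"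
  proof (rule premfd_imp_smooth_charts[OF premfd_Fib[OF c] _ ch])
    fix V \<psi> assume "(V, \<psi>) \<in> atlas (Fib c)"
    then obtain U \<kappa> u where U: "V = U \<inter> level c" "\<psi> = (\<lambda>x. fst (\<kappa> x))" "adapted_chart M p c U \<kappa> u"
      unfolding atlas_Fib by blast
    obtain N where N: "open N" "\<kappa> ` U = {x. 0 \<le> x \<bullet> (u, 0)} \<inter> N"
      using adapted_hchart[OF U(3)] by (auto simp: hchart_def openin_open)
    have "\<psi> ` V = {a. 0 \<le> a \<bullet> u} \<inter> (\<lambda>a. (a, 0)) -` N"
    proof (intro subset_antisym subsetI)
      fix a assume "a \<in> \<psi> ` V"
      then obtain x where x: "x \<in> V" "a = fst (\<kappa> x)" using U by blast
      then have "\<kappa> x = (a, 0)" using adapted_level[OF c U(3)] U by auto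
      moreover have "\<kappa> x \<in> \<kappa> ` U" using x U by blast
      ultimately show "a \<in> {a. 0 \<le> a \<bullet> u} \<inter> (\<lambda>a. (a, 0)) -` N" using N by auto
    next
      fix a assume "a \<in> {a. 0 \<le> a \<bullet> u} \<inter> (\<lambda>a. (a, 0)) -` N"
      then have "(a, 0) \<in> \<kappa> ` U" using N by auto
      then obtain x where x: "x \<in> U" "\<kappa> x = (a, 0)" by (metis imageE)
      then have "p x = c" using adapted_snd_0[OF c U(3) x(1)] by simp
      then have "x \<in> V" using x U adapted_points[OF U(3)] by auto
      then show "a \<in> \<psi> ` V" using x U by (intro image_eqI[of _ _ x]) auto
    qed
    then show "\<exists>u. openin (top_of_set {x. 0 \<le> x \<bullet> u}) (\<psi> ` V)"
      using open_slice[OF N(1)] by (auto intro: openin_open_Int)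
  qed
qed

lemma smooth_map_into_Fib:
  assumes c: "norm c = 1" and K: "premfd K" and f: "smooth_map K M f" and "\<And>x. x \<in> points K \<Longrightarrow> p (f x) = c"
  shows "smooth_map K (Fib c) f"
proof (rule smooth_mapI[OF K])
  have fp: "f x \<in> points M" if "x \<in> points K" for x by (rule smooth_map_points[OF f that])
  show "continuous_map (mtop K) (mtop (Fib c)) f"
    using f fp assms(4) by (auto simp: smooth_map_def continuous_map_in_subtopology)
  fix x V \<psi> assume x: "x \<in> points K" "(V, \<psi>) \<in> atlas (Fib c)" "f x \<in> V"
  then obtain U \<kappa> u where U: "V = U \<inter> level c" "\<psi> = (\<lambda>x. fst (\<kappa> x))" "adapted_chart M p c U \<kappa> u"
    unfolding atlas_Fib by blast
  show "smooth_at K (\<lambda>x. \<psi> (f x)) x"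
    unfolding U(2) by (rule smooth_map_smooth_at[OF K M f x(1)])
      (use x U smooth_at_fst[OF gchart_smooth_at[OF adapted_gchart[OF U(3)]]] in auto)
qed

lemma smooth_map_Fib_incl:
  assumes c: "norm c = 1" shows "smooth_map (Fib c) M (\<lambda>x. x)"
proof (rule smooth_mapI[OF premfd_Fib[OF c]])
  show "continuous_map (mtop (Fib c)) (mtop M) (\<lambda>x. x)"
    using continuous_map_id_subt[of "mtop M" "level c"] by (simp add: id_def)
  fix x V \<psi> assume "x \<in> points (Fib c)" "(V, \<psi>) \<in> atlas M" "x \<in> V"
  then show "smooth_at (Fib c) \<psi> x" using smooth_at_Fib_restrict[OF c smooth_at_atlas] by auto
qed

section \<open>A smooth retraction onto one fiber\<close>

text \<open>The half-space condition does not involve the angle, so a chart can be cut down to a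
  product with a symmetric interval of angles. In such a chart a point may be moved towards angle
  zero without leaving the domain.\<close>

lemma box_chart:
  assumes x: "x \<in> points M"
  obtains U and \<kappa> :: "'a \<Rightarrow> 'f \<times> real" and u where "x \<in> U" "adapted_chart M p (p x) U \<kappa> u"
    "\<And>a t s. (a, t) \<in> \<kappa> ` U \<Longrightarrow> \<bar>s\<bar> \<le> \<bar>t\<bar> \<Longrightarrow> (a, s) \<in> \<kappa> ` U"
proof -
  obtain U and \<kappa> :: "'a \<Rightarrow> 'f \<times> real" and u where U: "x \<in> U" "adapted_chart M p (p x) U \<kappa> u"
    using adapted[OF x] by blast
  note hc = adapted_hchart[OF U(2)] and gc = adapted_gchart[OF U(2)]
  obtain N where N: "open N" "\<kappa> x \<in> N" "\<And>z. z \<in> N \<Longrightarrow> 0 \<le> z \<bullet> (u, 0) \<Longrightarrow> z \<in> \<kappa> ` U"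
    using hchart_image_nhd[OF hc U(1)] by blast
  have "snd (\<kappa> x) = 0" using adapted_snd_0[OF p_norm[OF x] U(2,1)] by simp
  then have "(fst (\<kappa> x), 0) \<in> N" using N(2) by (metis prod.collapse)
  then obtain A T where AT: "open A" "open T" "fst (\<kappa> x) \<in> A" "0 \<in> T" "A \<times> T \<subseteq> N"
    using open_prod_elim[OF N(1)] by (metis mem_Sigma_iff)
  obtain d where d: "d > 0" "ball 0 d \<subseteq> T" using openE[OF AT(2,4)] by blast
  define B where "B = A \<times> ball (0::real) d"
  have B: "open B" "\<kappa> x \<in> B" "B \<subseteq> N"
    using AT d \<open>snd (\<kappa> x) = 0\<close> by (auto simp: B_def open_Times mem_Times_iff)
  let ?V = "{y\<in>U. \<kappa> y \<in> B}"
  have opV: "openin (mtop M) ?V"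
    by (rule smooth_at_openin_vimage[OF M gchart_openin[OF gc] gchart_smooth_at[OF gc] B(1)])
  have "hchart M ?V \<kappa> (u, 0)" by (rule hchart_subset[OF M hc opV]) auto
  then have ad: "adapted_chart M p (p x) ?V \<kappa> u" using U(2) by (auto simp: adapted_chart_def)
  have "(a, s) \<in> \<kappa> ` ?V" if at: "(a, t) \<in> \<kappa> ` ?V" and st: "\<bar>s\<bar> \<le> \<bar>t\<bar>" for a t s
  proof -
    obtain x where "x \<in> U" "\<kappa> x \<in> B" "\<kappa> x = (a, t)" using at by (metis (mono_tags, lifting) imageE mem_Collect_eq)
    then have "(a, t) \<in> B" "0 \<le> a \<bullet> u" using hchart_ge_0[OF hc, of x] by auto
    then have "(a, s) \<in> B" "0 \<le> (a, s) \<bullet> (u, 0)" using st by (auto simp: B_def)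
    then have "(a, s) \<in> \<kappa> ` U" using N(3) B(3) by blast
    then obtain y where "y \<in> U" "\<kappa> y = (a, s)" by (metis imageE)
    then show ?thesis using \<open>(a, s) \<in> B\<close> by (intro image_eqI[of _ _ y]) auto
  qed
  then show thesis using that[of ?V \<kappa> u] ad U(1) B(2) by blast
qed

text \<open>Fixing the fiber pointwise determines the derivative in the fiber directions. The
  equivalence for boundary points is what later lets coordinates of \<open>R x\<close> respect a
  half-space.\<close>

definition fiber_fixing :: "complex \<Rightarrow> ('a \<Rightarrow> 'a) \<Rightarrow> bool" where
  "fiber_fixing c R \<longleftrightarrow> smooth_map M M R \<and> (\<forall>y\<in>level c. R y = y) \<and> (\<forall>y\<in>points M. R y \<in> bdry M \<longleftrightarrow> y \<in> bdry M)"

text \<open>Multiplying the angle coordinate by \<open>1 - b\<close>, where \<open>b\<close> is a bump function, pushes a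
  neighbourhood of a point of the fiber onto the fiber.\<close>

lemma local_push:
  assumes c: "norm c = 1" and y: "y \<in> level c"
  obtains R V where "fiber_fixing c R" "openin (mtop M) V" "y \<in> V" "\<And>x. x \<in> V \<Longrightarrow> p (R x) = c"
proof -
  have yM: "y \<in> points M" "p y = c" using y by auto
  obtain U and \<kappa> :: "'a \<Rightarrow> 'f \<times> real" and u where U: "y \<in> U" "adapted_chart M p c U \<kappa> u"
    "\<And>a t s. (a, t) \<in> \<kappa> ` U \<Longrightarrow> \<bar>s\<bar> \<le> \<bar>t\<bar> \<Longrightarrow> (a, s) \<in> \<kappa> ` U"
    using box_chart[OF yM(1)] yM(2) by blast
  note hc = adapted_hchart[OF U(2)] and gc = adapted_gchart[OF U(2)]
  have haus: "Hausdorff_space (mtop M)" using M_manifold by (simp add: smooth_manifold_def)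
  obtain b :: "'a \<Rightarrow> real" and C K where b: "\<And>x. x \<in> points M \<Longrightarrow> smooth_at M b x"
    "\<And>x. 0 \<le> b x" "\<And>x. b x \<le> 1" "openin (mtop M) C" "y \<in> C" "\<And>x. x \<in> C \<Longrightarrow> b x = 1"
    "closedin (mtop M) K" "K \<subseteq> U" "\<And>x. x \<notin> K \<Longrightarrow> b x = 0"
    using smooth_bump[OF M compact haus gchart_openin[OF gc] U(1)] by blast
  define m where "m x = (fst (\<kappa> x), (1 - b x) * snd (\<kappa> x))" for x
  define R where "R x = (if x \<in> U then inv_into U \<kappa> (m x) else x)" for x
  have mU: "m x \<in> \<kappa> ` U" if "x \<in> U" for x
    unfolding m_def
  proof (rule U(3))
    show "(fst (\<kappa> x), snd (\<kappa> x)) \<in> \<kappa> ` U" using that by simp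
    have "\<bar>(1 - b x) * snd (\<kappa> x)\<bar> = (1 - b x) * \<bar>snd (\<kappa> x)\<bar>" using b(3) by (simp add: abs_mult)
    also have "\<dots> \<le> 1 * \<bar>snd (\<kappa> x)\<bar>" using b(2) by (intro mult_right_mono) auto
    finally show "\<bar>(1 - b x) * snd (\<kappa> x)\<bar> \<le> \<bar>snd (\<kappa> x)\<bar>" by simp
  qed
  have RU: "R x \<in> U" "\<kappa> (R x) = m x" if "x \<in> U" for x
    using mU[OF that] that by (simp_all add: R_def inv_into_into f_inv_into_f)
  \<comment> \<open>Inside \<open>U\<close> but off \<open>K\<close> the bump function is zero, so
    the two clauses of \<open>R\<close> agree there and fit together smoothly.\<close>
  have RK: "R x = x" if "x \<notin> K" for x
    using b(9)[OF that] inv_into_f_f[OF gchart_inj[OF gc]] by (auto simp: R_def m_def)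
  have m_smooth: "smooth_at M m x" if "x \<in> U" for x
  proof -
    have xM: "x \<in> points M" using gchart_points[OF gc] that by blast
    have "smooth_at M (\<lambda>x. 1 + - b x) x"
      by (intro smooth_at_add[OF M] smooth_at_const[OF M xM] smooth_at_minus b(1)[OF xM])
    then have "smooth_at M (\<lambda>x. (1 + - b x) * snd (\<kappa> x)) x"
      by (intro smooth_at_mult[OF M] smooth_at_snd gchart_smooth_at[OF gc that])
    then show ?thesis unfolding m_def
      using smooth_at_Pair[OF M smooth_at_fst[OF gchart_smooth_at[OF gc that]]] by simp
  qed
  have smR: "smooth_map M M R"
  proof -
    have opU: "openin (mtop M) U" by (rule gchart_openin[OF gc])
    have opK: "openin (mtop M) (points M - K)" using b(7) by (simp add: closedin_def)
    have contR: "\<exists>A. openin (mtop M) A \<and> x \<in> A \<and> R ` A \<subseteq> T"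
      if x: "x \<in> points M" and T: "openin (mtop M) T" "R x \<in> T" for x T
    proof (cases "x \<in> U")
      case True
      obtain N where N: "open N" "\<kappa> (R x) \<in> N" "\<And>y. y \<in> U \<Longrightarrow> \<kappa> y \<in> N \<Longrightarrow> y \<in> T"
        using gchart_nhd[OF M gc T(1), of "R x"] T(2) RU(1)[OF True] by blast
      have "openin (mtop M) {y\<in>U. m y \<in> N}"
        by (rule smooth_at_openin_vimage[OF M opU m_smooth N(1)])
      then show ?thesis
        by (rule_tac exI[of _ "{y\<in>U. m y \<in> N}"]) (use True RU N in auto)
    next
      case False
      then have "x \<in> T \<inter> (points M - K)" using x T b(8) by (auto simp: R_def)
      then show ?thesis using T opK by (intro exI[of _ "T \<inter> (points M - K)"]) (auto simp: RK)
    qed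
    show ?thesis
    proof (rule smooth_mapI[OF M])
      show "continuous_map (mtop M) (mtop M) R"
        unfolding continuous_map_def
      proof (intro conjI allI impI)
        show "R \<in> points M \<rightarrow> points M"
          using RU(1) gchart_points[OF gc] by (auto simp: R_def) (metis RU(1) R_def subsetD)
        fix T assume T: "openin (mtop M) T"
        show "openin (mtop M) {x \<in> points M. R x \<in> T}"
        proof (subst openin_subopen, intro ballI)
          fix x assume "x \<in> {x \<in> points M. R x \<in> T}"
          then obtain A where A: "openin (mtop M) A" "x \<in> A" "R ` A \<subseteq> T" using contR[of x T] T by auto
          then have "A \<subseteq> {x \<in> points M. R x \<in> T}" using openin_subset[OF A(1)] by blast
          then show "\<exists>A. openin (mtop M) A \<and> x \<in> A \<and> A \<subseteq> {x \<in> points M. R x \<in> T}" using A by blast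
        qed
      qed
      fix x V \<psi> assume x: "x \<in> points M" and V: "(V, \<psi>) \<in> atlas M" "R x \<in> V"
      show "smooth_at M (\<lambda>x. \<psi> (R x)) x"
      proof (cases "x \<in> U")
        case True
        obtain N g where g: "\<kappa> (R x) \<in> N" "Cinf_on g N" "\<And>y. y \<in> U \<Longrightarrow> \<kappa> y \<in> N \<Longrightarrow> y \<in> V \<and> \<psi> y = g (\<kappa> y)"
          using gchart_transition[OF gc RU(1)[OF True] V] by blast
        have mx: "m x \<in> N" using g(1) RU(2)[OF True] by simp
        show ?thesis
        proof (rule smooth_at_cong[OF M smooth_at_compose[OF m_smooth[OF True] g(2) mx]])
          show "openin (mtop M) {y\<in>U. m y \<in> N}"
            by (rule smooth_at_openin_vimage[OF M opU m_smooth Cinf_on_open[OF g(2)]])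
          show "g (m y) = \<psi> (R y)" if "y \<in> {y\<in>U. m y \<in> N}" for y
            using g(3)[of "R y"] RU[of y] that by auto
        qed (use mx True in auto)
      next
        case False
        then have xK: "x \<in> points M - K" "R x = x" using x b(8) by (auto simp: R_def)
        show ?thesis
          by (rule smooth_at_cong[OF M smooth_at_atlas[OF V(1)] opK xK(1)]) (use V xK RK in auto)
      qed
    qed
  qed
  have fixes_level: "R x = x" if x: "x \<in> level c" for x
  proof (cases "x \<in> U")
    case True
    then have "m x = \<kappa> x" using adapted_level[OF c U(2), of x] x by (simp add: m_def prod_eq_iff)
    then show ?thesis using True inv_into_f_f[OF gchart_inj[OF gc] True] by (simp add: R_def)
  qed (simp add: R_def)
  have bd: "R x \<in> bdry M \<longleftrightarrow> x \<in> bdry M" if x: "x \<in> points M" for x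
  proof (cases "x \<in> U")
    case True
    show ?thesis
      using hchart_bdry_iff[OF M hc RU(1)[OF True] dim'] hchart_bdry_iff[OF M hc True dim'] RU(2)[OF True]
      by (cases "\<kappa> x") (simp add: m_def)
  qed (simp add: R_def)
  have "p (R x) = c" if "x \<in> U \<inter> C" for x
  proof -
    have "snd (\<kappa> (R x)) = 0" using RU(2) b(6) that by (simp add: m_def)
    then show ?thesis using adapted_snd_0[OF c U(2) RU(1)] that by blast
  qed
  moreover have "openin (mtop M) (U \<inter> C)" using gchart_openin[OF gc] b(4) by blast
  moreover have "fiber_fixing c R" using smR fixes_level bd by (simp add: fiber_fixing_def)
  ultimately show thesis using that[of R "U \<inter> C"] U(1) b(5) by blast
qed

lemma fiber_fixing_compose: "fiber_fixing c R \<Longrightarrow> fiber_fixing c R' \<Longrightarrow> fiber_fixing c (\<lambda>x. R (R' x))"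
  using smooth_map_compose[OF M M M, of R' R] smooth_map_points[of M M R'] by (simp add: fiber_fixing_def)

lemma fiber_fixing_foldr:
  assumes "\<And>R. R \<in> set Rs \<Longrightarrow> fiber_fixing c R" shows "fiber_fixing c (foldr (\<lambda>R f x. R (f x)) Rs (\<lambda>x. x))"
  using assms
proof (induction Rs)
  case Nil
  then show ?case by (simp add: fiber_fixing_def smooth_map_ident[OF M])
next
  case (Cons R Rs)
  then show ?case using fiber_fixing_compose[of c R] by simp
qed

text \<open>The pushes applied before \<open>R\<close> fix \<open>y\<close>, so they still send a
  neighbourhood of \<open>y\<close> into \<open>V\<close>; those applied after \<open>R\<close>
  leave its values alone, since they fix the fiber pointwise.\<close>

lemma fiber_fixing_foldr_onto:
  assumes "\<And>R. R \<in> set Rs \<Longrightarrow> fiber_fixing c R" and y: "y \<in> level c"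
    and "R \<in> set Rs" "openin (mtop M) V" "y \<in> V" "\<And>x. x \<in> V \<Longrightarrow> p (R x) = c"
  shows "\<exists>A. openin (mtop M) A \<and> y \<in> A \<and> (\<forall>x\<in>A. p (foldr (\<lambda>R f x. R (f x)) Rs (\<lambda>x. x) x) = c)"
  using assms(1,3)
proof (induction Rs)
  case (Cons R' Rs)
  let ?f = "foldr (\<lambda>R f x. R (f x)) Rs (\<lambda>x. x)"
  have f: "fiber_fixing c ?f" using Cons.prems by (intro fiber_fixing_foldr) auto
  have R': "fiber_fixing c R'" using Cons.prems by simp
  have fM: "?f x \<in> points M" if "x \<in> points M" for x
    using f smooth_map_points[of M M ?f x] that by (simp add: fiber_fixing_def)
  show ?case
  proof (cases "R = R'")
    case True
    have "openin (mtop M) {x \<in> points M. ?f x \<in> V}"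
      using f assms(4) by (auto simp: fiber_fixing_def smooth_map_def continuous_map_def)
    moreover have "?f y = y" using f y by (simp add: fiber_fixing_def)
    ultimately show ?thesis using y assms(5,6) True
      by (intro exI[of _ "{x \<in> points M. ?f x \<in> V}"]) auto
  next
    case False
    then obtain A where A: "openin (mtop M) A" "y \<in> A" "\<forall>x\<in>A. p (?f x) = c" using Cons by auto
    have "R' (?f x) = ?f x" if "x \<in> A" for x
    proof -
      have "?f x \<in> level c" using A that fM openin_subset[OF A(1)] by auto
      then show ?thesis using R' by (simp add: fiber_fixing_def)
    qed
    then show ?thesis using A by (intro exI[of _ A]) auto
  qed
qed simp

text \<open>By compactness finitely many local pushes cover the fiber. Their composition is defined
  and smooth on all of \<open>M\<close>, but takes values in the fiber only on the neighbourhood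
  \<Omega>.\<close>

lemma fiber_retraction:
  assumes c: "norm c = 1"
  obtains r \<Omega> where "fiber_fixing c r" "openin (mtop M) \<Omega>" "level c \<subseteq> \<Omega>" "\<And>x. x \<in> \<Omega> \<Longrightarrow> p (r x) = c"
proof -
  have "\<forall>y\<in>level c. \<exists>t. fiber_fixing c (fst t) \<and> openin (mtop M) (snd t) \<and> y \<in> snd t \<and> (\<forall>x\<in>snd t. p (fst t x) = c)"
  proof
    fix y assume y: "y \<in> level c"
    obtain R V where "fiber_fixing c R" "openin (mtop M) V" "y \<in> V" "\<And>x. x \<in> V \<Longrightarrow> p (R x) = c"
      using local_push[OF c y] by blast
    then show "\<exists>t. fiber_fixing c (fst t) \<and> openin (mtop M) (snd t) \<and> y \<in> snd t \<and> (\<forall>x\<in>snd t. p (fst t x) = c)"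
      by (intro exI[of _ "(R, V)"]) simp
  qed
  from bchoice[OF this] obtain t where t: "\<And>y. y \<in> level c \<Longrightarrow> fiber_fixing c (fst (t y))"
    "\<And>y. y \<in> level c \<Longrightarrow> openin (mtop M) (snd (t y)) \<and> y \<in> snd (t y)"
    "\<And>y x. y \<in> level c \<Longrightarrow> x \<in> snd (t y) \<Longrightarrow> p (fst (t y) x) = c" by auto
  have "closedin (mtop M) (level c)"
    using closedin_continuous_map_preimage[OF smooth_at_continuous_map[OF M p_smooth], of "{c}"] by simp
  then have "compactin (mtop M) (level c)" by (rule closedin_compact_space[OF compact])
  moreover have "level c \<subseteq> \<Union>((\<lambda>y. snd (t y)) ` level c)" using t(2) by blast
  ultimately obtain F where F: "finite F" "F \<subseteq> (\<lambda>y. snd (t y)) ` level c" "level c \<subseteq> \<Union>F"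
    using compactinD[of "mtop M" "level c" "(\<lambda>y. snd (t y)) ` level c"] t(2) by auto
  obtain S where S: "finite S" "S \<subseteq> level c" "F = (\<lambda>y. snd (t y)) ` S"
    using finite_subset_image[OF F(1,2)] by blast
  obtain ys where ys: "set ys = S" using finite_list[OF S(1)] by blast
  define Rs where "Rs = map (\<lambda>y. fst (t y)) ys"
  define r where "r = foldr (\<lambda>R f x. R (f x)) Rs (\<lambda>x. x)"
  have Rs: "fiber_fixing c R" if "R \<in> set Rs" for R using that t(1) S ys by (auto simp: Rs_def)
  have "\<exists>A. openin (mtop M) A \<and> y \<in> A \<and> (\<forall>x\<in>A. p (r x) = c)" if y: "y \<in> level c" for y
  proof -
    obtain s where s: "s \<in> S" "y \<in> snd (t s)" using F(3) S(3) y by blast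
    have sl: "s \<in> level c" using s S by blast
    show ?thesis unfolding r_def
    proof (rule fiber_fixing_foldr_onto[OF Rs y])
      show "fst (t s) \<in> set Rs" using s ys by (auto simp: Rs_def)
      show "openin (mtop M) (snd (t s))" using t(2)[OF sl] by blast
      show "y \<in> snd (t s)" by (rule s)
      show "p (fst (t s) x) = c" if "x \<in> snd (t s)" for x by (rule t(3)[OF sl that])
    qed
  qed
  then obtain A where A: "\<And>y. y \<in> level c \<Longrightarrow> openin (mtop M) (A y) \<and> y \<in> A y \<and> (\<forall>x\<in>A y. p (r x) = c)"
    by metis
  show thesis
  proof (rule that[of r "\<Union>(A ` level c)"])
    show "fiber_fixing c r" unfolding r_def by (rule fiber_fixing_foldr[OF Rs])
    show "openin (mtop M) (\<Union>(A ` level c))" using A by (intro openin_Union) blast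
  qed (use A in blast)+
qed

text \<open>Replace the fiber coordinates of \<open>x\<close> by those of \<open>r x\<close> and
  keep the angle. At a point of the fiber the new derivative is the identity in the fiber
  directions, hence injective. The delicate case is a boundary point, where both the derivative and
  the image are known from one side only.\<close>

lemma retraction_chart:
  assumes c: "norm c = 1" and r: "fiber_fixing c r" and \<Omega>: "openin (mtop M) \<Omega>" and y: "y \<in> level c" "y \<in> \<Omega>"
  obtains U and \<kappa> :: "'a \<Rightarrow> 'f \<times> real" and u O' where "adapted_chart M p c U \<kappa> u" "y \<in> O'" "O' \<subseteq> U \<inter> \<Omega>" "r ` O' \<subseteq> U"
    "hchart M O' (\<lambda>x. (fst (\<kappa> (r x)), Im (Ln (p x / c)))) (u, 0)"
proof -
  have yM: "y \<in> points M" "p y = c" using y by auto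
  have ry: "r y = y" using r y by (auto simp: fiber_fixing_def)
  have smr: "smooth_map M M r" using r by (simp add: fiber_fixing_def)
  obtain U and \<kappa> :: "'a \<Rightarrow> 'f \<times> real" and u where U: "y \<in> U" "adapted_chart M p c U \<kappa> u"
    using adapted[OF yM(1)] yM(2) by blast
  note hc = adapted_hchart[OF U(2)] and gc = adapted_gchart[OF U(2)]
  let ?A0 = "U \<inter> \<Omega> \<inter> {x\<in>points M. r x \<in> U}"
  have A0: "openin (mtop M) ?A0"
    using smr gchart_openin[OF gc] \<Omega> by (auto simp: smooth_map_def continuous_map_def)
  have yA0: "y \<in> ?A0" using y ry U yM by auto
  have hc0: "hchart M ?A0 \<kappa> (u, 0)" by (rule hchart_subset[OF M hc A0]) auto
  note gc0 = hchart_gchart[OF hc0]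
  obtain N0 where N0: "open N0" "\<kappa> y \<in> N0" "\<And>z. z \<in> N0 \<Longrightarrow> 0 \<le> z \<bullet> (u, 0) \<Longrightarrow> z \<in> \<kappa> ` ?A0"
    using hchart_image_nhd[OF hc0 yA0] by blast
  have "smooth_at M (\<lambda>x. fst (\<kappa> (r x))) y"
    by (rule smooth_map_smooth_at[OF M M smr yM(1)]) (simp add: ry smooth_at_fst[OF gchart_smooth_at[OF gc U(1)]])
  then obtain N1 g where g: "\<kappa> y \<in> N1" "Cinf_on g N1"
    "\<And>x. x \<in> ?A0 \<Longrightarrow> \<kappa> x \<in> N1 \<Longrightarrow> fst (\<kappa> (r x)) = g (\<kappa> x)"
    using smooth_at_gchart[OF _ gc0 yA0, of "\<lambda>x. fst (\<kappa> (r x))"] by auto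
  define a0 where "a0 = fst (\<kappa> y)"
  have ky: "\<kappa> y = (a0, 0)" unfolding a0_def using adapted_level[OF c U(2), of y] y U by auto
  define N where "N = N0 \<inter> N1"
  have N: "open N" "\<kappa> y \<in> N" using N0 g Cinf_on_open[OF g(2)] by (auto simp: N_def)
  define G where "G z = (g z, snd z)" for z
  have g_N: "Cinf_on g N" by (rule Cinf_on_subset[OF g(2)]) (use N in \<open>auto simp: N_def\<close>)
  have G: "Cinf_on G N" unfolding G_def
    by (intro Cinf_on_Pair g_N Cinf_on_bounded_linear[OF bounded_linear_snd] N)
  define D where "D = frechet_derivative g (at (\<kappa> y))"
  have gD: "(g has_derivative D) (at (\<kappa> y))" unfolding D_def by (rule Cinf_on_has_derivative[OF g_N N(2)])
  \<comment> \<open>As \<open>r\<close> fixes the fiber, \<open>g (b, 0) = b\<close> wherever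
    \<open>(b, 0)\<close> is a chart value; at a boundary point such values fill only half of a
    neighbourhood.\<close>
  have Dh: "D (h, 0) = h" for h
  proof (rule derivative_eq_ident_halfspace[of g D a0 u N h])
    show "(g has_derivative D) (at (a0, 0))" using gD by (simp add: ky)
    show "0 \<le> a0 \<bullet> u" using hchart_ge_0[OF hc U(1)] by (simp add: ky)
    show "(a0, 0) \<in> N" using N(2) by (simp add: ky)
    fix b assume b: "0 \<le> b \<bullet> u" "(b, 0) \<in> N"
    then obtain x where x: "x \<in> ?A0" "\<kappa> x = (b, 0)" using N0(3)[of "(b, 0)"] by (auto simp: N_def)
    then have "p x = c" using adapted_snd_0[OF c U(2), of x] by auto
    then have "r x = x" using r x by (auto simp: fiber_fixing_def)
    then show "g (b, 0) = b" using g(3)[OF x(1)] x b by (simp add: N_def)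
  qed (rule N)
  have linD: "linear D" by (rule has_derivative_linear[OF gD])
  have "(G has_derivative (\<lambda>h. (D h, snd h))) (at (\<kappa> y))"
    unfolding G_def by (intro has_derivative_Pair gD bounded_linear_imp_has_derivative bounded_linear_snd)
  then have fd: "frechet_derivative G (at (\<kappa> y)) = (\<lambda>h. (D h, snd h))"
    by (rule frechet_derivative_at[symmetric])
  have inj: "inj (frechet_derivative G (at (\<kappa> y)))"
  proof -
    have "linear (\<lambda>h. (D h, snd h))" using linD by (intro linearI) (auto simp: linear_add linear_scale)
    moreover have "h = 0" if "(D h, snd h) = 0" for h
    proof -
      have "snd h = 0" "D h = 0" using that by (simp_all add: zero_prod_def)
      then have "h = (fst h, 0)" "D (fst h, 0) = 0" by (simp_all add: prod_eq_iff) (metis prod.collapse)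
      then show ?thesis using Dh by (metis zero_prod_def)
    qed
    ultimately show ?thesis unfolding fd by (metis (no_types, lifting) linear_injective_0)
  qed
  obtain N2 where N2: "open N2" "\<kappa> y \<in> N2" "N2 \<subseteq> N" "inj_on G N2" "open (G ` N2)"
    "\<And>N'' . open N'' \<Longrightarrow> N'' \<subseteq> N2 \<Longrightarrow> open (G ` N'') \<and> gchart M {x\<in>?A0. \<kappa> x \<in> N''} (\<lambda>x. G (\<kappa> x))"
    using gchart_inverse_function[OF M gc0 yA0 N(2) G inj refl] by blast
  let ?w = "(u, 0::real)"
  have Gk: "G (\<kappa> x) = (fst (\<kappa> (r x)), snd (\<kappa> x))" if "x \<in> ?A0" "\<kappa> x \<in> N" for x
    using g(3)[OF that(1)] that(2) by (simp add: G_def N_def)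
  have Gw: "G (\<kappa> x) \<bullet> ?w = \<kappa> (r x) \<bullet> ?w" if "x \<in> ?A0" "\<kappa> x \<in> N" for x
    using Gk[OF that] by (cases "\<kappa> (r x)") simp
  have Gge: "0 \<le> G (\<kappa> x) \<bullet> ?w" if "x \<in> ?A0" "\<kappa> x \<in> N" for x
    using Gw[OF that] hchart_ge_0[OF hc, of "r x"] that by simp
  \<comment> \<open>For \<open>u\<close> nonzero, a vanishing half-space coordinate means lying on
    the boundary, and \<open>r\<close> preserves the boundary in both directions.\<close>
  have Gzero: "G (\<kappa> x) \<bullet> ?w = 0 \<longleftrightarrow> \<kappa> x \<bullet> ?w = 0" if x: "x \<in> ?A0" "\<kappa> x \<in> N" for x
  proof (cases "u = 0")
    case False
    then have "\<kappa> (r x) \<bullet> ?w = 0 \<longleftrightarrow> r x \<in> bdry M" "\<kappa> x \<bullet> ?w = 0 \<longleftrightarrow> x \<in> bdry M"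
      using hchart_bdry_iff[OF M hc _ dim', of "r x"] hchart_bdry_iff[OF M hc _ dim', of x] x
      by (auto simp: zero_prod_def)
    moreover have "r x \<in> bdry M \<longleftrightarrow> x \<in> bdry M" using r x by (auto simp: fiber_fixing_def)
    ultimately show ?thesis using Gw[OF x] by simp
  qed (simp flip: zero_prod_def)
  have preim: "\<exists>x. x \<in> ?A0 \<and> z = \<kappa> x" if "z \<in> N" "0 \<le> z \<bullet> ?w" for z
    using N0(3)[of z] that by (auto simp: N_def)
  obtain N3 where N3: "open N3" "\<kappa> y \<in> N3" "N3 \<subseteq> N2" "\<And>z. z \<in> N3 \<Longrightarrow> 0 \<le> G z \<bullet> ?w \<Longrightarrow> 0 \<le> z \<bullet> ?w"
  proof (rule halfspace_image[of N2 "\<kappa> y" G ?w])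
    show "continuous_on N2 G" by (rule continuous_on_subset[OF Cinf_on_continuous[OF G] N2(3)])
    show "0 \<le> \<kappa> y \<bullet> ?w" by (rule hchart_ge_0[OF hc U(1)])
    show "0 < G z \<bullet> ?w" if z: "z \<in> N2" "0 < z \<bullet> ?w" for z
    proof -
      obtain x where x: "x \<in> ?A0" "z = \<kappa> x" using preim[of z] z N2(3) by auto
      then show ?thesis using Gge[of x] Gzero[of x] z N2(3) by force
    qed
    show "G z \<bullet> ?w = 0" if z: "z \<in> N2" "z \<bullet> ?w = 0" for z
    proof -
      obtain x where x: "x \<in> ?A0" "z = \<kappa> x" using preim[of z] z N2(3) by auto
      then show ?thesis using Gzero[of x] z N2(3) by force
    qed
  qed (use N2 in auto)
  let ?O = "{x\<in>?A0. \<kappa> x \<in> N3}"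
  have gcO: "gchart M ?O (\<lambda>x. G (\<kappa> x))" and opG: "open (G ` N3)" using N2(6)[OF N3(1,3)] by auto
  have im: "(\<lambda>x. G (\<kappa> x)) ` ?O = {z. 0 \<le> z \<bullet> ?w} \<inter> G ` N3"
  proof (intro subset_antisym subsetI)
    fix v assume "v \<in> (\<lambda>x. G (\<kappa> x)) ` ?O"
    then obtain x where "x \<in> ?A0" "\<kappa> x \<in> N3" "v = G (\<kappa> x)" by blast
    then show "v \<in> {z. 0 \<le> z \<bullet> ?w} \<inter> G ` N3" using Gge[of x] N3(3) N2(3) by blast
  next
    fix v assume "v \<in> {z. 0 \<le> z \<bullet> ?w} \<inter> G ` N3"
    then obtain z where z: "z \<in> N3" "v = G z" "0 \<le> z \<bullet> ?w" using N3(4) by blast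
    then obtain x where "x \<in> ?A0" "z = \<kappa> x" using preim[of z] N3(3) N2(3) by blast
    then show "v \<in> (\<lambda>x. G (\<kappa> x)) ` ?O" using z by blast
  qed
  have eq: "G (\<kappa> x) = (fst (\<kappa> (r x)), Im (Ln (p x / c)))" if "x \<in> ?O" for x
    using Gk[of x] adapted_snd[OF U(2), of x] that N3(3) N2(3) by auto
  have hcO: "hchart M ?O (\<lambda>x. G (\<kappa> x)) ?w"
    unfolding hchart_def im using gcO opG by (auto intro: openin_open_Int)
  show thesis
  proof (rule that[OF U(2)])
    have opO: "openin (mtop M) ?O" by (rule gchart_openin[OF gcO])
    show "hchart M ?O (\<lambda>x. (fst (\<kappa> (r x)), Im (Ln (p x / c)))) ?w"
      unfolding hchart_def
    proof
      have "(\<lambda>x. (fst (\<kappa> (r x)), Im (Ln (p x / c)))) ` ?O = (\<lambda>x. G (\<kappa> x)) ` ?O"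
        using eq by (intro image_cong) auto
      then show "openin (top_of_set {x. 0 \<le> x \<bullet> ?w}) ((\<lambda>x. (fst (\<kappa> (r x)), Im (Ln (p x / c)))) ` ?O)"
        using hcO by (simp add: hchart_def)
      show "gchart M ?O (\<lambda>x. (fst (\<kappa> (r x)), Im (Ln (p x / c))))"
      proof (rule gchartI[OF opO])
        show "inj_on (\<lambda>x. (fst (\<kappa> (r x)), Im (Ln (p x / c)))) ?O"
          using gchart_inj[OF gcO] by (rule inj_on_cong[THEN iffD1, rotated]) (rule eq)
        show "smooth_at M (\<lambda>x. (fst (\<kappa> (r x)), Im (Ln (p x / c)))) x" if "x \<in> ?O" for x
          by (rule smooth_at_cong[OF M gchart_smooth_at[OF gcO that] opO that]) (rule eq)
        fix x V \<psi> assume x: "x \<in> ?O" and V: "(V, \<psi>) \<in> atlas M" "x \<in> V"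
        obtain N g where ng: "G (\<kappa> x) \<in> N" "Cinf_on g N" "\<And>z. z \<in> ?O \<Longrightarrow> G (\<kappa> z) \<in> N \<Longrightarrow> z \<in> V \<and> \<psi> z = g (G (\<kappa> z))"
          using gchart_transition[OF gcO x V] by blast
        have "(fst (\<kappa> (r x)), Im (Ln (p x / c))) \<in> N" using ng(1) eq[OF x] by simp
        moreover have "z \<in> V \<and> \<psi> z = g (fst (\<kappa> (r z)), Im (Ln (p z / c)))"
          if "z \<in> ?O" "(fst (\<kappa> (r z)), Im (Ln (p z / c))) \<in> N" for z
          using ng(3)[OF that(1)] eq[OF that(1)] that(2) by simp
        ultimately show "\<exists>N g. (fst (\<kappa> (r x)), Im (Ln (p x / c))) \<in> N \<and> Cinf_on g N \<and>
           (\<forall>z\<in>?O. (fst (\<kappa> (r z)), Im (Ln (p z / c))) \<in> N \<longrightarrow> z \<in> V \<and> \<psi> z = g (fst (\<kappa> (r z)), Im (Ln (p z / c))))"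
          using ng(2) by (intro exI[of _ N] exI[of _ g]) simp
      qed
    qed
    show "y \<in> ?O" using yA0 N3 by simp
  qed auto
qed

end

section \<open>Product structure over a short arc\<close>

lemma norm_cis_minus_1: "norm (cis t - 1) \<le> \<bar>t\<bar>"
proof -
  have "(norm (cis t - 1))\<^sup>2 = (cos t - 1)\<^sup>2 + (sin t)\<^sup>2" by (simp add: cmod_power2)
  also have "\<dots> = 2 - 2 * cos t" using sin_cos_squared_add[of t] by (simp add: power2_eq_square algebra_simps)
  also have "\<dots> = (2 * \<bar>sin (t / 2)\<bar>)\<^sup>2" using cos_double_sin[of "t / 2"] by (simp add: power_mult_distrib)
  finally have "norm (cis t - 1) = 2 * \<bar>sin (t / 2)\<bar>" by (rule power2_eq_imp_eq) simp_all
  also have "\<dots> \<le> \<bar>t\<bar>" using abs_sin_x_le_abs_x[of "t / 2"] by simp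
  finally show ?thesis .
qed

lemma eq_if_Im_Ln_eq:
  assumes "norm z = 1" "norm w = 1" "norm c = 1" "Im (Ln (z / c)) = Im (Ln (w / c))" shows "z = w"
proof -
  have "z / c = w / c"
    using cis_Im_Ln[of "z / c"] cis_Im_Ln[of "w / c"] assms by (metis norm_divide div_by_1)
  then show ?thesis using assms(3) by auto
qed

lemma dist_le_Im_Ln:
  assumes "norm z = 1" "norm c = 1" shows "dist z c \<le> \<bar>Im (Ln (z / c))\<bar>"
proof -
  have nz: "c \<noteq> 0" using assms by auto
  have "dist z c = norm (c * (z / c - 1))" using nz by (simp add: dist_norm right_diff_distrib)
  also have "\<dots> = norm (z / c - 1)" using assms by (simp add: norm_mult)
  also have "\<dots> = norm (cis (Im (Ln (z / c))) - 1)" using cis_Im_Ln[of "z / c"] assms by (simp add: norm_divide)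
  also have "\<dots> \<le> \<bar>Im (Ln (z / c))\<bar>" by (rule norm_cis_minus_1)
  finally show ?thesis .
qed

lemma diffeomorphismI:
  assumes "smooth_map M N f" "smooth_map N M g" "\<And>x. x \<in> points M \<Longrightarrow> g (f x) = x" "\<And>y. y \<in> points N \<Longrightarrow> f (g y) = y"
  shows "diffeomorphism M N f"
  using assms unfolding diffeomorphism_def by blast

lemma diffeomorphismE:
  assumes "diffeomorphism M N f"
  obtains g where "smooth_map M N f" "smooth_map N M g" "\<And>x. x \<in> points M \<Longrightarrow> g (f x) = x" "\<And>y. y \<in> points N \<Longrightarrow> f (g y) = y"
  using assms unfolding diffeomorphism_def by blast

lemma diffeomorphism_compose:
  assumes "premfd M" "premfd N" "premfd K" "diffeomorphism M N f" "diffeomorphism N K h"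
  shows "diffeomorphism M K (\<lambda>x. h (f x))"
proof -
  obtain f' where f: "smooth_map M N f" "smooth_map N M f'" "\<And>x. x \<in> points M \<Longrightarrow> f' (f x) = x" "\<And>y. y \<in> points N \<Longrightarrow> f (f' y) = y"
    by (rule diffeomorphismE[OF assms(4)]) blast
  obtain h' where h: "smooth_map N K h" "smooth_map K N h'" "\<And>x. x \<in> points N \<Longrightarrow> h' (h x) = x" "\<And>y. y \<in> points K \<Longrightarrow> h (h' y) = y"
    by (rule diffeomorphismE[OF assms(5)]) blast
  show ?thesis
  proof (rule diffeomorphismI[where g = "\<lambda>x. f' (h' x)"])
    show "f' (h' (h (f x))) = x" if "x \<in> points M" for x
      using f(3)[OF that] h(3)[OF smooth_map_points[OF f(1) that]] by simp
    show "h (f (f' (h' y))) = y" if "y \<in> points K" for y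
      using h(4)[OF that] f(4)[OF smooth_map_points[OF h(2) that]] by simp
    show "smooth_map M K (\<lambda>x. h (f x))" by (rule smooth_map_compose[OF assms(1-3) f(1) h(1)])
    show "smooth_map K M (\<lambda>x. f' (h' x))" by (rule smooth_map_compose[OF assms(3,2,1) h(2) f(2)])
  qed
qed

lemma diffeomorphism_sym:
  assumes "diffeomorphism M N f" obtains g where "diffeomorphism N M g"
  using assms unfolding diffeomorphism_def by blast

context circle_submersion
begin

text \<open>Surjectivity of the trivialization: near each point of the fiber a retraction chart
  reaches all small angles over all nearby fiber points, and compactness of the fiber makes the
  range of angles uniform.\<close>

lemma uniform_lift:
  assumes c: "norm c = 1" and r: "fiber_fixing c r" and \<Omega>: "openin (mtop M) \<Omega>" "level c \<subseteq> \<Omega>" "\<And>x. x \<in> \<Omega> \<Longrightarrow> p (r x) = c"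
  obtains \<delta> where "\<delta> > 0"
    "\<And>y t. y \<in> level c \<Longrightarrow> \<bar>t\<bar> < \<delta> \<Longrightarrow> \<exists>x\<in>points M. r x = y \<and> p x / c \<notin> \<real>\<^sub>\<le>\<^sub>0 \<and> Im (Ln (p x / c)) = t"
proof -
  have "\<forall>y\<in>level c. \<exists>s. openin (mtop M) (fst s) \<and> y \<in> fst s \<and> snd s > 0 \<and>
      (\<forall>y'\<in>fst s \<inter> level c. \<forall>t. \<bar>t\<bar> < snd s \<longrightarrow> (\<exists>x\<in>points M. r x = y' \<and> p x / c \<notin> \<real>\<^sub>\<le>\<^sub>0 \<and> Im (Ln (p x / c)) = t))"
  proof
    fix y assume y: "y \<in> level c"
    have y\<Omega>: "y \<in> \<Omega>" using y \<Omega>(2) by blast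
    obtain U and \<kappa> :: "'a \<Rightarrow> 'f \<times> real" and u O' where U: "adapted_chart M p c U \<kappa> u" "y \<in> O'" "O' \<subseteq> U \<inter> \<Omega>" "r ` O' \<subseteq> U"
      "hchart M O' (\<lambda>x. (fst (\<kappa> (r x)), Im (Ln (p x / c)))) (u, 0)"
      by (rule retraction_chart[OF c r \<Omega>(1) y y\<Omega>]) blast
    note hc = adapted_hchart[OF U(1)] and gc = adapted_gchart[OF U(1)]
    have ry: "r y = y" using r y by (simp add: fiber_fixing_def)
    obtain N where N: "open N" "(fst (\<kappa> (r y)), Im (Ln (p y / c))) \<in> N"
      "\<And>z. z \<in> N \<Longrightarrow> 0 \<le> z \<bullet> (u, 0) \<Longrightarrow> z \<in> (\<lambda>x. (fst (\<kappa> (r x)), Im (Ln (p x / c)))) ` O'"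
      by (rule hchart_image_nhd[OF U(5,2)]) blast
    have "p y / c = 1" using y c by auto
    then have "(fst (\<kappa> y), 0) \<in> N" using N(2) by (simp add: ry)
    then obtain A T where AT: "open A" "open T" "fst (\<kappa> y) \<in> A" "0 \<in> T" "A \<times> T \<subseteq> N"
      using open_prod_elim[OF N(1)] by (metis mem_Sigma_iff)
    obtain d where d: "d > 0" "ball 0 d \<subseteq> T" using openE[OF AT(2,4)] by blast
    have yU: "y \<in> U" using U by blast
    have op: "openin (mtop M) {x\<in>U. fst (\<kappa> x) \<in> A}"
      by (rule smooth_at_openin_vimage[OF M gchart_openin[OF gc] smooth_at_fst[OF gchart_smooth_at[OF gc]] AT(1)])
    have "\<exists>x\<in>points M. r x = y' \<and> p x / c \<notin> \<real>\<^sub>\<le>\<^sub>0 \<and> Im (Ln (p x / c)) = t"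
      if y': "y' \<in> {x\<in>U. fst (\<kappa> x) \<in> A} \<inter> level c" and t: "\<bar>t\<bar> < d" for y' t
    proof -
      have "t \<in> T" using t d by (auto simp: subset_iff)
      then have "(fst (\<kappa> y'), t) \<in> N" using AT(5) y' by blast
      moreover have "0 \<le> (fst (\<kappa> y'), t) \<bullet> (u, 0)" using hchart_ge_0[OF hc, of y'] y' by (cases "\<kappa> y'") auto
      ultimately obtain x where x: "x \<in> O'" "fst (\<kappa> (r x)) = fst (\<kappa> y')" "Im (Ln (p x / c)) = t" using N(3) by force
      have xU: "x \<in> U" "r x \<in> U" "x \<in> \<Omega>" using x U(3,4) by auto
      have xM: "x \<in> points M" using gchart_points[OF gc] xU by blast
      have "r x \<in> points M" using gchart_points[OF gc] xU by blast
      then have "\<kappa> (r x) = (fst (\<kappa> (r x)), 0)" using adapted_level[OF c U(1), of "r x"] xU \<Omega>(3) by auto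
      also have "\<dots> = \<kappa> y'" using adapted_level[OF c U(1), of y'] y' x(2) by simp
      finally have "r x = y'" using gchart_inj[OF gc] xU y' by (auto dest: inj_onD)
      then show ?thesis using x xM adapted_nonpos[OF U(1) xU(1)] by blast
    qed
    then show "\<exists>s. openin (mtop M) (fst s) \<and> y \<in> fst s \<and> snd s > 0 \<and>
      (\<forall>y'\<in>fst s \<inter> level c. \<forall>t. \<bar>t\<bar> < snd s \<longrightarrow> (\<exists>x\<in>points M. r x = y' \<and> p x / c \<notin> \<real>\<^sub>\<le>\<^sub>0 \<and> Im (Ln (p x / c)) = t))"
      using op yU AT(3) d(1) by (intro exI[of _ "({x\<in>U. fst (\<kappa> x) \<in> A}, d)"]) simp
  qed
  from bchoice[OF this] obtain s where s: "\<And>y. y \<in> level c \<Longrightarrow> openin (mtop M) (fst (s y)) \<and> y \<in> fst (s y)"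
    "\<And>y. y \<in> level c \<Longrightarrow> snd (s y) > 0"
    "\<And>y y' t. y \<in> level c \<Longrightarrow> y' \<in> fst (s y) \<inter> level c \<Longrightarrow> \<bar>t\<bar> < snd (s y) \<Longrightarrow>
       \<exists>x\<in>points M. r x = y' \<and> p x / c \<notin> \<real>\<^sub>\<le>\<^sub>0 \<and> Im (Ln (p x / c)) = t"
    by (elim exE) (rule that, blast+)
  have "closedin (mtop M) (level c)"
    using closedin_continuous_map_preimage[OF smooth_at_continuous_map[OF M p_smooth], of "{c}"] by simp
  then have "compactin (mtop M) (level c)" by (rule closedin_compact_space[OF compact])
  moreover have "level c \<subseteq> \<Union>((\<lambda>y. fst (s y)) ` level c)" using s(1) by blast
  ultimately obtain F where F: "finite F" "F \<subseteq> (\<lambda>y. fst (s y)) ` level c" "level c \<subseteq> \<Union>F"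
    using compactinD[of "mtop M" "level c" "(\<lambda>y. fst (s y)) ` level c"] s(1) by auto
  obtain S where S: "finite S" "S \<subseteq> level c" "F = (\<lambda>y. fst (s y)) ` S"
    using finite_subset_image[OF F(1,2)] by blast
  \<comment> \<open>The inserted 1 keeps the set nonempty when the fiber is empty.\<close>
  define \<delta> where "\<delta> = Min (insert 1 ((\<lambda>y. snd (s y)) ` S))"
  have "\<delta> > 0" using S s(2) by (auto simp: \<delta>_def)
  moreover have "\<exists>x\<in>points M. r x = y \<and> p x / c \<notin> \<real>\<^sub>\<le>\<^sub>0 \<and> Im (Ln (p x / c)) = t"
    if y: "y \<in> level c" and t: "\<bar>t\<bar> < \<delta>" for y t
  proof -
    obtain y0 where y0: "y0 \<in> S" "y \<in> fst (s y0)" using F(3) S(3) y by blast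
    have "\<delta> \<le> snd (s y0)" unfolding \<delta>_def using S(1) y0 by (intro Min_le) auto
    then show ?thesis using s(3)[of y0 y t] y0 y t S(2) by auto
  qed
  ultimately show thesis using that by blast
qed

text \<open>Compactness is applied in the square of \<open>M\<close>. Around a diagonal pair over
  \<open>(c, c)\<close> a retraction chart is injective; around any other pair the images under
  \<open>r\<close> are separated, because \<open>r\<close> fixes both points. A tube around the
  fiber over \<open>(c, c)\<close> gives the uniform \<delta>.\<close>

lemma uniform_injectivity:
  assumes c: "norm c = 1" and r: "fiber_fixing c r" and \<Omega>: "openin (mtop M) \<Omega>" "level c \<subseteq> \<Omega>" "\<And>x. x \<in> \<Omega> \<Longrightarrow> p (r x) = c"
  obtains \<delta> where "\<delta> > 0"
    "\<And>x x'. x \<in> points M \<Longrightarrow> x' \<in> points M \<Longrightarrow> dist (p x) c < \<delta> \<Longrightarrow> dist (p x') c < \<delta> \<Longrightarrow>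
       r x = r x' \<Longrightarrow> p x = p x' \<Longrightarrow> x = x'"
proof -
  define \<A> where "\<A> = {A \<times> A' | A A'. openin (mtop M) A \<and> openin (mtop M) A' \<and>
      (\<forall>x\<in>A. \<forall>x'\<in>A'. r x = r x' \<and> p x = p x' \<longrightarrow> x = x')}"
  have in\<A>: "A \<times> A' \<in> \<A>" if "openin (mtop M) A" "openin (mtop M) A'"
    "\<And>x x'. x \<in> A \<Longrightarrow> x' \<in> A' \<Longrightarrow> r x = r x' \<Longrightarrow> p x = p x' \<Longrightarrow> x = x'" for A A'
    using that unfolding \<A>_def by blast
  have op: "openin (prod_topology (mtop M) (mtop M)) (\<Union>\<A>)"
    by (rule openin_Union) (auto simp: \<A>_def openin_prod_Times_iff)
  have cont: "continuous_map (prod_topology (mtop M) (mtop M)) euclidean (\<lambda>z. (p (fst z), p (snd z)))"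
  proof -
    have pc: "continuous_map (mtop M) euclidean p" by (rule smooth_at_continuous_map[OF M p_smooth])
    have "continuous_map (prod_topology (mtop M) (mtop M)) euclidean (\<lambda>z. p (fst z))"
      "continuous_map (prod_topology (mtop M) (mtop M)) euclidean (\<lambda>z. p (snd z))"
      using continuous_map_compose[OF continuous_map_fst pc] continuous_map_compose[OF continuous_map_snd pc]
      by (simp_all add: comp_def)
    from continuous_map_pairedI[OF this] show ?thesis by simp
  qed
  have cpt: "compact_space (prod_topology (mtop M) (mtop M))"
    using compact by (simp add: compact_space_prod_topology)
  have cover: "z \<in> \<Union>\<A>" if "z \<in> topspace (prod_topology (mtop M) (mtop M))" "(p (fst z), p (snd z)) = (c, c)" for z
  proof -
    obtain x x' where z: "z = (x, x')" by force
    have x: "x \<in> level c" "x' \<in> level c" using that by (auto simp: z)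
    have rx: "r x = x" "r x' = x'" using r x by (auto simp: fiber_fixing_def)
    show ?thesis
    proof (cases "x = x'")
      case True
      have x\<Omega>: "x \<in> \<Omega>" using x(1) \<Omega>(2) by blast
      obtain U and \<kappa> :: "'a \<Rightarrow> 'f \<times> real" and u O' where U: "adapted_chart M p c U \<kappa> u" "x \<in> O'"
        "hchart M O' (\<lambda>x. (fst (\<kappa> (r x)), Im (Ln (p x / c)))) (u, 0)"
        by (rule retraction_chart[OF c r \<Omega>(1) x(1) x\<Omega>]) blast
      note gcO = hchart_gchart[OF U(3)]
      have "O' \<times> O' \<in> \<A>"
        by (rule in\<A>[OF gchart_openin[OF gcO] gchart_openin[OF gcO]])
          (rule inj_onD[OF gchart_inj[OF gcO]], simp_all)
      then show ?thesis using U(2) True z by blast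
    next
      case False
      have "Hausdorff_space (mtop M)" using M_manifold by (simp add: smooth_manifold_def)
      then obtain T T' where T: "openin (mtop M) T" "openin (mtop M) T'" "x \<in> T" "x' \<in> T'" "disjnt T T'"
        using False x unfolding Hausdorff_space_def by blast
      let ?A = "\<lambda>T. {x \<in> points M. r x \<in> T}"
      have opA: "openin (mtop M) (?A T)" if "openin (mtop M) T" for T
        using r that by (auto simp: fiber_fixing_def smooth_map_def continuous_map_def)
      have "?A T \<times> ?A T' \<in> \<A>"
        by (rule in\<A>[OF opA[OF T(1)] opA[OF T(2)]]) (use T(5) in \<open>auto simp: disjnt_iff\<close>)
      moreover have "z \<in> ?A T \<times> ?A T'" using T x rx by (simp add: z)
      ultimately show ?thesis by blast
    qed
  qed
  obtain \<delta> where \<delta>: "\<delta> > 0" "\<And>z. z \<in> topspace (prod_topology (mtop M) (mtop M)) \<Longrightarrow>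
      dist (p (fst z), p (snd z)) (c, c) < \<delta> \<Longrightarrow> z \<in> \<Union>\<A>"
    by (rule compact_fiber_nhd[OF cpt cont op cover]) auto
  show thesis
  proof (rule that[of "\<delta> / 2"])
    fix x x' assume x: "x \<in> points M" "x' \<in> points M" "dist (p x) c < \<delta> / 2" "dist (p x') c < \<delta> / 2" "r x = r x'" "p x = p x'"
    have "dist (p x, p x') (c, c) \<le> dist (p x) c + dist (p x') c"
      unfolding dist_Pair_Pair by (rule sqrt_sum_squares_le_sum) simp_all
    then have "(x, x') \<in> \<Union>\<A>" using \<delta>(2)[of "(x, x')"] x by auto
    then show "x = x'" using x(5,6) by (auto simp: \<A>_def)
  qed (use \<delta> in simp)
qed

text \<open>The trivialization is \<open>x \<mapsto> (r x, p x)\<close> over an arc short enough for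
  the uniform injectivity, the uniform lifts and the retraction charts to be available over all of
  it.\<close>

lemma local_triviality:
  assumes c: "norm c = 1"
  obtains U h where "c \<in> U" "local_trivialization (Fib c) M circle p (U, h)"
proof -
  obtain r \<Omega> where r: "fiber_fixing c r" and \<Omega>: "openin (mtop M) \<Omega>" "level c \<subseteq> \<Omega>" "\<And>x. x \<in> \<Omega> \<Longrightarrow> p (r x) = c"
    by (rule fiber_retraction[OF c]) blast
  have smr: "smooth_map M M r" using r by (simp add: fiber_fixing_def)
  define good where "good O' \<longleftrightarrow> (\<exists>U (\<kappa> :: 'a \<Rightarrow> 'f \<times> real) u. adapted_chart M p c U \<kappa> u \<and> O' \<subseteq> U \<inter> \<Omega> \<and> r ` O' \<subseteq> U \<and>
      hchart M O' (\<lambda>x. (fst (\<kappa> (r x)), Im (Ln (p x / c)))) (u, 0))" for O'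
  have op1: "openin (mtop M) (\<Union>{O'. good O'})"
    by (rule openin_Union) (auto simp: good_def dest: hchart_gchart gchart_openin)
  have cov1: "x \<in> \<Union>{O'. good O'}" if "x \<in> points M" "p x = c" for x
  proof -
    have x: "x \<in> level c" "x \<in> \<Omega>" using that \<Omega>(2) by auto
    obtain U and \<kappa> :: "'a \<Rightarrow> 'f \<times> real" and u O' where "adapted_chart M p c U \<kappa> u" "x \<in> O'" "O' \<subseteq> U \<inter> \<Omega>" "r ` O' \<subseteq> U"
      "hchart M O' (\<lambda>x. (fst (\<kappa> (r x)), Im (Ln (p x / c)))) (u, 0)"
      by (rule retraction_chart[OF c r \<Omega>(1) x]) blast
    then have "good O' \<and> x \<in> O'" unfolding good_def by (intro conjI exI)
    then show ?thesis by blast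
  qed
  have pc: "continuous_map (mtop M) euclidean p" by (rule smooth_at_continuous_map[OF M p_smooth])
  obtain \<delta>1 where \<delta>1: "\<delta>1 > 0" "\<And>x. x \<in> points M \<Longrightarrow> dist (p x) c < \<delta>1 \<Longrightarrow> x \<in> \<Union>{O'. good O'}"
    by (rule compact_fiber_nhd[OF compact pc op1 cov1]) auto
  obtain \<delta>2 where \<delta>2: "\<delta>2 > 0" "\<And>x x'. x \<in> points M \<Longrightarrow> x' \<in> points M \<Longrightarrow> dist (p x) c < \<delta>2 \<Longrightarrow> dist (p x') c < \<delta>2 \<Longrightarrow>
       r x = r x' \<Longrightarrow> p x = p x' \<Longrightarrow> x = x'"
    by (rule uniform_injectivity[OF c r \<Omega>]) auto
  obtain \<delta>3 where \<delta>3: "\<delta>3 > 0" "\<And>y t. y \<in> level c \<Longrightarrow> \<bar>t\<bar> < \<delta>3 \<Longrightarrow>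
      \<exists>x\<in>points M. r x = y \<and> p x / c \<notin> \<real>\<^sub>\<le>\<^sub>0 \<and> Im (Ln (p x / c)) = t"
    by (rule uniform_lift[OF c r \<Omega>]) auto
  define \<delta> where "\<delta> = min \<delta>1 (min \<delta>2 \<delta>3)"
  have \<delta>: "\<delta> > 0" "\<delta> \<le> \<delta>1" "\<delta> \<le> \<delta>2" "\<delta> \<le> \<delta>3" using \<delta>1 \<delta>2 \<delta>3 by (auto simp: \<delta>_def)
  define I where "I = sphere 0 1 \<inter> {z. z / c \<in> - \<real>\<^sub>\<le>\<^sub>0 \<and> \<bar>Im (Ln (z / c))\<bar> < \<delta>}"
  have opI: "openin (mtop circle) I" unfolding I_def mtop_circle
    by (rule openin_open_Int[OF Im_Ln_nhd[OF \<delta>(1) c]])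
  have cI: "c \<in> I" using c \<delta>(1) by (auto simp: I_def)
  have I_norm: "norm z = 1" if "z \<in> I" for z using that by (simp add: I_def)
  define Z where "Z = {x\<in>points M. p x \<in> I}"
  have opZ: "openin (mtop M) Z"
  proof -
    have "continuous_map (mtop M) (mtop circle) p"
      using smooth_map_circleI[OF M p_smooth p_norm] by (auto simp: smooth_map_def)
    then show ?thesis unfolding Z_def using opI by (auto simp: continuous_map_def)
  qed
  have Zdist: "dist (p x) c < \<delta>" if "x \<in> Z" for x
    using dist_le_Im_Ln[of "p x" c] p_norm c that by (auto simp: Z_def I_def)
  have Zinj: "x = x'" if "x \<in> Z" "x' \<in> Z" "r x = r x'" "p x = p x'" for x x'
    using \<delta>2(2)[of x x'] Zdist[OF that(1)] Zdist[OF that(2)] that \<delta>(3) by (auto simp: Z_def)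
  have Zgood: "\<exists>O'. good O' \<and> x \<in> O'" if "x \<in> Z" for x
    using \<delta>1(2)[of x] Zdist[OF that] that \<delta>(2) by (auto simp: Z_def)
  have rZ: "r x \<in> level c" if "x \<in> Z" for x
    using Zgood[OF that] \<Omega>(3) smooth_map_points[OF smr, of x] that by (auto simp: good_def Z_def)
  have lift: "\<exists>x\<in>Z. r x = y \<and> p x = z" if y: "y \<in> level c" and z: "z \<in> I" for y z
  proof -
    have "\<bar>Im (Ln (z / c))\<bar> < \<delta>3" using z \<delta>(4) by (auto simp: I_def)
    then obtain x where x: "x \<in> points M" "r x = y" "Im (Ln (p x / c)) = Im (Ln (z / c))"
      using \<delta>3(2)[OF y] by blast
    have "p x = z" by (rule eq_if_Im_Ln_eq[OF p_norm[OF x(1)] I_norm[OF z] c x(3)])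
    then show ?thesis using x z by (auto simp: Z_def)
  qed
  \<comment> \<open>The inverse is chosen pointwise; \<open>Zinj\<close> makes the choice unique,
    and smoothness is read off afterwards in retraction charts.\<close>
  define k where "k w = (SOME x. x \<in> Z \<and> r x = fst w \<and> p x = snd w)" for w
  have k: "k (y, z) \<in> Z" "r (k (y, z)) = y" "p (k (y, z)) = z" if "y \<in> level c" "z \<in> I" for y z
  proof -
    have "\<exists>x. x \<in> Z \<and> r x = fst (y, z) \<and> p x = snd (y, z)" using lift[OF that] by auto
    from someI_ex[OF this] show "k (y, z) \<in> Z" "r (k (y, z)) = y" "p (k (y, z)) = z"
      by (simp_all add: k_def)
  qed
  let ?E = "open_submfd M Z" and ?I = "open_submfd circle I"
  let ?P = "prod_mfd (Fib c) ?I"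
  have E: "premfd ?E" and I: "premfd ?I" and FC: "premfd (Fib c)"
    using premfd_open_submfd[OF M opZ] premfd_open_submfd[OF premfd_circle opI] premfd_Fib[OF c] by auto
  have P: "premfd ?P" by (rule premfd_prod[OF FC I])
  have ptsE: "points ?E = Z" and ptsI: "points ?I = I" using openin_subset[OF opZ] openin_subset[OF opI] by auto
  have h: "smooth_map ?E ?P (\<lambda>x. (r x, p x))"
  proof (rule smooth_map_Pair[OF E FC I])
    show "smooth_map ?E (Fib c) r"
      by (rule smooth_map_into_Fib[OF c E smooth_map_from_open_submfd[OF M opZ smr M]]) (use rZ ptsE in auto)
    show "smooth_map ?E ?I p"
      by (rule smooth_map_into_open_submfd[OF E smooth_map_from_open_submfd[OF M opZ
            smooth_map_circleI[OF M p_smooth p_norm] premfd_circle] premfd_circle])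
        (auto simp: Z_def)
  qed
  have ks: "smooth_map ?P ?E k"
  proof (rule smooth_mapI_gchart[OF P E])
    fix w assume "w \<in> points ?P"
    then obtain y z where w: "w = (y, z)" "y \<in> level c" "z \<in> I" using ptsI by (cases w) auto
    define x where "x = k (y, z)"
    have x: "x \<in> Z" "r x = y" "p x = z" using k[OF w(2,3)] by (auto simp: x_def)
    obtain O' where O': "good O'" "x \<in> O'" using Zgood[OF x(1)] by blast
    obtain U and \<kappa> :: "'a \<Rightarrow> 'f \<times> real" and u where U: "adapted_chart M p c U \<kappa> u" "O' \<subseteq> U \<inter> \<Omega>" "r ` O' \<subseteq> U"
      "hchart M O' (\<lambda>x. (fst (\<kappa> (r x)), Im (Ln (p x / c)))) (u, 0)"
      using O'(1) unfolding good_def by blast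
    note hc = adapted_hchart[OF U(1)] and gc = adapted_gchart[OF U(1)]
    let ?\<mu> = "\<lambda>x. (fst (\<kappa> (r x)), Im (Ln (p x / c)))"
    have op: "openin (mtop M) (O' \<inter> Z)" using gchart_openin[OF hchart_gchart[OF U(4)]] opZ by blast
    have hZ: "hchart M (O' \<inter> Z) ?\<mu> (u, 0)" by (rule hchart_subset[OF M U(4) op]) auto
    obtain N where N: "open N" "?\<mu> x \<in> N" "\<And>v. v \<in> N \<Longrightarrow> 0 \<le> v \<bullet> (u, 0) \<Longrightarrow> v \<in> ?\<mu> ` (O' \<inter> Z)"
      by (rule hchart_image_nhd[OF hZ, of x]) (use O' x in auto)
    \<comment> \<open>In terms of \<open>?\<nu>\<close> on the product and \<open>?\<mu>\<close> on
      \<open>M\<close> the inverse \<open>k\<close> becomes the identity.\<close>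
    let ?\<nu> = "map_prod (\<lambda>y. fst (\<kappa> y)) (\<lambda>z. Im (Ln (z / c)))"
    have \<nu>: "smooth_at ?P ?\<nu> v" if vA: "v \<in> (U \<inter> level c) \<times> I" for v
    proof -
      obtain y z where v: "v = (y, z)" "y \<in> U" "y \<in> level c" "z \<in> I" using vA by blast
      have "smooth_at (Fib c) (\<lambda>y. fst (\<kappa> y)) y"
        by (rule smooth_at_Fib_restrict[OF c smooth_at_fst[OF gchart_smooth_at[OF gc v(2)]]]) (use v in simp)
      moreover have "smooth_at circle (\<lambda>z. Im (Ln (z / c))) z"
        by (rule smooth_at_Im_Ln[OF smooth_at_circle_ident _ ]) (use v c in \<open>auto simp: I_def\<close>)
      then have "smooth_at ?I (\<lambda>z. Im (Ln (z / c))) z"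
        using smooth_at_open_submfd[OF premfd_circle opI v(4)] by blast
      ultimately show ?thesis unfolding v(1) by (rule smooth_at_map_prod)
    qed
    let ?A = "{v\<in>(U \<inter> level c) \<times> I. ?\<nu> v \<in> N}"
    have "openin (mtop ?P) ((U \<inter> level c) \<times> I)"
      using gchart_openin[OF gc] opI by (auto simp: openin_prod_Times_iff openin_subtopology openin_open_subtopology)
    then have A: "openin (mtop ?P) ?A" by (rule smooth_at_openin_vimage[OF P _ \<nu> N(1)])
    have yU: "y \<in> U" using O'(2) U(3) x(2) by blast
    have wA: "w \<in> ?A" using w yU N(2) x by simp
    have kA: "k v \<in> O' \<inter> Z \<and> ?\<mu> (k v) = ?\<nu> v" if vA: "v \<in> ?A" for v
    proof -
      obtain y' z' where v: "v = (y', z')" "y' \<in> U" "y' \<in> level c" "z' \<in> I" "(fst (\<kappa> y'), Im (Ln (z' / c))) \<in> N"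
        using vA by auto
      have "0 \<le> (fst (\<kappa> y'), Im (Ln (z' / c))) \<bullet> (u, 0)" using hchart_ge_0[OF hc v(2)] by (cases "\<kappa> y'") auto
      then obtain x' where x': "x' \<in> O' \<inter> Z" "fst (\<kappa> y') = fst (\<kappa> (r x'))" "Im (Ln (z' / c)) = Im (Ln (p x' / c))"
        using N(3)[OF v(5)] by blast
      have "p x' = z'"
        using eq_if_Im_Ln_eq[OF p_norm I_norm[OF v(4)] c, of x'] x' by (auto simp: Z_def)
      moreover have "r x' = y'"
      proof -
        have "r x' \<in> U \<inter> level c" using x' U(3) rZ by blast
        then have "\<kappa> (r x') = \<kappa> y'"
          using adapted_level[OF c U(1), of "r x'"] adapted_level[OF c U(1), of y'] v x'(2) by simp
        then show ?thesis using gchart_inj[OF gc] v(2) \<open>r x' \<in> U \<inter> level c\<close> by (auto dest: inj_onD)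
      qed
      ultimately have "x' = k v" using Zinj[of x' "k v"] k[OF v(3,4)] x'(1) v(1) by auto
      then show ?thesis using x' v(1) by auto
    qed
    show "\<exists>V \<psi> A. gchart ?E V (\<psi> :: 'a \<Rightarrow> 'f \<times> real) \<and> openin (mtop ?P) A \<and> w \<in> A \<and> k ` A \<subseteq> V \<and> smooth_at ?P (\<lambda>y. \<psi> (k y)) w"
    proof (intro exI conjI)
      show "gchart ?E (O' \<inter> Z) ?\<mu>" using hchart_gchart[OF hZ] by (simp add: gchart_open_submfd[OF M opZ])
      show "openin (mtop ?P) ?A" by (rule A)
      show "smooth_at ?P (\<lambda>y. ?\<mu> (k y)) w"
      proof (rule smooth_at_cong[OF P \<nu> A wA])
        show "w \<in> (U \<inter> level c) \<times> I" using wA by blast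
        show "?\<nu> v = ?\<mu> (k v)" if "v \<in> ?A" for v using kA[OF that] by simp
      qed
    qed (use wA kA in auto)
  qed
  have "diffeomorphism ?E ?P (\<lambda>x. (r x, p x))"
  proof (rule diffeomorphismI[OF h ks])
    show "k (r x, p x) = x" if "x \<in> points ?E" for x
    proof -
      have "x \<in> Z" "p x \<in> I" using that ptsE by (auto simp: Z_def)
      then show ?thesis using Zinj[of "k (r x, p x)" x] k[OF rZ] by blast
    qed
    show "(r (k w), p (k w)) = w" if "w \<in> points ?P" for w
      using k[of "fst w" "snd w"] that ptsI by (cases w) auto
  qed
  then have "local_trivialization (Fib c) M circle p (I, \<lambda>x. (r x, p x))"
    using opI by (auto simp: local_trivialization_def Z_def)
  then show thesis using that cI by blast
qed

section \<open>Comparison of the fibers\<close>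

lemma local_trivialization_fiber_diffeo:
  assumes c: "norm c = 1" and lt: "local_trivialization (Fib c) M circle p (U, h)" and c': "c' \<in> U"
  obtains d where "diffeomorphism (Fib c) (Fib c') d"
proof -
  have opU: "openin (mtop circle) U" and diff: "diffeomorphism (open_submfd M {x\<in>points M. p x \<in> U}) (prod_mfd (Fib c) (open_submfd circle U)) h"
    and snd: "\<And>x. x \<in> points M \<Longrightarrow> p x \<in> U \<Longrightarrow> snd (h x) = p x"
    using lt by (auto simp: local_trivialization_def)
  let ?Z = "{x\<in>points M. p x \<in> U}"
  let ?E = "open_submfd M ?Z" and ?I = "open_submfd circle U"
  let ?P = "prod_mfd (Fib c) ?I"
  have nc': "norm c' = 1" using openin_subset[OF opU] c' by auto
  have opZ: "openin (mtop M) ?Z"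
    using smooth_map_circleI[OF M p_smooth p_norm] opU unfolding smooth_map_def continuous_map_def by blast
  have E: "premfd ?E" and I: "premfd ?I" and FC: "premfd (Fib c)" and FC': "premfd (Fib c')"
    using premfd_open_submfd[OF M opZ] premfd_open_submfd[OF premfd_circle opU] premfd_Fib[OF c] premfd_Fib[OF nc'] by auto
  have P: "premfd ?P" by (rule premfd_prod[OF FC I])
  have ptsE: "points ?E = ?Z" and ptsI: "points ?I = U" using openin_subset[OF opU] by auto
  obtain k where k: "smooth_map ?E ?P h" "smooth_map ?P ?E k" "\<And>x. x \<in> points ?E \<Longrightarrow> k (h x) = x" "\<And>w. w \<in> points ?P \<Longrightarrow> h (k w) = w"
    by (rule diffeomorphismE[OF diff]) blast
  have pk: "p (k (y, c')) = c'" "k (y, c') \<in> ?Z" if "y \<in> level c" for y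
  proof -
    have w: "(y, c') \<in> points ?P" using that c' ptsI by auto
    show Z: "k (y, c') \<in> ?Z" using smooth_map_points[OF k(2) w] ptsE by blast
    show "p (k (y, c')) = c'" using snd[of "k (y, c')"] Z k(4)[OF w] by simp
  qed
  have inE: "smooth_map ?E M (\<lambda>x. x)" by (rule smooth_map_from_open_submfd[OF M opZ smooth_map_ident[OF M] M])
  have 1: "smooth_map (Fib c) (Fib c') (\<lambda>y. k (y, c'))"
  proof (rule smooth_map_into_Fib[OF nc' FC])
    have "smooth_map (Fib c) ?P (\<lambda>y. (y, c'))"
      by (rule smooth_map_Pair[OF FC FC I smooth_map_ident[OF FC] smooth_map_const[OF FC]]) (use c' ptsI in simp)
    from smooth_map_compose[OF FC P M this smooth_map_compose[OF P E M k(2) inE]]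
    show "smooth_map (Fib c) M (\<lambda>y. k (y, c'))" .
  qed (use pk in auto)
  have 2: "smooth_map (Fib c') (Fib c) (\<lambda>x. fst (h x))"
  proof -
    have "smooth_map (Fib c') ?E (\<lambda>x. x)"
      by (rule smooth_map_into_open_submfd[OF FC' smooth_map_Fib_incl[OF nc'] M]) (use c' in auto)
    from smooth_map_compose[OF FC' P FC smooth_map_compose[OF FC' E P this k(1)] smooth_map_fst[OF FC I]]
    show ?thesis .
  qed
  have "diffeomorphism (Fib c) (Fib c') (\<lambda>y. k (y, c'))"
  proof (rule diffeomorphismI[OF 1 2])
    show "fst (h (k (y, c'))) = y" if "y \<in> points (Fib c)" for y
      using k(4)[of "(y, c')"] that c' ptsI nc' by auto
    show "k (fst (h x), c') = x" if "x \<in> points (Fib c')" for x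
    proof -
      have x: "x \<in> ?Z" "p x = c'" using that c' by auto
      then have "h x = (fst (h x), c')" using snd[of x] by (metis (no_types, lifting) mem_Collect_eq prod.collapse)
      then show ?thesis using k(3)[of x] x ptsE by auto
    qed
  qed
  then show thesis using that by blast
qed

text \<open>Fibers over a trivializing arc are diffeomorphic, so by connectedness of the circle all
  fibers are, and one of them can serve as the model everywhere. Surjectivity comes from the same
  diffeomorphisms, since one fiber is inhabited.\<close>

theorem fiber_bundle_Fib:
  assumes "points M \<noteq> {}"
  shows "\<exists>F' :: ('a, 'f) mfd. fiber_bundle F' M circle p"
proof -
  obtain x0 where x0: "x0 \<in> points M" using assms by blast
  define c0 where "c0 = p x0"
  have c0: "norm c0 = 1" using p_norm[OF x0] by (simp add: c0_def)
  define rel where "rel a b \<longleftrightarrow> (\<exists>d. diffeomorphism (Fib a) (Fib b) d)" for a b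
  have prem: "premfd (Fib c)" if "c \<in> sphere 0 1" for c using premfd_Fib that by simp
  have all: "rel a b" if "a \<in> sphere 0 1" "b \<in> sphere 0 1" for a b
  proof (rule connected_equivalence_relation[OF _ that])
    show "connected (sphere (0::complex) 1)" by (rule connected_sphere) simp
    show "rel y x" if "rel x y" for x y using that diffeomorphism_sym unfolding rel_def by metis
    show "rel x z" if "rel x y" "rel y z" "x \<in> sphere 0 1" "y \<in> sphere 0 1" "z \<in> sphere 0 1" for x y z
      using that diffeomorphism_compose[OF prem prem prem] unfolding rel_def by metis
    fix a :: complex assume a: "a \<in> sphere 0 1"
    then have na: "norm a = 1" by simp
    obtain U h where U: "a \<in> U" "local_trivialization (Fib a) M circle p (U, h)" by (rule local_triviality[OF na])
    have "rel a x" if "x \<in> U" for x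
      using local_trivialization_fiber_diffeo[OF na U(2) that] unfolding rel_def by blast
    moreover have "openin (top_of_set (sphere 0 1)) U" using U(2) by (simp add: local_trivialization_def)
    ultimately show "\<exists>T. openin (top_of_set (sphere 0 1)) T \<and> a \<in> T \<and> (\<forall>x\<in>T. rel a x)" using U(1) by blast
  qed
  have "fiber_bundle (Fib c0) M circle p"
    unfolding fiber_bundle_def
  proof (intro conjI ballI)
    show "smooth_manifold (Fib c0)" by (rule smooth_manifold_Fib[OF c0])
    show "smooth_map M circle p" by (rule smooth_map_circleI[OF M p_smooth p_norm])
    show "p ` points M = points circle"
    proof (intro subset_antisym subsetI)
      fix b assume b: "b \<in> points circle"
      then obtain d where d: "diffeomorphism (Fib c0) (Fib b) d" using all[of c0 b] c0 by (auto simp: rel_def)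
      have "smooth_map (Fib c0) (Fib b) d" by (rule diffeomorphismE[OF d])
      moreover have "x0 \<in> points (Fib c0)" using x0 by (simp add: c0_def)
      ultimately have "d x0 \<in> points (Fib b)" by (rule smooth_map_points)
      then show "b \<in> p ` points M" by auto
    qed (use p_norm in auto)
    fix b assume b: "b \<in> points circle"
    then have nb: "norm b = 1" by simp
    obtain d where d: "diffeomorphism (Fib b) (Fib c0) d" using all[of b c0] c0 b by (auto simp: rel_def)
    obtain d' where d': "smooth_map (Fib b) (Fib c0) d" "smooth_map (Fib c0) (Fib b) d'"
      "\<And>x. x \<in> points (Fib b) \<Longrightarrow> d' (d x) = x" "\<And>y. y \<in> points (Fib c0) \<Longrightarrow> d (d' y) = y"
      by (rule diffeomorphismE[OF d]) blast
    obtain U h where U: "b \<in> U" "local_trivialization (Fib b) M circle p (U, h)" by (rule local_triviality[OF nb])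
    let ?Z = "{x\<in>points M. p x \<in> U}"
    let ?E = "open_submfd M ?Z" and ?I = "open_submfd circle U"
    have lt: "openin (mtop circle) U" "diffeomorphism ?E (prod_mfd (Fib b) ?I) h"
      "\<And>x. x \<in> points M \<Longrightarrow> p x \<in> U \<Longrightarrow> snd (h x) = p x"
      using U(2) by (auto simp: local_trivialization_def)
    have opZ: "openin (mtop M) ?Z"
      using smooth_map_circleI[OF M p_smooth p_norm] lt(1) unfolding smooth_map_def continuous_map_def by blast
    have E: "premfd ?E" and I: "premfd ?I" and Fb: "premfd (Fib b)" and F0: "premfd (Fib c0)"
      using premfd_open_submfd[OF M opZ] premfd_open_submfd[OF premfd_circle lt(1)] premfd_Fib[OF nb] premfd_Fib[OF c0] by auto
    have Pb: "premfd (prod_mfd (Fib b) ?I)" and P0: "premfd (prod_mfd (Fib c0) ?I)"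
      using premfd_prod[OF Fb I] premfd_prod[OF F0 I] by auto
    have "diffeomorphism (prod_mfd (Fib b) ?I) (prod_mfd (Fib c0) ?I) (\<lambda>w. (d (fst w), snd w))"
    proof (rule diffeomorphismI[where g = "\<lambda>w. (d' (fst w), snd w)"])
      show "smooth_map (prod_mfd (Fib b) ?I) (prod_mfd (Fib c0) ?I) (\<lambda>w. (d (fst w), snd w))"
        by (intro smooth_map_Pair[OF Pb F0 I] smooth_map_compose[OF Pb Fb F0 smooth_map_fst[OF Fb I] d'(1)] smooth_map_snd[OF Fb I])
      show "smooth_map (prod_mfd (Fib c0) ?I) (prod_mfd (Fib b) ?I) (\<lambda>w. (d' (fst w), snd w))"
        by (intro smooth_map_Pair[OF P0 Fb I] smooth_map_compose[OF P0 F0 Fb smooth_map_fst[OF F0 I] d'(2)] smooth_map_snd[OF F0 I])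
    qed (use d'(3,4) in auto)
    from diffeomorphism_compose[OF E Pb P0 lt(2) this]
    have "local_trivialization (Fib c0) M circle p (U, \<lambda>x. (d (fst (h x)), snd (h x)))"
      using lt(1,3) by (auto simp: local_trivialization_def)
    then show "\<exists>U h. b \<in> U \<and> local_trivialization (Fib c0) M circle p (U, h)" using U(1) by blast
  qed
  then show ?thesis by blast
qed

end

section \<open>Circle-valued functions on products with circles\<close>

abbreviation circ :: "complex topology" where "circ \<equiv> top_of_set (sphere 0 1)"

lemma continuous_map_compose_continuous_on:
  assumes "continuous_map X euclidean g" "continuous_on S h" "\<And>x. x \<in> topspace X \<Longrightarrow> g x \<in> S"
  shows "continuous_map X euclidean (\<lambda>x. h (g x))"
proof -
  have "continuous_map X (top_of_set S) g" using assms by (auto simp: continuous_map_in_subtopology)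
  moreover have "continuous_map (top_of_set S) euclidean h" using assms(2) by simp
  ultimately show ?thesis using continuous_map_compose[of X "top_of_set S" g euclidean h] by (simp add: comp_def)
qed

lemma continuous_map_binary:
  assumes "continuous_map X euclidean g" "continuous_map X euclidean h" "continuous_on S (\<lambda>z. k (fst z) (snd z))"
    "\<And>x. x \<in> topspace X \<Longrightarrow> (g x, h x) \<in> S"
  shows "continuous_map X euclidean (\<lambda>x. k (g x) (h x))"
  using continuous_map_compose_continuous_on[OF _ assms(3), of X "\<lambda>x. (g x, h x)"]
    continuous_map_pairedI[OF assms(1,2)] assms(4) by simp

lemma continuous_map_divide_complex:
  fixes g h :: "'a \<Rightarrow> complex"
  assumes "continuous_map X euclidean g" "continuous_map X euclidean h" "\<And>x. x \<in> topspace X \<Longrightarrow> h x \<noteq> 0"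
  shows "continuous_map X euclidean (\<lambda>x. g x / h x)"
  by (rule continuous_map_binary[OF assms(1,2), where S = "UNIV \<times> (- {0})"])
    (use assms(3) in \<open>auto intro!: continuous_intros\<close>)

lemma not_nonpos_if_near_1:
  assumes "norm (z - 1 :: complex) < 1" shows "z \<notin> \<real>\<^sub>\<le>\<^sub>0"
proof
  assume "z \<in> \<real>\<^sub>\<le>\<^sub>0"
  then have "Re z \<le> 0" by (simp add: complex_nonpos_Reals_iff)
  then have "1 \<le> \<bar>Re (z - 1)\<bar>" by simp
  also have "\<dots> \<le> norm (z - 1)" by (rule abs_Re_le_cmod)
  finally show False using assms by simp
qed

text \<open>\<open>X\<close> carries no metric, so uniformity comes from compactness: the triples
  with \<open>t = t'\<close> form the zero fiber of \<open>t - t'\<close>, and the triples whose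
  values are closer than 1 form a neighbourhood of it.\<close>

lemma uniform_partition:
  fixes H :: "'a \<times> real \<Rightarrow> complex"
  assumes X: "compact_space X" and H: "continuous_map (prod_topology X (top_of_set {0..1})) euclidean H"
  obtains n :: nat where "n > 0" "\<And>x t t'. x \<in> topspace X \<Longrightarrow> t \<in> {0..1} \<Longrightarrow> t' \<in> {0..1} \<Longrightarrow> \<bar>t - t'\<bar> \<le> 1 / n \<Longrightarrow>
      dist (H (x, t)) (H (x, t')) < 1"
proof -
  let ?J = "top_of_set {0..1::real}"
  let ?Y = "prod_topology X (prod_topology ?J ?J)"
  have f1: "continuous_map ?Y ?J (\<lambda>w. fst (snd w))" and f2: "continuous_map ?Y ?J (\<lambda>w. snd (snd w))"
    using continuous_map_compose[OF continuous_map_snd continuous_map_fst, of X ?J ?J]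
      continuous_map_compose[OF continuous_map_snd continuous_map_snd, of X ?J ?J] by (simp_all add: comp_def)
  have 1: "continuous_map ?Y euclidean (\<lambda>w. H (fst w, fst (snd w)))"
    using continuous_map_compose[OF continuous_map_pairedI[OF continuous_map_fst f1] H] by (simp add: comp_def)
  have 2: "continuous_map ?Y euclidean (\<lambda>w. H (fst w, snd (snd w)))"
    using continuous_map_compose[OF continuous_map_pairedI[OF continuous_map_fst f2] H] by (simp add: comp_def)
  have d: "continuous_map ?Y euclidean (\<lambda>w. dist (H (fst w, fst (snd w))) (H (fst w, snd (snd w))))"
    by (rule continuous_map_binary[OF 1 2, where S = UNIV]) (auto intro!: continuous_intros)
  have t: "continuous_map ?Y euclidean (\<lambda>w. fst (snd w) - snd (snd w))"
    by (rule continuous_map_binary[where S = UNIV and k = "(-)"])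
      (use f1 f2 in \<open>auto simp: continuous_map_in_subtopology intro!: continuous_intros\<close>)
  have cpt: "compact_space ?Y"
  proof -
    have "compact_space (prod_topology ?J ?J)" by (simp add: compact_space_subtopology compact_Times)
    then show ?thesis using X unfolding compact_space_prod_topology[of X] by blast
  qed
  let ?W = "{w \<in> topspace ?Y. dist (H (fst w, fst (snd w))) (H (fst w, snd (snd w))) \<in> {..<1}}"
  have W: "openin ?Y ?W" by (rule openin_continuous_map_preimage[OF d]) simp
  obtain \<delta> where \<delta>: "\<delta> > 0" "\<And>w. w \<in> topspace ?Y \<Longrightarrow> dist (fst (snd w) - snd (snd w)) 0 < \<delta> \<Longrightarrow> w \<in> ?W"
    by (rule compact_fiber_nhd[OF cpt t W, of 0]) auto
  obtain n :: nat where n: "n > 0" "1 / n < \<delta>" using \<delta>(1) by (metis nat_approx_posE zero_less_Suc)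
  show thesis
  proof (rule that[OF n(1)])
    fix x t t' assume "x \<in> topspace X" "t \<in> {0..1}" "t' \<in> {0..1}" "\<bar>t - t'\<bar> \<le> 1 / n"
    then show "dist (H (x, t)) (H (x, t')) < 1" using \<delta>(2)[of "(x, t, t')"] n by auto
  qed
qed

text \<open>The lift adds up the principal arguments of quotients of successive values. These values
  are unimodular and closer than 1, so the quotients avoid the negative axis and their arguments
  depend continuously on all variables.\<close>

lemma lift_homotopy:
  fixes H :: "'a \<times> real \<Rightarrow> complex"
  assumes X: "compact_space X" and H: "continuous_map (prod_topology X (top_of_set {0..1})) euclidean H"
    and norm: "\<And>x t. x \<in> topspace X \<Longrightarrow> t \<in> {0..1} \<Longrightarrow> norm (H (x, t)) = 1"
    and start: "\<And>x. x \<in> topspace X \<Longrightarrow> H (x, 0) = 1"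
  obtains F where "continuous_map (prod_topology X (top_of_set {0..1})) euclideanreal F"
    "\<And>x. x \<in> topspace X \<Longrightarrow> F (x, 0) = 0"
    "\<And>x t. x \<in> topspace X \<Longrightarrow> t \<in> {0..1} \<Longrightarrow> cis (F (x, t)) = H (x, t)"
proof -
  let ?J = "top_of_set {0..1::real}"
  let ?Y = "prod_topology X ?J"
  obtain n :: nat where n: "n > 0" "\<And>x t t'. x \<in> topspace X \<Longrightarrow> t \<in> {0..1} \<Longrightarrow> t' \<in> {0..1} \<Longrightarrow> \<bar>t - t'\<bar> \<le> 1 / n \<Longrightarrow>
      dist (H (x, t)) (H (x, t')) < 1"
    using uniform_partition[OF X H] by blast
  \<comment> \<open>The partition is stopped at \<open>t\<close>: from there on the quotients are 1,
    so the same \<open>n\<close> summands serve every \<open>t\<close>, and they telescope from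
    \<open>H (x, 0)\<close> to \<open>H (x, t)\<close>.\<close>
  define c where "c k t = min t (real k / n)" for k t
  have cJ: "c k t \<in> {0..1}" if "t \<in> {0..1}" for k t using that by (auto simp: c_def)
  have cstep: "\<bar>c (Suc k) t - c k t\<bar> \<le> 1 / n" for k t
    using n(1) by (auto simp: c_def min_def field_simps)
  have Hc: "continuous_map ?Y euclidean (\<lambda>w. H (fst w, c k (snd w)))" for k
  proof -
    have "continuous_map ?J ?J (c k)"
      using cJ by (auto simp: continuous_map_in_subtopology c_def intro!: continuous_intros)
    then have "continuous_map ?Y ?J (\<lambda>w. c k (snd w))"
      using continuous_map_compose[OF continuous_map_snd, of ?J ?J "c k" X] by (simp add: comp_def)
    from continuous_map_compose[OF continuous_map_pairedI[OF continuous_map_fst this] H]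
    show ?thesis by (simp add: comp_def)
  qed
  define q where "q = (\<lambda>k w. H (fst w, c (Suc k) (snd w)) / H (fst w, c k (snd w)))"
  have qn: "norm (q k w) = 1" "q k w \<notin> \<real>\<^sub>\<le>\<^sub>0" if w: "w \<in> topspace ?Y" for k w
  proof -
    have x: "fst w \<in> topspace X" "snd w \<in> {0..1}" using w by auto
    have n1: "norm (H (fst w, c k (snd w))) = 1" "norm (H (fst w, c (Suc k) (snd w))) = 1"
      using norm[OF x(1) cJ[OF x(2)]] by auto
    then show "norm (q k w) = 1" by (simp add: q_def norm_divide)
    have "dist (H (fst w, c (Suc k) (snd w))) (H (fst w, c k (snd w))) < 1"
      by (rule n(2)[OF x(1) cJ[OF x(2)] cJ[OF x(2)] cstep])
    moreover have "q k w - 1 = (H (fst w, c (Suc k) (snd w)) - H (fst w, c k (snd w))) / H (fst w, c k (snd w))"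
      using n1 by (auto simp: q_def diff_divide_distrib)
    ultimately have "norm (q k w - 1) < 1" using n1 by (simp add: norm_divide dist_norm)
    then show "q k w \<notin> \<real>\<^sub>\<le>\<^sub>0" by (rule not_nonpos_if_near_1)
  qed
  define F where "F = (\<lambda>w. \<Sum>k<n. Im (Ln (q k w)))"
  have "continuous_map ?Y euclidean (\<lambda>w. Im (Ln (q k w)))" for k
  proof (rule continuous_map_compose_continuous_on[where S = "- \<real>\<^sub>\<le>\<^sub>0" and g = "q k" and h = "\<lambda>z. Im (Ln z)"])
    show "continuous_map ?Y euclidean (q k)"
      unfolding q_def
    proof (rule continuous_map_divide_complex[OF Hc Hc])
      fix w assume "w \<in> topspace ?Y"
      then show "H (fst w, c k (snd w)) \<noteq> 0"
        using norm[of "fst w" "c k (snd w)"] cJ[of "snd w" k] by auto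
    qed
    show "continuous_on (- \<real>\<^sub>\<le>\<^sub>0) (\<lambda>z. Im (Ln z))" by (intro continuous_intros) auto
  qed (use qn in auto)
  then have Fc: "continuous_map ?Y euclideanreal F" unfolding F_def by (intro continuous_map_sum) auto
  have part: "cis (\<Sum>k<j. Im (Ln (q k (x, t)))) = H (x, c j t)" if x: "x \<in> topspace X" "t \<in> {0..1}" for j x t
  proof (induction j)
    case 0
    have "c 0 t = 0" using x by (simp add: c_def)
    then show ?case using start[OF x(1)] by simp
  next
    case (Suc j)
    have w: "(x, t) \<in> topspace ?Y" using x by simp
    have "H (x, c j t) \<noteq> 0" using norm[OF x(1) cJ[OF x(2)], of j] by auto
    moreover have "cis (\<Sum>k<Suc j. Im (Ln (q k (x, t)))) = H (x, c j t) * q j (x, t)"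
      using Suc cis_Im_Ln[OF qn(1)[OF w]] by (simp add: cis_mult[symmetric])
    ultimately show ?case by (simp add: q_def)
  qed
  show thesis
  proof (rule that[OF Fc])
    show "F (x, 0) = 0" if "x \<in> topspace X" for x
    proof -
      have "q k (x, 0) = 1" for k using start[OF that] by (simp add: q_def c_def)
      then show ?thesis by (simp add: F_def)
    qed
    show "cis (F (x, t)) = H (x, t)" if "x \<in> topspace X" "t \<in> {0..1}" for x t
    proof -
      have "c n t = t" using that n(1) by (simp add: c_def)
      then show ?thesis using part[OF that, of n] by (simp add: F_def)
    qed
  qed
qed

text \<open>Between two distinct integer values a connected image would contain a
  half-integer.\<close>

lemma connected_integers_constant:
  fixes g :: "'a \<Rightarrow> real"
  assumes "connected_space X" "continuous_map X euclidean g" "\<And>x. x \<in> topspace X \<Longrightarrow> g x \<in> \<int>"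
  obtains m :: int where "\<And>x. x \<in> topspace X \<Longrightarrow> g x = m"
proof (cases "topspace X = {}")
  case False
  then obtain x0 where x0: "x0 \<in> topspace X" by blast
  obtain m :: int where m: "g x0 = m" using assms(3)[OF x0] by (auto elim: Ints_cases)
  have "connectedin euclidean (g ` topspace X)"
    using connectedin_continuous_map_image[OF assms(2)] assms(1) by (simp add: connectedin_topspace)
  then have con: "connected (g ` topspace X)" by simp
  have "g x = m" if x: "x \<in> topspace X" for x
  proof (rule ccontr)
    assume ne: "g x \<noteq> m"
    obtain k :: int where k: "g x = k" using assms(3)[OF x] by (auto elim: Ints_cases)
    have *: "(1/2 + real_of_int (min k m)) \<in> g ` topspace X"
    proof (rule subsetD[OF connected_contains_Icc[OF con, of "min k m" "max k m"]])
      have "real_of_int k \<in> g ` topspace X" "real_of_int m \<in> g ` topspace X"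
        using x x0 k m by (metis image_eqI)+
      then show "real_of_int (min k m) \<in> g ` topspace X" "real_of_int (max k m) \<in> g ` topspace X"
        by (auto simp: min_def max_def)
      have "min k m + 1 \<le> max k m" using ne k by auto
      then have "real_of_int (min k m) + 1 \<le> real_of_int (max k m)" by linarith
      then show "1/2 + real_of_int (min k m) \<in> {real_of_int (min k m)..real_of_int (max k m)}" by auto
    qed
    then obtain y where "y \<in> topspace X" "1/2 + real_of_int (min k m) = g y" by blast
    then have "1/2 + real_of_int (min k m) \<in> \<int>" using assms(3) by metis
    then have "1/2 \<in> (\<int> :: real set)" using Ints_diff[of "1/2 + real_of_int (min k m)" "real_of_int (min k m)"] by simp
    then obtain j :: int where "1/2 = real_of_int j" by (auto elim: Ints_cases)
    then have "1 = 2 * j" by linarith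
    then show False by presburger
  qed
  then show thesis using that by blast
qed (use that in blast)

text \<open>Lift along \<open>t \<mapsto> cis (2 * pi * t)\<close>. The end value divided by
  \<open>2 * pi\<close> is the winding number, an integer and hence constant over the connected
  \<open>X\<close>. Subtracting the linear lift of \<open>z powi m\<close> makes both ends agree, so
  the remainder descends to the circle.\<close>

lemma circle_factor:
  fixes u :: "'a \<times> complex \<Rightarrow> complex"
  assumes X: "compact_space X" "connected_space X" "Hausdorff_space X"
    and u: "continuous_map (prod_topology X circ) euclidean u"
    and norm: "\<And>x z. x \<in> topspace X \<Longrightarrow> norm z = 1 \<Longrightarrow> norm (u (x, z)) = 1"
    and start: "\<And>x. x \<in> topspace X \<Longrightarrow> u (x, 1) = 1"
  obtains m :: int and f where "continuous_map (prod_topology X circ) euclideanreal f"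
    "\<And>x z. x \<in> topspace X \<Longrightarrow> norm z = 1 \<Longrightarrow> u (x, z) = z powi m * cis (f (x, z))"
proof -
  let ?J = "top_of_set {0..1::real}"
  let ?e = "\<lambda>t. cis (2 * pi * t)"
  let ?q = "\<lambda>w. (fst w, ?e (snd w))"
  have e: "continuous_map ?J circ ?e" by (auto simp: continuous_map_in_subtopology intro!: continuous_intros)
  then have e': "continuous_map (prod_topology X ?J) circ (\<lambda>w. ?e (snd w))"
    using continuous_map_compose[OF continuous_map_snd e, of X] by (simp add: comp_def)
  have q: "continuous_map (prod_topology X ?J) (prod_topology X circ) ?q"
    by (rule continuous_map_pairedI[OF continuous_map_fst e'])
  have Hc: "continuous_map (prod_topology X ?J) euclidean (\<lambda>w. u (?q w))"
    using continuous_map_compose[OF q u] by (simp add: comp_def)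
  obtain F where F: "continuous_map (prod_topology X ?J) euclideanreal F" "\<And>x. x \<in> topspace X \<Longrightarrow> F (x, 0) = 0"
    "\<And>x t. x \<in> topspace X \<Longrightarrow> t \<in> {0..1} \<Longrightarrow> cis (F (x, t)) = u (x, ?e t)"
    by (rule lift_homotopy[OF X(1) Hc]) (use norm start in auto)
  have "continuous_map X ?J (\<lambda>x. 1)" by simp
  from continuous_map_compose[OF continuous_map_pairedI[OF continuous_map_id[unfolded id_def] this] F(1)]
  have F1: "continuous_map X euclidean (\<lambda>x. F (x, 1))" by (simp add: comp_def)
  have "continuous_map X euclidean (\<lambda>x. F (x, 1) / (2 * pi))"
    by (rule continuous_map_compose_continuous_on[OF F1, of UNIV "\<lambda>y. y / (2 * pi)"]) (auto intro!: continuous_intros)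
  moreover have "F (x, 1) / (2 * pi) \<in> \<int>" if x: "x \<in> topspace X" for x
  proof -
    have "cis (F (x, 1)) = 1" using F(3)[OF x, of 1] start[OF x] by simp
    then have "cos (F (x, 1)) = 1" by (metis cis.sel(1) one_complex.sel(1))
    then obtain n :: int where "F (x, 1) = n * 2 * pi" using cos_one_2pi_int[of "F (x, 1)"] by auto
    then show ?thesis by simp
  qed
  ultimately obtain m :: int where m: "\<And>x. x \<in> topspace X \<Longrightarrow> F (x, 1) / (2 * pi) = m"
    by (rule connected_integers_constant[OF X(2)]) auto
  define f0 where "f0 = (\<lambda>w. F w - m * (2 * pi * snd w))"
  have f0: "continuous_map (prod_topology X ?J) euclideanreal f0"
  proof -
    have "continuous_map (prod_topology X ?J) euclideanreal (\<lambda>w. snd w)"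
      using continuous_map_snd[of X ?J] by (simp add: continuous_map_in_subtopology)
    then show ?thesis unfolding f0_def
      by (rule continuous_map_binary[OF F(1), where S = UNIV and k = "\<lambda>a t. a - m * (2 * pi * t)"])
        (auto intro!: continuous_intros)
  qed
  have "compact_space ?J" by (simp add: compact_space_subtopology)
  then have cpt: "compact_space (prod_topology X ?J)" using X by (simp add: compact_space_prod_topology)
  have haus: "Hausdorff_space (prod_topology X circ)"
    using X(3) by (simp add: Hausdorff_space_prod_topology Hausdorff_space_subtopology)
  have onto: "\<exists>t\<in>{0..1}. z = ?e t" if "norm z = 1" for z
  proof (cases "Arg z \<ge> 0")
    case True
    then show ?thesis using norm_eq_1_imp_cis[OF that] Arg_le_pi[of z]
      by (intro bexI[of _ "Arg z / (2 * pi)"]) (auto simp: field_simps)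
  next
    case False
    have "cis (Arg z + 2 * pi) = z" using norm_eq_1_imp_cis[OF that] by (simp add: cis_mult[symmetric])
    moreover have "2 * pi * ((Arg z + 2 * pi) / (2 * pi)) = Arg z + 2 * pi" by simp
    moreover have "(Arg z + 2 * pi) / (2 * pi) \<in> {0..1}"
      using False mpi_less_Arg[of z] by (auto simp: field_simps)
    ultimately show ?thesis by metis
  qed
  have qm: "quotient_map (prod_topology X ?J) (prod_topology X circ) ?q"
  proof (rule continuous_closed_imp_quotient_map[OF q continuous_imp_closed_map[OF q cpt haus]])
    show "?q ` topspace (prod_topology X ?J) = topspace (prod_topology X circ)"
    proof (intro subset_antisym subsetI)
      fix w assume "w \<in> topspace (prod_topology X circ)"
      then obtain x z where w: "w = (x, z)" "x \<in> topspace X" "norm z = 1" by (cases w) auto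
      then obtain t where "t \<in> {0..1}" "z = ?e t" using onto by blast
      then show "w \<in> ?q ` topspace (prod_topology X ?J)" using w by (intro image_eqI[of _ _ "(x, t)"]) auto
    qed auto
  qed
  \<comment> \<open>The parametrization identifies only the two ends of the interval, and there the
    corrected lift takes the value 0 twice.\<close>
  have respect: "f0 v = f0 w" if vw: "v \<in> topspace (prod_topology X ?J)" "w \<in> topspace (prod_topology X ?J)" "?q v = ?q w" for v w
  proof -
    obtain x t x' t' where v: "v = (x, t)" "w = (x', t')" by (metis surj_pair)
    have x: "x' = x" "x \<in> topspace X" "t \<in> {0..1}" "t' \<in> {0..1}" "?e t = ?e t'" using vw by (auto simp: v)
    have ends: "f0 (x, 1) = 0" "f0 (x, 0) = 0" using m[OF x(2)] F(2)[OF x(2)] by (auto simp: f0_def field_simps)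
    have "t = t' \<or> {t, t'} = {0, 1}"
    proof -
      have "cos (2 * pi * t) = cos (2 * pi * t')" "sin (2 * pi * t) = sin (2 * pi * t')" using x(5) by (metis cis.sel)+
      then obtain n :: int where "2 * pi * t = 2 * pi * t' + 2 * pi * n" using sin_cos_eq_iff by metis
      then have "2 * pi * t = 2 * pi * (t' + n)" by (simp add: distrib_left)
      then have tn: "t = t' + n" by simp
      then have "real_of_int n \<le> 1" "- 1 \<le> real_of_int n" using x(3,4) by auto
      then have "n \<in> {-1, 0, 1}" by auto
      then show ?thesis using tn x(3,4) by auto
    qed
    then show ?thesis using ends x(1) by (auto simp: v doubleton_eq_iff)
  qed
  have "\<exists>f. continuous_map (prod_topology X circ) euclideanreal f \<and> (\<forall>w\<in>topspace (prod_topology X ?J). f (?q w) = f0 w)"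
  proof (rule quotient_map_lift_exists[OF qm f0])
    fix g assume "continuous_map (prod_topology X circ) euclideanreal g"
      "\<And>w. w \<in> topspace (prod_topology X ?J) \<Longrightarrow> g (?q w) = f0 w"
    then show ?thesis by blast
  qed (rule respect)
  then obtain f where f: "continuous_map (prod_topology X circ) euclideanreal f"
    "\<And>w. w \<in> topspace (prod_topology X ?J) \<Longrightarrow> f (?q w) = f0 w" by blast
  show thesis
  proof (rule that[OF f(1)])
    fix x :: 'a and z :: complex assume x: "x \<in> topspace X" and z: "norm z = 1"
    obtain t where t: "t \<in> {0..1}" "z = ?e t" using onto[OF z] by blast
    have "f (x, z) = F (x, t) - m * (2 * pi * t)" using f(2)[of "(x, t)"] x t by (simp add: f0_def)
    then have "z powi m * cis (f (x, z)) = cis (F (x, t))"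
      using t(2) by (simp add: cis_power_int cis_mult)
    then show "u (x, z) = z powi m * cis (f (x, z))" using F(3)[OF x t(1)] t(2) by simp
  qed
qed

text \<open>Two applications of \<open>circle_factor\<close>: first along \<open>y\<close> with the
  last variable frozen at \<open>b2\<close>, then along \<open>z\<close> with \<open>(x, y)\<close>
  as parameter. Rotation by \<open>b1\<close> and \<open>b2\<close> moves the base point to 1, and
  division by the values at the start supplies the normalization required there.\<close>

lemma torus_factor:
  fixes u :: "'a \<times> complex \<times> complex \<Rightarrow> complex"
  assumes X: "compact_space X" "connected_space X" "Hausdorff_space X"
    and u: "continuous_map (prod_topology X (prod_topology circ circ)) euclidean u"
    and norm: "\<And>x y z. x \<in> topspace X \<Longrightarrow> norm y = 1 \<Longrightarrow> norm z = 1 \<Longrightarrow> norm (u (x, y, z)) = 1"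
    and b: "norm b1 = 1" "norm b2 = 1" "norm c = 1" and start: "\<And>x. x \<in> topspace X \<Longrightarrow> u (x, b1, b2) = c"
  obtains m n :: int and f where "continuous_map (prod_topology X (prod_topology circ circ)) euclideanreal f"
    "\<And>x y z. x \<in> topspace X \<Longrightarrow> norm y = 1 \<Longrightarrow> norm z = 1 \<Longrightarrow> u (x, y, z) = y powi m * z powi n * cis (f (x, y, z))"
proof -
  have mult: "continuous_map circ circ (\<lambda>z. a * z)" if "norm a = 1" for a
    using that by (auto simp: continuous_map_in_subtopology norm_mult intro!: continuous_intros)
  let ?X2 = "prod_topology X circ"
  have nz: "b1 \<noteq> 0" "b2 \<noteq> 0" "c \<noteq> 0" using b by auto
  define u1 where "u1 = (\<lambda>w. u (fst w, b1 * snd w, b2) / c)"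
  have c1: "continuous_map ?X2 circ (\<lambda>w. b1 * snd w)"
    using continuous_map_compose[OF continuous_map_snd mult[OF b(1)], of X] by (simp add: comp_def)
  have "continuous_map ?X2 circ (\<lambda>w. b2)" using b by simp
  from continuous_map_compose[OF continuous_map_pairedI[OF continuous_map_fst continuous_map_pairedI[OF c1 this]] u]
  have c1': "continuous_map ?X2 euclidean (\<lambda>w. u (fst w, b1 * snd w, b2))" by (simp add: comp_def)
  have u1: "continuous_map ?X2 euclidean u1"
    unfolding u1_def by (rule continuous_map_divide_complex[OF c1']) (use nz in auto)
  obtain m :: int and f1 where f1: "continuous_map ?X2 euclideanreal f1"
    "\<And>x z. x \<in> topspace X \<Longrightarrow> norm z = 1 \<Longrightarrow> u1 (x, z) = z powi m * cis (f1 (x, z))"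
    by (rule circle_factor[OF X u1]) (use norm start b nz in \<open>auto simp: u1_def norm_divide norm_mult\<close>)
  define u2 where "u2 = (\<lambda>w. u (fst (fst w), b1 * snd (fst w), b2 * snd w) / u (fst (fst w), b1 * snd (fst w), b2))"
  have X2: "compact_space ?X2" "connected_space ?X2" "Hausdorff_space ?X2"
  proof -
    have "compact_space circ" by (simp add: compact_space_subtopology)
    then show "compact_space ?X2" using X by (simp add: compact_space_prod_topology)
    have "connected_space circ" by (simp add: connected_space_subtopology connected_sphere)
    then show "connected_space ?X2" using X by (simp add: connected_space_prod_topology)
    show "Hausdorff_space ?X2" using X(3) by (simp add: Hausdorff_space_prod_topology Hausdorff_space_subtopology)
  qed
  let ?X3 = "prod_topology ?X2 circ"
  have p1: "continuous_map ?X3 X (\<lambda>w. fst (fst w))"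
    using continuous_map_compose[OF continuous_map_fst continuous_map_fst, of X circ circ] by (simp add: comp_def)
  have p2: "continuous_map ?X3 circ (\<lambda>w. b1 * snd (fst w))"
    using continuous_map_compose[OF continuous_map_fst c1, of circ] by (simp add: comp_def)
  have p3: "continuous_map ?X3 circ (\<lambda>w. b2 * snd w)"
    using continuous_map_compose[OF continuous_map_snd mult[OF b(2)], of ?X2] by (simp add: comp_def)
  have k1: "continuous_map ?X3 euclidean (\<lambda>w. u (fst (fst w), b1 * snd (fst w), b2 * snd w))"
    using continuous_map_compose[OF continuous_map_pairedI[OF p1 continuous_map_pairedI[OF p2 p3]] u] by (simp add: comp_def)
  have k2: "continuous_map ?X3 euclidean (\<lambda>w. u (fst (fst w), b1 * snd (fst w), b2))"
    using continuous_map_compose[OF continuous_map_fst c1', of circ] by (simp add: comp_def)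
  have u2: "continuous_map ?X3 euclidean u2"
    unfolding u2_def
  proof (rule continuous_map_divide_complex[OF k1 k2])
    fix w assume "w \<in> topspace ?X3"
    then show "u (fst (fst w), b1 * snd (fst w), b2) \<noteq> 0"
      using norm[of "fst (fst w)" "b1 * snd (fst w)" b2] b by (auto simp: norm_mult)
  qed
  obtain n :: int and f2 where f2: "continuous_map ?X3 euclideanreal f2"
    "\<And>w z. w \<in> topspace ?X2 \<Longrightarrow> norm z = 1 \<Longrightarrow> u2 (w, z) = z powi n * cis (f2 (w, z))"
  proof (rule circle_factor[OF X2 u2])
    show "norm (u2 (w, z)) = 1" if "w \<in> topspace ?X2" "norm z = 1" for w z
      using that norm b by (cases w) (auto simp: u2_def norm_divide norm_mult)
    show "u2 (w, 1) = 1" if "w \<in> topspace ?X2" for w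
    proof -
      have "norm (u (fst w, b1 * snd w, b2)) = 1" using that norm[of "fst w" "b1 * snd w" b2] b by (cases w) (auto simp: norm_mult)
      then show ?thesis by (auto simp: u2_def)
    qed
  qed (rule that)
  have fac: "u (x, b1 * y, b2 * z) = c * (y powi m * z powi n) * cis (f1 (x, y) + f2 ((x, y), z))"
    if "x \<in> topspace X" "norm y = 1" "norm z = 1" for x y z
  proof -
    have "norm (u (x, b1 * y, b2)) = 1" using norm[OF that(1), of "b1 * y" b2] that b by (simp add: norm_mult)
    then have "u (x, b1 * y, b2 * z) = c * u1 (x, y) * u2 ((x, y), z)" using nz by (auto simp: u1_def u2_def)
    then show ?thesis using f1(2)[of x y] f2(2)[of "(x, y)" z] that by (simp add: cis_mult[symmetric] mult_ac)
  qed
  \<comment> \<open>Undoing the rotations leaves a unimodular constant, whose argument is added to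
    the lift.\<close>
  define C where "C = Arg (c * (b1 powi (-m) * b2 powi (-n)))"
  have C: "cis C = c * (b1 powi (-m) * b2 powi (-n))"
  proof -
    have "norm (c * (b1 powi (-m) * b2 powi (-n))) = 1" using b by (simp add: norm_mult norm_power_int)
    then show ?thesis unfolding C_def using norm_eq_1_imp_cis by metis
  qed
  let ?i = "\<lambda>a z. z / a"
  have inv: "continuous_map circ circ (\<lambda>z. z / a)" if "norm a = 1" for a :: complex
    using that by (auto simp: continuous_map_in_subtopology norm_divide intro!: continuous_intros)
  let ?X4 = "prod_topology X (prod_topology circ circ)"
  have s1: "continuous_map ?X4 circ (\<lambda>w. fst (snd w) / b1)"
    using continuous_map_compose[OF continuous_map_compose[OF continuous_map_snd continuous_map_fst] inv[OF b(1)], of X circ]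
    by (simp add: comp_def)
  have s2: "continuous_map ?X4 circ (\<lambda>w. snd (snd w) / b2)"
    using continuous_map_compose[OF continuous_map_compose[OF continuous_map_snd continuous_map_snd] inv[OF b(2)], of X circ]
    by (simp add: comp_def)
  have g1: "continuous_map ?X4 ?X2 (\<lambda>w. (fst w, fst (snd w) / b1))" by (rule continuous_map_pairedI[OF continuous_map_fst s1])
  have h1: "continuous_map ?X4 euclideanreal (\<lambda>w. f1 (fst w, fst (snd w) / b1))"
    using continuous_map_compose[OF g1 f1(1)] by (simp add: comp_def)
  have h2: "continuous_map ?X4 euclideanreal (\<lambda>w. f2 ((fst w, fst (snd w) / b1), snd (snd w) / b2))"
    using continuous_map_compose[OF continuous_map_pairedI[OF g1 s2] f2(1)] by (simp add: comp_def)
  have h: "continuous_map ?X4 euclideanreal (\<lambda>w. C + (f1 (fst w, fst (snd w) / b1) + f2 ((fst w, fst (snd w) / b1), snd (snd w) / b2)))"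
    by (intro continuous_map_add h1 h2) simp
  show thesis
  proof (rule that[OF h])
    fix x :: 'a and y z :: complex assume x: "x \<in> topspace X" "norm y = 1" "norm z = 1"
    have e1: "(y / b1) powi m = y powi m * b1 powi (-m)" and e2: "(z / b2) powi n = z powi n * b2 powi (-n)"
      using nz by (simp_all add: power_int_divide_distrib power_int_minus field_simps)
    have "u (x, y, z) = c * ((y / b1) powi m * (z / b2) powi n) * cis (f1 (x, y / b1) + f2 ((x, y / b1), z / b2))"
      using fac[of x "y / b1" "z / b2"] x b nz by (simp add: norm_divide)
    also have "\<dots> = c * (y powi m * b1 powi (-m) * (z powi n * b2 powi (-n))) * cis (f1 (x, y / b1) + f2 ((x, y / b1), z / b2))"
      by (simp only: e1 e2)
    also have "c * (y powi m * b1 powi (-m) * (z powi n * b2 powi (-n))) = y powi m * z powi n * cis C"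
      by (simp add: C mult_ac)
    finally show "u (x, y, z) = y powi m * z powi n * cis (C + (f1 (fst (x, y, z), fst (snd (x, y, z)) / b1) +
        f2 ((fst (x, y, z), fst (snd (x, y, z)) / b1), snd (snd (x, y, z)) / b2)))"
      by (simp add: cis_mult[symmetric] mult_ac)
  qed
qed

section \<open>The boundary of a surface bundle over the torus\<close>

lemma bdry_circle: "bdry circle = {}"
proof -
  have "z \<notin> bdry circle" for z
  proof
    assume z: "z \<in> bdry circle"
    then have "z \<in> points circle" using bdry_points[OF premfd_circle] by blast
    then obtain U \<phi> where U: "(U, \<phi>) \<in> atlas circle" "z \<in> U" by (rule premfd_chart[OF premfd_circle])
    obtain t where t: "U = carc t" "\<phi> = cangle t" using U by (auto simp: atlas_circle)
    have "cangle t ` carc t = {t<..<t + 2 * pi}"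
    proof (intro set_eqI iffI)
      show "s \<in> {t<..<t + 2 * pi}" if "s \<in> cangle t ` carc t" for s using that by (auto simp: angle_cis)
      show "s \<in> cangle t ` carc t" if "s \<in> {t<..<t + 2 * pi}" for s
        using that by (intro image_eqI[of _ _ "cis s"]) (simp_all add: angle_cis)
    qed
    then have "open (\<phi> ` U)" using t by simp
    then have "\<phi> z \<in> interior (\<phi> ` U)" using U by (simp add: interior_open)
    then show False using bdry_iff[OF premfd_circle gchart_atlas[OF premfd_circle U(1)] U(2)] z by simp
  qed
  then show ?thesis by blast
qed

lemma premfd_torus: "premfd torus"
  unfolding torus_def by (rule premfd_prod[OF premfd_circle premfd_circle])

lemma mtop_torus: "mtop torus = prod_topology circ circ"
  by (simp add: torus_def)

lemma points_torus: "y \<in> points torus \<longleftrightarrow> norm (fst y) = 1 \<and> norm (snd y) = 1"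
  by (cases y) (simp add: torus_def)

lemma bdry_torus:
  assumes "y \<in> points torus" shows "y \<notin> bdry torus"
proof -
  have y: "fst y \<in> points circle" "snd y \<in> points circle" using assms by (simp_all add: points_torus)
  have n: "snd y \<notin> bdry circle" unfolding bdry_circle by blast
  have "fst y \<notin> bdry circle" unfolding bdry_circle by blast
  then have "(fst y, snd y) \<notin> bdry (prod_mfd circle circle)"
    unfolding bdry_prod[OF premfd_circle premfd_circle y n] .
  then show ?thesis unfolding torus_def prod.collapse .
qed

locale torus_bundle =
  fixes \<Sigma> :: "('s, real ^ 2) mfd" and W :: "('w, real ^ 4) mfd" and q :: "'w \<Rightarrow> complex \<times> complex"
    and \<Theta> :: "((complex \<times> complex) set \<times> ('w \<Rightarrow> 's \<times> (complex \<times> complex))) set"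
  assumes \<Sigma>_manifold: "smooth_manifold \<Sigma>" and \<Sigma>_compact: "compact_space (mtop \<Sigma>)"
    and \<Sigma>_bdry: "bdry \<Sigma> \<noteq> {}" "connectedin (mtop \<Sigma>) (bdry \<Sigma>)"
    and W_manifold: "smooth_manifold W" and W_compact: "compact_space (mtop W)"
    and q: "smooth_map W torus q"
    and atlas: "bdry_fixing_bundle_atlas \<Sigma> W torus q \<Theta>"
begin

lemma \<Sigma>: "premfd \<Sigma>" by (rule smooth_manifold_imp_premfd[OF \<Sigma>_manifold])
lemma W: "premfd W" by (rule smooth_manifold_imp_premfd[OF W_manifold])

lemma triv_cover: "y \<in> points torus \<Longrightarrow> \<exists>U h. (U, h) \<in> \<Theta> \<and> y \<in> U"
proof -
  assume "y \<in> points torus"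
  then have "y \<in> \<Union>(fst ` \<Theta>)" using atlas by (simp add: bdry_fixing_bundle_atlas_def)
  then show ?thesis by force
qed

abbreviation over :: "(complex \<times> complex) set \<Rightarrow> 'w set" where "over U \<equiv> {x\<in>points W. q x \<in> U}"

lemma triv_local: "(U, h) \<in> \<Theta> \<Longrightarrow> local_trivialization \<Sigma> W torus q (U, h)"
  using atlas by (simp add: bdry_fixing_bundle_atlas_def)

lemma triv_open:
  assumes "(U, h) \<in> \<Theta>" shows "openin (mtop torus) U" "openin (mtop W) (over U)"
proof -
  show U: "openin (mtop torus) U" using triv_local[OF assms] by (simp add: local_trivialization_def)
  have "continuous_map (mtop W) (mtop torus) q" using q by (simp add: smooth_map_def)
  then show "openin (mtop W) (over U)" using U by (rule openin_continuous_map_preimage)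
qed

lemma triv:
  assumes "(U, h) \<in> \<Theta>"
  obtains k where "smooth_map (open_submfd W (over U)) (prod_mfd \<Sigma> (open_submfd torus U)) h"
    "smooth_map (prod_mfd \<Sigma> (open_submfd torus U)) (open_submfd W (over U)) k"
    "\<And>x. x \<in> points W \<Longrightarrow> q x \<in> U \<Longrightarrow> k (h x) = x"
    "\<And>s y. s \<in> points \<Sigma> \<Longrightarrow> y \<in> U \<Longrightarrow> h (k (s, y)) = (s, y) \<and> k (s, y) \<in> points W \<and> q (k (s, y)) = y"
    "\<And>x. x \<in> points W \<Longrightarrow> q x \<in> U \<Longrightarrow> snd (h x) = q x \<and> fst (h x) \<in> points \<Sigma>"
proof -
  have "local_trivialization \<Sigma> W torus q (U, h)" by (rule triv_local[OF assms])
  then have d: "diffeomorphism (open_submfd W (over U)) (prod_mfd \<Sigma> (open_submfd torus U)) h"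
    and snd: "\<And>x. x \<in> points W \<Longrightarrow> q x \<in> U \<Longrightarrow> snd (h x) = q x"
    by (auto simp: local_trivialization_def)
  have ptsW: "points (open_submfd W (over U)) = over U" by auto
  have ptsU: "points (open_submfd torus U) = U" using openin_subset[OF triv_open(1)[OF assms]] by auto
  obtain k where k: "smooth_map (open_submfd W (over U)) (prod_mfd \<Sigma> (open_submfd torus U)) h"
    "smooth_map (prod_mfd \<Sigma> (open_submfd torus U)) (open_submfd W (over U)) k"
    "\<And>x. x \<in> points (open_submfd W (over U)) \<Longrightarrow> k (h x) = x"
    "\<And>w. w \<in> points (prod_mfd \<Sigma> (open_submfd torus U)) \<Longrightarrow> h (k w) = w"
    by (rule diffeomorphismE[OF d]) blast
  have ksy: "h (k (s, y)) = (s, y) \<and> k (s, y) \<in> points W \<and> q (k (s, y)) = y" if sy: "s \<in> points \<Sigma>" "y \<in> U" for s y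
  proof -
    have w: "(s, y) \<in> points (prod_mfd \<Sigma> (open_submfd torus U))" using sy ptsU by simp
    have "k (s, y) \<in> over U" using smooth_map_points[OF k(2) w] ptsW by blast
    then show ?thesis using k(4)[OF w] snd[of "k (s, y)"] by simp
  qed
  have "fst (h x) \<in> points \<Sigma>" if "x \<in> points W" "q x \<in> U" for x
    using smooth_map_points[OF k(1), of x] that ptsW by (cases "h x") auto
  then show thesis using that[OF k(1,2)] k(3) ksy snd ptsW by blast
qed

lemma premfd_triv:
  assumes "(U, h) \<in> \<Theta>"
  shows "premfd (open_submfd W (over U))" "premfd (open_submfd torus U)" "premfd (prod_mfd \<Sigma> (open_submfd torus U))"
  using premfd_open_submfd[OF W triv_open(2)[OF assms]] premfd_open_submfd[OF premfd_torus triv_open(1)[OF assms]]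
    premfd_prod[OF \<Sigma>] by auto

text \<open>A trivialization turns the boundary of W over \<open>U\<close> into that of \<Sigma>
  times \<open>U\<close>, because the torus contributes no boundary points.\<close>

lemma bdry_triv:
  assumes U: "(U, h) \<in> \<Theta>" and x: "x \<in> points W" "q x \<in> U"
  shows "x \<in> bdry W \<longleftrightarrow> fst (h x) \<in> bdry \<Sigma>"
proof -
  obtain k where k: "smooth_map (open_submfd W (over U)) (prod_mfd \<Sigma> (open_submfd torus U)) h"
    "smooth_map (prod_mfd \<Sigma> (open_submfd torus U)) (open_submfd W (over U)) k"
    "\<And>x. x \<in> points W \<Longrightarrow> q x \<in> U \<Longrightarrow> k (h x) = x"
    "\<And>s y. s \<in> points \<Sigma> \<Longrightarrow> y \<in> U \<Longrightarrow> h (k (s, y)) = (s, y) \<and> k (s, y) \<in> points W \<and> q (k (s, y)) = y"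
    "\<And>x. x \<in> points W \<Longrightarrow> q x \<in> U \<Longrightarrow> snd (h x) = q x \<and> fst (h x) \<in> points \<Sigma>"
    by (rule triv[OF U]) blast
  note pm = premfd_triv[OF U] and opU = triv_open[OF U]
  have hx: "h x = (fst (h x), q x)" using k(5)[OF x] by (metis prod.collapse)
  have ptsU: "points (open_submfd torus U) = U" using openin_subset[OF opU(1)] by auto
  have yT: "q x \<in> points torus" by (rule smooth_map_points[OF q x(1)])
  have "x \<in> bdry (open_submfd W (over U)) \<longleftrightarrow> h x \<in> bdry (prod_mfd \<Sigma> (open_submfd torus U))"
  proof (rule bdry_diffeo[OF pm(1,3) k(1,2)])
    show "k (h x) = x" if "x \<in> points (open_submfd W (over U))" for x using k(3) that by auto
    show "h (k w) = w" if "w \<in> points (prod_mfd \<Sigma> (open_submfd torus U))" for w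
      using k(4)[of "fst w" "snd w"] that ptsU by (cases w) auto
  qed (use x in auto)
  also have "\<dots> \<longleftrightarrow> fst (h x) \<in> bdry \<Sigma>"
    using bdry_prod[OF \<Sigma> pm(2), of "fst (h x)" "q x"] k(5)[OF x] x ptsU bdry_torus[OF yT]
      bdry_open_submfd[OF premfd_torus opU(1) x(2)] hx yT by simp
  also have "x \<in> bdry (open_submfd W (over U)) \<longleftrightarrow> x \<in> bdry W"
    using bdry_open_submfd[OF W opU(2), of x] x by simp
  finally show ?thesis .
qed

section \<open>Identification of the boundary with a product\<close>

lemma triv_agree:
  assumes "(U, h) \<in> \<Theta>" "(U', h') \<in> \<Theta>" "x \<in> points W" "q x \<in> U" "q x \<in> U'" "fst (h x) \<in> bdry \<Sigma>"
  shows "h' x = h x"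
proof -
  have "\<forall>(U, h)\<in>\<Theta>. \<forall>(V, k)\<in>\<Theta>. \<forall>x\<in>points W. q x \<in> U \<inter> V \<and> fst (h x) \<in> bdry \<Sigma> \<longrightarrow> k x = h x"
    using atlas by (simp add: bdry_fixing_bundle_atlas_def)
  from bspec[OF bspec[OF this assms(1), simplified] assms(2)] show ?thesis using assms by simp
qed

abbreviation ident :: "'s \<times> complex \<times> complex \<Rightarrow> 'w" where "ident \<equiv> bdry_identification W q \<Theta>"

text \<open>The definite description is unambiguous because trivializations agree at boundary
  points. It may therefore be computed with the inverse of any one of them, which gives continuity
  and the other local properties.\<close>

lemma ident_eq:
  assumes U: "(U, h) \<in> \<Theta>" and s: "s \<in> bdry \<Sigma>" and y: "y \<in> U"
    and k: "k (s, y) \<in> points W" "h (k (s, y)) = (s, y)" "q (k (s, y)) = y"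
    and kh: "\<And>x. x \<in> points W \<Longrightarrow> q x \<in> U \<Longrightarrow> k (h x) = x"
  shows "ident (s, y) = k (s, y)"
  unfolding bdry_identification_def
proof (rule the_equality)
  show "k (s, y) \<in> points W \<and> (\<exists>(U, h)\<in>\<Theta>. q (k (s, y)) \<in> U \<and> h (k (s, y)) = (s, y))"
    using k U y by (intro conjI bexI[of _ "(U, h)"]) auto
  fix x assume "x \<in> points W \<and> (\<exists>(U, h)\<in>\<Theta>. q x \<in> U \<and> h x = (s, y))"
  then obtain U' h' where x: "x \<in> points W" "(U', h') \<in> \<Theta>" "q x \<in> U'" "h' x = (s, y)" by blast
  obtain k' where "\<And>x. x \<in> points W \<Longrightarrow> q x \<in> U' \<Longrightarrow> snd (h' x) = q x \<and> fst (h' x) \<in> points \<Sigma>"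
    by (rule triv[OF x(2)]) blast
  then have qx: "q x = y" using x by force
  have "h x = h' x" by (rule triv_agree[OF x(2) U x(1,3)]) (use qx y x s in auto)
  then show "x = k (s, y)" using kh[of x] x qx y by simp
qed

lemma ident_props:
  assumes s: "s \<in> bdry \<Sigma>" and y: "y \<in> points torus"
  shows "ident (s, y) \<in> bdry W" "q (ident (s, y)) = y"
proof -
  obtain U h where U: "(U, h) \<in> \<Theta>" "y \<in> U" using triv_cover[OF y] by blast
  obtain k where k: "\<And>x. x \<in> points W \<Longrightarrow> q x \<in> U \<Longrightarrow> k (h x) = x"
    "\<And>s y. s \<in> points \<Sigma> \<Longrightarrow> y \<in> U \<Longrightarrow> h (k (s, y)) = (s, y) \<and> k (s, y) \<in> points W \<and> q (k (s, y)) = y"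
    by (rule triv[OF U(1)]) blast
  have sp: "s \<in> points \<Sigma>" using s bdry_points[OF \<Sigma>] by blast
  have eq: "ident (s, y) = k (s, y)" by (rule ident_eq[OF U(1) s U(2)]) (use k(2)[OF sp U(2)] k(1) in auto)
  show "q (ident (s, y)) = y" using k(2)[OF sp U(2)] eq by simp
  show "ident (s, y) \<in> bdry W" using bdry_triv[OF U(1), of "k (s, y)"] k(2)[OF sp U(2)] eq s U(2) by simp
qed

lemma ident_of_bdry:
  assumes U: "(U, h) \<in> \<Theta>" and x: "x \<in> bdry W" "q x \<in> U"
  shows "fst (h x) \<in> bdry \<Sigma>" "ident (fst (h x), q x) = x"
proof -
  have xW: "x \<in> points W" using x bdry_points[OF W] by blast
  obtain k where k: "\<And>x. x \<in> points W \<Longrightarrow> q x \<in> U \<Longrightarrow> k (h x) = x"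
    "\<And>s y. s \<in> points \<Sigma> \<Longrightarrow> y \<in> U \<Longrightarrow> h (k (s, y)) = (s, y) \<and> k (s, y) \<in> points W \<and> q (k (s, y)) = y"
    "\<And>x. x \<in> points W \<Longrightarrow> q x \<in> U \<Longrightarrow> snd (h x) = q x \<and> fst (h x) \<in> points \<Sigma>"
    by (rule triv[OF U(1)]) blast
  show s: "fst (h x) \<in> bdry \<Sigma>" using bdry_triv[OF U xW x(2)] x by simp
  have "fst (h x) \<in> points \<Sigma>" using k(3)[OF xW x(2)] by simp
  then have eq: "ident (fst (h x), q x) = k (fst (h x), q x)"
    by (intro ident_eq[OF U s x(2)]) (use k(2)[of "fst (h x)" "q x"] x k(1) in auto)
  have "(fst (h x), q x) = h x" using k(3)[OF xW x(2)] by (metis prod.collapse)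
  then show "ident (fst (h x), q x) = x" using eq k(1)[OF xW x(2)] by simp
qed

text \<open>On the boundary this is the first component of the inverse of \<open>ident\<close>,
  where the choice of trivialization has no influence. It is meant for boundary points only.\<close>

definition \<sigma> :: "'w \<Rightarrow> 's" where
  "\<sigma> x = fst (snd (SOME t. t \<in> \<Theta> \<and> q x \<in> fst t) x)"

lemma \<sigma>_eq:
  assumes U: "(U, h) \<in> \<Theta>" and x: "x \<in> bdry W" "q x \<in> U" shows "\<sigma> x = fst (h x)"
proof -
  have xW: "x \<in> points W" using x bdry_points[OF W] by blast
  define t where "t = (SOME t. t \<in> \<Theta> \<and> q x \<in> fst t)"
  have "\<exists>t. t \<in> \<Theta> \<and> q x \<in> fst t" using U x by (intro exI[of _ "(U, h)"]) simp
  then have t: "t \<in> \<Theta> \<and> q x \<in> fst t" unfolding t_def by (rule someI_ex)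
  have "snd t x = h x"
    by (rule triv_agree[of U h "fst t"]) (use U t x xW ident_of_bdry(1)[OF U x] in auto)
  then show ?thesis by (simp add: \<sigma>_def t_def)
qed

abbreviation bdryT :: "'s topology" where "bdryT \<equiv> subtopology (mtop \<Sigma>) (bdry \<Sigma>)"

lemma topspace_bdryT [simp]: "topspace bdryT = bdry \<Sigma>"
  using bdry_points[OF \<Sigma>] by auto

lemma bdryT_props: "compact_space bdryT" "connected_space bdryT" "Hausdorff_space bdryT"
proof -
  show "compact_space bdryT"
    using closedin_compact_space[OF \<Sigma>_compact closedin_bdry[OF \<Sigma>]] by (rule compact_space_subtopology)
  show "connected_space bdryT" using \<Sigma>_bdry(2) by (simp add: connectedin_def)
  show "Hausdorff_space bdryT" using \<Sigma>_manifold by (simp add: smooth_manifold_def Hausdorff_space_subtopology)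
qed

lemma continuous_map_ident: "continuous_map (prod_topology bdryT (mtop torus)) (subtopology (mtop W) (bdry W)) ident"
  unfolding continuous_map_in_subtopology
proof
  let ?P = "prod_topology bdryT (mtop torus)"
  show "ident \<in> topspace ?P \<rightarrow> bdry W" using ident_props(1) by auto
  show "continuous_map ?P (mtop W) ident"
    unfolding continuous_map_def
  proof (intro conjI allI impI)
    show "ident \<in> topspace ?P \<rightarrow> points W" using ident_props(1) bdry_points[OF W] by auto
    fix T assume T: "openin (mtop W) T"
    show "openin ?P {w\<in>topspace ?P. ident w \<in> T}"
    proof (subst openin_subopen, intro ballI)
      fix w assume w: "w \<in> {w\<in>topspace ?P. ident w \<in> T}"
      obtain s y where sy: "w = (s, y)" "s \<in> bdry \<Sigma>" "y \<in> points torus" using w by auto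
      obtain U h where U: "(U, h) \<in> \<Theta>" "y \<in> U" using triv_cover[OF sy(3)] by blast
      obtain k where k: "smooth_map (prod_mfd \<Sigma> (open_submfd torus U)) (open_submfd W (over U)) k"
        "\<And>x. x \<in> points W \<Longrightarrow> q x \<in> U \<Longrightarrow> k (h x) = x"
        "\<And>s y. s \<in> points \<Sigma> \<Longrightarrow> y \<in> U \<Longrightarrow> h (k (s, y)) = (s, y) \<and> k (s, y) \<in> points W \<and> q (k (s, y)) = y"
        by (rule triv[OF U(1)]) blast
      have eq: "ident (s, y) = k (s, y)" if "s \<in> bdry \<Sigma>" "y \<in> U" for s y
        by (rule ident_eq[OF U(1) that]) (use k(3)[of s y] k(2) that bdry_points[OF \<Sigma>] in auto)
      have opU: "openin (mtop torus) U" by (rule triv_open(1)[OF U(1)])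
      have "continuous_map (prod_topology (mtop \<Sigma>) (subtopology (mtop torus) U)) (mtop W) k"
        using k(1) by (auto simp: smooth_map_def continuous_map_in_subtopology)
      then have "openin (prod_topology (mtop \<Sigma>) (subtopology (mtop torus) U))
          {w \<in> topspace (prod_topology (mtop \<Sigma>) (subtopology (mtop torus) U)). k w \<in> T}" (is "openin _ ?A")
        using T by (rule openin_continuous_map_preimage)
      moreover have "(s, y) \<in> ?A"
        using w sy U(2) eq[OF sy(2) U(2)] bdry_points[OF \<Sigma>] by auto
      ultimately obtain A B where AB: "openin (mtop \<Sigma>) A" "openin (subtopology (mtop torus) U) B" "s \<in> A" "y \<in> B" "A \<times> B \<subseteq> ?A"
        unfolding openin_prod_topology_alt by meson
      have B: "openin (mtop torus) B" "B \<subseteq> U" using AB(2) by (auto simp: openin_open_subtopology[OF opU])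
      have "openin bdryT (A \<inter> bdry \<Sigma>)" using AB(1) by (auto simp: openin_subtopology)
      then have "openin ?P ((A \<inter> bdry \<Sigma>) \<times> B)" using B(1) by (simp add: openin_prod_Times_iff)
      moreover have "(A \<inter> bdry \<Sigma>) \<times> B \<subseteq> {w\<in>topspace ?P. ident w \<in> T}"
      proof
        fix v assume "v \<in> (A \<inter> bdry \<Sigma>) \<times> B"
        then obtain s' y' where v: "v = (s', y')" "s' \<in> A" "s' \<in> bdry \<Sigma>" "y' \<in> B" by blast
        have "k (s', y') \<in> T" using AB(5) v by blast
        moreover have "y' \<in> points torus" using openin_subset[OF B(1)] v by blast
        ultimately show "v \<in> {w\<in>topspace ?P. ident w \<in> T}" using v eq[of s' y'] B(2) bdry_points[OF \<Sigma>] by auto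
      qed
      ultimately show "\<exists>A. openin ?P A \<and> w \<in> A \<and> A \<subseteq> {w\<in>topspace ?P. ident w \<in> T}"
        using sy AB by (intro exI[of _ "(A \<inter> bdry \<Sigma>) \<times> B"]) auto
    qed
  qed
qed

abbreviation bdryW :: "'w topology" where "bdryW \<equiv> subtopology (mtop W) (bdry W)"

lemma topspace_bdryW [simp]: "topspace bdryW = bdry W"
  using bdry_points[OF W] by auto

lemma continuous_map_\<sigma>: "continuous_map bdryW bdryT \<sigma>"
  unfolding continuous_map_def
proof (intro conjI allI impI)
  have \<sigma>b: "\<sigma> x \<in> bdry \<Sigma>" if x: "x \<in> bdry W" for x
  proof -
    have "q x \<in> points torus" using smooth_map_points[OF q] x bdry_points[OF W] by blast
    then obtain U h where U: "(U, h) \<in> \<Theta>" "q x \<in> U" using triv_cover by blast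
    then show ?thesis using \<sigma>_eq[OF U(1) x U(2)] ident_of_bdry(1)[OF U(1) x U(2)] by simp
  qed
  then show "\<sigma> \<in> topspace bdryW \<rightarrow> topspace bdryT" using bdry_points[OF \<Sigma>] by auto
  fix T assume T: "openin bdryT T"
  then obtain T' where T': "openin (mtop \<Sigma>) T'" "T = T' \<inter> bdry \<Sigma>" by (auto simp: openin_subtopology)
  show "openin bdryW {x\<in>topspace bdryW. \<sigma> x \<in> T}"
  proof (subst openin_subopen, intro ballI)
    fix x assume x: "x \<in> {x\<in>topspace bdryW. \<sigma> x \<in> T}"
    then have xb: "x \<in> bdry W" "\<sigma> x \<in> T" by auto
    have "q x \<in> points torus" using smooth_map_points[OF q] xb bdry_points[OF W] by blast
    then obtain U h where U: "(U, h) \<in> \<Theta>" "q x \<in> U" using triv_cover by blast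
    have sh: "smooth_map (open_submfd W (over U)) (prod_mfd \<Sigma> (open_submfd torus U)) h"
      by (rule triv[OF U(1)]) blast
    have "continuous_map (subtopology (mtop W) (over U)) (mtop \<Sigma>) (\<lambda>x. fst (h x))"
      using continuous_map_compose[OF _ continuous_map_fst, of "subtopology (mtop W) (over U)" "mtop \<Sigma>" "subtopology (mtop torus) U" h] sh
      by (simp add: smooth_map_def comp_def)
    from openin_continuous_map_preimage[OF this T'(1)]
    have op: "openin (mtop W) {x\<in>over U. fst (h x) \<in> T'}"
      using openin_open_subtopology[OF triv_open(2)[OF U(1)]] by (auto simp: Int_def conj_ac)
    show "\<exists>A. openin bdryW A \<and> x \<in> A \<and> A \<subseteq> {x\<in>topspace bdryW. \<sigma> x \<in> T}"
    proof (intro exI conjI)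
      show "openin bdryW ({x\<in>over U. fst (h x) \<in> T'} \<inter> bdry W)" using op by (auto simp: openin_subtopology)
      show "x \<in> {x\<in>over U. fst (h x) \<in> T'} \<inter> bdry W"
        using xb U \<sigma>_eq[OF U(1) xb(1) U(2)] T'(2) bdry_points[OF W] by auto
      show "{x\<in>over U. fst (h x) \<in> T'} \<inter> bdry W \<subseteq> {x\<in>topspace bdryW. \<sigma> x \<in> T}"
      proof
        fix y assume y: "y \<in> {x\<in>over U. fst (h x) \<in> T'} \<inter> bdry W"
        then have "\<sigma> y = fst (h y)" using \<sigma>_eq[OF U(1), of y] by blast
        then show "y \<in> {x\<in>topspace bdryW. \<sigma> x \<in> T}" using y T'(2) \<sigma>b[of y] by auto
      qed
    qed
  qed
qed

text \<open>Transport \<pi> to the product by \<open>ident\<close>, factor it there with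
  \<open>bdry \<Sigma>\<close> as the parameter space, and pull the result back along
  \<open>x \<mapsto> (\<sigma> x, q x)\<close>.\<close>

lemma bdry_factorization:
  assumes \<pi>: "continuous_map bdryW circ \<pi>" and c: "norm c = 1" and b: "b \<in> points torus"
    and fiber: "\<And>s. s \<in> bdry \<Sigma> \<Longrightarrow> \<pi> (ident (s, b)) = c"
  obtains m n :: int and f where "continuous_map bdryW euclideanreal f"
    "\<And>x. x \<in> bdry W \<Longrightarrow> \<pi> x = fst (q x) powi m * snd (q x) powi n * cis (f x)"
proof -
  have \<pi>': "continuous_map bdryW euclidean \<pi>" and \<pi>n: "\<And>x. x \<in> bdry W \<Longrightarrow> norm (\<pi> x) = 1"
    using \<pi> bdry_points[OF W] by (auto simp: continuous_map_in_subtopology Pi_iff)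
  have u: "continuous_map (prod_topology bdryT (prod_topology circ circ)) euclidean (\<lambda>w. \<pi> (ident w))"
    using continuous_map_compose[OF continuous_map_ident \<pi>'] by (simp add: mtop_torus comp_def)
  obtain m n :: int and f where f: "continuous_map (prod_topology bdryT (prod_topology circ circ)) euclideanreal f"
    "\<And>x y z. x \<in> topspace bdryT \<Longrightarrow> norm y = 1 \<Longrightarrow> norm z = 1 \<Longrightarrow> \<pi> (ident (x, y, z)) = y powi m * z powi n * cis (f (x, y, z))"
  proof (rule torus_factor[OF bdryT_props u])
    show "norm (\<pi> (ident (x, y, z))) = 1" if "x \<in> topspace bdryT" "norm y = 1" "norm z = 1" for x y z
      using that ident_props(1)[of x "(y, z)"] \<pi>n by (simp add: points_torus)
    show "norm (fst b) = 1" "norm (snd b) = 1" using b by (simp_all add: points_torus)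
    show "norm c = 1" by (rule c)
    show "\<pi> (ident (x, fst b, snd b)) = c" if "x \<in> topspace bdryT" for x using fiber that by simp
  qed (rule that)
  have qc: "continuous_map bdryW (prod_topology circ circ) q"
    using q by (simp add: smooth_map_def mtop_torus continuous_map_from_subtopology)
  have "continuous_map bdryW euclideanreal (\<lambda>x. f (\<sigma> x, q x))"
    using continuous_map_compose[OF continuous_map_pairedI[OF continuous_map_\<sigma> qc] f(1)] by (simp add: comp_def)
  moreover have "\<pi> x = fst (q x) powi m * snd (q x) powi n * cis (f (\<sigma> x, q x))" if x: "x \<in> bdry W" for x
  proof -
    have qx: "q x \<in> points torus" using smooth_map_points[OF q] x bdry_points[OF W] by blast
    then obtain U h where U: "(U, h) \<in> \<Theta>" "q x \<in> U" using triv_cover by blast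
    have "\<sigma> x \<in> bdry \<Sigma>" "ident (\<sigma> x, q x) = x"
      using \<sigma>_eq[OF U(1) x U(2)] ident_of_bdry[OF U(1) x U(2)] by auto
    then show ?thesis using f(2)[of "\<sigma> x" "fst (q x)" "snd (q x)"] qx topspace_bdryT by (simp add: points_torus del: topspace_subtopology)
  qed
  ultimately show thesis by (rule that)
qed

lemma bdry_W_nonempty: "bdry W \<noteq> {}"
proof -
  obtain s where "s \<in> bdry \<Sigma>" using \<Sigma>_bdry(1) by blast
  then show ?thesis using ident_props(1)[of s "(1, 1)"] by (auto simp: points_torus)
qed

section \<open>The projection in coordinates\<close>

lemma q_norm: "x \<in> points W \<Longrightarrow> norm (fst (q x)) = 1 \<and> norm (snd (q x)) = 1"
  using smooth_map_points[OF q] by (simp add: points_torus)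

lemma q_smooth:
  assumes x: "x \<in> points W" shows "smooth_at W (\<lambda>x. fst (q x)) x" "smooth_at W (\<lambda>x. snd (q x)) x"
proof -
  have y: "fst (q x) \<in> points circle" "snd (q x) \<in> points circle" using q_norm[OF x] by auto
  have "smooth_at (prod_mfd circle circle) (\<lambda>w. fst w) (fst (q x), snd (q x))"
    by (rule smooth_at_prod_fst[OF premfd_circle smooth_at_circle_ident y(2)]) (use y in simp)
  then have "smooth_at torus (\<lambda>w. fst w) (q x)" unfolding torus_def prod.collapse .
  then show "smooth_at W (\<lambda>x. fst (q x)) x" by (rule smooth_map_smooth_at[OF W premfd_torus q x])
  have "smooth_at (prod_mfd circle circle) (\<lambda>w. snd w) (fst (q x), snd (q x))"
    by (rule smooth_at_prod_snd[OF premfd_circle smooth_at_circle_ident y(1)]) (use y in simp)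
  then have "smooth_at torus (\<lambda>w. snd w) (q x)" unfolding torus_def prod.collapse .
  then show "smooth_at W (\<lambda>x. snd (q x)) x" by (rule smooth_map_smooth_at[OF W premfd_torus q x])
qed

text \<open>A chart of \<Sigma> times branches of the two base angles. The product model keeps fiber
  and base directions apart, and the half-space vector lies in the fiber factor because the torus
  has no boundary.\<close>

lemma q_chart:
  assumes x: "x \<in> points W"
  obtains U and \<kappa> :: "'w \<Rightarrow> (real ^ 2) \<times> (real \<times> real)" and u where "x \<in> U" "hchart W U \<kappa> (u, 0)"
    "\<And>y. y \<in> U \<Longrightarrow> q y = (cis (fst (snd (\<kappa> y))), cis (snd (snd (\<kappa> y))))"
proof -
  have "q x \<in> points torus" by (rule smooth_map_points[OF q x])
  then obtain U h where U: "(U, h) \<in> \<Theta>" "q x \<in> U" using triv_cover by blast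
  obtain k where k: "smooth_map (open_submfd W (over U)) (prod_mfd \<Sigma> (open_submfd torus U)) h"
    "smooth_map (prod_mfd \<Sigma> (open_submfd torus U)) (open_submfd W (over U)) k"
    "\<And>x. x \<in> points W \<Longrightarrow> q x \<in> U \<Longrightarrow> k (h x) = x"
    "\<And>s y. s \<in> points \<Sigma> \<Longrightarrow> y \<in> U \<Longrightarrow> h (k (s, y)) = (s, y) \<and> k (s, y) \<in> points W \<and> q (k (s, y)) = y"
    "\<And>x. x \<in> points W \<Longrightarrow> q x \<in> U \<Longrightarrow> snd (h x) = q x \<and> fst (h x) \<in> points \<Sigma>"
    by (rule triv[OF U(1)]) blast
  note pm = premfd_triv[OF U(1)] and opU = triv_open[OF U(1)]
  have ptsU: "points (open_submfd torus U) = U" using openin_subset[OF opU(1)] by auto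
  have "fst (h x) \<in> points \<Sigma>" using k(5)[OF x U(2)] by simp
  then obtain V \<psi> where V: "(V, \<psi>) \<in> atlas \<Sigma>" "fst (h x) \<in> V" by (rule premfd_chart[OF \<Sigma>])
  obtain u where u: "hchart \<Sigma> V \<psi> u" by (rule smooth_manifold_hchart[OF \<Sigma>_manifold V(1)])
  have "q x \<in> points (open_submfd torus U)" using U ptsU by simp
  then obtain B \<xi> where B: "(B, \<xi>) \<in> atlas (open_submfd torus U)" "q x \<in> B" by (rule premfd_chart[OF pm(2)])
  obtain B' where B': "(B', \<xi>) \<in> atlas torus" "B = B' \<inter> U" using B(1) by (auto simp: atlas_open_submfd)
  obtain t1 t2 where t: "B' = carc t1 \<times> carc t2" "\<xi> = map_prod (cangle t1) (cangle t2)"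
    using B'(1) unfolding torus_def atlas_prod_mfd atlas_circle by blast
  have gcB: "gchart (open_submfd torus U) B \<xi>" by (rule gchart_atlas[OF pm(2) B(1)])
  have opB: "open (\<xi> ` B)"
  proof -
    have "\<xi> y \<in> interior (\<xi> ` B)" if "y \<in> B" for y
    proof -
      have yU: "y \<in> U" using that B'(2) by blast
      have "y \<notin> bdry (open_submfd torus U)"
        using bdry_open_submfd[OF premfd_torus opU(1) yU] bdry_torus[of y] openin_subset[OF opU(1)] yU by blast
      then show ?thesis using bdry_iff[OF pm(2) gcB that] by simp
    qed
    then show ?thesis by (metis imageE interior_subset open_interior subsetI subset_antisym)
  qed
  have gcP: "gchart (prod_mfd \<Sigma> (open_submfd torus U)) (V \<times> B) (map_prod \<psi> \<xi>)"
    by (rule gchart_prod[OF gchart_atlas[OF \<Sigma> V(1)] gcB])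
  define \<kappa> where "\<kappa> y = map_prod \<psi> \<xi> (h y)" for y
  define A where "A = {y \<in> points (open_submfd W (over U)). h y \<in> V \<times> B}"
  have kh: "k (h y) = y" if "y \<in> points (open_submfd W (over U))" for y using k(3) that by auto
  have hk: "h (k w) = w" if "w \<in> points (prod_mfd \<Sigma> (open_submfd torus U))" for w
    using k(4)[of "fst w" "snd w"] that ptsU by (cases w) auto
  have gcA: "gchart (open_submfd W (over U)) A \<kappa>" and imA: "\<kappa> ` A = map_prod \<psi> \<xi> ` (V \<times> B)"
    unfolding A_def \<kappa>_def
    using gchart_diffeo[OF pm(1,3) k(1,2) kh hk gcP] by (simp_all only:)
  have gcW: "gchart W A \<kappa>" using gcA gchart_open_submfd[OF W opU(2)] by blast
  obtain N where N: "open N" "\<psi> ` V = {x. 0 \<le> x \<bullet> u} \<inter> N" using u by (auto simp: hchart_def openin_open)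
  have "\<kappa> ` A = {z. 0 \<le> z \<bullet> (u, 0)} \<inter> N \<times> \<xi> ` B"
  proof -
    have "map_prod \<psi> \<xi> ` (V \<times> B) = (\<psi> ` V) \<times> (\<xi> ` B)" by auto
    then show ?thesis unfolding imA using N(2) by auto
  qed
  then have hcW: "hchart W A \<kappa> (u, 0)"
    unfolding hchart_def using gcW N(1) opB by (auto intro!: openin_open_Int open_Times)
  have qA: "q y = (cis (fst (snd (\<kappa> y))), cis (snd (snd (\<kappa> y))))" if y: "y \<in> A" for y
  proof -
    have "y \<in> points W" "q y \<in> U" "h y \<in> V \<times> B" using y by (auto simp: A_def)
    moreover have "snd (h y) = q y" using k(5) calculation by blast
    ultimately have hy: "h y = (fst (h y), q y)" and qB: "q y \<in> B" by (metis prod.collapse, metis mem_Times_iff)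
    have "q y \<in> carc t1 \<times> carc t2" using qB B'(2) t(1) by blast
    then have q12: "fst (q y) \<in> carc t1" "snd (q y) \<in> carc t2" by (simp_all only: mem_Times_iff)
    have "snd (\<kappa> y) = map_prod (cangle t1) (cangle t2) (q y)" unfolding \<kappa>_def t(2) by (subst hy) simp
    then have "cis (fst (snd (\<kappa> y))) = fst (q y)" "cis (snd (snd (\<kappa> y))) = snd (q y)"
      using cis_angle(1)[OF q12(1)] cis_angle(1)[OF q12(2)] by (simp_all only: fst_map_prod snd_map_prod)
    then show ?thesis by simp
  qed
  have "x \<in> A" using x U V(2) B(2) k(5)[OF x U(2)] by (auto simp: A_def mem_Times_iff)
  then show thesis using that hcW qA by blast
qed

end

section \<open>Boundary functions and their extensions\<close>

text \<open>Near 0 both \<open>t\<close> and \<open>h t\<close> lie between -pi and pi, where the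
  argument of a unimodular number is unique.\<close>

lemma eventually_lift_eq:
  fixes h :: "real \<Rightarrow> real"
  assumes "isCont h 0" "h 0 = 0" "\<delta> > 0" "\<And>t. \<bar>t\<bar> < \<delta> \<Longrightarrow> cis (h t) = cis t"
  shows "\<forall>\<^sub>F t in nhds 0. h t = t"
proof -
  have "(h \<longlongrightarrow> h 0) (nhds 0)" using assms(1) unfolding continuous_at tendsto_at_iff_tendsto_nhds .
  then have "\<forall>\<^sub>F t in nhds 0. dist (h t) 0 < pi" unfolding assms(2) by (rule tendstoD) simp
  moreover have "\<forall>\<^sub>F t in nhds (0::real). dist t 0 < min \<delta> pi"
    using assms(3) by (intro eventually_nhds_metric[THEN iffD2] exI[of _ "min \<delta> pi"]) auto
  ultimately show ?thesis
  proof eventually_elim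
    case (elim t)
    then show ?case using cis_close(2)[of t] cis_close(2)[of "h t"] assms(4)[of t] by (simp add: dist_real_def)
  qed
qed

text \<open>As long as \<open>f y\<close> stays within pi of \<open>f x\<close>, the difference is
  the principal argument of \<open>w y / w x\<close>, which is smooth; continuity of
  \<open>f\<close> guarantees this near \<open>x\<close>.\<close>

lemma smooth_at_lift:
  fixes f :: "'a \<Rightarrow> real"
  assumes M: "premfd M" and f: "continuous_map (mtop M) euclideanreal f" and x: "x \<in> points M"
    and w: "smooth_at M w x" "\<And>y. y \<in> points M \<Longrightarrow> w y = cis (f y)"
  shows "smooth_at M f x"
proof -
  define A where "A = {y \<in> points M. f y \<in> ball (f x) pi}"
  have A: "openin (mtop M) A" unfolding A_def by (rule openin_continuous_map_preimage[OF f]) simp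
  have "w x / w x \<notin> \<real>\<^sub>\<le>\<^sub>0" using w(2)[OF x] by simp
  then have "smooth_at M (\<lambda>y. Im (Ln (w y / w x))) x"
    by (intro smooth_at_Im_Ln w(1)) (simp_all add: w(2)[OF x])
  then have "smooth_at M (\<lambda>y. f x + Im (Ln (w y / w x))) x"
    by (rule smooth_at_add[OF M smooth_at_const[OF M x]])
  then show ?thesis
  proof (rule smooth_at_cong[OF M _ A])
    show "x \<in> A" using x by (simp add: A_def)
    fix y assume y: "y \<in> A"
    then have "w y / w x = cis (f y - f x)" using w(2) x by (simp add: A_def cis_divide)
    moreover have "\<bar>f y - f x\<bar> < pi" using y by (simp add: A_def dist_real_def abs_minus_commute)
    ultimately show "f x + Im (Ln (w y / w x)) = f y" using cis_close(2) by simp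
  qed
qed

text \<open>Freezing the fiber coordinate of a local trivialization gives a section through
  \<open>x\<close>; followed along \<open>\<pi> x * cis t\<close>, it is a curve on which the angle
  of \<pi> grows at unit speed. It plays the part of a tangent vector, tested only through the
  differentiability of \<open>f\<close> along it. Its continuity keeps it inside a given chart
  domain for small \<open>t\<close>.\<close>

lemma fiber_bundle_curve:
  fixes f :: "'a \<Rightarrow> 'b::euclidean_space"
  assumes B: "premfd B" and F\<pi>: "fiber_bundle F B circle \<pi>" and x: "x \<in> points B" and f: "smooth_at B f x"
  obtains c and \<delta> :: real where "\<delta> > 0" "c 0 = x"
    "\<And>t. \<bar>t\<bar> < \<delta> \<Longrightarrow> c t \<in> points B \<and> \<pi> (c t) = \<pi> x * cis t"
    "(\<lambda>t. f (c t)) differentiable (at 0)" "continuous_map (top_of_set (ball 0 \<delta>)) (mtop B) c"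
proof -
  have F: "premfd F" using F\<pi> by (simp add: fiber_bundle_def smooth_manifold_imp_premfd)
  have \<pi>: "smooth_map B circle \<pi>" using F\<pi> by (simp add: fiber_bundle_def)
  have \<pi>x: "\<pi> x \<in> points circle" by (rule smooth_map_points[OF \<pi> x])
  obtain V h where V: "\<pi> x \<in> V" and lt: "local_trivialization F B circle \<pi> (V, h)"
    using F\<pi> \<pi>x unfolding fiber_bundle_def by blast
  define A where "A = {y \<in> points B. \<pi> y \<in> V}"
  have opV: "openin (mtop circle) V" and d: "diffeomorphism (open_submfd B A) (prod_mfd F (open_submfd circle V)) h"
    and snd: "\<And>y. y \<in> points B \<Longrightarrow> \<pi> y \<in> V \<Longrightarrow> snd (h y) = \<pi> y"
    using lt by (auto simp: local_trivialization_def A_def)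
  have opA: "openin (mtop B) A" unfolding A_def
    by (rule openin_continuous_map_preimage[OF _ opV]) (use \<pi> in \<open>simp add: smooth_map_def\<close>)
  have ptsA: "points (open_submfd B A) = A" by (auto simp: A_def)
  have ptsV: "points (open_submfd circle V) = V" using openin_subset[OF opV] by auto
  note pA = premfd_open_submfd[OF B opA] and pV = premfd_open_submfd[OF premfd_circle opV]
  obtain k where k: "smooth_map (open_submfd B A) (prod_mfd F (open_submfd circle V)) h"
    "smooth_map (prod_mfd F (open_submfd circle V)) (open_submfd B A) k"
    "\<And>y. y \<in> points (open_submfd B A) \<Longrightarrow> k (h y) = y"
    "\<And>w. w \<in> points (prod_mfd F (open_submfd circle V)) \<Longrightarrow> h (k w) = w"
    by (rule diffeomorphismE[OF d]) blast
  have xA: "x \<in> A" using x V by (simp add: A_def)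
  have hx: "h x = (fst (h x), \<pi> x)" using snd[OF x V] by (metis prod.collapse)
  have a: "fst (h x) \<in> points F" using smooth_map_points[OF k(1), of x] xA ptsA by (cases "h x") auto
  define s where "s z = k (fst (h x), z)" for z
  have s: "s z \<in> points B \<and> \<pi> (s z) = z" if z: "z \<in> V" for z
  proof -
    have w: "(fst (h x), z) \<in> points (prod_mfd F (open_submfd circle V))" using a z ptsV by simp
    have "s z \<in> A" using smooth_map_points[OF k(2) w] ptsA by (simp add: s_def)
    then show ?thesis using k(4)[OF w] snd[of "s z"] by (simp add: s_def A_def)
  qed
  have sx: "s (\<pi> x) = x" using k(3)[of x] xA x ptsA hx by (simp add: s_def)
  have "continuous_map (prod_topology (mtop F) (subtopology circ V)) (mtop B) k"
    using k(2) by (simp add: smooth_map_def open_submfd_def continuous_map_in_subtopology)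
  from continuous_map_compose[OF continuous_map_pairedI[OF continuous_map_const[THEN iffD2] continuous_map_id] this]
  have s_cont: "continuous_map (subtopology circ V) (mtop B) s"
    using a by (simp add: comp_def s_def[abs_def])
  have "smooth_at (open_submfd B A) f x" by (rule iffD2[OF smooth_at_open_submfd[OF B opA xA] f])
  then have "smooth_at (open_submfd B A) f (k (fst (h x), \<pi> x))" using sx by (simp add: s_def)
  then have "smooth_at (prod_mfd F (open_submfd circle V)) (\<lambda>w. f (k w)) (fst (h x), \<pi> x)"
    by (intro smooth_map_smooth_at[OF premfd_prod[OF F pV] pA k(2)]) (use a V ptsV in auto)
  then have "smooth_at (open_submfd circle V) (\<lambda>z. f (s z)) (\<pi> x)"
    unfolding s_def by (rule smooth_at_slice_snd)
  then have "smooth_at circle (\<lambda>z. f (s z)) (\<pi> x)" by (rule iffD1[OF smooth_at_open_submfd[OF premfd_circle opV V]])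
  then obtain U \<phi> N g where g: "(U, \<phi>) \<in> atlas circle" "\<pi> x \<in> U" "\<phi> (\<pi> x) \<in> N" "Cinf_on g N"
    "\<And>z. z \<in> U \<Longrightarrow> \<phi> z \<in> N \<Longrightarrow> f (s z) = g (\<phi> z)"
    by (rule smooth_atE) blast
  obtain t0 where t0: "U = carc t0" "\<phi> = cangle t0" using g(1) by (auto simp: atlas_circle)
  define a where "a = cangle t0 (\<pi> x)"
  have a: "a \<in> {t0<..<t0 + 2 * pi}" "cis a = \<pi> x" using cis_angle[of "\<pi> x" t0] g(2) t0 by (simp_all add: a_def)
  obtain T where T: "open T" "V = sphere 0 1 \<inter> T" using opV by (auto simp: openin_open)
  have "continuous_on UNIV (\<lambda>t. cis (a + t))" by (intro continuous_intros)
  then have "open ((\<lambda>t. cis (a + t)) -` T \<inter> (\<lambda>t. a + t) -` (N \<inter> {t0<..<t0 + 2 * pi}))" (is "open ?O")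
    using T(1) Cinf_on_open[OF g(4)] by (intro open_Int open_vimage continuous_intros) auto
  moreover have "0 \<in> ?O" using a g(3) T(2) V t0 by (simp add: a_def)
  ultimately obtain \<delta> where \<delta>: "\<delta> > 0" "ball 0 \<delta> \<subseteq> ?O" by (rule openE)
  have eq: "f (s (\<pi> x * cis t)) = g (a + t)" and inV: "\<pi> x * cis t \<in> V" if t: "\<bar>t\<bar> < \<delta>" for t
  proof -
    have "t \<in> ?O" using t \<delta>(2) by (auto simp: dist_real_def)
    then have t': "cis (a + t) \<in> T" "a + t \<in> N" "a + t \<in> {t0<..<t0 + 2 * pi}" by auto
    have c: "\<pi> x * cis t = cis (a + t)" using a(2) by (simp add: cis_mult[symmetric])
    show "\<pi> x * cis t \<in> V" unfolding c T(2) using t'(1) by simp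
    have "cis (a + t) \<in> U" "\<phi> (cis (a + t)) = a + t" using t'(3) t0 angle_cis by auto
    then show "f (s (\<pi> x * cis t)) = g (a + t)" unfolding c using g(5)[of "cis (a + t)"] t'(2) by simp
  qed
  have "a \<in> N" using g(3) t0 by (simp add: a_def)
  from Cinf_on_has_derivative[OF g(4) this] have "(g has_derivative frechet_derivative g (at a)) (at (a + 0))" by simp
  moreover have "((\<lambda>t. a + t) has_derivative (\<lambda>t. t)) (at 0)" by (auto intro!: derivative_eq_intros)
  ultimately have "((\<lambda>t. g (a + t)) has_derivative frechet_derivative g (at a)) (at 0)"
    by (rule has_derivative_compose[of "\<lambda>t. a + t" "\<lambda>t. t" 0 UNIV g "frechet_derivative g (at a)", rotated])
  then have "((\<lambda>t. f (s (\<pi> x * cis t))) has_derivative frechet_derivative g (at a)) (at 0)"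
    by (rule has_derivative_transform_within[OF _ \<delta>(1)]) (auto simp: eq dist_real_def)
  then have diff: "(\<lambda>t. f (s (\<pi> x * cis t))) differentiable (at 0)" by (rule differentiableI)
  show thesis
  proof (rule that[OF \<delta>(1), of "\<lambda>t. s (\<pi> x * cis t)"])
    show "s (\<pi> x * cis 0) = x" using sx by simp
    show "s (\<pi> x * cis t) \<in> points B \<and> \<pi> (s (\<pi> x * cis t)) = \<pi> x * cis t" if "\<bar>t\<bar> < \<delta>" for t
      using s[OF inV[OF that]] .
    have "continuous_map (top_of_set (ball 0 \<delta>)) (subtopology circ V) (\<lambda>t. \<pi> x * cis t)"
      using inV \<pi>x unfolding continuous_map_in_subtopology
      by (auto simp: norm_mult dist_real_def intro!: continuous_intros)
    from continuous_map_compose[OF this s_cont]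
    show "continuous_map (top_of_set (ball 0 \<delta>)) (mtop B) (\<lambda>t. s (\<pi> x * cis t))" by (simp add: comp_def)
  qed (rule diff)
qed

text \<open>At a point where a global lift is maximal, the curve of the preceding lemma would make
  the lift increase at unit speed.\<close>

lemma no_global_lift:
  fixes f :: "'a \<Rightarrow> real"
  assumes B: "premfd B" and compact: "compact_space (mtop B)" and ne: "points B \<noteq> {}"
    and F\<pi>: "fiber_bundle F B circle \<pi>"
    and f: "\<And>x. x \<in> points B \<Longrightarrow> smooth_at B f x" and lift: "\<And>x. x \<in> points B \<Longrightarrow> \<pi> x = cis (f x)"
  shows False
proof -
  have "compactin euclideanreal (f ` points B)"
    using compact by (intro image_compactin[of "mtop B"] smooth_at_continuous_map[OF B f]) (auto simp: compact_space_def)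
  then have "compact (f ` points B)" by simp
  then obtain x where x: "x \<in> points B" "\<And>y. y \<in> points B \<Longrightarrow> f y \<le> f x"
    using compact_attains_sup[of "f ` points B"] ne by auto
  obtain c \<delta> where c: "\<delta> > 0" "c 0 = x" "\<And>t. \<bar>t\<bar> < \<delta> \<Longrightarrow> c t \<in> points B \<and> \<pi> (c t) = \<pi> x * cis t"
    "(\<lambda>t. f (c t)) differentiable (at 0)"
    by (rule fiber_bundle_curve[OF B F\<pi> x(1) f[OF x(1)]]) (rule that)
  define h where "h t = f (c t) - f x" for t
  have "isCont (\<lambda>t. f (c t)) 0" using c(4) by (rule differentiable_imp_continuous_within)
  then have "isCont h 0" unfolding h_def by (intro continuous_intros)
  then have "\<forall>\<^sub>F t in nhds 0. h t = t"
  proof (rule eventually_lift_eq[OF _ _ c(1)])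
    show "h 0 = 0" by (simp add: h_def c(2))
    fix t :: real assume t: "\<bar>t\<bar> < \<delta>"
    have "cis (h t) = \<pi> (c t) / \<pi> x" using lift[of "c t"] lift[OF x(1)] c(3)[OF t] by (simp only: h_def cis_divide)
    also have "\<dots> = cis t" using c(3)[OF t] lift[OF x(1)] by simp
    finally show "cis (h t) = cis t" .
  qed
  then obtain e where e: "e > 0" "\<And>t. dist t 0 < e \<Longrightarrow> h t = t" unfolding eventually_nhds_metric by blast
  define t where "t = min e \<delta> / 2"
  have t: "0 < t" "t < e" "t < \<delta>" using e(1) c(1) by (auto simp: t_def)
  then have "h t = t" using e(2)[of t] by simp
  moreover have "f (c t) \<le> f x" using x(2) c(3)[of t] t by simp
  ultimately show False using t(1) by (simp add: h_def)
qed

text \<open>With this profile the derivative equals \<open>- cutoff \<epsilon> s / (\<epsilon> - s)\<^sup>2\<close> for \<open>s < \<epsilon>\<close>, so for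
  \<open>\<epsilon> \<le> 1\<close> it dominates the value even where both become small.\<close>

definition cutoff :: "real \<Rightarrow> real \<Rightarrow> real" where
  "cutoff \<epsilon> s = flat 0 (\<epsilon> - s) / flat 0 \<epsilon>"

lemma cutoff_0: "\<epsilon> > 0 \<Longrightarrow> cutoff \<epsilon> 0 = 1"
  using flat_0_pos[of \<epsilon>] by (auto simp: cutoff_def simp del: flat_0_pos)

lemma cutoff_has_derivative:
  "(cutoff \<epsilon> has_real_derivative - (flat 2 (\<epsilon> - s) / flat 0 \<epsilon>)) (at s)"
proof -
  have "((\<lambda>s. \<epsilon> - s) has_real_derivative - 1) (at s)" by (auto intro!: derivative_eq_intros)
  from DERIV_cdivide[OF DERIV_chain2[OF flat_has_derivative this, of 0], of "flat 0 \<epsilon>"]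
  show ?thesis by (simp add: cutoff_def[abs_def] numeral_2_eq_2)
qed

lemma Cinf_on_cutoff: "Cinf_on (cutoff \<epsilon>) UNIV"
proof -
  have "Cinf_on (\<lambda>s. flat 0 (\<epsilon> - s)) UNIV"
    by (rule Cinf_on_compose[OF Cinf_on_diff Cinf_on_flat]) auto
  then have "Cinf_on (\<lambda>s. flat 0 (\<epsilon> - s) * (1 / flat 0 \<epsilon>)) UNIV" by (rule Cinf_on_mult) simp
  then show ?thesis by (simp add: cutoff_def[abs_def])
qed

lemma flat_2: "flat 2 s = flat 0 s * (inverse s)\<^sup>2"
  by (simp add: flat_def)

section \<open>A boundary defining function and a uniform collar\<close>

context torus_bundle
begin

definition product_chart :: "'w set \<Rightarrow> ('w \<Rightarrow> (real ^ 2) \<times> (real \<times> real)) \<Rightarrow> real ^ 2 \<Rightarrow> bool" where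
  "product_chart U \<kappa> u \<longleftrightarrow> hchart W U \<kappa> (u, 0) \<and>
     (\<forall>y\<in>U. q y = (cis (fst (snd (\<kappa> y))), cis (snd (snd (\<kappa> y)))))"

lemma product_chartD:
  assumes "product_chart U \<kappa> u"
  shows "hchart W U \<kappa> (u, 0)" "gchart W U \<kappa>" "openin (mtop W) U" "U \<subseteq> points W"
    "\<And>y. y \<in> U \<Longrightarrow> q y = (cis (fst (snd (\<kappa> y))), cis (snd (snd (\<kappa> y))))"
proof -
  show h: "hchart W U \<kappa> (u, 0)" using assms by (simp add: product_chart_def)
  show g: "gchart W U \<kappa>" by (rule hchart_gchart[OF h])
  show "openin (mtop W) U" "U \<subseteq> points W" by (rule gchart_openin[OF g], rule gchart_points[OF g])
  show "\<And>y. y \<in> U \<Longrightarrow> q y = (cis (fst (snd (\<kappa> y))), cis (snd (snd (\<kappa> y))))"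
    using assms by (simp add: product_chart_def)
qed

lemma bdry_product_chart:
  assumes "product_chart U \<kappa> u" "x \<in> U"
  shows "x \<in> bdry W \<longleftrightarrow> u \<noteq> 0 \<and> \<kappa> x \<bullet> (u, 0) = 0"
proof -
  have "((u, 0) :: (real ^ 2) \<times> (real \<times> real)) = 0 \<longleftrightarrow> u = 0" by (simp add: prod_eq_iff)
  then show ?thesis using hchart_bdry_iff[OF W product_chartD(1)[OF assms(1)] assms(2)] by simp
qed

text \<open>The value 1 in charts without boundary points keeps the coordinate positive there, so a
  sum of such coordinates weighted by a partition of unity vanishes on the boundary only.\<close>

definition defining_coordinate :: "('w \<Rightarrow> (real ^ 2) \<times> (real \<times> real)) \<Rightarrow> real ^ 2 \<Rightarrow> 'w \<Rightarrow> real" where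
  "defining_coordinate \<kappa> u y = (if u = 0 then 1 else \<kappa> y \<bullet> (u, 0))"

lemma defining_coordinate:
  assumes "product_chart U \<kappa> u" "x \<in> U"
  shows "0 \<le> defining_coordinate \<kappa> u x" "defining_coordinate \<kappa> u x = 0 \<longleftrightarrow> x \<in> bdry W"
    "smooth_at W (defining_coordinate \<kappa> u) x"
proof -
  note D = product_chartD[OF assms(1)]
  show "0 \<le> defining_coordinate \<kappa> u x" using hchart_ge_0[OF D(1) assms(2)] by (simp add: defining_coordinate_def)
  show "defining_coordinate \<kappa> u x = 0 \<longleftrightarrow> x \<in> bdry W"
    using bdry_product_chart[OF assms] by (simp add: defining_coordinate_def)
  have x: "x \<in> points W" using D(4) assms(2) by blast
  have "smooth_at W (\<lambda>y. \<kappa> y \<bullet> (u, 0)) x"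
    by (rule smooth_at_bounded_linear[OF bounded_linear_inner_left gchart_smooth_at[OF D(2) assms(2)]])
  then show "smooth_at W (defining_coordinate \<kappa> u) x"
    using smooth_at_const[OF W x, of "1::real"] by (cases "u = 0") (simp_all add: defining_coordinate_def[abs_def])
qed

text \<open>One partition of unity glues both the local extensions of \<open>f\<close> and the local
  defining coordinates. For the inward derivative of \<open>r\<close> at a boundary point, compare
  with one summand of positive weight: all summands are nonnegative and vanish at that point, so the
  difference quotients of \<open>r\<close> are at least those of this summand.\<close>

lemma boundary_pair:
  fixes f :: "'w \<Rightarrow> real"
  assumes f: "\<And>x. x \<in> bdry W \<Longrightarrow> smooth_at (bdry_mfd W :: ('w, real ^ 3) mfd) f x"
  obtains F r :: "'w \<Rightarrow> real" where
    "\<And>x. x \<in> points W \<Longrightarrow> smooth_at W F x" "\<And>x. x \<in> points W \<Longrightarrow> smooth_at W r x"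
    "\<And>x. x \<in> bdry W \<Longrightarrow> F x = f x"
    "\<And>x. x \<in> points W \<Longrightarrow> 0 \<le> r x" "\<And>x. x \<in> points W \<Longrightarrow> r x = 0 \<longleftrightarrow> x \<in> bdry W"
    "\<And>x. x \<in> bdry W \<Longrightarrow> \<exists>U \<kappa> u N g. x \<in> U \<and> product_chart U \<kappa> u \<and> \<kappa> x \<in> N \<and> Cinf_on g N \<and>
        (\<forall>y\<in>U. \<kappa> y \<in> N \<longrightarrow> r y = g (\<kappa> y)) \<and> frechet_derivative g (at (\<kappa> x)) (u, 0) > 0"
proof -
  interpret B: bdry_manifold W "bdry_mfd W :: ('w, real ^ 3) mfd" by (rule bdry_manifold.intro[OF W_manifold refl]) simp
  define P where "P x U \<kappa> u F \<longleftrightarrow> x \<in> U \<and> product_chart U \<kappa> u \<and>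
      (\<forall>y\<in>U. smooth_at W F y) \<and> (\<forall>y\<in>U \<inter> bdry W. F y = f y)" for x U \<kappa> u and F :: "'w \<Rightarrow> real"
  have ex: "\<exists>U \<kappa> u F. P x U \<kappa> u F" if x: "x \<in> points W" for x
  proof -
    obtain U and \<kappa> :: "'w \<Rightarrow> (real ^ 2) \<times> (real \<times> real)" and u where U: "x \<in> U" "hchart W U \<kappa> (u, 0)"
      "\<And>y. y \<in> U \<Longrightarrow> q y = (cis (fst (snd (\<kappa> y))), cis (snd (snd (\<kappa> y))))"
      by (rule q_chart[OF x]) blast
    have sub: "\<exists>U \<kappa> u F. P x U \<kappa> u F"
      if A: "openin (mtop W) A" "x \<in> A" "\<And>y. y \<in> A \<Longrightarrow> smooth_at W F y" "\<And>y. y \<in> A \<inter> bdry W \<Longrightarrow> F y = f y"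
      for A and F :: "'w \<Rightarrow> real"
    proof -
      have op: "openin (mtop W) (U \<inter> A)" using A(1) gchart_openin[OF hchart_gchart[OF U(2)]] by (rule openin_Int[rotated])
      have "hchart W (U \<inter> A) \<kappa> (u, 0)" by (rule hchart_subset[OF W U(2) op]) simp
      moreover have "q y = (cis (fst (snd (\<kappa> y))), cis (snd (snd (\<kappa> y))))" if "y \<in> U \<inter> A" for y
        using U(3)[of y] that by (simp only: Int_iff)
      ultimately have pc: "product_chart (U \<inter> A) \<kappa> u" unfolding product_chart_def by (intro conjI ballI)
      have "P x (U \<inter> A) \<kappa> u F" unfolding P_def
        by (intro conjI ballI pc) (use U(1) A(2-4) in simp_all)
      then show ?thesis by (intro exI)
    qed
    show ?thesis
    proof (cases "x \<in> bdry W")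
      case True
      obtain F A where "openin (mtop W) A" "x \<in> A" "\<And>y. y \<in> A \<Longrightarrow> smooth_at W F y"
        "\<And>y. y \<in> A \<inter> bdry W \<Longrightarrow> F y = f y"
        by (rule B.smooth_at_extend[OF f[OF True]]) blast
      then show ?thesis by (rule sub)
    next
      case False
      have "openin (mtop W) (points W - bdry W)" by (rule openin_diff[OF openin_topspace closedin_bdry[OF W]])
      then show ?thesis
      proof (rule sub)
        show "x \<in> points W - bdry W" using x False by simp
        show "smooth_at W (\<lambda>_. 0 :: real) y" if "y \<in> points W - bdry W" for y
          using smooth_at_const[OF W] that by blast
        show "0 = f y" if "y \<in> (points W - bdry W) \<inter> bdry W" for y using that by simp
      qed
    qed
  qed
  from ex have "\<forall>x\<in>points W. \<exists>U \<kappa> u F. P x U \<kappa> u F" by (intro ballI)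
  from bchoice[OF this] obtain U where "\<forall>x\<in>points W. \<exists>\<kappa> u F. P x (U x) \<kappa> u F" by (elim exE)
  from bchoice[OF this] obtain \<kappa> where "\<forall>x\<in>points W. \<exists>u F. P x (U x) (\<kappa> x) u F" by (elim exE)
  from bchoice[OF this] obtain u where "\<forall>x\<in>points W. \<exists>F. P x (U x) (\<kappa> x) (u x) F" by (elim exE)
  from bchoice[OF this] obtain G where P: "\<forall>x\<in>points W. P x (U x) (\<kappa> x) (u x) (G x)" by (elim exE)
  have pc: "product_chart (U x) (\<kappa> x) (u x)" and xU: "x \<in> U x" and G: "\<And>y. y \<in> U x \<Longrightarrow> smooth_at W (G x) y"
    and Gb: "\<And>y. y \<in> U x \<inter> bdry W \<Longrightarrow> G x y = f y" if "x \<in> points W" for x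
    using bspec[OF P that] unfolding P_def by simp_all
  have opU: "openin (mtop W) (U x)" if "x \<in> points W" for x using product_chartD(3)[OF pc[OF that]] .
  have haus: "Hausdorff_space (mtop W)" using W_manifold by (simp add: smooth_manifold_def)
  have cover: "openin (mtop W) (U x) \<and> x \<in> U x" if "x \<in> points W" for x using opU[OF that] xU[OF that] by blast
  obtain S and b :: "'w \<Rightarrow> 'w \<Rightarrow> real" and K where S: "finite S" "S \<subseteq> points W"
    "\<And>p x. p \<in> S \<Longrightarrow> x \<in> points W \<Longrightarrow> smooth_at W (b p) x"
    "\<And>p x. p \<in> S \<Longrightarrow> x \<in> points W \<Longrightarrow> 0 \<le> b p x"
    "\<And>p. p \<in> S \<Longrightarrow> closedin (mtop W) (K p)" "\<And>p. p \<in> S \<Longrightarrow> K p \<subseteq> U p"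
    "\<And>p x. p \<in> S \<Longrightarrow> x \<notin> K p \<Longrightarrow> b p x = 0"
    "\<And>x. x \<in> points W \<Longrightarrow> (\<Sum>p\<in>S. b p x) = 1"
    by (rule smooth_partition_of_unity[OF W W_compact haus cover], assumption) (rule that)
  define \<rho> where "\<rho> p = defining_coordinate (\<kappa> p) (u p)" for p
  define F where "F y = (\<Sum>p\<in>S. if y \<in> U p then b p y *\<^sub>R G p y else 0)" for y
  define r where "r y = (\<Sum>p\<in>S. if y \<in> U p then b p y *\<^sub>R \<rho> p y else 0)" for y
  have smooth_sum: "smooth_at W (\<lambda>y. \<Sum>p\<in>S. if y \<in> U p then b p y *\<^sub>R H p y else 0) x"
    if x: "x \<in> points W" and H: "\<And>p y. p \<in> S \<Longrightarrow> y \<in> U p \<Longrightarrow> smooth_at W (H p) y" for x and H :: "'w \<Rightarrow> 'w \<Rightarrow> real"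
  proof (rule smooth_at_sum[OF W x])
    fix p assume p: "p \<in> S"
    then have pW: "p \<in> points W" using S(2) by blast
    show "smooth_at W (\<lambda>y. if y \<in> U p then b p y *\<^sub>R H p y else 0) x"
      by (rule smooth_at_cutoff[OF W opU[OF pW] H[OF p] S(3)[OF p] S(5)[OF p] S(6)[OF p] S(7)[OF p] x])
  qed
  have term_nonneg: "0 \<le> (if y \<in> U p then b p y *\<^sub>R \<rho> p y else 0)" if "p \<in> S" "y \<in> points W" for p y
    using S(2,4) that defining_coordinate(1)[OF pc, of p y] by (auto simp: \<rho>_def)
  have r_ge: "b p y * \<rho> p y \<le> r y" if p: "p \<in> S" and y: "y \<in> U p" for p y
  proof -
    have yW: "y \<in> points W" using product_chartD(4)[OF pc] p y S(2) by blast
    have "(if y \<in> U p then b p y *\<^sub>R \<rho> p y else 0) \<le> r y"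
      unfolding r_def by (rule member_le_sum[OF p _ S(1)]) (use term_nonneg yW in blast)
    then show ?thesis using y by simp
  qed
  have exb: "\<exists>p\<in>S. 0 < b p x \<and> x \<in> U p" if x: "x \<in> points W" for x
  proof -
    have "\<exists>p\<in>S. b p x \<noteq> 0"
    proof (rule ccontr)
      assume "\<not> ?thesis"
      then have "(\<Sum>p\<in>S. b p x) = 0" by (intro sum.neutral) blast
      then show False using S(8)[OF x] by simp
    qed
    then obtain p where "p \<in> S" "b p x \<noteq> 0" by blast
    moreover have "0 \<le> b p x" using S(4) calculation x by blast
    moreover have "x \<in> U p" using S(6,7) calculation by blast
    ultimately show ?thesis by force
  qed
  have r_bdry: "r x = 0" if x: "x \<in> bdry W" for x
    unfolding r_def
  proof (rule sum.neutral, intro ballI)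
    fix p assume p: "p \<in> S"
    show "(if x \<in> U p then b p x *\<^sub>R \<rho> p x else 0) = 0"
      using defining_coordinate(2)[OF pc, of p x] S(2) p x by (auto simp: \<rho>_def)
  qed
  show thesis
  proof (rule that)
    fix x assume x: "x \<in> points W"
    show "smooth_at W F x" unfolding F_def by (rule smooth_sum[OF x]) (use G S(2) in blast)
    show "smooth_at W r x" unfolding r_def
      by (rule smooth_sum[OF x]) (use defining_coordinate(3)[OF pc] S(2) in \<open>auto simp: \<rho>_def\<close>)
    show "0 \<le> r x" unfolding r_def by (rule sum_nonneg) (use term_nonneg x in blast)
    show "r x = 0 \<longleftrightarrow> x \<in> bdry W"
    proof
      assume r0: "r x = 0"
      obtain p where p: "p \<in> S" "0 < b p x" "x \<in> U p" using exb[OF x] by blast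
      have "b p x * \<rho> p x \<le> 0" using r_ge[OF p(1,3)] r0 by simp
      then have "\<rho> p x \<le> 0" using p(2) by (simp add: mult_le_0_iff)
      moreover have "p \<in> points W" using p(1) S(2) by blast
      ultimately show "x \<in> bdry W"
        using defining_coordinate(1,2)[OF pc p(3)] by (simp add: \<rho>_def)
    qed (rule r_bdry)
  next
    fix x assume x: "x \<in> bdry W"
    then have xW: "x \<in> points W" using bdry_points[OF W] by blast
    have "F x = (\<Sum>p\<in>S. b p x * f x)"
      unfolding F_def
    proof (rule sum.cong[OF refl])
      fix p assume p: "p \<in> S"
      show "(if x \<in> U p then b p x *\<^sub>R G p x else 0) = b p x * f x"
        using Gb[of p x] S(2) S(6,7)[OF p] p x by auto
    qed
    also have "\<dots> = f x" using S(8)[OF xW] by (simp add: sum_distrib_right[symmetric])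
    finally show "F x = f x" .
    obtain p where p: "p \<in> S" "0 < b p x" "x \<in> U p" using exb[OF xW] by blast
    have pW: "p \<in> points W" using p(1) S(2) by blast
    note D = product_chartD[OF pc[OF pW]]
    have u: "u p \<noteq> 0" "\<kappa> p x \<bullet> (u p, 0) = 0" using bdry_product_chart[OF pc[OF pW] p(3)] x by auto
    have "smooth_at W r x" unfolding r_def
      by (rule smooth_sum[OF xW]) (use defining_coordinate(3)[OF pc] S(2) in \<open>auto simp: \<rho>_def\<close>)
    then obtain N g where g: "\<kappa> p x \<in> N" "Cinf_on g N" "\<And>y. y \<in> U p \<Longrightarrow> \<kappa> p y \<in> N \<Longrightarrow> r y = g (\<kappa> p y)"
      by (rule smooth_at_gchart[OF _ D(2) p(3)]) blast
    obtain N1 gb where gb: "\<kappa> p x \<in> N1" "Cinf_on gb N1" "\<And>y. y \<in> U p \<Longrightarrow> \<kappa> p y \<in> N1 \<Longrightarrow> b p y = gb (\<kappa> p y)"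
      by (rule smooth_at_gchart[OF S(3)[OF p(1) xW] D(2) p(3)]) blast
    obtain N2 where N2: "open N2" "\<kappa> p x \<in> N2" "\<And>z. z \<in> N2 \<Longrightarrow> 0 \<le> z \<bullet> (u p, 0) \<Longrightarrow> z \<in> \<kappa> p ` U p"
      by (rule hchart_image_nhd[OF D(1) p(3)]) blast
    define w :: "(real ^ 2) \<times> (real \<times> real)" where "w = (u p, 0)"
    define z where "z = \<kappa> p x"
    have w: "w \<bullet> w > 0" using u(1) by (simp add: w_def)
    have zw: "z \<bullet> w = 0" using u(2) by (simp add: z_def w_def)
    have gz: "g z = 0" using g(1) g(3)[OF p(3)] r_bdry[OF x] by (simp add: z_def)
    define D where "D = frechet_derivative g (at z) w"
    have "(g has_derivative frechet_derivative g (at z)) (at (z + 0 *\<^sub>R w))"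
      using Cinf_on_has_derivative[OF g(2,1)] by (simp add: z_def)
    moreover have "((\<lambda>s. z + s *\<^sub>R w) has_derivative (\<lambda>s. s *\<^sub>R w)) (at 0)" by (auto intro!: derivative_eq_intros)
    ultimately have "((\<lambda>s. g (z + s *\<^sub>R w)) has_derivative (\<lambda>s. frechet_derivative g (at z) (s *\<^sub>R w))) (at 0)"
      by (rule has_derivative_compose[of "\<lambda>s. z + s *\<^sub>R w" "\<lambda>s. s *\<^sub>R w" 0 UNIV g "frechet_derivative g (at z)", rotated])
    moreover have "linear (frechet_derivative g (at z))"
      using Cinf_on_has_derivative[OF g(2,1)] by (simp add: z_def has_derivative_linear)
    then have "(\<lambda>s. frechet_derivative g (at z) (s *\<^sub>R w)) = (*) D"
      by (auto simp: D_def linear_cmul)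
    ultimately have "((\<lambda>s. g (z + s *\<^sub>R w)) has_real_derivative D) (at 0)" by (simp add: has_field_derivative_def)
    then have lim: "((\<lambda>s. g (z + s *\<^sub>R w) / s) \<longlongrightarrow> D) (at_right 0)"
      by (auto simp: has_field_derivative_iff gz intro: tendsto_within_subset)
    have "isCont gb (z + 0 *\<^sub>R w)" using gb(1) Cinf_on_continuous[OF gb(2)] Cinf_on_open[OF gb(2)]
      by (simp add: z_def continuous_on_eq_continuous_at)
    then have "isCont (\<lambda>s. gb (z + s *\<^sub>R w)) 0" by (intro isCont_o2[of 0 "\<lambda>s. z + s *\<^sub>R w" gb]) (auto intro!: continuous_intros)
    then have "((\<lambda>s. gb (z + s *\<^sub>R w)) \<longlongrightarrow> gb z) (at_right 0)"
      by (auto simp: isCont_def intro: tendsto_within_subset)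
    then have lim2: "((\<lambda>s. gb (z + s *\<^sub>R w) * (w \<bullet> w)) \<longlongrightarrow> gb z * (w \<bullet> w)) (at_right 0)"
      by (intro tendsto_intros)
    have "open ((\<lambda>s. z + s *\<^sub>R w) -` (N \<inter> N1 \<inter> N2))"
      using Cinf_on_open[OF g(2)] Cinf_on_open[OF gb(2)] N2(1) by (intro open_vimage open_Int continuous_intros)
    moreover have "0 \<in> (\<lambda>s. z + s *\<^sub>R w) -` (N \<inter> N1 \<inter> N2)" using g(1) gb(1) N2(2) by (simp add: z_def)
    ultimately have "\<forall>\<^sub>F s in nhds 0. s \<in> (\<lambda>s. z + s *\<^sub>R w) -` (N \<inter> N1 \<inter> N2)" by (rule eventually_nhds_in_open)
    then have "\<forall>\<^sub>F s in at_right 0. z + s *\<^sub>R w \<in> N \<inter> N1 \<inter> N2" by (simp add: eventually_at_filter eventually_mono)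
    \<comment> \<open>Along the inward normal \<open>w\<close> the coordinate
      \<open>\<rho> p\<close> equals \<open>s * (w \<bullet> w)\<close>, so the bound by one summand
      becomes a lower bound for the difference quotient, with the positive limit
      \<open>gb z * (w \<bullet> w)\<close>.\<close>
    then have le: "\<forall>\<^sub>F s in at_right 0. gb (z + s *\<^sub>R w) * (w \<bullet> w) \<le> g (z + s *\<^sub>R w) / s"
      using eventually_at_right_less[of "0::real"]
    proof eventually_elim
      case (elim s)
      have "(z + s *\<^sub>R w) \<bullet> w = s * (w \<bullet> w)" by (simp add: zw inner_add_left)
      then have "0 \<le> (z + s *\<^sub>R w) \<bullet> (u p, 0)" using elim(2) w by (simp add: w_def[symmetric])
      then obtain y where y: "y \<in> U p" "\<kappa> p y = z + s *\<^sub>R w" using N2(3) elim(1) by (metis IntD2 imageE)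
      have "\<rho> p y = s * (w \<bullet> w)" using u(1) y(2) by (simp add: \<rho>_def defining_coordinate_def w_def[symmetric] zw inner_add_left)
      then have "gb (z + s *\<^sub>R w) * (s * (w \<bullet> w)) \<le> g (z + s *\<^sub>R w)"
        using r_ge[OF p(1) y(1)] g(3)[OF y(1)] gb(3)[OF y(1)] elim(1) y(2) by simp
      then show ?case using elim(2) by (simp add: field_simps)
    qed
    have "gb z * (w \<bullet> w) \<le> D" by (rule tendsto_le[OF _ lim lim2 le]) simp
    moreover have "gb z > 0" using gb(1,3) p(2,3) by (simp add: z_def)
    ultimately have "D > 0" using w by (smt (verit) mult_pos_pos)
    then show "\<exists>U \<kappa> u N g. x \<in> U \<and> product_chart U \<kappa> u \<and> \<kappa> x \<in> N \<and> Cinf_on g N \<and>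
        (\<forall>y\<in>U. \<kappa> y \<in> N \<longrightarrow> r y = g (\<kappa> y)) \<and> frechet_derivative g (at (\<kappa> x)) (u, 0) > 0"
      using p(3) pc[OF pW] g by (intro exI[of _ "U p"] exI[of _ "\<kappa> p"] exI[of _ "u p"] exI[of _ N] exI[of _ g])
        (simp add: D_def z_def w_def)
  qed
qed

text \<open>Points with a product chart in which the inward derivative of \<open>r\<close> is positive and controls
  that of \<open>F\<close>; in the submersion argument this makes the derivative of \<open>(F + k) \<cdot> cutoff \<epsilon> r\<close>
  negative as soon as \<open>F + k > \<bar>R\<bar>\<close>.\<close>

definition collar_point :: "('w \<Rightarrow> real) \<Rightarrow> ('w \<Rightarrow> real) \<Rightarrow> real \<Rightarrow> 'w \<Rightarrow> bool" where
  "collar_point F r R y \<longleftrightarrow> (\<exists>U \<kappa> u N f g. y \<in> U \<and> product_chart U \<kappa> u \<and> \<kappa> y \<in> N \<and> Cinf_on f N \<and> Cinf_on g N \<and>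
     (\<forall>y'\<in>U. \<kappa> y' \<in> N \<longrightarrow> F y' = f (\<kappa> y') \<and> r y' = g (\<kappa> y')) \<and>
     0 < frechet_derivative g (at (\<kappa> y)) (u, 0) \<and>
     \<bar>frechet_derivative f (at (\<kappa> y)) (u, 0)\<bar> \<le> R * frechet_derivative g (at (\<kappa> y)) (u, 0))"

lemma collar_point_mono:
  assumes "collar_point F r R y" "R \<le> R'" shows "collar_point F r R' y"
proof -
  obtain U \<kappa> u N f g where *: "y \<in> U" "product_chart U \<kappa> u" "\<kappa> y \<in> N" "Cinf_on f N" "Cinf_on g N"
     "\<forall>y'\<in>U. \<kappa> y' \<in> N \<longrightarrow> F y' = f (\<kappa> y') \<and> r y' = g (\<kappa> y')"
     "0 < frechet_derivative g (at (\<kappa> y)) (u, 0)"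
     "\<bar>frechet_derivative f (at (\<kappa> y)) (u, 0)\<bar> \<le> R * frechet_derivative g (at (\<kappa> y)) (u, 0)"
    using assms(1) unfolding collar_point_def by (elim exE conjE) (rule that)
  have "R * frechet_derivative g (at (\<kappa> y)) (u, 0) \<le> R' * frechet_derivative g (at (\<kappa> y)) (u, 0)"
    using *(7) assms(2) by (intro mult_right_mono) simp_all
  with *(8) have "\<bar>frechet_derivative f (at (\<kappa> y)) (u, 0)\<bar> \<le> R' * frechet_derivative g (at (\<kappa> y)) (u, 0)" by simp
  then show ?thesis unfolding collar_point_def
    by (intro exI[of _ U] exI[of _ \<kappa>] exI[of _ u] exI[of _ N] exI[of _ f] exI[of _ g] conjI *)
qed

text \<open>The chart found at the boundary point serves all nearby points, interior ones included,
  because the required inequalities between derivatives are open conditions.\<close>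

lemma collar_point_nhd:
  assumes F: "smooth_at W F x"
    and r: "\<exists>U \<kappa> u N g. x \<in> U \<and> product_chart U \<kappa> u \<and> \<kappa> x \<in> N \<and> Cinf_on g N \<and>
        (\<forall>y\<in>U. \<kappa> y \<in> N \<longrightarrow> r y = g (\<kappa> y)) \<and> frechet_derivative g (at (\<kappa> x)) (u, 0) > 0"
  obtains A R where "openin (mtop W) A" "x \<in> A" "\<And>y. y \<in> A \<Longrightarrow> collar_point F r R y"
proof -
  obtain U \<kappa> u N g where g: "x \<in> U" "product_chart U \<kappa> u" "\<kappa> x \<in> N" "Cinf_on g N"
     "\<forall>y\<in>U. \<kappa> y \<in> N \<longrightarrow> r y = g (\<kappa> y)" "frechet_derivative g (at (\<kappa> x)) (u, 0) > 0"
    using r by (elim exE conjE) (rule that)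
  note D = product_chartD[OF g(2)]
  obtain N' f where f: "\<kappa> x \<in> N'" "Cinf_on f N'" "\<And>y. y \<in> U \<Longrightarrow> \<kappa> y \<in> N' \<Longrightarrow> F y = f (\<kappa> y)"
    by (rule smooth_at_gchart[OF F D(2) g(1)]) blast
  let ?Df = "\<lambda>z. frechet_derivative f (at z) (u, 0)" and ?Dg = "\<lambda>z. frechet_derivative g (at z) (u, 0)"
  \<comment> \<open>The summand 1 makes the comparison strict at \<open>x\<close>, and a strict
    inequality between continuous functions persists nearby.\<close>
  define R where "R = (\<bar>?Df (\<kappa> x)\<bar> + 1) / ?Dg (\<kappa> x)"
  have opN: "open (N \<inter> N')" using Cinf_on_open[OF g(4)] Cinf_on_open[OF f(2)] by (rule open_Int)
  have C: "Cinf_on f (N \<inter> N')" "Cinf_on g (N \<inter> N')"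
    using Cinf_on_subset[OF f(2) _ opN] Cinf_on_subset[OF g(4) _ opN] by blast+
  have "open {w. \<bar>fst w\<bar> < R * snd w \<and> 0 < (snd w :: real)}"
    unfolding Collect_conj_eq by (intro open_Int open_Collect_less continuous_intros)
  then have "open ((N \<inter> N') \<inter> (\<lambda>z. (?Df z, ?Dg z)) -` {w. \<bar>fst w\<bar> < R * snd w \<and> 0 < (snd w :: real)})" (is "open ?N")
    by (rule Cinf_on_vimage[OF Cinf_on_Pair[OF Cinf_on_derivative[OF C(1)] Cinf_on_derivative[OF C(2)]]])
  then have opU: "open ?N" .
  have xN: "\<kappa> x \<in> ?N"
  proof -
    have "\<bar>a\<bar> < (\<bar>a\<bar> + 1) / d * d" if "0 < d" for a d :: real using that by simp
    from this[OF g(6)] have "\<bar>?Df (\<kappa> x)\<bar> < R * ?Dg (\<kappa> x)" unfolding R_def .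
    then show ?thesis using g(3,6) f(1)
      by (simp only: Int_iff vimage_eq mem_Collect_eq fst_conv snd_conv simp_thms)
  qed
  define A where "A = {y \<in> U. \<kappa> y \<in> ?N}"
  have "openin (mtop W) A" unfolding A_def
    by (rule smooth_at_openin_vimage[OF W D(3) gchart_smooth_at[OF D(2)] opU])
  moreover have "x \<in> A" using g(1) xN by (simp only: A_def mem_Collect_eq simp_thms)
  moreover have "collar_point F r R y" if "y \<in> A" for y
  proof -
    have y: "y \<in> U" "\<kappa> y \<in> ?N" using that by (simp_all only: A_def mem_Collect_eq)
    have y': "\<kappa> y \<in> N \<inter> N'" "\<bar>?Df (\<kappa> y)\<bar> < R * ?Dg (\<kappa> y)" "0 < ?Dg (\<kappa> y)" using y(2)
      by (simp_all only: Int_iff vimage_eq mem_Collect_eq fst_conv snd_conv simp_thms)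
    have eq: "\<forall>y'\<in>U. \<kappa> y' \<in> N \<inter> N' \<longrightarrow> F y' = f (\<kappa> y') \<and> r y' = g (\<kappa> y')" using f(3) g(5) by simp
    show ?thesis unfolding collar_point_def
      by (rule exI[of _ U], rule exI[of _ \<kappa>], rule exI[of _ u], rule exI[of _ "N \<inter> N'"], rule exI[of _ f], rule exI[of _ g])
        (use y y' g(2) C eq in simp)
  qed
  ultimately show thesis by (rule that)
qed

text \<open>The largest of finitely many local constants serves as the common \<open>R\<close>, and
  the tube lemma applied to \<open>r\<close> turns a neighbourhood of the boundary into a sublevel
  set.\<close>

lemma uniform_collar:
  assumes F: "\<And>x. x \<in> points W \<Longrightarrow> smooth_at W F x" and r_smooth: "\<And>x. x \<in> points W \<Longrightarrow> smooth_at W r x"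
    and r_ge: "\<And>x. x \<in> points W \<Longrightarrow> 0 \<le> r x" and r0: "\<And>x. x \<in> points W \<Longrightarrow> r x = 0 \<longleftrightarrow> x \<in> bdry W"
    and r: "\<And>x. x \<in> bdry W \<Longrightarrow> \<exists>U \<kappa> u N g. x \<in> U \<and> product_chart U \<kappa> u \<and> \<kappa> x \<in> N \<and> Cinf_on g N \<and>
        (\<forall>y\<in>U. \<kappa> y \<in> N \<longrightarrow> r y = g (\<kappa> y)) \<and> frechet_derivative g (at (\<kappa> x)) (u, 0) > 0"
  obtains R \<epsilon> :: real where "0 < \<epsilon>" "\<epsilon> \<le> 1" "\<And>x. x \<in> points W \<Longrightarrow> r x < \<epsilon> \<Longrightarrow> collar_point F r R x"
proof -
  \<comment> \<open>Only boundary points in \<open>A\<close> carry a condition, so around an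
    interior point the complement of the boundary will do. In this way a cover of the whole compact
    space is obtained.\<close>
  define Q where "Q x A R \<longleftrightarrow> openin (mtop W) A \<and> x \<in> A \<and> (\<forall>y\<in>A \<inter> bdry W.
      (\<exists>B. openin (mtop W) B \<and> y \<in> B \<and> (\<forall>z\<in>B. collar_point F r R z)))" for x A R
  have "\<exists>A R. Q x A R" if x: "x \<in> points W" for x
  proof (cases "x \<in> bdry W")
    case True
    obtain A R where A: "openin (mtop W) A" "x \<in> A" "\<And>y. y \<in> A \<Longrightarrow> collar_point F r R y"
      by (rule collar_point_nhd[OF F[OF x] r[OF True]]) blast
    then have "Q x A R" unfolding Q_def by blast
    then show ?thesis by (intro exI)
  next
    case False
    have "openin (mtop W) (points W - bdry W)" by (rule openin_diff[OF openin_topspace closedin_bdry[OF W]])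
    then have "Q x (points W - bdry W) 0" unfolding Q_def using False x by blast
    then show ?thesis by (intro exI)
  qed
  then have "\<forall>x\<in>points W. \<exists>A R. Q x A R" by (intro ballI)
  from bchoice[OF this] obtain A where "\<forall>x\<in>points W. \<exists>R. Q x (A x) R" by (elim exE)
  from bchoice[OF this] obtain \<rho> where A: "\<forall>x\<in>points W. Q x (A x) (\<rho> x)" by (elim exE)
  have A': "openin (mtop W) (A x) \<and> x \<in> A x" if "x \<in> points W" for x using bspec[OF A that] unfolding Q_def by simp
  obtain S where S: "finite S" "S \<subseteq> points W" "points W \<subseteq> (\<Union>x\<in>S. A x)"
    by (rule compact_space_finite_cover[OF W_compact A'], assumption) (rule that)
  define R where "R = Max (insert 0 (\<rho> ` S))"
  have R: "\<rho> x \<le> R" if "x \<in> S" for x unfolding R_def using S(1) that by (intro Max_ge) auto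
  define Z where "Z = \<Union>{B. openin (mtop W) B \<and> (\<forall>z\<in>B. collar_point F r R z)}"
  have opZ: "openin (mtop W) Z" unfolding Z_def by (rule openin_Union) simp
  have bZ: "x \<in> Z" if x: "x \<in> points W" "r x = 0" for x
  proof -
    have xb: "x \<in> bdry W" using r0[OF x(1)] x(2) by simp
    obtain p where p: "p \<in> S" "x \<in> A p" using S(3) x(1) by blast
    have pW: "p \<in> points W" using p(1) S(2) by blast
    obtain B where B: "openin (mtop W) B" "x \<in> B" "\<forall>z\<in>B. collar_point F r (\<rho> p) z"
      using bspec[OF A pW] p(2) xb unfolding Q_def by blast
    have "\<forall>z\<in>B. collar_point F r R z" using B(3) collar_point_mono[OF _ R[OF p(1)]] by blast
    then show ?thesis unfolding Z_def using B(1,2) by blast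
  qed
  obtain \<delta> where \<delta>: "\<delta> > 0" "\<And>x. x \<in> points W \<Longrightarrow> dist (r x) 0 < \<delta> \<Longrightarrow> x \<in> Z"
    by (rule compact_fiber_nhd[OF W_compact smooth_at_continuous_map[OF W r_smooth] opZ bZ]) blast+
  show thesis
  \<comment> \<open>A collar of width at most 1 makes \<open>flat 2\<close> at least as large as
    \<open>flat 0\<close> at the arguments \<open>\<epsilon> - r x\<close> inside it.\<close>
  proof (rule that[of "min \<delta> 1" R])
    fix x assume x: "x \<in> points W" "r x < min \<delta> 1"
    have "dist (r x) 0 < \<delta>" using r_ge[OF x(1)] x(2) by (simp add: dist_real_def)
    then have "x \<in> Z" by (rule \<delta>(2)[OF x(1)])
    then show "collar_point F r R x" unfolding Z_def by blast
  qed (use \<delta>(1) in auto)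
qed

text \<open>Once the chart carries a real phase \<open>g\<close> of \<open>p\<close>, everything
  rests on one vector \<open>v\<close> orthogonal to the half-space vector along which
  \<open>g\<close> has nonzero derivative. Each region of W will supply its own
  \<open>v\<close>.\<close>

lemma product_adapted:
  fixes \<kappa> :: "'w \<Rightarrow> (real ^ 2) \<times> (real \<times> real)"
  assumes \<kappa>: "hchart W U \<kappa> w" and x: "x \<in> U" and wv: "w \<bullet> v = 0"
    and g: "Cinf_on g N" "\<kappa> x \<in> N" "\<And>y. y \<in> U \<Longrightarrow> \<kappa> y \<in> N \<Longrightarrow> p y = cis (g (\<kappa> y))"
    and der: "frechet_derivative g (at (\<kappa> x)) v \<noteq> 0"
  shows "\<exists>V (\<mu> :: 'w \<Rightarrow> (real ^ 3) \<times> real) u. x \<in> V \<and> adapted_chart W p (p x) V \<mu> u"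
proof -
  have px: "p x = cis (g (\<kappa> x))" by (rule g(3)[OF x g(2)])
  have dim: "DIM(real ^ 3) + 1 = DIM((real ^ 2) \<times> (real \<times> real))" by simp
  have np: "norm (p x) = 1" by (simp add: px)
  have eq: "p y = p x * cis (g (\<kappa> y) - g (\<kappa> x))" if "y \<in> U" "\<kappa> y \<in> N" for y
    using g(3)[OF that] by (simp add: px cis_mult)
  obtain V and \<mu> :: "'w \<Rightarrow> (real ^ 3) \<times> real" and u where "x \<in> V" "adapted_chart W p (p x) V \<mu> u"
    by (rule adapted_chartI[OF W \<kappa> x dim wv np g(1,2) eq der], assumption, assumption) (rule that)
  then show ?thesis by (intro exI conjI)
qed

end

text \<open>The phase of the extension in a product chart: the monomial in the base coordinates
  becomes the linear part with slopes \<open>a\<close> and \<open>b\<close>, and the negative term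
  is the derivative of the cut-off profile. On a vector in the fiber factor the linear part
  vanishes.\<close>

lemma has_derivative_sloped:
  fixes f g :: "'b::euclidean_space \<times> (real \<times> real) \<Rightarrow> real" and a b k \<epsilon> :: real
  assumes f: "Cinf_on f N" "z \<in> N" and g: "Cinf_on g N"
  defines "h \<equiv> \<lambda>z. a * fst (snd z) + b * snd (snd z) + (f z + k) * cutoff \<epsilon> (g z)"
  shows "Cinf_on h N" "frechet_derivative h (at z) v = a * fst (snd v) + b * snd (snd v) +
     (frechet_derivative f (at z) v * cutoff \<epsilon> (g z)
      - (f z + k) * (flat 2 (\<epsilon> - g z) / flat 0 \<epsilon>) * frechet_derivative g (at z) v)"
proof -
  have op: "open N" by (rule Cinf_on_open[OF f(1)])
  have l: "bounded_linear (\<lambda>z :: 'b \<times> (real \<times> real). a * fst (snd z) + b * snd (snd z))"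
    by (intro bounded_linear_intros)
  have "Cinf_on (\<lambda>z. (f z + k) * cutoff \<epsilon> (g z)) N"
    by (intro Cinf_on_mult Cinf_on_add f Cinf_on_const op Cinf_on_compose[OF g Cinf_on_cutoff]) simp
  then show "Cinf_on h N" unfolding h_def by (intro Cinf_on_add Cinf_on_bounded_linear[OF l op])
  have "(cutoff \<epsilon> has_derivative (*) (- (flat 2 (\<epsilon> - g z) / flat 0 \<epsilon>))) (at (g z))"
    using cutoff_has_derivative[of \<epsilon> "g z"] by (simp add: has_field_derivative_def)
  from has_derivative_compose[OF Cinf_on_has_derivative[OF g f(2)] this]
  have c: "((\<lambda>z. cutoff \<epsilon> (g z)) has_derivative (\<lambda>v. - (flat 2 (\<epsilon> - g z) / flat 0 \<epsilon>) * frechet_derivative g (at z) v)) (at z)" .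
  have "((\<lambda>z. (f z + k) * cutoff \<epsilon> (g z)) has_derivative
      (\<lambda>v. (f z + k) * (- (flat 2 (\<epsilon> - g z) / flat 0 \<epsilon>) * frechet_derivative g (at z) v)
        + (frechet_derivative f (at z) v + 0) * cutoff \<epsilon> (g z))) (at z)"
    by (rule has_derivative_mult[OF has_derivative_add[OF Cinf_on_has_derivative[OF f] has_derivative_const] c])
  from has_derivative_add[OF bounded_linear_imp_has_derivative[OF l] this]
  have "(h has_derivative (\<lambda>v. a * fst (snd v) + b * snd (snd v) +
     (frechet_derivative f (at z) v * cutoff \<epsilon> (g z)
      - (f z + k) * (flat 2 (\<epsilon> - g z) / flat 0 \<epsilon>) * frechet_derivative g (at z) v))) (at z)"
    unfolding h_def by (rule has_derivative_eq_rhs) (simp add: fun_eq_iff algebra_simps)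
  from frechet_derivative_at[OF this, symmetric]
  show "frechet_derivative h (at z) v = a * fst (snd v) + b * snd (snd v) +
     (frechet_derivative f (at z) v * cutoff \<epsilon> (g z)
      - (f z + k) * (flat 2 (\<epsilon> - g z) / flat 0 \<epsilon>) * frechet_derivative g (at z) v)" by simp
qed

section \<open>Extending the boundary fibration\<close>

theorem (in torus_bundle) extends_over_W:
  fixes F :: "('w, real ^ 2) mfd"
  assumes F\<pi>: "fiber_bundle F (bdry_mfd W :: ('w, real ^ 3) mfd) circle \<pi>"
    and c: "c \<in> points circle" and b: "b \<in> points torus"
    and fiber: "\<And>s. s \<in> bdry \<Sigma> \<Longrightarrow> \<pi> (ident (s, b)) = c"
  shows "\<exists>(\<pi>' :: 'w \<Rightarrow> complex) (F' :: ('w, real ^ 3) mfd).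
           fiber_bundle F' W circle \<pi>' \<and> (\<forall>x\<in>bdry W. \<pi>' x = \<pi> x)"
proof -
  interpret B: bdry_manifold W "bdry_mfd W :: ('w, real ^ 3) mfd"
    by (rule bdry_manifold.intro[OF W_manifold refl]) simp
  let ?B = "bdry_mfd W :: ('w, real ^ 3) mfd"
  have ptB: "points ?B = bdry W" by (rule B.points_B)
  have mtB: "mtop ?B = bdryW" by (rule B.mtop_B)
  have bW: "x \<in> points W" if "x \<in> bdry W" for x using that bdry_points[OF W] by blast
  have \<pi>: "smooth_map ?B circle \<pi>" using F\<pi> by (simp only: fiber_bundle_def)
  have \<pi>_cont: "continuous_map bdryW circ \<pi>" using \<pi> unfolding smooth_map_def mtop_circle mtB by (rule conjunct1)
  have \<pi>_smooth: "smooth_at ?B \<pi> x" if "x \<in> bdry W" for x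
    using smooth_at_circle_map(1)[OF B.premfd_B \<pi>, of x] that unfolding ptB by blast
  have norm_c: "norm c = 1" using c by simp
  obtain m n :: int and f where f: "continuous_map bdryW euclideanreal f"
    "\<And>x. x \<in> bdry W \<Longrightarrow> \<pi> x = fst (q x) powi m * snd (q x) powi n * cis (f x)"
    by (rule bdry_factorization[OF \<pi>_cont norm_c b fiber], assumption) (rule that)
  define p0 where "p0 x = fst (q x) powi m * snd (q x) powi n" for x
  have p0_norm: "norm (p0 x) = 1" if "x \<in> points W" for x
    using q_norm[OF that] by (simp add: p0_def norm_mult norm_power_int)
  have p0_smooth: "smooth_at W p0 x" if x: "x \<in> points W" for x
  proof -
    have "fst (q x) \<in> - {0}" "snd (q x) \<in> - {0}" using q_norm[OF x] by auto
    then show ?thesis unfolding p0_def[abs_def]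
      by (intro smooth_at_mult[OF W] smooth_at_compose[OF q_smooth(1)[OF x] Cinf_on_power_int]
          smooth_at_compose[OF q_smooth(2)[OF x] Cinf_on_power_int])
  qed
  have f_smooth: "smooth_at ?B f x" if x: "x \<in> bdry W" for x
  proof (rule smooth_at_lift[OF B.premfd_B])
    show "continuous_map (mtop ?B) euclideanreal f" unfolding mtB by (rule f(1))
    show "x \<in> points ?B" unfolding ptB by (rule x)
    have "p0 x \<in> - {0}" using p0_norm[OF bW[OF x]] by auto
    then have "smooth_at ?B (\<lambda>y. inverse (p0 y)) x"
      by (rule B.smooth_at_restrict[OF smooth_at_compose[OF p0_smooth[OF bW[OF x]] Cinf_on_inverse] x])
    then show "smooth_at ?B (\<lambda>y. \<pi> y * inverse (p0 y)) x" by (rule smooth_at_mult[OF B.premfd_B \<pi>_smooth[OF x]])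
    fix y assume "y \<in> points ?B"
    then have y: "y \<in> bdry W" unfolding ptB .
    have "p0 y \<noteq> 0" using p0_norm[OF bW[OF y]] by auto
    then show "\<pi> y * inverse (p0 y) = cis (f y)" using f(2)[OF y] by (simp add: p0_def field_simps)
  qed
  have mn: "m \<noteq> 0 \<or> n \<noteq> 0"
  proof (rule ccontr)
    assume "\<not> ?thesis"
    then have "\<pi> x = cis (f x)" if "x \<in> bdry W" for x using f(2)[OF that] by simp
    moreover have "compact_space (mtop ?B)" unfolding mtB
      using closedin_compact_space[OF W_compact closedin_bdry[OF W]] by (rule compact_space_subtopology)
    ultimately show False
      using no_global_lift[OF B.premfd_B _ _ F\<pi>, of f] f_smooth bdry_W_nonempty unfolding ptB by blast
  qed
  obtain G r :: "'w \<Rightarrow> real" where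
    G: "\<And>x. x \<in> points W \<Longrightarrow> smooth_at W G x" and r: "\<And>x. x \<in> points W \<Longrightarrow> smooth_at W r x"
    and Gf: "\<And>x. x \<in> bdry W \<Longrightarrow> G x = f x"
    and r_ge: "\<And>x. x \<in> points W \<Longrightarrow> 0 \<le> r x" and r0: "\<And>x. x \<in> points W \<Longrightarrow> r x = 0 \<longleftrightarrow> x \<in> bdry W"
    and r_normal: "\<And>x. x \<in> bdry W \<Longrightarrow> \<exists>U \<kappa> u N g. x \<in> U \<and> product_chart U \<kappa> u \<and> \<kappa> x \<in> N \<and> Cinf_on g N \<and>
        (\<forall>y\<in>U. \<kappa> y \<in> N \<longrightarrow> r y = g (\<kappa> y)) \<and> frechet_derivative g (at (\<kappa> x)) (u, 0) > 0"
    by (rule boundary_pair[OF f_smooth], assumption) (rule that)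
  obtain R \<epsilon> :: real where \<epsilon>: "0 < \<epsilon>" "\<epsilon> \<le> 1" and collar: "\<And>x. x \<in> points W \<Longrightarrow> r x < \<epsilon> \<Longrightarrow> collar_point G r R x"
    by (rule uniform_collar[OF G r r_ge r0 r_normal], assumption+) (rule that)
  have "compactin euclideanreal (G ` points W)"
    using W_compact by (intro image_compactin[of "mtop W"] smooth_at_continuous_map[OF W G]) (auto simp: compact_space_def)
  then have "bounded (G ` points W)" by (simp add: compact_imp_bounded)
  then obtain C where C: "\<And>x. x \<in> points W \<Longrightarrow> \<bar>G x\<bar> \<le> C" by (auto simp: bounded_iff)
  \<comment> \<open>\<open>K\<close> is a whole number of turns, and \<open>2 * pi * k\<close> is at
    least \<open>k\<close>; so \<open>G + K\<close> is at least \<open>\<bar>R\<bar> + 1\<close>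
    everywhere, although \<open>G\<close> may be as low as \<open>- C\<close>.\<close>
  obtain k :: nat where k: "C + \<bar>R\<bar> + 1 \<le> real k" using real_arch_simple by blast
  define K where "K = 2 * pi * real k"
  have "real k \<le> 2 * pi * real k" using pi_ge_two by (simp add: mult_le_cancel_right1)
  then have K: "\<bar>R\<bar> + 1 \<le> G x + K" if "x \<in> points W" for x
    using C[OF that] k by (simp add: K_def abs_le_iff)
  have cisK: "cis K = 1" unfolding K_def by (rule cis_multiple_2pi) simp
  define p where "p x = p0 x * cis ((G x + K) * cutoff \<epsilon> (r x))" for x
  have p_bdry: "p x = \<pi> x" if x: "x \<in> bdry W" for x
  proof -
    have "r x = 0" using r0[OF bW[OF x]] x by simp
    then have "p x = p0 x * (cis (f x) * cis K)" by (simp add: p_def Gf[OF x] cutoff_0[OF \<epsilon>(1)] cis_mult)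
    then show ?thesis by (simp add: f(2)[OF x] cisK p0_def)
  qed
  have p_norm: "norm (p x) = 1" if "x \<in> points W" for x using p0_norm[OF that] by (simp add: p_def norm_mult)
  have p_smooth: "smooth_at W p x" if x: "x \<in> points W" for x
  proof -
    have "smooth_at W (\<lambda>x. (G x + K) * cutoff \<epsilon> (r x)) x"
      by (intro smooth_at_mult[OF W] smooth_at_add[OF W] G x smooth_at_const[OF W] smooth_at_compose[OF r[OF x] Cinf_on_cutoff]) simp
    from smooth_at_compose[OF this Cinf_on_cis UNIV_I] show ?thesis
      unfolding p_def[abs_def] by (rule smooth_at_mult[OF W p0_smooth[OF x]])
  qed
  \<comment> \<open>A real lift of \<open>p\<close> in a product chart, where \<open>f\<close> and
    \<open>g\<close> represent \<open>G\<close> and \<open>r\<close>. It turns the submersion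
    property into a nonzero derivative of one real function.\<close>
  define \<Lambda> where "\<Lambda> f g z = of_int m * fst (snd z) + of_int n * snd (snd z) + (f z + K) * cutoff \<epsilon> (g z)"
    for f g :: "(real ^ 2) \<times> (real \<times> real) \<Rightarrow> real" and z
  have p_chart: "p y = cis (\<Lambda> f g (\<kappa> y))"
    if "product_chart U \<kappa> u" "y \<in> U" "G y = f (\<kappa> y)" "r y = g (\<kappa> y)" for U \<kappa> u y f g
    using product_chartD(5)[OF that(1,2)] that(3,4)
    by (simp add: p_def p0_def \<Lambda>_def cis_power_int cis_mult)
  have \<Lambda>: "Cinf_on (\<Lambda> f g) N" "frechet_derivative (\<Lambda> f g) (at z) v = of_int m * fst (snd v) + of_int n * snd (snd v) +
     (frechet_derivative f (at z) v * cutoff \<epsilon> (g z)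
      - (f z + K) * (flat 2 (\<epsilon> - g z) / flat 0 \<epsilon>) * frechet_derivative g (at z) v)"
    if "Cinf_on f N" "z \<in> N" "Cinf_on g N" for f g N z v
    unfolding \<Lambda>_def[abs_def] by (rule has_derivative_sloped[OF that])+
  have local: "\<exists>U \<kappa> u N f g. x \<in> U \<and> product_chart U \<kappa> u \<and> \<kappa> x \<in> N \<and> Cinf_on f N \<and> Cinf_on g N \<and>
      (\<forall>y\<in>U. \<kappa> y \<in> N \<longrightarrow> G y = f (\<kappa> y) \<and> r y = g (\<kappa> y))" if x: "x \<in> points W" for x
  proof -
    obtain U and \<kappa> :: "'w \<Rightarrow> (real ^ 2) \<times> (real \<times> real)" and u where U: "x \<in> U" "hchart W U \<kappa> (u, 0)"
      "\<And>y. y \<in> U \<Longrightarrow> q y = (cis (fst (snd (\<kappa> y))), cis (snd (snd (\<kappa> y))))"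
      by (rule q_chart[OF x]) blast
    have pc: "product_chart U \<kappa> u" unfolding product_chart_def by (intro conjI ballI U(2,3))
    note D = product_chartD[OF pc]
    obtain N1 f where f: "\<kappa> x \<in> N1" "Cinf_on f N1" "\<And>y. y \<in> U \<Longrightarrow> \<kappa> y \<in> N1 \<Longrightarrow> G y = f (\<kappa> y)"
      by (rule smooth_at_gchart[OF G[OF x] D(2) U(1)]) blast
    obtain N2 g where g: "\<kappa> x \<in> N2" "Cinf_on g N2" "\<And>y. y \<in> U \<Longrightarrow> \<kappa> y \<in> N2 \<Longrightarrow> r y = g (\<kappa> y)"
      by (rule smooth_at_gchart[OF r[OF x] D(2) U(1)]) blast
    have op: "open (N1 \<inter> N2)" using Cinf_on_open[OF f(2)] Cinf_on_open[OF g(2)] by (rule open_Int)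
    have "Cinf_on f (N1 \<inter> N2)" "Cinf_on g (N1 \<inter> N2)"
      using Cinf_on_subset[OF f(2) _ op] Cinf_on_subset[OF g(2) _ op] by blast+
    with U(1) pc f(1,3) g(1,3) show ?thesis
      by - (rule exI[of _ U], rule exI[of _ \<kappa>], rule exI[of _ u], rule exI[of _ "N1 \<inter> N2"], rule exI[of _ f], rule exI[of _ g], simp)
  qed
  have adapted: "\<exists>V (\<mu> :: 'w \<Rightarrow> (real ^ 3) \<times> real) u. x \<in> V \<and> adapted_chart W p (p x) V \<mu> u" if x: "x \<in> points W" for x
  proof (cases "x \<in> bdry W")
    case True
    obtain U \<kappa> u N f g where U: "x \<in> U" "product_chart U \<kappa> u" "\<kappa> x \<in> N" "Cinf_on f N" "Cinf_on g N"
      "\<forall>y\<in>U. \<kappa> y \<in> N \<longrightarrow> G y = f (\<kappa> y) \<and> r y = g (\<kappa> y)"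
      using local[OF x] by (elim exE conjE) (rule that)
    note D = product_chartD[OF U(2)]
    have pU: "p y = cis (\<Lambda> f g (\<kappa> y))" if "y \<in> U" "\<kappa> y \<in> N" for y
      using p_chart[OF U(2) that(1)] bspec[OF U(6) that(1)] that(2) by simp
    have C\<Lambda>: "Cinf_on (\<Lambda> f g) N" by (rule \<Lambda>(1)[OF U(4,3,5)])
    have opA: "openin (mtop W) {y \<in> U. \<kappa> y \<in> N}"
      by (rule smooth_at_openin_vimage[OF W D(3) gchart_smooth_at[OF D(2)] Cinf_on_open[OF U(4)]])
    have \<kappa>B: "smooth_at ?B \<kappa> x" by (rule B.smooth_at_restrict[OF gchart_smooth_at[OF D(2) U(1)] True])
    have xB: "x \<in> points ?B" unfolding ptB by (rule True)
    obtain \<gamma> and \<delta> :: real where \<gamma>: "\<delta> > 0" "\<gamma> 0 = x"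
      "\<And>t. \<bar>t\<bar> < \<delta> \<Longrightarrow> \<gamma> t \<in> points ?B \<and> \<pi> (\<gamma> t) = \<pi> x * cis t"
      "(\<lambda>t. \<kappa> (\<gamma> t)) differentiable (at 0)" "continuous_map (top_of_set (ball 0 \<delta>)) (mtop ?B) \<gamma>"
      by (rule fiber_bundle_curve[OF B.premfd_B F\<pi> xB \<kappa>B]) (rule that)
    have \<gamma>b: "\<gamma> t \<in> bdry W" "p (\<gamma> t) = p x * cis t" if "\<bar>t\<bar> < \<delta>" for t
      using \<gamma>(3)[OF that] p_bdry[OF True] p_bdry[of "\<gamma> t"] unfolding ptB by simp_all
    have "openin (mtop ?B) ({y \<in> U. \<kappa> y \<in> N} \<inter> bdry W)" unfolding mtB using opA by (auto simp: openin_subtopology)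
    from openin_continuous_map_preimage[OF \<gamma>(5) this]
    have "open {t \<in> ball 0 \<delta>. \<gamma> t \<in> {y \<in> U. \<kappa> y \<in> N} \<inter> bdry W}" by (simp add: openin_open_eq)
    moreover have "0 \<in> {t \<in> ball 0 \<delta>. \<gamma> t \<in> {y \<in> U. \<kappa> y \<in> N} \<inter> bdry W}" using \<gamma>(1,2) U(1,3) True by simp
    ultimately obtain e where e: "e > 0" "ball 0 e \<subseteq> {t \<in> ball 0 \<delta>. \<gamma> t \<in> {y \<in> U. \<kappa> y \<in> N} \<inter> bdry W}"
      by (rule openE)
    have \<gamma>U: "\<bar>t\<bar> < \<delta>" "\<gamma> t \<in> U" "\<kappa> (\<gamma> t) \<in> N" if "\<bar>t\<bar> < e" for t
      using e(2) that by (auto simp: dist_real_def subset_iff)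
    obtain D' where D': "((\<lambda>t. \<kappa> (\<gamma> t)) has_derivative D') (at 0)" using \<gamma>(4) by (auto simp: differentiable_def)
    \<comment> \<open>On the boundary \<open>p\<close> is \<pi>, so along the section the phase
      advances exactly by \<open>t\<close>; hence its derivative on the velocity \<open>D' 1\<close>
      is 1.\<close>
    define h where "h t = \<Lambda> f g (\<kappa> (\<gamma> t)) - \<Lambda> f g (\<kappa> x)" for t
    have "(\<Lambda> f g has_derivative frechet_derivative (\<Lambda> f g) (at (\<kappa> x))) (at (\<kappa> (\<gamma> 0)))"
      unfolding \<gamma>(2) by (rule Cinf_on_has_derivative[OF C\<Lambda> U(3)])
    from has_derivative_diff[OF has_derivative_compose[OF D' this] has_derivative_const]
    have dh: "(h has_derivative (\<lambda>t. frechet_derivative (\<Lambda> f g) (at (\<kappa> x)) (D' t))) (at 0)"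
      unfolding h_def[abs_def] by simp
    have "\<forall>\<^sub>F t in nhds 0. h t = t"
    proof (rule eventually_lift_eq[OF _ _ e(1)])
      show "isCont h 0" by (rule has_derivative_continuous[OF dh])
      show "h 0 = 0" by (simp add: h_def \<gamma>(2))
      show "cis (h t) = cis t" if t: "\<bar>t\<bar> < e" for t
      proof -
        have "cis (h t) = p (\<gamma> t) / p x" using pU[OF \<gamma>U(2,3)[OF t]] pU[OF U(1,3)] by (simp add: h_def cis_divide)
        also have "\<dots> = cis t" using \<gamma>b(2)[OF \<gamma>U(1)[OF t]] p_norm[OF x] by auto
        finally show ?thesis .
      qed
    qed
    then obtain e' where e': "e' > 0" "\<And>t. dist t 0 < e' \<Longrightarrow> h t = t" unfolding eventually_nhds_metric by blast
    have "(h has_derivative (\<lambda>t. t)) (at 0)"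
      by (rule has_derivative_transform_within[OF has_derivative_ident e'(1)]) (simp_all add: e'(2))
    from fun_cong[OF has_derivative_unique[OF dh this], of 1]
    have der: "frechet_derivative (\<Lambda> f g) (at (\<kappa> x)) (D' 1) \<noteq> 0" by simp
    \<comment> \<open>The curve stays in the boundary, where the half-space coordinate is
      identically zero, so its velocity is parallel to the bounding hyperplane.\<close>
    have tangent: "(u, 0) \<bullet> D' 1 = 0"
    proof -
      have d: "((\<lambda>t. (u, 0) \<bullet> \<kappa> (\<gamma> t)) has_derivative (\<lambda>t. (u, 0) \<bullet> D' t)) (at 0)"
        by (rule has_derivative_inner_right[OF D'])
      have zero: "(u, 0) \<bullet> \<kappa> (\<gamma> t) = 0" if "dist t 0 < e" for t
      proof -
        have "\<bar>t\<bar> < e" using that by (simp add: dist_real_def)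
        note * = \<gamma>U[OF this]
        show ?thesis using bdry_product_chart[OF U(2) *(2)] \<gamma>b(1)[OF *(1)] by (simp add: inner_commute)
      qed
      have "((\<lambda>t. 0 :: real) has_derivative (\<lambda>t. (u, 0) \<bullet> D' t)) (at 0)"
        by (rule has_derivative_transform_within[OF d e(1)]) (simp_all add: zero)
      from fun_cong[OF has_derivative_unique[OF this has_derivative_const], of 1] show ?thesis by simp
    qed
    show ?thesis by (rule product_adapted[OF D(1) U(1) tangent C\<Lambda> U(3) pU der])
  next
    case False
    note int = False
    show ?thesis
    proof (cases "r x < \<epsilon>")
      case True
      obtain U \<kappa> u N f g where U: "x \<in> U" "product_chart U \<kappa> u" "\<kappa> x \<in> N" "Cinf_on f N" "Cinf_on g N"
        "\<forall>y\<in>U. \<kappa> y \<in> N \<longrightarrow> G y = f (\<kappa> y) \<and> r y = g (\<kappa> y)"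
        "0 < frechet_derivative g (at (\<kappa> x)) (u, 0)"
        "\<bar>frechet_derivative f (at (\<kappa> x)) (u, 0)\<bar> \<le> R * frechet_derivative g (at (\<kappa> x)) (u, 0)"
        using collar[OF x True] unfolding collar_point_def by (elim exE conjE) (rule that)
      have dim: "DIM((real ^ 2) \<times> (real \<times> real)) = DIM(real ^ 4)" by simp
      \<comment> \<open>At an interior point the chart is shrunk until its half-space vector is 0;
        then the inward vector is an admissible test direction too.\<close>
      obtain U' where U': "x \<in> U'" "U' \<subseteq> U" "hchart W U' \<kappa> 0"
        by (rule hchart_interior_point[OF W product_chartD(2)[OF U(2)] U(1) int dim]) (rule that)
      have pU: "p y = cis (\<Lambda> f g (\<kappa> y))" if "y \<in> U'" "\<kappa> y \<in> N" for y
      proof -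
        have y: "y \<in> U" using that(1) U'(2) by blast
        show ?thesis using p_chart[OF U(2) y] bspec[OF U(6) y] that(2) by simp
      qed
      define s where "s = \<epsilon> - r x"
      have s: "0 < s" "s \<le> 1" using True r_ge[OF x] \<epsilon>(2) by (simp_all add: s_def)
      have gx: "G x = f (\<kappa> x)" "r x = g (\<kappa> x)" using U(1,3,6) by simp_all
      define e where "e = flat 0 s / flat 0 \<epsilon>"
      have e: "e > 0" unfolding e_def using s(1) \<epsilon>(1) by (intro divide_pos_pos) simp_all
      define d where "d = frechet_derivative g (at (\<kappa> x)) (u, 0)"
      \<comment> \<open>The ratio of \<open>flat 2\<close> to \<open>flat 0\<close> at
        \<open>s\<close>; it is at least 1 since \<open>s\<close> is at most 1.\<close>
      define i where "i = (inverse s)\<^sup>2"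
      have i: "i \<ge> 1" unfolding i_def using s by (intro one_le_power) (simp add: one_le_inverse)
      have "frechet_derivative (\<Lambda> f g) (at (\<kappa> x)) (u, 0) =
          frechet_derivative f (at (\<kappa> x)) (u, 0) * e - (G x + K) * (e * i) * d"
        unfolding \<Lambda>(2)[OF U(4,3,5)] gx(1)
        by (simp add: cutoff_def gx(2)[symmetric] s_def[symmetric] e_def flat_2 d_def i_def)
      also have "\<dots> < 0"
      proof -
        have d: "d > 0" using U(7) by (simp add: d_def)
        \<comment> \<open>Both terms carry the factor \<open>e * d\<close>, so it does not matter
          how small the cut-off has become; what remains is the comparison of
          \<open>\<bar>R\<bar>\<close> with \<open>\<bar>R\<bar> + 1\<close>.\<close>
        have "frechet_derivative f (at (\<kappa> x)) (u, 0) * e \<le> (\<bar>R\<bar> * d) * e"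
        proof (rule mult_right_mono)
          have "R * d \<le> \<bar>R\<bar> * d" using d by (intro mult_right_mono) simp_all
          then show "frechet_derivative f (at (\<kappa> x)) (u, 0) \<le> \<bar>R\<bar> * d" using U(8) by (simp add: d_def)
        qed (use e in simp)
        also have "\<dots> < (\<bar>R\<bar> + 1) * (e * d)" using e d by (simp add: algebra_simps)
        also have "\<dots> \<le> (G x + K) * ((e * i) * d)"
        proof (rule mult_mono)
          show "\<bar>R\<bar> + 1 \<le> G x + K" by (rule K[OF x])
          then show "0 \<le> G x + K" by simp
          have "e * 1 \<le> e * i" using i e by (intro mult_left_mono) simp_all
          then show "e * d \<le> e * i * d" using d by (intro mult_right_mono) simp_all
        qed (use e d in simp)
        finally show ?thesis by (simp add: mult.assoc)
      qed
      finally have der: "frechet_derivative (\<Lambda> f g) (at (\<kappa> x)) (u, 0) \<noteq> 0" by simp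
      show ?thesis by (rule product_adapted[OF U'(3,1) inner_zero_left \<Lambda>(1)[OF U(4,3,5)] U(3) pU der])
    next
      case False
      obtain U \<kappa> u N f g where U: "x \<in> U" "product_chart U \<kappa> u" "\<kappa> x \<in> N" "Cinf_on f N" "Cinf_on g N"
        "\<forall>y\<in>U. \<kappa> y \<in> N \<longrightarrow> G y = f (\<kappa> y) \<and> r y = g (\<kappa> y)"
        using local[OF x] by (elim exE conjE) (rule that)
      have dim: "DIM((real ^ 2) \<times> (real \<times> real)) = DIM(real ^ 4)" by simp
      obtain U' where U': "x \<in> U'" "U' \<subseteq> U" "hchart W U' \<kappa> 0"
        by (rule hchart_interior_point[OF W product_chartD(2)[OF U(2)] U(1) int dim]) (rule that)
      have pU: "p y = cis (\<Lambda> f g (\<kappa> y))" if "y \<in> U'" "\<kappa> y \<in> N" for y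
      proof -
        have y: "y \<in> U" using that(1) U'(2) by blast
        show ?thesis using p_chart[OF U(2) y] bspec[OF U(6) y] that(2) by simp
      qed
      have gx: "\<epsilon> - g (\<kappa> x) \<le> 0" using U(1,3,6) False by simp
      have "frechet_derivative (\<Lambda> f g) (at (\<kappa> x)) (0, (real_of_int m, real_of_int n)) = of_int m * of_int m + of_int n * of_int n"
        unfolding \<Lambda>(2)[OF U(4,3,5)] cutoff_def flat_eq_0[OF gx] by simp
      also have "\<dots> \<noteq> 0" using mn by (simp add: sum_squares_eq_zero_iff)
      finally have der: "frechet_derivative (\<Lambda> f g) (at (\<kappa> x)) (0, (real_of_int m, real_of_int n)) \<noteq> 0" .
      show ?thesis by (rule product_adapted[OF U'(3,1) inner_zero_left \<Lambda>(1)[OF U(4,3,5)] U(3) pU der])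
    qed
  qed
  interpret p: circle_submersion W p "\<lambda>c. \<lparr>mtop = subtopology (mtop W) {x\<in>points W. p x = c},
        atlas = {(U \<inter> {x\<in>points W. p x = c}, \<lambda>x. fst (\<kappa> x)) | U (\<kappa> :: 'w \<Rightarrow> (real ^ 3) \<times> real) u. adapted_chart W p c U \<kappa> u}\<rparr>"
    by (rule circle_submersion.intro[OF W_manifold W_compact p_smooth p_norm _ adapted refl]) simp_all
  have "points W \<noteq> {}" using bdry_W_nonempty bW by blast
  from p.fiber_bundle_Fib[OF this] obtain F' :: "('w, real ^ 3) mfd" where "fiber_bundle F' W circle p" by (elim exE)
  then show ?thesis using p_bdry by (intro exI conjI ballI)
qed

theorem theorem2p2:
  fixes g :: nat
    and \<Sigma> :: "('s, real ^ 2) mfd"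
    and W :: "('w, real ^ 4) mfd"
    and q :: "'w \<Rightarrow> complex \<times> complex"
    and \<Theta> :: "((complex \<times> complex) set \<times> ('w \<Rightarrow> 's \<times> (complex \<times> complex))) set"
    and F :: "('w, real ^ 2) mfd"
    and \<pi> :: "'w \<Rightarrow> complex"
    and T :: "'w set" and c :: complex and b :: "complex \<times> complex"
  assumes "surface_one_bdry g \<Sigma>"
    and "smooth_manifold W" and "compact_space (mtop W)"
    and "fiber_bundle \<Sigma> W torus q"
    and "bdry_fixing_bundle_atlas \<Sigma> W torus q \<Theta>"
    and "fiber_bundle F (bdry_mfd W :: ('w, real ^ 3) mfd) circle \<pi>"
    and "c \<in> points circle" and "T = {x \<in> bdry W. \<pi> x = c}"
    and "b \<in> points torus"
    and "bdry_identification W q \<Theta> ` (bdry \<Sigma> \<times> {b}) \<subseteq> T"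
  shows "\<exists>(\<pi>' :: 'w \<Rightarrow> complex) (F' :: ('w, real ^ 3) mfd).
           fiber_bundle F' W circle \<pi>' \<and> (\<forall>x\<in>bdry W. \<pi>' x = \<pi> x)"
proof -
  have \<Sigma>: "smooth_manifold \<Sigma>" "compact_space (mtop \<Sigma>)" "bdry \<Sigma> \<noteq> {}" "connectedin (mtop \<Sigma>) (bdry \<Sigma>)"
    using assms(1) unfolding surface_one_bdry_def by blast+
  have q: "smooth_map W torus q" using assms(4) by (simp only: fiber_bundle_def)
  interpret torus_bundle \<Sigma> W q \<Theta>
    by (rule torus_bundle.intro[OF \<Sigma> assms(2,3) q assms(5)])
  have "\<pi> (bdry_identification W q \<Theta> (s, b)) = c" if "s \<in> bdry \<Sigma>" for s
    using assms(8,10) that by auto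
  with assms(6,7,9) show ?thesis by (rule extends_over_W)
qed

end
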